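(* For every $\Delta_2$-computable real number $x\in[0,2]$ there exists a minimal $\mathbb{Z}^3$-subshift of finite type $X$ which has an entropy dimension and whose entropy dimension satisfies $D_h(X)=x$.
   Context: A subshift of $\mathcal A^{\mathbb Z^d}$ ($\mathcal A$ finite) is a closed shift-invariant set; it is of finite type (SFT) if it is the set of configurations avoiding a finite set of forbidden patterns. $X$ is minimal if every pattern appearing in some configuration of $X$ appears in every configuration of $X$. With $N_n(X)$ the number of patterns on $\llbracket 1,n\rrbracket^d$ appearing in $X$, the upper/lower entropy dimensions are $\limsup_n$ / $\liminf_n$ of $\frac{\log_2\log_2 N_n(X)}{\log_2 n}$; $X$ has an entropy dimension $D_h(X)$ when these coincide. A real $x$ is $\Delta_2$-computable if some Turing machine on input $n$ outputs a rational $r_n$ with $r_n\to x$. *)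

theory Defs
  imports "HOL-Analysis.Analysis" "HOL-Library.Liminf_Limsup"
begin

type_synonym pos = "int \<times> int \<times> int"
type_synonym config = "pos \<Rightarrow> nat"
type_synonym pattern = "pos \<rightharpoonup> nat"

definition vadd :: "pos \<Rightarrow> pos \<Rightarrow> pos" where
  "vadd p q = (fst p + fst q, fst (snd p) + fst (snd q), snd (snd p) + snd (snd q))"

definition shift :: "pos \<Rightarrow> config \<Rightarrow> config" where
  "shift v x = (\<lambda>p. x (vadd p v))"

definition full_shift :: "nat set \<Rightarrow> config set" where
  "full_shift A = {x. \<forall>p. x p \<in> A}"

definition subshift :: "nat set \<Rightarrow> config set \<Rightarrow> bool" where
  "subshift A X \<longleftrightarrow> finite A \<and> X \<subseteq> full_shift A \<and> closed X \<and> (\<forall>v. \<forall>x\<in>X. shift v x \<in> X)"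

definition is_pattern :: "pattern \<Rightarrow> bool" where
  "is_pattern P \<longleftrightarrow> finite (dom P)"

definition appears_in :: "pattern \<Rightarrow> config \<Rightarrow> bool" where
  "appears_in P x \<longleftrightarrow> (\<exists>v. \<forall>p\<in>dom P. P p = Some (x (vadd p v)))"

definition SFT :: "nat set \<Rightarrow> config set \<Rightarrow> bool" where
  "SFT A X \<longleftrightarrow> finite A \<and> (\<exists>F. finite F \<and> (\<forall>P\<in>F. is_pattern P) \<and>
      X = {x \<in> full_shift A. \<forall>P\<in>F. \<not> appears_in P x})"

definition minimal_subshift :: "config set \<Rightarrow> bool" where
  "minimal_subshift X \<longleftrightarrow> (\<forall>P. is_pattern P \<longrightarrow>
      (\<exists>x\<in>X. appears_in P x) \<longrightarrow> (\<forall>y\<in>X. appears_in P y))"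

definition cube :: "nat \<Rightarrow> pos set" where
  "cube n = {1..int n} \<times> {1..int n} \<times> {1..int n}"

definition N_count :: "config set \<Rightarrow> nat \<Rightarrow> nat" where
  "N_count X n = card ((\<lambda>x. restrict x (cube n)) ` X)"

definition dim_seq :: "config set \<Rightarrow> nat \<Rightarrow> real" where
  "dim_seq X n = log 2 (log 2 (real (N_count X n))) / log 2 (real n)"

definition upper_entropy_dim :: "config set \<Rightarrow> ereal" where
  "upper_entropy_dim X = limsup (\<lambda>n. ereal (dim_seq X n))"

definition lower_entropy_dim :: "config set \<Rightarrow> ereal" where
  "lower_entropy_dim X = liminf (\<lambda>n. ereal (dim_seq X n))"

definition has_entropy_dim :: "config set \<Rightarrow> bool" where
  "has_entropy_dim X \<longleftrightarrow> upper_entropy_dim X = lower_entropy_dim X"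

definition entropy_dim :: "config set \<Rightarrow> ereal" where
  "entropy_dim X = upper_entropy_dim X"

text \<open>total_rec n f: f is a total recursive function of arity n (only its values on
  lists of length n matter). Kleene: these are exactly the Turing-computable total functions.\<close>
inductive total_rec :: "nat \<Rightarrow> (nat list \<Rightarrow> nat) \<Rightarrow> bool" where
  zero: "total_rec n (\<lambda>_. 0)"
| succ: "total_rec 1 (\<lambda>xs. Suc (hd xs))"
| proj: "i < n \<Longrightarrow> total_rec n (\<lambda>xs. xs ! i)"
| comp: "total_rec m f \<Longrightarrow> length gs = m \<Longrightarrow> (\<forall>g\<in>set gs. total_rec n g) \<Longrightarrow>
         total_rec n (\<lambda>xs. f (map (\<lambda>g. g xs) gs))"
| prim: "total_rec n f \<Longrightarrow> total_rec (Suc (Suc n)) g \<Longrightarrow>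
         total_rec (Suc n) (\<lambda>xs. rec_nat (f (tl xs)) (\<lambda>y r. g (y # r # tl xs)) (hd xs))"
| mu: "total_rec (Suc n) f \<Longrightarrow> (\<forall>xs. length xs = n \<longrightarrow> (\<exists>y. f (y # xs) = 0)) \<Longrightarrow>
       total_rec n (\<lambda>xs. LEAST y. f (y # xs) = 0)"
| ext: "total_rec n f \<Longrightarrow> (\<forall>xs. length xs = n \<longrightarrow> g xs = f xs) \<Longrightarrow> total_rec n g"

definition computable_nat_fun :: "(nat \<Rightarrow> nat) \<Rightarrow> bool" where
  "computable_nat_fun f \<longleftrightarrow> total_rec 1 (\<lambda>xs. f (hd xs))"

definition computable_rat_seq :: "(nat \<Rightarrow> real) \<Rightarrow> bool" where
  "computable_rat_seq r \<longleftrightarrow> (\<exists>a b c. computable_nat_fun a \<and> computable_nat_fun b \<and> computable_nat_fun c \<and>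
      (\<forall>n. r n = (real (a n) - real (b n)) / (real (c n) + 1)))"

definition Delta2_computable :: "real \<Rightarrow> bool" where
  "Delta2_computable x \<longleftrightarrow> (\<exists>r. computable_rat_seq r \<and> r \<longlonglongrightarrow> x)"

end

(*
  The configuration y0 is built from the 2-adic levels of the three coordinates. A counter machine
  runs along the levels: P l k is the position of its marker l at time k, and a cell whose
  coordinates have levels i and k sees whether i lies below, at or above P l k. Marker 1 moves with
  asymptotic frequency 1 - x/2. For every s, the cells whose two horizontal coordinates have level s
  form arrays with 2^(JJ s - s) rows and columns, where JJ s is the time at which marker 1 leaves s,
  and the cells of an array carry distinct binary digits of the vertical coordinate. A cube of side
  2^k therefore shows about 4^(k - P 1 k) independent digits, and log log N / log n tends to
  2 (1 - (1 - x/2)) = x. All layers are functions of 2-adic coordinates, so y0 is a Toeplitz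
  configuration and its orbit closure is minimal; each layer is pinned down by rules for neighbouring
  cells, so the orbit closure is of finite type. To reach the frequency 1 - x/2, the machine computes
  greedily a sequence of bits whose mean follows the given rational approximations; while it computes,
  it spends in each round on moving marker 1 a proportion of time given by the numbers of bits 1 and
  0 found so far. The time a computation takes is irrelevant, which is why Delta_2 suffices.
*)
theory Submission
  imports Defs "HOL-Real_Asymp.Real_Asymp"
begin

section \<open>Odometers\<close>

text \<open>With three axes one cell can show two consecutive levels and a third coordinate compared
  with both; this makes an induction along the levels a local matter. The obstacle is a point whose
  levels are infinite. It does not occur in \<open>y0\<close> but does in limits of translates, and
  the rules do not fix, for instance, the machine state there. The subshift is therefore cut out not
  by the rules but by all windows of \<open>y0\<close> of radius \<open>2 ^ K0\<close>. The 27 cells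
  around a point, its germ, take finitely many values; so for large \<open>K0\<close> a germ seen at
  a point of level \<open>K0\<close> recurs at arbitrarily high levels, and the germ together with
  the rules fixes all other cells. The second obstacle is that the rules inside an array of level
  \<open>s\<close> tie its counter to the vertical odometer modulo \<open>2 ^ s\<close> only; the
  higher digits could drift. The carries out of arrays of consecutive levels are compared, which
  links every array to one whose first digit lies beyond its own last digit.\<close>

definition odo :: "(nat \<Rightarrow> int) \<Rightarrow> bool" where
  "odo r \<longleftrightarrow> (\<forall>k. 2 ^ k dvd r (Suc k) - r k)"

text \<open>An odometer \<^term>\<open>r\<close> is a 2-adic integer, given by its residues \<^term>\<open>r k\<close> modulo \<^term>\<open>2 ^ k\<close>.
  The predicates \<open>ge\<close> and \<open>ex\<close> say that the 2-adic level of \<open>n - r\<close> is at least, respectively exactly, \<open>k\<close>;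
  \<open>ph\<close> and \<open>bitr\<close> read binary digits of \<open>n - r\<close> from position \<open>k\<close> on.
  The occurrences of level \<open>s\<close> in a period \<open>2 ^ Suc J\<close> are numbered by \<open>cnt\<close>.\<close>

definition ge :: "(nat \<Rightarrow> int) \<Rightarrow> nat \<Rightarrow> int \<Rightarrow> bool" where
  "ge r k n \<longleftrightarrow> 2 ^ k dvd n - r k"

definition ex :: "(nat \<Rightarrow> int) \<Rightarrow> nat \<Rightarrow> int \<Rightarrow> bool" where
  "ex r k n \<longleftrightarrow> ge r k n \<and> \<not> ge r (Suc k) n"

definition ph :: "(nat \<Rightarrow> int) \<Rightarrow> nat \<Rightarrow> int \<Rightarrow> int" where
  "ph r k n = (n - r (Suc (Suc k))) div 2 ^ k mod 4"

definition bitr :: "(nat \<Rightarrow> int) \<Rightarrow> nat \<Rightarrow> int \<Rightarrow> int" where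
  "bitr r k n = (n - r (Suc k)) div 2 ^ k mod 2"

definition cnt :: "(nat \<Rightarrow> int) \<Rightarrow> nat \<Rightarrow> nat \<Rightarrow> int \<Rightarrow> nat" where
  "cnt r J s n = nat (((n - r (Suc J)) mod 2 ^ Suc J + 2 ^ s) div 2 ^ Suc s)"

lemma odo_dvd: assumes "odo r" "j \<le> k" shows "2 ^ j dvd r k - r j"
  using assms(2,1)
proof (induction k rule: dec_induct)
  case (step n)
  then have "2 ^ j dvd r n - r j" "(2::int) ^ j dvd 2 ^ n" "2 ^ n dvd r (Suc n) - r n"
    by (auto simp: odo_def le_imp_power_dvd)
  then have "2 ^ j dvd (r (Suc n) - r n) + (r n - r j)"
    by (meson dvd_add dvd_trans)
  then show ?case by simp
qed simp

lemma ge_0 [simp]: "ge r 0 n" by (simp add: ge_def)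

lemma dvd_diff_cong: "(d::int) dvd a - b \<Longrightarrow> d dvd n - a \<longleftrightarrow> d dvd n - b"
proof -
  assume d: "d dvd a - b"
  have 1: "n - b = (n - a) + (a - b)" and 2: "n - a = (n - b) - (a - b)" by simp_all
  show ?thesis using d unfolding 1 by (metis 1 2 dvd_add dvd_diff)
qed

lemma ge_iff_dvd: "odo r \<Longrightarrow> j \<le> k \<Longrightarrow> ge r j n \<longleftrightarrow> 2 ^ j dvd n - r k"
  unfolding ge_def using dvd_diff_cong[OF odo_dvd] by blast

lemma ge_mono: "odo r \<Longrightarrow> ge r k n \<Longrightarrow> j \<le> k \<Longrightarrow> ge r j n"
  by (metis ge_def ge_iff_dvd dvd_trans le_imp_power_dvd)

text \<open>A point of high level can stand in for the odometer, so that levels become functions of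
  the offset from that point.\<close>

lemma ge_rel: "odo r \<Longrightarrow> ge r K p \<Longrightarrow> k \<le> K \<Longrightarrow> ge r k n \<longleftrightarrow> 2 ^ k dvd n - p"
proof -
  assume "odo r" "ge r K p" "k \<le> K"
  then have "2 ^ k dvd p - r k" using ge_mono ge_def by blast
  from dvd_diff_cong[OF this, of n] show ?thesis by (simp add: ge_def)
qed

lemma ex_unique: "odo r \<Longrightarrow> ex r j n \<Longrightarrow> ex r k n \<Longrightarrow> j = k"
  by (metis ex_def ge_mono not_less_eq_eq nle_le)

lemma ex_ge_iff: "odo r \<Longrightarrow> ex r k n \<Longrightarrow> ge r j n \<longleftrightarrow> j \<le> k"
  by (metis ex_def ge_mono not_less_eq_eq)

lemma ex_or_all: "(\<exists>k. ex r k n) \<or> (\<forall>k. ge r k n)"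
proof (rule disjCI)
  assume "\<not> (\<forall>k. ge r k n)"
  then have "\<exists>k. \<not> ge r k n" by blast
  then obtain k where k: "\<not> ge r k n" "\<forall>j<k. ge r j n"
    using exists_least_iff[of "\<lambda>k. \<not> ge r k n"] by blast
  then obtain m where "k = Suc m" by (cases k) auto
  with k show "\<exists>k. ex r k n" by (auto simp: ex_def)
qed

lemma mod_offset: "(d::int) dvd p + (c - p) mod d - c"
proof -
  have "p + (c - p) mod d - c = - ((c - p) - (c - p) mod d)" by simp
  then show ?thesis by (metis dvd_minus_iff dvd_minus_mod)
qed

lemma pow_not_dvd: "\<not> (2::int) ^ Suc k dvd 2 ^ k"
proof
  assume "(2::int) ^ Suc k dvd 2 ^ k"
  then have "(2::int) ^ Suc k \<le> 2 ^ k" by (rule zdvd_imp_le) simp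
  then show False by simp
qed

lemma ex_exists: "odo r \<Longrightarrow> \<exists>n. ex r k n \<and> p \<le> n \<and> n \<le> p + 2 ^ Suc k"
proof -
  assume o: "odo r"
  define m where "m = p + (r (Suc k) + 2 ^ k - p) mod 2 ^ Suc k"
  have "2 ^ Suc k dvd m - (r (Suc k) + 2 ^ k)"
    unfolding m_def by (rule mod_offset)
  then obtain c where "m - (r (Suc k) + 2 ^ k) = 2 ^ Suc k * c" by (elim dvdE)
  then have c: "m = r (Suc k) + 2 ^ k + 2 ^ Suc k * c" by simp
  have "ge r k m" using o by (auto simp: ge_iff_dvd[OF o, of k "Suc k"] c mult.assoc)
  moreover have "\<not> ge r (Suc k) m"
  proof
    assume "ge r (Suc k) m"
    then have "(2::int) ^ Suc k dvd 2 ^ k + 2 ^ Suc k * c" by (simp add: ge_def c)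
    then have "(2::int) ^ Suc k dvd 2 ^ k" by (metis dvd_add_left_iff dvd_triv_left)
    then show False using pow_not_dvd by blast
  qed
  moreover have "p \<le> m" by (simp add: m_def)
  moreover have "m \<le> p + 2 ^ Suc k"
  proof -
    have "(0::int) < 2 ^ Suc k" by simp
    from pos_mod_bound[OF this, of "r (Suc k) + 2 ^ k - p"] show ?thesis unfolding m_def by linarith
  qed
  ultimately show ?thesis unfolding ex_def by blast
qed

lemma ge_exists: "\<exists>n. ge r k n \<and> p \<le> n \<and> n < p + 2 ^ k"
proof -
  define m where "m = p + (r k - p) mod 2 ^ k"
  have "2 ^ k dvd m - r k"
    unfolding m_def by (rule mod_offset)
  then have "ge r k m" by (simp add: ge_def)
  moreover have "p \<le> m" "m < p + 2 ^ k" unfolding m_def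
    using pos_mod_bound[of "2 ^ k" "r k - p"] pos_mod_sign[of "2 ^ k" "r k - p"] by simp_all
  ultimately show ?thesis by blast
qed

section \<open>Counters, digits and the numbering of a level\<close>

lemma int_const: fixes h :: "int \<Rightarrow> 'a" assumes "\<And>n. h n = h (n - 1)" shows "h n = h m"
proof (induction n rule: int_induct[where k = m])
  case (step1 i) then show ?case using assms[of "i + 1"] by simp
next
  case (step2 i) then show ?case using assms[of i] by simp
qed simp

lemma div_step: "(D::int) > 0 \<Longrightarrow> (n - c) div D = (n - 1 - c) div D + of_bool (D dvd n - c)"
proof -
  assume D: "D > 0"
  define m where "m = n - c"
  have "m div D = (m - 1) div D + of_bool (D dvd m)"
  proof (cases "D dvd m")
    case True
    then obtain q where q: "m = D * q" by blast
    have "(m - 1) div D = q - 1"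
      by (rule int_div_pos_eq[of _ _ _ "D - 1"]) (use D q in \<open>auto simp: algebra_simps\<close>)
    then show ?thesis using True D q by simp
  next
    case False
    have "m = D * (m div D) + m mod D" by simp
    moreover have "m mod D \<noteq> 0" "0 \<le> m mod D" "m mod D < D" using False D by auto
    ultimately have "(m - 1) div D = m div D"
      by (intro int_div_pos_eq[of _ _ _ "m mod D - 1"]) linarith+
    then show ?thesis using False by simp
  qed
  then show ?thesis by (simp add: m_def algebra_simps)
qed

text \<open>The rule forces \<open>f\<close> to differ from the reference counter
  \<open>(n - c) div D\<close> by a constant modulo \<open>m\<close>, and a constant
  \<open>e\<close> is absorbed by moving the origin by \<open>e * D\<close>. This is how a local
  rule for a digit yields one more residue of an odometer.\<close>

lemma counter_form:
  fixes f :: "int \<Rightarrow> int"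
  assumes D: "D > 0" and m: "m > 0"
    and f: "\<And>n. f n = (f (n - 1) + of_bool (D dvd n - c)) mod m"
  shows "\<exists>c'. D dvd c' - c \<and> (\<forall>n. f n = (n - c') div D mod m)"
proof -
  define h where "h n = (f n - (n - c) div D) mod m" for n
  have "h n = h (n - 1)" for n
  proof -
    have "h n = ((f (n - 1) + of_bool (D dvd n - c)) mod m - ((n - 1 - c) div D + of_bool (D dvd n - c))) mod m"
      unfolding h_def using f[of n] div_step[OF D, of n c] by simp
    also have "\<dots> = ((f (n - 1) + of_bool (D dvd n - c)) - ((n - 1 - c) div D + of_bool (D dvd n - c))) mod m"
      by (simp add: mod_simps)
    finally show ?thesis by (simp add: h_def)
  qed
  then have hc: "h n = h 0" for n by (rule int_const)
  define e where "e = h 0"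
  have "f n = (n - (c - e * D)) div D mod m" for n
  proof -
    have "(n - (c - e * D)) div D = (n - c) div D + e"
    proof -
      have "n - (c - e * D) = (n - c) + e * D" by simp
      then show ?thesis using D by (simp only: div_mult_self1)
    qed
    moreover have "f n mod m = f n" using f[of n] m by (metis mod_mod_trivial)
    moreover have "((n - c) div D + e) mod m = f n mod m"
    proof -
      have "((n - c) div D + e) mod m = ((n - c) div D + (f n - (n - c) div D) mod m) mod m"
        using hc[of n] by (simp add: e_def h_def)
      also have "\<dots> = f n mod m" by (simp add: mod_simps)
      finally show ?thesis .
    qed
    ultimately show ?thesis by simp
  qed
  then show ?thesis by (intro exI[of _ "c - e * D"]) auto
qed

lemma dvd_div_mod: "(D::int) > 0 \<Longrightarrow> D dvd m \<Longrightarrow> k > 0 \<Longrightarrow> m div D mod k = 0 \<longleftrightarrow> D * k dvd m"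
proof (elim dvdE)
  fix q assume "D > 0" "k > 0" "m = D * q"
  then show ?thesis by (simp add: mod_eq_0_iff_dvd)
qed

lemma ph_range: "0 \<le> ph r k n" "ph r k n < 4" by (simp_all add: ph_def)

lemma ph_step: assumes "odo r" shows "ph r k n = (ph r k (n - 1) + of_bool (ge r k n)) mod 4"
proof -
  have "ge r k n \<longleftrightarrow> 2 ^ k dvd n - r (Suc (Suc k))" using ge_iff_dvd[OF assms, of k "Suc (Suc k)"] by simp
  then show ?thesis unfolding ph_def using div_step[of "2 ^ k" n "r (Suc (Suc k))"]
    by (simp add: mod_simps)
qed

lemma ph_level: assumes o: "odo r" and g: "ge r k n"
  shows "even (ph r k n) \<longleftrightarrow> ge r (Suc k) n" "ph r k n = 0 \<longleftrightarrow> ge r (Suc (Suc k)) n"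
    "ph r k n = 2 \<longleftrightarrow> ex r (Suc k) n"
proof -
  have d: "2 ^ k dvd n - r (Suc (Suc k))" using ge_iff_dvd[OF o, of k "Suc (Suc k)"] g by simp
  then obtain q where q: "n - r (Suc (Suc k)) = 2 ^ k * q" by blast
  have p: "ph r k n = q mod 4" by (simp add: ph_def q)
  have "ge r (Suc k) n \<longleftrightarrow> (2::int) ^ k * 2 dvd 2 ^ k * q"
    using ge_iff_dvd[OF o, of "Suc k" "Suc (Suc k)"] by (simp add: q mult.commute)
  then have s: "ge r (Suc k) n \<longleftrightarrow> even q" by simp
  have "ge r (Suc (Suc k)) n \<longleftrightarrow> (2::int) ^ k * 4 dvd 2 ^ k * q"
    unfolding ge_def q by (simp add: power_add)
  then have t: "ge r (Suc (Suc k)) n \<longleftrightarrow> 4 dvd q" by simp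
  show "even (ph r k n) \<longleftrightarrow> ge r (Suc k) n" unfolding p s by presburger
  show "ph r k n = 0 \<longleftrightarrow> ge r (Suc (Suc k)) n" unfolding p t by presburger
  show "ph r k n = 2 \<longleftrightarrow> ex r (Suc k) n" unfolding p ex_def s using t by simp presburger
qed

text \<open>The digit pairs at levels \<open>k\<close> and \<open>Suc k\<close> share one digit;
  this overlap will link the residues found at successive levels.\<close>

lemma ph_Suc: assumes o: "odo r" shows "ph r (Suc k) n mod 2 = ph r k n div 2"
proof -
  have "2 ^ (Suc (Suc k)) dvd r (Suc (Suc (Suc k))) - r (Suc (Suc k))" using o unfolding odo_def by blast
  then obtain q where "r (Suc (Suc (Suc k))) - r (Suc (Suc k)) = 2 ^ (Suc (Suc k)) * q" by (elim dvdE)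
  then have q: "r (Suc (Suc (Suc k))) = r (Suc (Suc k)) + 2 ^ (Suc (Suc k)) * q" by simp
  have "(n - r (Suc (Suc (Suc k)))) div 2 ^ Suc k = (n - r (Suc (Suc k)) + 2 ^ Suc k * (- 2 * q)) div 2 ^ Suc k"
    unfolding q by (simp add: power_add algebra_simps)
  also have "\<dots> = (n - r (Suc (Suc k))) div 2 ^ Suc k + (- 2 * q)"
    by (subst div_mult_self2) simp_all
  finally have 0: "(n - r (Suc (Suc (Suc k)))) div 2 ^ Suc k = (n - r (Suc (Suc k))) div 2 ^ Suc k + (- 2 * q)" .
  have 2: "(m + - 2 * q) mod 4 mod 2 = m mod 2" for m :: int by presburger
  have 1: "ph r (Suc k) n mod 2 = ((n - r (Suc (Suc k))) div 2 ^ Suc k) mod 2"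
    unfolding ph_def 0 by (rule 2)
  have "(n - r (Suc (Suc k))) div 2 ^ Suc k = (n - r (Suc (Suc k))) div 2 ^ k div 2"
    by (simp add: power_Suc2 zdiv_zmult2_eq del: power_Suc)
  moreover have "m mod 4 div 2 = m div 2 mod 2" for m :: int by presburger
  ultimately show ?thesis using 1 by (simp only: ph_def[of r k])
qed

lemma bitr_step: assumes "odo r" shows "bitr r k n = (bitr r k (n - 1) + of_bool (ge r k n)) mod 2"
proof -
  have "ge r k n \<longleftrightarrow> 2 ^ k dvd n - r (Suc k)" using ge_iff_dvd[OF assms, of k "Suc k"] by simp
  then show ?thesis unfolding bitr_def using div_step[of "2 ^ k" n "r (Suc k)"]
    by (simp add: mod_simps)
qed

text \<open>The second claim is the carry law of a binary counter: a carry leaves digit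
  \<open>k\<close> exactly when it enters and the digit was 1 one step before. The rule for
  \<open>HH\<close> and \<open>UU\<close> is modelled on it.\<close>

lemma bitr_ge: assumes o: "odo r"
  shows "ge r k n \<Longrightarrow> bitr r k n = 0 \<longleftrightarrow> ge r (Suc k) n"
    "ge r (Suc k) n \<longleftrightarrow> ge r k n \<and> bitr r k (n - 1) = 1"
proof -
  show a: "ge r k n \<Longrightarrow> bitr r k n = 0 \<longleftrightarrow> ge r (Suc k) n"
    using dvd_div_mod[of "2 ^ k" "n - r (Suc k)" 2] ge_iff_dvd[OF o, of k "Suc k"]
    by (simp add: bitr_def ge_def mult.commute)
  have "bitr r k (n - 1) = 0 \<or> bitr r k (n - 1) = 1" unfolding bitr_def by presburger
  then show "ge r (Suc k) n \<longleftrightarrow> ge r k n \<and> bitr r k (n - 1) = 1"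
    using a bitr_step[OF o, of k n] ge_mono[OF o, of "Suc k" n k] by auto
qed

lemma dvd_pow_mod: "j \<le> k \<Longrightarrow> (2::int) ^ j dvd m mod 2 ^ k \<longleftrightarrow> 2 ^ j dvd m"
  by (rule dvd_mod_iff) (simp add: le_imp_power_dvd)

text \<open>Points of level exactly \<open>s\<close> are the odd multiples of \<open>2 ^ s\<close>
  in the residue; adding \<open>2 ^ s\<close> turns them into multiples of \<open>2 ^ Suc s\<close>,
  so that a floor division counts them. The hypothesis excludes the start of a period, where the
  count drops back to 0.\<close>

lemma cnt_step:
  assumes o: "odo r" and s: "s \<le> J" and ng: "\<not> ge r (Suc J) n"
  shows "cnt r J s n = cnt r J s (n - 1) + of_bool (ex r s n)"
proof -
  define m where "m = (n - r (Suc J)) mod 2 ^ Suc J"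
  have nz: "m \<noteq> 0" using ng by (auto simp: m_def ge_def dvd_eq_mod_eq_0)
  have m0: "0 \<le> m" "m < 2 ^ Suc J" by (auto simp: m_def)
  have m1: "(n - 1 - r (Suc J)) mod 2 ^ Suc J = m - 1"
  proof -
    have "(n - 1 - r (Suc J)) mod 2 ^ Suc J = (m - 1) mod 2 ^ Suc J"
      unfolding m_def by (simp add: mod_simps algebra_simps)
    also have "\<dots> = m - 1" using nz m0 by (intro mod_pos_pos_trivial) auto
    finally show ?thesis .
  qed
  have gs: "ge r s n \<longleftrightarrow> 2 ^ s dvd m" "ge r (Suc s) n \<longleftrightarrow> 2 ^ Suc s dvd m"
    using s ge_iff_dvd[OF o, of s "Suc J"] ge_iff_dvd[OF o, of "Suc s" "Suc J"] dvd_pow_mod[of _ "Suc J"]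
    unfolding m_def by (auto simp del: power_Suc)
  have e: "ex r s n \<longleftrightarrow> 2 ^ Suc s dvd m + 2 ^ s"
  proof
    assume "ex r s n"
    then have "2 ^ s dvd m" "\<not> 2 ^ Suc s dvd m" unfolding ex_def gs by auto
    then obtain q where q: "m = 2 ^ s * q" by (elim dvdE)
    then have "odd q" using \<open>\<not> 2 ^ Suc s dvd m\<close> by (auto simp: mult.commute)
    with q have "m + 2 ^ s = 2 ^ s * (q + 1)" "even (q + 1)" by (auto simp: algebra_simps)
    then show "2 ^ Suc s dvd m + 2 ^ s" by (simp add: mult.commute)
  next
    assume a: "2 ^ Suc s dvd m + 2 ^ s"
    then have "2 ^ s dvd m + 2 ^ s" by (rule dvd_trans[rotated]) simp
    then have b: "2 ^ s dvd m" by simp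
    have "\<not> 2 ^ Suc s dvd m"
    proof
      assume "2 ^ Suc s dvd m"
      with a have "(2::int) ^ Suc s dvd 2 ^ s" using dvd_add_right_iff by blast
      then show False using pow_not_dvd by blast
    qed
    with b show "ex r s n" unfolding ex_def gs by simp
  qed
  have "(m + 2 ^ s) div 2 ^ Suc s = (m - 1 + 2 ^ s) div 2 ^ Suc s + of_bool (2 ^ Suc s dvd m + 2 ^ s)"
    using div_step[of "2 ^ Suc s" "m + 2 ^ s" 0] by (simp add: algebra_simps)
  moreover have "0 \<le> (m - 1 + 2 ^ s) div 2 ^ Suc s"
    using nz m0 by (intro div_int_pos_iff[THEN iffD2]) auto
  ultimately show ?thesis unfolding cnt_def m_def[symmetric] m1 e
    by (auto simp: nat_add_distrib)
qed

lemma cnt_0: assumes "ge r (Suc J) n" shows "cnt r J s n = 0"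
proof -
  have "(n - r (Suc J)) mod 2 ^ Suc J = 0" using assms by (auto simp: ge_def)
  then show ?thesis by (simp add: cnt_def div_eq_0_iff)
qed

lemma cnt_last: assumes g: "ge r (Suc J) n" and s: "s \<le> J" shows "cnt r J s (n - 1) = 2 ^ (J - s)"
proof -
  have "(n - r (Suc J)) mod 2 ^ Suc J = 0" using g by (auto simp: ge_def)
  then have "((n - r (Suc J)) + - 1) mod 2 ^ Suc J = (- 1) mod 2 ^ Suc J"
    by (metis add_0 mod_add_left_eq)
  then have "(n - 1 - r (Suc J)) mod 2 ^ Suc J = (- 1) mod 2 ^ Suc J" by (simp add: algebra_simps)
  also have "\<dots> = 2 ^ Suc J - 1" by (simp add: zmod_minus1)
  finally have m: "(n - 1 - r (Suc J)) mod 2 ^ Suc J = 2 ^ Suc J - 1" .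
  have "(2::int) ^ Suc J = 2 ^ Suc s * 2 ^ (J - s)" using s by (simp flip: power_add)
  then have e: "(2 ^ Suc J - 1 + 2 ^ s) = (2::int) ^ Suc s * 2 ^ (J - s) + (2 ^ s - 1)" by simp
  have "(0::int) < 2 ^ s" by simp
  then have "(0::int) \<le> 2 ^ s - 1" "(2::int) ^ s - 1 < 2 ^ Suc s" unfolding power_Suc by linarith+
  then have "(2 ^ Suc J - 1 + 2 ^ s) div 2 ^ Suc s = (2::int) ^ (J - s)"
    by (intro int_div_pos_eq[OF e])
  then show ?thesis unfolding cnt_def m by (simp add: nat_power_eq)
qed

lemma int_div_less_bound: "(d::int) > 0 \<Longrightarrow> x < d * c \<Longrightarrow> x div d < c"
  using mult_left_mono[of c "x div d" d] minus_mod_eq_mult_div[of x d] pos_mod_sign[of d x] by linarith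

lemma cnt_le: assumes s: "s \<le> J" shows "cnt r J s n \<le> 2 ^ (J - s)"
proof -
  have "(2::int) ^ Suc J = 2 ^ Suc s * 2 ^ (J - s)" using s by (simp flip: power_add)
  moreover have "(n - r (Suc J)) mod 2 ^ Suc J < 2 ^ Suc J" by simp
  moreover have "(2::int) ^ s < 2 ^ Suc s" by simp
  ultimately have "(n - r (Suc J)) mod 2 ^ Suc J + 2 ^ s < 2 ^ Suc s * (2 ^ (J - s) + 1)"
    unfolding distrib_left mult_1_right by linarith
  then have "((n - r (Suc J)) mod 2 ^ Suc J + 2 ^ s) div 2 ^ Suc s < 2 ^ (J - s) + 1"
    by (metis int_div_less_bound zero_less_numeral zero_less_power)
  then show ?thesis unfolding cnt_def by (simp add: nat_le_iff)
qed

text \<open>The 2-adic integer \<open>-1/3\<close>: as it is not in \<open>\<int>\<close>, every integer has a finite level.\<close>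

definition r0 :: "nat \<Rightarrow> int" where
  "r0 k = (\<Sum>i<k. if even i then 2 ^ i else 0)"

lemma r0_third: "3 * r0 k + 1 = 2 ^ (if even k then k else Suc k)"
  by (induction k) (auto simp: r0_def algebra_simps)

lemma odo_r0: "odo r0"
  by (auto simp: odo_def r0_def)

text \<open>At a point \<open>n\<close> of infinite level every power of 2 would divide
  \<open>3 * n + 1\<close>, which is nonzero.\<close>

lemma r0_finite_level: "\<exists>k. ex r0 k n"
proof (rule ccontr)
  assume "\<nexists>k. ex r0 k n"
  then have all: "ge r0 k n" for k using ex_or_all by blast
  have d: "2 ^ k dvd 3 * n + 1" for k
  proof -
    have "2 ^ k dvd 3 * (n - r0 k)" using all[of k] unfolding ge_def by (rule dvd_mult)
    moreover have "2 ^ k dvd 3 * r0 k + 1" unfolding r0_third by (rule le_imp_power_dvd) auto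
    ultimately have "2 ^ k dvd 3 * (n - r0 k) + (3 * r0 k + 1)" by (rule dvd_add)
    then show ?thesis by (simp add: algebra_simps)
  qed
  have nz: "3 * n + 1 \<noteq> 0" by presburger
  have "(2::int) ^ k \<le> \<bar>3 * n + 1\<bar>" for k
    using d[of k] nz by (metis abs_of_nonneg dvd_abs_iff zdvd_imp_le zero_less_abs_iff)
  from this[of "nat \<bar>3 * n + 1\<bar>"] have "(2::int) ^ nat \<bar>3 * n + 1\<bar> \<le> int (nat \<bar>3 * n + 1\<bar>)" by simp
  then show False by (metis less_exp linorder_not_less of_nat_le_iff of_nat_numeral of_nat_power)
qed

definition lv :: "int \<Rightarrow> nat" where "lv n = (THE k. ex r0 k n)"

lemma ex_r0_iff: "ex r0 k n \<longleftrightarrow> lv n = k"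
proof -
  obtain j where j: "ex r0 j n" using r0_finite_level by blast
  then have "lv n = j" unfolding lv_def using ex_unique[OF odo_r0] by blast
  with j show ?thesis using ex_unique[OF odo_r0] by blast
qed

lemma ge_r0_iff: "ge r0 k n \<longleftrightarrow> k \<le> lv n"
  using ex_ge_iff[OF odo_r0, of "lv n" n k] ex_r0_iff by simp

section \<open>Layers and local rules\<close>

datatype ax = AX | AY | AZ

fun co :: "ax \<Rightarrow> pos \<Rightarrow> int" where
  "co AX p = fst p" | "co AY p = fst (snd p)" | "co AZ p = snd (snd p)"

fun upd :: "ax \<Rightarrow> int \<Rightarrow> pos \<Rightarrow> pos" where
  "upd AX n p = (n, fst (snd p), snd (snd p))"
| "upd AY n p = (fst p, n, snd (snd p))"
| "upd AZ n p = (fst p, fst (snd p), n)"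

definition dn :: "ax \<Rightarrow> pos \<Rightarrow> pos" where "dn a p = upd a (co a p - 1) p"

lemma co_upd [simp]: "co a (upd b n p) = (if a = b then n else co a p)"
  by (cases a; cases b) auto

lemma co_dn [simp]: "co a (dn b p) = (if a = b then co a p - 1 else co a p)"
  by (simp add: dn_def)

lemma co_vadd [simp]: "co a (vadd p q) = co a p + co a q"
  by (cases a) (auto simp: vadd_def)

lemma pos_eqI: "(\<And>a. co a p = co a q) \<Longrightarrow> p = q"
  by (metis co.simps prod.collapse)

declare co.simps [simp del] upd.simps [simp del]

text \<open>\<open>B0 a\<close>: the level of coordinate \<open>a\<close> is 0.  \<open>EV a b\<close>: the level of \<open>a\<close> is at least that of \<open>b\<close>.
  \<open>PH a b\<close>: the two digits of coordinate \<open>a\<close> at the level of \<open>b\<close>.  \<open>LA a\<close>: the machine state at the time given by the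
  level of \<open>a\<close>.  \<open>CM l a b\<close>: the level of \<open>a\<close> compared with the position of marker \<open>l\<close> at the time given by the level of \<open>b\<close>.
  \<open>UU\<close> is a binary counter driven by the coordinate \<open>AZ\<close> whose digits are laid out row by row over the cells where the
  levels of \<open>AX\<close> and \<open>AY\<close> agree; \<open>HH\<close> is the carry inside a row, entering it as \<open>ST\<close> and leaving it as \<open>OV\<close>, and \<open>VV\<close>
  passes it to the next row.  \<open>FX\<close> and \<open>FY\<close> are the carry out of the whole array, seen from either axis.\<close>

datatype lay = B0 ax | EV ax ax | PH ax ax | LA ax | CM nat ax ax
  | ST | OV | HH | UU | VV | FX | FY

text \<open>Strict inequality, successor and equality of the levels of two axes, as visible in one cell.\<close>

definition gtl :: "(lay \<Rightarrow> int) \<Rightarrow> ax \<Rightarrow> ax \<Rightarrow> bool" where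
  "gtl g a b \<longleftrightarrow> g (EV a b) = 1 \<and> even (g (PH a b))"
definition sul :: "(lay \<Rightarrow> int) \<Rightarrow> ax \<Rightarrow> ax \<Rightarrow> bool" where
  "sul g a b \<longleftrightarrow> g (EV a b) = 1 \<and> g (PH a b) = 2"
definition eql :: "(lay \<Rightarrow> int) \<Rightarrow> ax \<Rightarrow> ax \<Rightarrow> bool" where
  "eql g a b \<longleftrightarrow> g (EV a b) = 1 \<and> odd (g (PH a b))"

definition dist3 :: "ax \<Rightarrow> ax \<Rightarrow> ax \<Rightarrow> bool" where
  "dist3 a b c \<longleftrightarrow> a \<noteq> b \<and> b \<noteq> c \<and> a \<noteq> c"

text \<open>In the rules, \<open>g\<close> is the content of a cell and \<open>gm a\<close> that of its predecessor along the axis \<open>a\<close>.\<close>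

definition rul_level :: "(lay \<Rightarrow> int) \<Rightarrow> (ax \<Rightarrow> lay \<Rightarrow> int) \<Rightarrow> bool" where
  "rul_level g gm \<longleftrightarrow>
    (\<forall>a. g (B0 a) \<in> {0, 1} \<and> (g (B0 a) = 1 \<longleftrightarrow> gm a (B0 a) \<noteq> 1) \<and> g (EV a a) = 0 \<and> g (PH a a) = 0) \<and>
    (\<forall>a b. a \<noteq> b \<longrightarrow> gm b (B0 a) = g (B0 a) \<and> g (EV a b) \<in> {0, 1} \<and>
      (g (B0 b) = 1 \<longrightarrow> g (EV a b) = 1 \<and> (g (B0 a) = 1 \<longleftrightarrow> odd (g (PH a b)))) \<and>
      g (PH a b) = (gm a (PH a b) + g (EV a b)) mod 4 \<and>
      (g (EV b a) = 1 \<longrightarrow> (g (EV a b) = 1 \<longleftrightarrow> odd (g (PH b a))))) \<and>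
    (\<forall>a b c. dist3 a b c \<longrightarrow> gm c (EV a b) = g (EV a b) \<and> gm c (PH a b) = g (PH a b) \<and>
      (sul g b c \<longrightarrow> (g (EV a b) = 1 \<longleftrightarrow> g (EV a c) = 1 \<and> even (g (PH a c))) \<and>
         g (PH a b) mod 2 = g (PH a c) div 2) \<and>
      (eql g b c \<longrightarrow> g (PH a b) = g (PH a c)))"

text \<open>Marker \<open>l\<close> is at level \<open>P l k\<close> at time \<open>k\<close>.  Only the coincidences with marker 0 are visible to the control, so that
  \<open>P l k - P 0 k\<close> acts as a counter with a zero test.\<close>

locale driver =
  fixes M :: nat and P :: "nat \<Rightarrow> nat \<Rightarrow> nat" and Lam :: "nat \<Rightarrow> int"
    and mv :: "nat \<Rightarrow> int \<Rightarrow> bool" and del :: "int \<Rightarrow> nat set \<Rightarrow> int"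
  assumes M2: "2 \<le> M" and Lam_fin: "finite (range Lam)"
    and P_0: "P l 0 = 0"
    and P_Suc: "l < M \<Longrightarrow> P l (Suc k) = P l k + (if mv l (Lam k) then 1 else 0)"
    and Lam_Suc: "Lam (Suc k) = del (Lam k) {l. l < M \<and> P l (Suc k) = P 0 (Suc k)}"
    and P_unb: "l < M \<Longrightarrow> \<exists>k. B \<le> P l k"
begin

text \<open>When \<open>b\<close> is one level above \<open>c\<close>, the cell compares the level
  of \<open>a\<close> with marker \<open>l\<close> at two consecutive times. If the marker moves,
  the earlier comparison cannot tell "at" from "above" the new position; the clauses on
  \<open>CM l c b\<close> decide this through a smaller level, that of \<open>c\<close>. The clause
  on \<open>gtl g b c\<close> carries "below the marker" to all later times, including an infinite
  level of \<open>b\<close>.\<close>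

definition rul_mach :: "(lay \<Rightarrow> int) \<Rightarrow> (ax \<Rightarrow> lay \<Rightarrow> int) \<Rightarrow> bool" where
  "rul_mach g gm \<longleftrightarrow>
    (\<forall>a. (g (B0 a) = 1 \<longrightarrow> g (LA a) = Lam 0) \<and> (\<forall>c. c \<noteq> a \<longrightarrow> gm c (LA a) = g (LA a))) \<and>
    (\<forall>l a b. (a = b \<or> M \<le> l \<longrightarrow> g (CM l a b) = 0) \<and>
      (a \<noteq> b \<and> l < M \<longrightarrow> g (CM l a b) \<in> {0, 1, 2} \<and>
        (g (B0 b) = 1 \<longrightarrow> g (CM l a b) = (if g (B0 a) = 1 then 1 else 2)) \<and>
        (gtl g a b \<longrightarrow> g (CM l a b) = 2))) \<and>
    (\<forall>l a b c. l < M \<and> dist3 a b c \<longrightarrow> gm c (CM l a b) = g (CM l a b) \<and>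
      (sul g b c \<longrightarrow> (if mv l (g (LA c))
         then (g (CM l a c) \<le> 1 \<longrightarrow> g (CM l a b) = 0) \<and> (g (CM l a c) = 2 \<longrightarrow> g (CM l a b) \<ge> 1)
         else g (CM l a b) = g (CM l a c))) \<and>
      (gtl g b c \<and> g (CM l a c) = 0 \<longrightarrow> g (CM l a b) = 0) \<and>
      (sul g a c \<and> g (CM l c b) = 0 \<longrightarrow> g (CM l a b) \<le> 1) \<and>
      (gtl g a c \<and> g (CM l c b) \<ge> 1 \<longrightarrow> g (CM l a b) = 2)) \<and>
    (\<forall>a b c. dist3 a b c \<and> sul g b c \<and> g (CM 0 a b) = 1 \<longrightarrow>
      g (LA b) = del (g (LA c)) {l. l < M \<and> g (CM l a b) = 1})"

text \<open>\<open>CM 1 AX AY = 0\<close> marks the end of a period along a column: the carry leaves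
  as \<open>FX\<close> and a fresh one, \<open>EV AZ AX\<close>, enters. Rows do the same with
  \<open>OV\<close> and \<open>ST\<close>. In between the carries are handed on unchanged, except
  where the levels of \<open>AX\<close> and \<open>AY\<close> agree, where \<open>VV\<close> passes
  through a row and \<open>HH\<close> through a half adder. The clauses on \<open>EV\<close> forbid
  a carry where the level of the vertical coordinate is too low for one; the last three tie arrays
  of consecutive levels together.\<close>

definition rul_digit :: "(lay \<Rightarrow> int) \<Rightarrow> (ax \<Rightarrow> lay \<Rightarrow> int) \<Rightarrow> bool" where
  "rul_digit g gm \<longleftrightarrow>
    (\<forall>i\<in>{ST, OV, HH, UU, VV, FX, FY}. g i \<in> {0, 1}) \<and>
    gm AX ST = g ST \<and> gm AX OV = g OV \<and> gm AY FX = g FX \<and> gm AX FY = g FY \<and>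
    (if g (CM 1 AX AY) = 0 then g VV = g (EV AZ AX) \<and> g FX = gm AY VV
     else if eql g AX AY then g VV = g OV \<and> g ST = gm AY VV else g VV = gm AY VV) \<and>
    (if g (CM 1 AY AX) = 0 then g HH = g ST \<and> g OV = gm AX HH \<and> g UU = 0
     else if eql g AX AY then g HH = gm AX HH * gm AZ UU \<and> g UU = (gm AX HH + gm AZ UU) mod 2
     else g HH = gm AX HH \<and> g UU = 0) \<and>
    (\<forall>i\<in>{HH, ST, OV, FY}. g i = 1 \<longrightarrow> g (EV AZ AY) = 1) \<and>
    (\<forall>i\<in>{VV, FX}. g i = 1 \<longrightarrow> g (EV AZ AX) = 1) \<and>
    (eql g AX AY \<longrightarrow> g FX = g FY) \<and> (sul g AX AY \<and> g FX = 1 \<longrightarrow> g FY = 1) \<and>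
    (sul g AY AX \<and> g FY = 1 \<longrightarrow> g FX = 1)"

definition ruled :: "(pos \<Rightarrow> lay \<Rightarrow> int) \<Rightarrow> bool" where
  "ruled \<xi> \<longleftrightarrow> (\<forall>p. rul_level (\<xi> p) (\<lambda>a. \<xi> (dn a p)) \<and> rul_mach (\<xi> p) (\<lambda>a. \<xi> (dn a p)) \<and>
     rul_digit (\<xi> p) (\<lambda>a. \<xi> (dn a p)))"

lemma P_mono: assumes "l < M" "j \<le> k" shows "P l j \<le> P l k"
  using assms(2,1) by (induction k rule: dec_induct) (auto simp: P_Suc)

lemma P_le: "l < M \<Longrightarrow> P l k \<le> k"
  by (induction k) (auto simp: P_0 P_Suc)

lemma P_diff: assumes "l < M" "j \<le> k" shows "P l k \<le> P l j + (k - j)"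
  using assms(2,1) by (induction k rule: dec_induct) (auto simp: P_Suc)

text \<open>Marker 1 leaves level \<open>s\<close> at time \<open>JJ s\<close>; until then the cells of level \<open>s\<close> are grouped into arrays with \<open>NN s\<close> rows
  and columns.\<close>

definition JJ :: "nat \<Rightarrow> nat" where "JJ s = (LEAST k. s < P 1 (Suc k))"
definition NN :: "nat \<Rightarrow> nat" where "NN s = 2 ^ (JJ s - s)"

lemma JJ_iff: "s < P 1 k \<longleftrightarrow> JJ s < k"
proof -
  have 1: "1 < M" using M2 by simp
  obtain k0 where "Suc s \<le> P 1 k0" using P_unb[OF 1] by blast
  then have "s < P 1 (Suc k0)" using P_mono[OF 1, of k0 "Suc k0"] by simp
  then have a: "s < P 1 (Suc (JJ s))" unfolding JJ_def by (rule LeastI)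
  show ?thesis
  proof
    assume s: "s < P 1 k"
    then obtain k' where k: "k = Suc k'" by (cases k) (auto simp: P_0)
    with s have "JJ s \<le> k'" unfolding JJ_def by (intro Least_le) simp
    then show "JJ s < k" by (simp add: k)
  next
    assume "JJ s < k"
    then show "s < P 1 k" using a P_mono[OF 1, of "Suc (JJ s)" k] by simp
  qed
qed

lemma JJ_ge: "s \<le> JJ s"
  using JJ_iff[of s "Suc (JJ s)"] P_le[of 1 "Suc (JJ s)"] M2 by simp

lemma P_JJ: "P 1 (JJ s) = s"
proof -
  have 1: "1 < M" using M2 by simp
  have "P 1 (JJ s) \<le> s" "s < P 1 (Suc (JJ s))"
    using JJ_iff[of s "JJ s"] JJ_iff[of s "Suc (JJ s)"] by linarith+
  moreover have "P 1 (Suc (JJ s)) \<le> P 1 (JJ s) + 1" using P_Suc[OF 1, of "JJ s"] by simp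
  ultimately show ?thesis by linarith
qed

text \<open>A marker climbs at most one level per unit of time, so marker 1 needs at least
  \<open>t - s\<close> units to get from \<open>s\<close> to \<open>t\<close>. The resulting
  monotonicity of \<open>NN\<close> is what the rules nesting \<open>FX\<close> and
  \<open>FY\<close> rest on.\<close>

lemma JJ_diff_mono: "s \<le> t \<Longrightarrow> JJ s - s \<le> JJ t - t"
proof -
  assume "s \<le> t"
  then have "JJ s \<le> JJ t" using JJ_iff[of t "JJ s"] P_JJ[of s] by linarith
  then have "t \<le> s + (JJ t - JJ s)" using P_diff[of 1 "JJ s" "JJ t"] M2 unfolding P_JJ by simp
  then show ?thesis using \<open>s \<le> t\<close> JJ_ge[of s] JJ_ge[of t] \<open>JJ s \<le> JJ t\<close> by linarith
qed

lemma NN_mono: "s \<le> t \<Longrightarrow> NN s \<le> NN t"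
  by (simp add: NN_def JJ_diff_mono)

lemma NN_pos: "0 < NN s" by (simp add: NN_def)

definition cmp :: "nat \<Rightarrow> nat \<Rightarrow> int" where
  "cmp i m = (if i < m then 0 else if i = m then 1 else 2)"

abbreviation (input) crow :: "(nat \<Rightarrow> int) \<Rightarrow> nat \<Rightarrow> int \<Rightarrow> nat" where
  "crow r s n \<equiv> cnt r (JJ s) s n"

text \<open>An array of level \<open>s\<close> shows the digits of the vertical coordinate in
  reading order. They start at digit \<open>s\<close> because the carry into that digit is visible
  locally as \<open>EV AZ AX\<close>. All carry layers have the form "the level of the vertical
  coordinate is at least \<open>i\<close>", which says that the carry reaches digit
  \<open>i\<close>.\<close>

fun y0 :: "pos \<Rightarrow> lay \<Rightarrow> int" where
  "y0 p (B0 a) = of_bool (lv (co a p) = 0)"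
| "y0 p (EV a b) = of_bool (a \<noteq> b \<and> lv (co b p) \<le> lv (co a p))"
| "y0 p (PH a b) = (if a = b then 0 else ph r0 (lv (co b p)) (co a p))"
| "y0 p (LA a) = Lam (lv (co a p))"
| "y0 p (CM l a b) = (if a = b \<or> M \<le> l then 0 else cmp (lv (co a p)) (P l (lv (co b p))))"
| "y0 p ST = (let s = lv (co AY p) in
     of_bool (s + NN s * (crow r0 s (co AY p) - 1) \<le> lv (co AZ p)))"
| "y0 p OV = (let s = lv (co AY p) in
     of_bool (s + NN s * crow r0 s (co AY p) \<le> lv (co AZ p)))"
| "y0 p HH = (let s = lv (co AY p) in
     of_bool (s + NN s * (crow r0 s (co AY p) - 1) + crow r0 s (co AX p) \<le> lv (co AZ p)))"
| "y0 p UU = (let s = lv (co AY p) in if lv (co AX p) = s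
     then bitr r0 (s + NN s * (crow r0 s (co AY p) - 1) + (crow r0 s (co AX p) - 1)) (co AZ p) else 0)"
| "y0 p VV = (let s = lv (co AX p) in of_bool (s + NN s * crow r0 s (co AY p) \<le> lv (co AZ p)))"
| "y0 p FX = (let s = lv (co AX p) in of_bool (s + NN s * NN s \<le> lv (co AZ p)))"
| "y0 p FY = (let s = lv (co AY p) in of_bool (s + NN s * NN s \<le> lv (co AZ p)))"

end

section \<open>The model configuration\<close>

context driver begin

lemma y0_gtl: "a \<noteq> b \<Longrightarrow> gtl (y0 p) a b \<longleftrightarrow> lv (co b p) < lv (co a p)"
  using ph_level(1)[OF odo_r0, of "lv (co b p)" "co a p"] by (auto simp: gtl_def ge_r0_iff)

lemma y0_sul: "a \<noteq> b \<Longrightarrow> sul (y0 p) a b \<longleftrightarrow> lv (co a p) = Suc (lv (co b p))"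
  using ph_level(3)[OF odo_r0, of "lv (co b p)" "co a p"] by (auto simp: sul_def ge_r0_iff ex_r0_iff)

lemma y0_eql: "a \<noteq> b \<Longrightarrow> eql (y0 p) a b \<longleftrightarrow> lv (co a p) = lv (co b p)"
  using ph_level(1)[OF odo_r0, of "lv (co b p)" "co a p"] by (auto simp: eql_def ge_r0_iff)

lemma lv_0_iff: "lv n = 0 \<longleftrightarrow> odd (n - r0 1)"
  using ge_r0_iff[of 1 n] by (auto simp: ge_def)

lemma lv_pred_0_iff: "lv (n - 1) = 0 \<longleftrightarrow> lv n \<noteq> 0"
proof -
  have "odd (n - 1 - c) \<longleftrightarrow> \<not> odd (n - c)" for c :: int by presburger
  then show ?thesis unfolding lv_0_iff by blast
qed

lemma y0_level: "rul_level (y0 p) (\<lambda>a. y0 (dn a p))"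
proof -
  have A: "y0 p (B0 a) \<in> {0, 1} \<and> (y0 p (B0 a) = 1 \<longleftrightarrow> y0 (dn a p) (B0 a) \<noteq> 1) \<and>
      y0 p (EV a a) = 0 \<and> y0 p (PH a a) = 0" for a
    by (auto simp: lv_pred_0_iff)
  have B: "y0 (dn b p) (B0 a) = y0 p (B0 a) \<and> y0 p (EV a b) \<in> {0, 1} \<and>
      (y0 p (B0 b) = 1 \<longrightarrow> y0 p (EV a b) = 1 \<and> (y0 p (B0 a) = 1 \<longleftrightarrow> odd (y0 p (PH a b)))) \<and>
      y0 p (PH a b) = (y0 (dn a p) (PH a b) + y0 p (EV a b)) mod 4 \<and>
      (y0 p (EV b a) = 1 \<longrightarrow> (y0 p (EV a b) = 1 \<longleftrightarrow> odd (y0 p (PH b a))))" if ab: "a \<noteq> b" for a b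
  proof (intro conjI impI)
    show "y0 p (PH a b) = (y0 (dn a p) (PH a b) + y0 p (EV a b)) mod 4"
      using ab ph_step[OF odo_r0, of "lv (co b p)" "co a p"] by (simp add: ge_r0_iff)
    show "(y0 p (B0 a) = 1) = odd (y0 p (PH a b))" if "y0 p (B0 b) = 1"
      using that ab ph_level(1)[OF odo_r0, of 0 "co a p"] by (auto simp: ge_r0_iff Suc_le_eq)
    show "(y0 p (EV a b) = 1) = odd (y0 p (PH b a))" if "y0 p (EV b a) = 1"
      using that ab y0_eql[of b a p] y0_gtl[of b a p] by (auto simp: eql_def gtl_def)
  qed (use ab in auto)
  have C: "y0 (dn c p) (EV a b) = y0 p (EV a b) \<and> y0 (dn c p) (PH a b) = y0 p (PH a b) \<and>
      (sul (y0 p) b c \<longrightarrow> (y0 p (EV a b) = 1 \<longleftrightarrow> y0 p (EV a c) = 1 \<and> even (y0 p (PH a c))) \<and>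
         y0 p (PH a b) mod 2 = y0 p (PH a c) div 2) \<and>
      (eql (y0 p) b c \<longrightarrow> y0 p (PH a b) = y0 p (PH a c))" if d: "dist3 a b c" for a b c
  proof (intro conjI impI)
    assume s: "sul (y0 p) b c"
    then have l: "lv (co b p) = Suc (lv (co c p))" using y0_sul d by (auto simp: dist3_def)
    show "(y0 p (EV a b) = 1) = (y0 p (EV a c) = 1 \<and> even (y0 p (PH a c)))"
      using y0_gtl[of a c p] d l by (auto simp: gtl_def dist3_def)
    show "y0 p (PH a b) mod 2 = y0 p (PH a c) div 2"
      using ph_Suc[OF odo_r0, of "lv (co c p)" "co a p"] d l by (simp add: dist3_def)
  next
    assume "eql (y0 p) b c"
    then show "y0 p (PH a b) = y0 p (PH a c)" using y0_eql[of b c p] d by (simp add: dist3_def)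
  qed (use d in \<open>auto simp: dist3_def\<close>)
  show ?thesis unfolding rul_level_def using A B C by blast
qed

lemma cmp_range: "cmp i m \<in> {0, 1, 2}" by (simp add: cmp_def)

lemma y0_mach: "rul_mach (y0 p) (\<lambda>a. y0 (dn a p))"
proof -
  have A: "(y0 p (B0 a) = 1 \<longrightarrow> y0 p (LA a) = Lam 0) \<and> (\<forall>c. c \<noteq> a \<longrightarrow> y0 (dn c p) (LA a) = y0 p (LA a))" for a
    by simp
  have B: "(a = b \<or> M \<le> l \<longrightarrow> y0 p (CM l a b) = 0) \<and>
      (a \<noteq> b \<and> l < M \<longrightarrow> y0 p (CM l a b) \<in> {0, 1, 2} \<and>
        (y0 p (B0 b) = 1 \<longrightarrow> y0 p (CM l a b) = (if y0 p (B0 a) = 1 then 1 else 2)) \<and>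
        (gtl (y0 p) a b \<longrightarrow> y0 p (CM l a b) = 2))" for l a b
  proof -
    have "cmp (lv (co a p)) (P l (lv (co b p))) = 2" if "lv (co b p) < lv (co a p)" "l < M"
      using P_le[OF that(2), of "lv (co b p)"] that by (simp add: cmp_def)
    then show ?thesis using y0_gtl[of a b p] cmp_range by (auto simp: P_0 cmp_def)
  qed
  have C: "y0 (dn c p) (CM l a b) = y0 p (CM l a b) \<and>
      (sul (y0 p) b c \<longrightarrow> (if mv l (y0 p (LA c))
         then (y0 p (CM l a c) \<le> 1 \<longrightarrow> y0 p (CM l a b) = 0) \<and> (y0 p (CM l a c) = 2 \<longrightarrow> y0 p (CM l a b) \<ge> 1)
         else y0 p (CM l a b) = y0 p (CM l a c))) \<and>
      (gtl (y0 p) b c \<and> y0 p (CM l a c) = 0 \<longrightarrow> y0 p (CM l a b) = 0) \<and>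
      (sul (y0 p) a c \<and> y0 p (CM l c b) = 0 \<longrightarrow> y0 p (CM l a b) \<le> 1) \<and>
      (gtl (y0 p) a c \<and> y0 p (CM l c b) \<ge> 1 \<longrightarrow> y0 p (CM l a b) = 2)" if d: "l < M" "dist3 a b c" for l a b c
  proof -
    have 1: "P l (lv (co c p)) \<le> P l (lv (co b p))" if "lv (co c p) < lv (co b p)"
      using P_mono d that by simp
    have n: "a \<noteq> b" "b \<noteq> c" "a \<noteq> c" "b \<noteq> a" "c \<noteq> b" "\<not> M \<le> l" using d by (auto simp: dist3_def)
    define i j k where "i = lv (co a p)" and "j = lv (co b p)" and "k = lv (co c p)"
    have e: "y0 p (CM l a b) = cmp i (P l j)" "y0 p (CM l a c) = cmp i (P l k)" "y0 p (CM l c b) = cmp k (P l j)"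
      "sul (y0 p) b c \<longleftrightarrow> j = Suc k" "gtl (y0 p) b c \<longleftrightarrow> k < j" "sul (y0 p) a c \<longleftrightarrow> i = Suc k"
      "gtl (y0 p) a c \<longleftrightarrow> k < i" "y0 p (LA c) = Lam k"
      using n by (simp_all add: y0_sul y0_gtl i_def j_def k_def)
    have m: "if mv l (Lam k) then (cmp i (P l k) \<le> 1 \<longrightarrow> cmp i (P l j) = 0) \<and> (cmp i (P l k) = 2 \<longrightarrow> cmp i (P l j) \<ge> 1)
        else cmp i (P l j) = cmp i (P l k)" if "j = Suc k"
      unfolding that P_Suc[OF d(1)] cmp_def by simp
    have "k < j \<and> cmp i (P l k) = 0 \<longrightarrow> cmp i (P l j) = 0"
      using 1 unfolding j_def[symmetric] k_def[symmetric]
      by (cases "k < j") (auto simp: cmp_def split: if_splits)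
    moreover have "i = Suc k \<and> cmp k (P l j) = 0 \<longrightarrow> cmp i (P l j) \<le> 1"
      "k < i \<and> cmp k (P l j) \<ge> 1 \<longrightarrow> cmp i (P l j) = 2"
      by (simp_all add: cmp_def split: if_splits)
    moreover have "y0 (dn c p) (CM l a b) = y0 p (CM l a b)" using n by simp
    ultimately show ?thesis unfolding e using m by blast
  qed
  have D: "y0 p (LA b) = del (y0 p (LA c)) {l. l < M \<and> y0 p (CM l a b) = 1}"
    if "dist3 a b c" "sul (y0 p) b c" "y0 p (CM 0 a b) = 1" for a b c
  proof -
    have l: "lv (co b p) = Suc (lv (co c p))" using that by (auto simp: dist3_def y0_sul)
    have c: "y0 p (CM l a b) = 1 \<longleftrightarrow> lv (co a p) = P l (lv (co b p))" if "l < M" for l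
      using that \<open>dist3 a b c\<close> by (simp add: dist3_def cmp_def)
    have "lv (co a p) = P 0 (lv (co b p))" using c[of 0] M2 that(3) by simp
    then have "{l. l < M \<and> y0 p (CM l a b) = 1} = {l. l < M \<and> P l (lv (co b p)) = P 0 (lv (co b p))}"
      using c by (auto simp del: y0.simps)
    then show ?thesis using Lam_Suc[of "lv (co c p)"] l by simp
  qed
  show ?thesis unfolding rul_mach_def
    apply (rule conjI)
     apply (rule allI, rule A)
    apply (rule conjI)
     apply ((rule allI)+, rule B)
    apply (rule conjI)
     apply ((rule allI)+, rule impI, rule C; simp)
    apply ((rule allI)+, rule impI, rule D; simp)
    done
qed

text \<open>Coordinates of level above \<open>JJ s\<close> are spaced by
  \<open>2 ^ Suc (JJ s)\<close>, the period of the arrays of level \<open>s\<close>; a comparison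
  with marker 1 thus serves as the period mark.\<close>

lemma y0_CM1: "a \<noteq> b \<Longrightarrow> y0 p (CM 1 a b) = 0 \<longleftrightarrow> JJ (lv (co a p)) < lv (co b p)"
  using M2 JJ_iff[of "lv (co a p)" "lv (co b p)"] by (auto simp: cmp_def)

lemma y0_digit: "rul_digit (y0 p) (\<lambda>a. y0 (dn a p))"
proof -
  define x y z where "x = co AX p" and "y = co AY p" and "z = co AZ p"
  define X Y Z where "X = lv x" and "Y = lv y" and "Z = lv z"
  note xyz = x_def[symmetric] y_def[symmetric] z_def[symmetric]
  note XYZ = X_def[symmetric] Y_def[symmetric] Z_def[symmetric]
  have ranges: "\<forall>i\<in>{ST, OV, HH, UU, VV, FX, FY}. y0 p i \<in> {0, 1}"
    by (auto simp: Let_def bitr_def)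
  have bY: "y0 p (CM 1 AX AY) = 0 \<longleftrightarrow> JJ X < Y" and bX: "y0 p (CM 1 AY AX) = 0 \<longleftrightarrow> JJ Y < X"
    using y0_CM1 by (simp_all add: X_def Y_def x_def y_def)
  have eq: "eql (y0 p) AX AY \<longleftrightarrow> X = Y" "sul (y0 p) AX AY \<longleftrightarrow> X = Suc Y" "sul (y0 p) AY AX \<longleftrightarrow> Y = Suc X"
    using y0_eql[of AX AY p] y0_sul[of AX AY p] y0_sul[of AY AX p] by (auto simp: X_def Y_def x_def y_def)
  have st: "\<not> JJ s < lv n \<Longrightarrow> crow r0 s n = crow r0 s (n - 1) + of_bool (lv n = s)" for s n
    using cnt_step[OF odo_r0 JJ_ge, of s n] by (simp add: ge_r0_iff ex_r0_iff Suc_le_eq)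
  have c0: "JJ s < lv n \<Longrightarrow> crow r0 s n = 0" "JJ s < lv n \<Longrightarrow> crow r0 s (n - 1) = NN s" for s n
    using cnt_0[of r0 "JJ s" n] cnt_last[of r0 "JJ s" n s] JJ_ge by (auto simp: ge_r0_iff NN_def Suc_le_eq)
  have V: "if y0 p (CM 1 AX AY) = 0 then y0 p VV = y0 p (EV AZ AX) \<and> y0 p FX = y0 (dn AY p) VV
     else if eql (y0 p) AX AY then y0 p VV = y0 p OV \<and> y0 p ST = y0 (dn AY p) VV else y0 p VV = y0 (dn AY p) VV"
    unfolding bY eq using c0[of X y] st[of X y]
    by (auto simp: Let_def xyz XYZ)
  have H: "if y0 p (CM 1 AY AX) = 0 then y0 p HH = y0 p ST \<and> y0 p OV = y0 (dn AX p) HH \<and> y0 p UU = 0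
     else if eql (y0 p) AX AY then y0 p HH = y0 (dn AX p) HH * y0 (dn AZ p) UU
        \<and> y0 p UU = (y0 (dn AX p) HH + y0 (dn AZ p) UU) mod 2
     else y0 p HH = y0 (dn AX p) HH \<and> y0 p UU = 0"
  proof -
    consider "JJ Y < X" | "\<not> JJ Y < X" "X = Y" | "\<not> JJ Y < X" "X \<noteq> Y" by blast
    then show ?thesis
    proof cases
      case 1
      have ny: "crow r0 Y y = crow r0 Y (y - 1) + 1" using st[of Y y] JJ_ge[of Y] by (simp add: XYZ)
      have "X \<noteq> Y" using 1 JJ_ge[of Y] by simp
      then show ?thesis unfolding bY bX eq using 1 c0[of Y x] ny
        by (auto simp: Let_def xyz XYZ)
    next
      case 2
      define b where "b = Y + NN Y * (crow r0 Y y - 1) + crow r0 Y (x - 1)"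
      have nx: "crow r0 Y x = Suc (crow r0 Y (x - 1))" using st[of Y x] 2 by (simp add: XYZ)
      have h: "y0 p HH = of_bool (Suc b \<le> Z)" "y0 (dn AX p) HH = of_bool (b \<le> Z)"
        "y0 p UU = bitr r0 b z" "y0 (dn AZ p) UU = bitr r0 b (z - 1)"
        using nx 2 by (auto simp: Let_def xyz XYZ b_def add.assoc)
      have "bitr r0 b (z - 1) = 0 \<or> bitr r0 b (z - 1) = 1" unfolding bitr_def by presburger
      then have "of_bool (Suc b \<le> Z) = of_bool (b \<le> Z) * bitr r0 b (z - 1)"
        "bitr r0 b z = (of_bool (b \<le> Z) + bitr r0 b (z - 1)) mod 2"
        using bitr_ge(2)[OF odo_r0, of b z] bitr_step[OF odo_r0, of b z]
        by (auto simp: ge_r0_iff XYZ add.commute)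
      then show ?thesis unfolding bX eq h using 2 by simp
    next
      case 3
      then show ?thesis unfolding bX eq using st[of Y x] by (auto simp: Let_def xyz XYZ)
    qed
  qed
  have cl: "\<forall>i\<in>{HH, ST, OV, FY}. y0 p i = 1 \<longrightarrow> y0 p (EV AZ AY) = 1"
    "\<forall>i\<in>{VV, FX}. y0 p i = 1 \<longrightarrow> y0 p (EV AZ AX) = 1"
    by (auto simp: Let_def)
  \<comment> \<open>A carry out of the array of level \<open>Suc Y\<close> implies one out of the
    array of level \<open>Y\<close>, because its last digit comes later.\<close>
  have m: "Y + NN Y * NN Y \<le> Suc Y + NN (Suc Y) * NN (Suc Y)" for Y
    using NN_mono[of Y "Suc Y"] mult_le_mono by (simp add: le_SucI)
  have n: "(eql (y0 p) AX AY \<longrightarrow> y0 p FX = y0 p FY) \<and> (sul (y0 p) AX AY \<and> y0 p FX = 1 \<longrightarrow> y0 p FY = 1) \<and>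
    (sul (y0 p) AY AX \<and> y0 p FY = 1 \<longrightarrow> y0 p FX = 1)"
    unfolding eq using m[of X] m[of Y] by (auto simp: Let_def xyz XYZ)
  show ?thesis unfolding rul_digit_def using ranges V H cl n by (simp add: Let_def)
qed

theorem y0_ruled: "ruled y0"
  unfolding ruled_def using y0_level y0_mach y0_digit by blast

end

section \<open>Rigidity of the levels\<close>

declare split_paired_All [simp del] split_paired_Ex [simp del]

lemma upd_upd [simp]: "upd a m (upd a n p) = upd a m p"
  by (rule pos_eqI) simp

lemma upd_co [simp]: "upd a (co a p) p = p"
  by (rule pos_eqI) simp

lemma dn_upd: "dn a (upd a n p) = upd a (n - 1) p"
  by (simp add: dn_def)

lemma const_along:
  assumes "\<And>p. f (dn c p) = f p" shows "f (upd c n p) = f p"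
proof -
  have "f (upd c n p) = f (upd c (co c p) p)"
    by (rule int_const[of "\<lambda>n. f (upd c n p)"]) (metis assms dn_upd)
  then show ?thesis by simp
qed

lemma dist3_cases: "a \<noteq> b \<Longrightarrow> \<exists>c. dist3 a b c"
  unfolding dist3_def by (cases a; cases b) (auto intro: exI[of _ AX] exI[of _ AY] exI[of _ AZ])

lemma dist3_all: "dist3 a b c \<Longrightarrow> d = a \<or> d = b \<or> d = c"
  unfolding dist3_def by (cases a; cases b; cases c; cases d) auto

lemma depends1:
  assumes "\<And>p c. c \<noteq> a \<Longrightarrow> f (dn c p) = f p" and "co a p = co a q"
  shows "f p = f q"
proof -
  obtain b where "a \<noteq> b" by (cases a) auto
  then obtain c where d: "dist3 a b c" using dist3_cases by blast
  then have n: "b \<noteq> a" "c \<noteq> a" by (auto simp: dist3_def)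
  have "f (upd b i r) = f r" "f (upd c i r) = f r" for i r
    using const_along[of f] assms(1)[OF n(1)] assms(1)[OF n(2)] by blast+
  then have "f p = f (upd c (co c q) (upd b (co b q) p))" by simp
  also have "upd c (co c q) (upd b (co b q) p) = q"
  proof (rule pos_eqI)
    fix e show "co e (upd c (co c q) (upd b (co b q) p)) = co e q"
      using dist3_all[OF d, of e] assms(2) n by auto
  qed
  finally show ?thesis .
qed

lemma depends2:
  assumes "\<And>p. f (dn c p) = f p" "dist3 a b c" and "co a p = co a q" "co b p = co b q"
  shows "f p = f q"
proof -
  have "f p = f (upd c (co c q) p)" using const_along[of f] assms(1) by simp
  also have "upd c (co c q) p = q"
  proof (rule pos_eqI)
    fix e show "co e (upd c (co c q) p) = co e q"
      using dist3_all[OF assms(2), of e] assms by auto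
  qed
  finally show ?thesis .
qed

lemma odo_const: "odo (\<lambda>_. c)" by (simp add: odo_def)

locale levelled =
  fixes \<xi> :: "pos \<Rightarrow> lay \<Rightarrow> int"
  assumes L: "rul_level (\<xi> p) (\<lambda>a. \<xi> (dn a p))"
begin

lemma L_B0: "\<xi> p (B0 a) = 1 \<longleftrightarrow> \<xi> (dn a p) (B0 a) \<noteq> 1" "b \<noteq> a \<Longrightarrow> \<xi> (dn b p) (B0 a) = \<xi> p (B0 a)"
  "\<xi> p (B0 a) \<in> {0, 1}"
  using L[of p] unfolding rul_level_def by metis+

lemma L_diag: "\<xi> p (EV a a) = 0" "\<xi> p (PH a a) = 0"
  using L[of p] unfolding rul_level_def by metis+

lemma L_EV: assumes "a \<noteq> b" shows "\<xi> p (EV a b) \<in> {0, 1}"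
  "\<xi> p (B0 b) = 1 \<Longrightarrow> \<xi> p (EV a b) = 1" "\<xi> p (B0 b) = 1 \<Longrightarrow> \<xi> p (B0 a) = 1 \<longleftrightarrow> odd (\<xi> p (PH a b))"
  "\<xi> p (PH a b) = (\<xi> (dn a p) (PH a b) + \<xi> p (EV a b)) mod 4"
  "\<xi> p (EV b a) = 1 \<Longrightarrow> \<xi> p (EV a b) = 1 \<longleftrightarrow> odd (\<xi> p (PH b a))"
  using L[of p] assms unfolding rul_level_def by metis+

lemma L_3: assumes "dist3 a b c" shows "\<xi> (dn c p) (EV a b) = \<xi> p (EV a b)"
  "\<xi> (dn c p) (PH a b) = \<xi> p (PH a b)"
  "sul (\<xi> p) b c \<Longrightarrow> \<xi> p (EV a b) = 1 \<longleftrightarrow> \<xi> p (EV a c) = 1 \<and> even (\<xi> p (PH a c))"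
  "sul (\<xi> p) b c \<Longrightarrow> \<xi> p (PH a b) mod 2 = \<xi> p (PH a c) div 2"
  "eql (\<xi> p) b c \<Longrightarrow> \<xi> p (PH a b) = \<xi> p (PH a c)"
  using L[of p] assms unfolding rul_level_def by metis+

lemma B0_dep: "co a p = co a q \<Longrightarrow> \<xi> p (B0 a) = \<xi> q (B0 a)"
  by (rule depends1[of a "\<lambda>p. \<xi> p (B0 a)"]) (simp_all add: L_B0(2))

lemma EV_dep: assumes "a \<noteq> b" "co a p = co a q" "co b p = co b q"
  shows "\<xi> p (EV a b) = \<xi> q (EV a b)" "\<xi> p (PH a b) = \<xi> q (PH a b)"
proof -
  obtain c where d: "dist3 a b c" using dist3_cases[OF assms(1)] by blast
  show "\<xi> p (EV a b) = \<xi> q (EV a b)"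
    by (rule depends2[of "\<lambda>p. \<xi> p (EV a b)" c a b]) (simp_all add: L_3(1)[OF d] d assms)
  show "\<xi> p (PH a b) = \<xi> q (PH a b)"
    by (rule depends2[of "\<lambda>p. \<xi> p (PH a b)" c a b]) (simp_all add: L_3(2)[OF d] d assms)
qed

text \<open>The digits of \<open>a\<close> must not depend on the axis from which they are read. Two
  readings are compared by placing the third coordinate in its set as well, since where the levels
  of \<open>b\<close> and \<open>c\<close> are equal the rule identifies \<open>PH a b\<close> with
  \<open>PH a c\<close>.\<close>

lemma uniform_PH:
  assumes S: "\<And>b c p. b \<noteq> c \<Longrightarrow> co b p \<in> S b \<Longrightarrow> co c p \<in> S c \<Longrightarrow> eql (\<xi> p) b c"
    and ne: "\<And>b. S b \<noteq> {}"
    and p: "a \<noteq> b" "co b p \<in> S b" and q: "a \<noteq> b'" "co b' q \<in> S b'" and pq: "co a p = co a q"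
  shows "\<xi> p (PH a b) = \<xi> q (PH a b')"
proof -
  have *: "\<xi> p (PH a b) = \<xi> q (PH a c)"
    if "dist3 a b c" "co b p \<in> S b" "co c q \<in> S c" "co a p = co a q" for b c p q
  proof -
    let ?p = "upd c (co c q) p"
    have "\<xi> ?p (PH a b) = \<xi> ?p (PH a c)"
      using S[of b c ?p] L_3(5)[of a b c ?p] that by (auto simp: dist3_def)
    moreover have "\<xi> ?p (PH a b) = \<xi> p (PH a b)"
      by (rule EV_dep) (use that in \<open>auto simp: dist3_def\<close>)
    moreover have "\<xi> ?p (PH a c) = \<xi> q (PH a c)"
      by (rule EV_dep) (use that in \<open>auto simp: dist3_def\<close>)
    ultimately show ?thesis by simp
  qed
  obtain c where d: "dist3 a b c" using dist3_cases[OF p(1)] by blast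
  obtain t where t: "t \<in> S c" using ne by blast
  have 1: "\<xi> p (PH a b) = \<xi> (upd c t q) (PH a c)"
    using d t pq p by (intro *) (auto simp: dist3_def)
  consider "b' = b" | "b' = c" using dist3_all[OF d, of b'] q by blast
  then show ?thesis
  proof cases
    case 1
    have "\<xi> q (PH a b) = \<xi> (upd c t q) (PH a c)"
      using d t pq q 1 by (intro *) (auto simp: dist3_def)
    then show ?thesis using \<open>\<xi> p (PH a b) = _\<close> 1 by simp
  next
    case 2
    then show ?thesis using *[OF d p(2)] q pq by simp
  qed
qed

text \<open>At stage \<open>k\<close> one integer \<open>C a\<close> per axis represents the
  odometer; only its residue modulo a power of 2 matters, and the next stage refines it.\<close>

definition St :: "nat \<Rightarrow> (ax \<Rightarrow> int) \<Rightarrow> bool" where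
  "St k C \<longleftrightarrow> (\<forall>a b p. a \<noteq> b \<and> ex (\<lambda>_. C b) k (co b p) \<longrightarrow>
     (\<xi> p (EV a b) = 1 \<longleftrightarrow> ge (\<lambda>_. C a) k (co a p)) \<and> \<xi> p (PH a b) = ph (\<lambda>_. C a) k (co a p))"

lemma St_base: "\<exists>C. St 0 C \<and> (\<forall>p a. \<xi> p (B0 a) = 1 \<longleftrightarrow> ex (\<lambda>_. C a) 0 (co a p))"
proof -
  define S where "S b = {co b p |p. \<xi> p (B0 b) = 1}" for b
  have Si: "co b p \<in> S b \<longleftrightarrow> \<xi> p (B0 b) = 1" for b p
  proof
    assume "co b p \<in> S b"
    then obtain q where "co b p = co b q" "\<xi> q (B0 b) = 1" unfolding S_def by blast
    then show "\<xi> p (B0 b) = 1" using B0_dep[of b p q] by metis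
  next
    assume "\<xi> p (B0 b) = 1" then show "co b p \<in> S b" unfolding S_def by blast
  qed
  have ne: "S b \<noteq> {}" for b
    using L_B0(1)[of "(0, 0, 0)" b] unfolding S_def by blast
  have Se: "eql (\<xi> p) b c" if "b \<noteq> c" "co b p \<in> S b" "co c p \<in> S c" for b c p
    using that L_EV[of b c p] unfolding Si eql_def by blast
  have "\<exists>C. \<forall>b p. b \<noteq> a \<and> co b p \<in> S b \<longrightarrow> \<xi> p (PH a b) = (co a p - C) mod 4" for a
  proof -
    obtain b0 where b0: "a \<noteq> b0" by (cases a) auto
    obtain p0 where p0: "co b0 p0 \<in> S b0" using ne[of b0] unfolding S_def by blast
    define f where "f n = \<xi> (upd a n p0) (PH a b0)" for n
    \<comment> \<open>At level 0 the counter advances at every step, hence the divisor 1.\<close>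
    have "f n = (f (n - 1) + of_bool (1 dvd n - 0)) mod 4" for n
    proof -
      have "\<xi> (upd a n p0) (B0 b0) = 1" using p0 b0 Si[of b0 p0] Si[of b0 "upd a n p0"] by simp
      then show ?thesis using L_EV(2,4)[OF b0, of "upd a n p0"] by (simp add: f_def dn_upd)
    qed
    from counter_form[of 1 4 f 0, OF _ _ this] obtain c where c: "\<And>n. f n = (n - c) mod 4" by auto
    have "\<xi> p (PH a b) = (co a p - c) mod 4" if "b \<noteq> a" "co b p \<in> S b" for b p
    proof -
      have "\<xi> p (PH a b) = \<xi> (upd a (co a p) p0) (PH a b0)"
        by (rule uniform_PH[of S]) (use Se ne that b0 p0 in auto)
      then show ?thesis using c[of "co a p"] by (simp add: f_def)
    qed
    then show ?thesis by blast
  qed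
  then obtain C where C: "\<And>a b p. b \<noteq> a \<Longrightarrow> co b p \<in> S b \<Longrightarrow> \<xi> p (PH a b) = (co a p - C a) mod 4"
    by metis
  have B: "\<xi> p (B0 a) = 1 \<longleftrightarrow> ex (\<lambda>_. C a) 0 (co a p)" for p a
  proof -
    obtain b where b: "a \<noteq> b" by (cases a) auto
    obtain t where t: "t \<in> S b" using ne by blast
    let ?p = "upd b t p"
    have "\<xi> ?p (PH a b) = (co a p - C a) mod 4" using C[of b a ?p] b t by simp
    moreover have "\<xi> ?p (B0 b) = 1" using Si[of b ?p] t by simp
    moreover have "\<xi> ?p (B0 a) = \<xi> p (B0 a)" by (rule B0_dep) (use b in simp)
    moreover have "odd (u mod 4) \<longleftrightarrow> odd u" for u :: int by presburger
    ultimately show ?thesis using L_EV(3)[OF b, of ?p] by (simp add: ex_def ge_def)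
  qed
  have "St 0 C" unfolding St_def
  proof (intro allI impI)
    fix a b p assume "a \<noteq> b \<and> ex (\<lambda>_. C b) 0 (co b p)"
    then have ab: "a \<noteq> b" "\<xi> p (B0 b) = 1" using B by auto
    then show "(\<xi> p (EV a b) = 1 \<longleftrightarrow> ge (\<lambda>_. C a) 0 (co a p)) \<and> \<xi> p (PH a b) = ph (\<lambda>_. C a) 0 (co a p)"
      using L_EV(2)[OF ab] C[of b a p] Si[of b p] by (simp add: ph_def)
  qed
  with B show ?thesis by blast
qed

text \<open>In cells where \<open>b\<close> has level \<open>Suc k\<close> and \<open>c\<close> has
  level \<open>k\<close> the flag \<open>sul\<close> is set, and its rules pass the knowledge about
  \<open>a\<close> from stage \<open>k\<close> to the next. Agreement modulo
  \<open>2 ^ (k + 2)\<close> is required so that "level exactly \<open>Suc k\<close>" means the same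
  for \<open>C\<close> and for \<open>D\<close>.\<close>

lemma St_step: assumes "St k C" shows "\<exists>D. St (Suc k) D \<and> (\<forall>a. 2 ^ (k + 2) dvd D a - C a)"
proof -
  define T where "T b = {n. ex (\<lambda>_. C b) k n}" for b
  define S where "S b = {n. ex (\<lambda>_. C b) (Suc k) n}" for b
  have neT: "\<exists>t. t \<in> T b" and neS: "S b \<noteq> {}" for b
    unfolding T_def S_def using ex_exists[OF odo_const] by blast+
  have st: "(\<xi> p (EV a c) = 1 \<longleftrightarrow> ge (\<lambda>_. C a) k (co a p)) \<and> \<xi> p (PH a c) = ph (\<lambda>_. C a) k (co a p)"
    if "a \<noteq> c" "co c p \<in> T c" for a c p using assms that unfolding St_def T_def by blast
  have su: "sul (\<xi> p) b c" "\<xi> p (PH b c) = 2" if "b \<noteq> c" "co b p \<in> S b" "co c p \<in> T c" for b c p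
  proof -
    have "ex (\<lambda>_. C b) (Suc k) (co b p)" using that by (simp add: S_def)
    moreover from this have g: "ge (\<lambda>_. C b) k (co b p)" using ge_mono[OF odo_const] by (auto simp: ex_def)
    ultimately show "sul (\<xi> p) b c" "\<xi> p (PH b c) = 2"
      using st[OF that(1,3)] ph_level(3)[OF odo_const g] by (auto simp: sul_def)
  qed
  have E: "\<xi> p (EV a b) = 1 \<longleftrightarrow> ge (\<lambda>_. C a) (Suc k) (co a p)" if ab: "a \<noteq> b" "co b p \<in> S b" for a b p
  proof -
    obtain c where d: "dist3 a b c" using dist3_cases[OF ab(1)] by blast
    then have n: "a \<noteq> c" "b \<noteq> c" by (auto simp: dist3_def)
    obtain t where t: "t \<in> T c" using neT by blast
    let ?p = "upd c t p"
    have "\<xi> ?p (EV a b) = 1 \<longleftrightarrow> ge (\<lambda>_. C a) k (co a p) \<and> even (ph (\<lambda>_. C a) k (co a p))"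
      using L_3(3)[OF d su(1)[OF n(2), of ?p]] st[OF n(1), of ?p] n ab t by simp
    also have "\<dots> \<longleftrightarrow> ge (\<lambda>_. C a) (Suc k) (co a p)"
      using ph_level(1)[OF odo_const] ge_mono[OF odo_const, of _ "Suc k" _ k] by auto
    finally show ?thesis using EV_dep(1)[OF ab(1), of ?p p] n by simp
  qed
  have Se: "eql (\<xi> p) b c" if bc: "b \<noteq> c" "co b p \<in> S b" "co c p \<in> S c" for b c p
  proof -
    have "\<xi> p (EV b c) = 1" using E[OF bc(1,3)] bc by (simp add: S_def ex_def)
    moreover obtain a where d: "dist3 b c a" using dist3_cases[OF bc(1)] by blast
    then have n: "a \<noteq> c" "a \<noteq> b" by (auto simp: dist3_def)
    obtain t where t: "t \<in> T a" using neT by blast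
    let ?p = "upd a t p"
    have "\<xi> ?p (PH b c) mod 2 = 1"
      using L_3(4)[OF d su(1)[of c a ?p]] su(2)[of b a ?p] n bc t by simp
    then have "\<xi> p (PH b c) mod 2 = 1" using EV_dep(2)[OF bc(1), of ?p p] n by simp
    ultimately show ?thesis by (simp add: eql_def odd_iff_mod_2_eq_one)
  qed
  have "\<exists>D. 2 ^ (k + 2) dvd D - C a \<and> (\<forall>b p. b \<noteq> a \<and> co b p \<in> S b \<longrightarrow> \<xi> p (PH a b) = (co a p - D) div 2 ^ Suc k mod 4)" for a
  proof -
    obtain b0 where b0: "a \<noteq> b0" by (cases a) auto
    obtain s0 where s0: "s0 \<in> S b0" using neS by blast
    define p0 where "p0 = upd b0 s0 (0, 0, 0)"
    have p0: "co b0 (upd a n p0) \<in> S b0" for n using b0 s0 by (simp add: p0_def)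
    define f where "f n = \<xi> (upd a n p0) (PH a b0)" for n
    have ev: "\<xi> (upd a n p0) (EV a b0) = of_bool (2 ^ Suc k dvd n - C a)" for n
      using E[OF b0 p0, of n] L_EV(1)[OF b0, of "upd a n p0"] by (auto simp: ge_def)
    have "f n = (f (n - 1) + of_bool (2 ^ Suc k dvd n - C a)) mod 4" for n
      using L_EV(4)[OF b0, of "upd a n p0"] by (simp add: f_def dn_upd ev)
    from counter_form[of "2 ^ Suc k" 4 f "C a", OF _ _ this] obtain D where
      D: "2 ^ Suc k dvd D - C a" "\<And>n. f n = (n - D) div 2 ^ Suc k mod 4" by auto
    have "\<xi> p (PH a b) = (co a p - D) div 2 ^ Suc k mod 4" if "b \<noteq> a" "co b p \<in> S b" for b p
    proof -
      have "\<xi> p (PH a b) = \<xi> (upd a (co a p) p0) (PH a b0)"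
        by (rule uniform_PH[of S]) (use Se neS that b0 p0 in auto)
      then show ?thesis using D(2)[of "co a p"] by (simp add: f_def)
    qed
    \<comment> \<open>\<open>counter_form\<close> gives agreement modulo \<open>2 ^ Suc k\<close>
      only. The overlap of the digit pairs supplies one more digit: at the point \<open>D\<close>
      the new pair is 0, so the upper digit of the old pair is 0, and its lower digit is 0 because
      the level there is at least \<open>Suc k\<close>.\<close>
    moreover have "2 ^ (k + 2) dvd D - C a"
    proof -
      obtain c where d: "dist3 a b0 c" using dist3_cases[OF b0] by blast
      then have n: "a \<noteq> c" "b0 \<noteq> c" by (auto simp: dist3_def)
      obtain t where t: "t \<in> T c" using neT by blast
      let ?p = "upd c t (upd a D p0)"
      have "\<xi> ?p (PH a b0) = f D" using EV_dep(2)[OF b0, of ?p "upd a D p0"] n by (simp add: f_def)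
      then have z: "\<xi> ?p (PH a b0) = 0" using D(2)[of D] by simp
      have p1: "co b0 ?p \<in> S b0" using p0[of D] n by simp
      have "\<xi> ?p (PH a c) div 2 = 0" using L_3(4)[OF d su(1)[OF n(2) p1]] t z by simp
      moreover have g: "ge (\<lambda>_. C a) (Suc k) D" using D(1) by (simp add: ge_def)
      then have "\<xi> ?p (PH a c) = ph (\<lambda>_. C a) k D" "even (ph (\<lambda>_. C a) k D)" "ge (\<lambda>_. C a) k D"
        using st[OF n(1), of ?p] t n ph_level(1)[OF odo_const] ge_mono[OF odo_const g, of k] by auto
      ultimately have "ph (\<lambda>_. C a) k D = 0" "ge (\<lambda>_. C a) k D" by presburger+
      then show ?thesis using ph_level(2)[OF odo_const] by (auto simp: ge_def)
    qed
    ultimately show ?thesis by blast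
  qed
  then obtain D where D: "\<And>a. 2 ^ (k + 2) dvd D a - C a"
    "\<And>a b p. b \<noteq> a \<Longrightarrow> co b p \<in> S b \<Longrightarrow> \<xi> p (PH a b) = (co a p - D a) div 2 ^ Suc k mod 4"
    by metis
  have gD: "ge (\<lambda>_. D a) j n \<longleftrightarrow> ge (\<lambda>_. C a) j n" if "j \<le> k + 2" for a j n
  proof -
    have "2 ^ j dvd D a - C a" using D(1)[of a] that by (meson dvd_trans le_imp_power_dvd)
    then show ?thesis unfolding ge_def by (rule dvd_diff_cong)
  qed
  have "St (Suc k) D" unfolding St_def
  proof (intro allI impI)
    fix a b p assume "a \<noteq> b \<and> ex (\<lambda>_. D b) (Suc k) (co b p)"
    then have ab: "a \<noteq> b" "co b p \<in> S b" using gD by (auto simp: S_def ex_def)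
    then show "(\<xi> p (EV a b) = 1 \<longleftrightarrow> ge (\<lambda>_. D a) (Suc k) (co a p)) \<and> \<xi> p (PH a b) = ph (\<lambda>_. D a) (Suc k) (co a p)"
      using E[OF ab] D(2)[of b a p] gD[of "Suc k"] by (simp add: ph_def)
  qed
  with D(1) show ?thesis by blast
qed

text \<open>The three odometers recovered from a configuration that obeys the level rules.\<close>

definition okr :: "(ax \<Rightarrow> nat \<Rightarrow> int) \<Rightarrow> bool" where
  "okr r \<longleftrightarrow> (\<forall>a. odo (r a)) \<and> (\<forall>p a. \<xi> p (B0 a) = 1 \<longleftrightarrow> ex (r a) 0 (co a p)) \<and>
    (\<forall>a b p k. a \<noteq> b \<and> ex (r b) k (co b p) \<longrightarrow>
     (\<xi> p (EV a b) = 1 \<longleftrightarrow> ge (r a) k (co a p)) \<and> \<xi> p (PH a b) = ph (r a) k (co a p))"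

lemma okr_exists: "\<exists>r. okr r"
proof -
  have "\<exists>f. \<forall>k. (St k (f k) \<and> (k = 0 \<longrightarrow> (\<forall>p a. \<xi> p (B0 a) = 1 \<longleftrightarrow> ex (\<lambda>_. f k a) 0 (co a p)))) \<and>
      (\<forall>a. 2 ^ (k + 2) dvd f (Suc k) a - f k a)"
  proof (rule dependent_nat_choice)
    show "\<exists>x. St 0 x \<and> (0 = 0 \<longrightarrow> (\<forall>p a. \<xi> p (B0 a) = 1 \<longleftrightarrow> ex (\<lambda>_. x a) 0 (co a p)))"
      using St_base by blast
  next
    fix x n assume "St n x \<and> (n = 0 \<longrightarrow> (\<forall>p a. \<xi> p (B0 a) = 1 \<longleftrightarrow> ex (\<lambda>_. x a) 0 (co a p)))"
    then obtain D where "St (Suc n) D" "\<forall>a. 2 ^ (n + 2) dvd D a - x a" using St_step[of n x] by blast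
    then show "\<exists>y. (St (Suc n) y \<and> (Suc n = 0 \<longrightarrow> (\<forall>p a. \<xi> p (B0 a) = 1 \<longleftrightarrow> ex (\<lambda>_. y a) 0 (co a p)))) \<and>
        (\<forall>a. 2 ^ (n + 2) dvd y a - x a)"
      by (intro exI[of _ D] conjI impI) (blast | simp only: nat.distinct)+
  qed
  then obtain f where F: "\<forall>k. (St k (f k) \<and> (k = 0 \<longrightarrow> (\<forall>p a. \<xi> p (B0 a) = 1 \<longleftrightarrow> ex (\<lambda>_. f k a) 0 (co a p)))) \<and>
      (\<forall>a. 2 ^ (k + 2) dvd f (Suc k) a - f k a)" ..
  have f1: "St k (f k)" and f3: "2 ^ (k + 2) dvd f (Suc k) a - f k a" for k a
    using spec[OF F, of k] by blast+
  have f2: "\<xi> p (B0 a) = 1 \<longleftrightarrow> ex (\<lambda>_. f 0 a) 0 (co a p)" for p a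
    using spec[OF F, of 0] by blast
  define r where "r a k = f k a" for a k
  have q: "2 ^ (k + 2) dvd r a (Suc k) - r a k" for a k using f3 by (simp add: r_def)
  have o: "odo (r a)" for a unfolding odo_def
    using q by (metis dvd_trans le_add1 le_imp_power_dvd)
  have o2: "2 ^ (k + 2) dvd r a (k + 2) - r a k" for a k
  proof -
    have "2 ^ (Suc k + 2) dvd r a (Suc (Suc k)) - r a (Suc k)" by (rule q)
    then have "2 ^ (k + 2) dvd r a (Suc (Suc k)) - r a (Suc k)" by (rule dvd_trans[rotated]) simp
    from dvd_add[OF this q[of k a]] show ?thesis by simp
  qed
  have g: "ge (r a) k n \<longleftrightarrow> ge (\<lambda>_. f k a) k n" for a k n by (simp add: ge_def r_def)
  have g1: "ge (r a) (Suc k) n \<longleftrightarrow> ge (\<lambda>_. f k a) (Suc k) n" for a k n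
  proof -
    have "2 ^ Suc k dvd r a (Suc k) - r a k" using q[of k a] by (rule dvd_trans[rotated]) simp
    then show ?thesis unfolding ge_def using dvd_diff_cong by (simp add: r_def)
  qed
  have p: "ph (r a) k n = ph (\<lambda>_. f k a) k n" for a k n
  proof -
    from o2[of k a] obtain c where "r a (k + 2) - r a k = 2 ^ (k + 2) * c" by (elim dvdE)
    then have s: "n - r a (k + 2) = (n - r a k) + 2 ^ k * (- 4 * c)" by (simp add: power_add)
    have ne: "(2::int) ^ k \<noteq> 0" by simp
    have "(n - r a (k + 2)) div 2 ^ k = (n - r a k) div 2 ^ k + (- 4 * c)"
      unfolding s div_mult_self2[OF ne] by (rule add.commute)
    moreover have "(u + (- 4 * c)) mod 4 = u mod 4" for u :: int by presburger
    ultimately show ?thesis unfolding ph_def by (simp add: r_def)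
  qed
  have e: "ex (r a) k n \<longleftrightarrow> ex (\<lambda>_. f k a) k n" for a k n using g g1 by (simp add: ex_def)
  have "(\<xi> p (EV a b) = 1 \<longleftrightarrow> ge (r a) k (co a p)) \<and> \<xi> p (PH a b) = ph (r a) k (co a p)"
    if "a \<noteq> b" "ex (r b) k (co b p)" for a b p k
    using f1[of k] that unfolding St_def e g p by blast
  moreover have "\<xi> p (B0 a) = 1 \<longleftrightarrow> ex (r a) 0 (co a p)" for p a unfolding e by (rule f2)
  ultimately have "okr r" unfolding okr_def using o by blast
  then show ?thesis by blast
qed

end

section \<open>Rigidity of the machine\<close>

lemma dvd_set_eq:
  assumes "\<And>z::int. 2 ^ k dvd z - a \<longleftrightarrow> 2 ^ k dvd z - b" shows "2 ^ k dvd a - b"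
  using assms[of a] by simp

text \<open>A half adder: \<open>h\<close> is the carry in, \<open>u\<close> the stored digit,
  \<open>h'\<close> the carry out. The digit is a counter modulo 2 driven by \<open>h\<close>, so by
  \<open>counter_form\<close> it settles one further binary digit of the residue.\<close>

lemma half_step:
  fixes h u h' :: "int \<Rightarrow> int"
  assumes h: "\<And>z. h z = of_bool (2 ^ g dvd z - c)"
    and u: "\<And>z. u z = (h z + u (z - 1)) mod 2" and h': "\<And>z. h' z = h z * u (z - 1)"
  shows "\<exists>c'. 2 ^ g dvd c' - c \<and> (\<forall>z. h' z = of_bool (2 ^ Suc g dvd z - c')) \<and> (\<forall>z. u z = bitr (\<lambda>_. c') g z)"
proof -
  have "u z = (u (z - 1) + of_bool (2 ^ g dvd z - c)) mod 2" for z using u[of z] unfolding h by (simp add: add.commute)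
  from counter_form[of "2 ^ g" 2 u c, OF _ _ this] obtain c' where
    c: "2 ^ g dvd c' - c" "\<And>z. u z = (z - c') div 2 ^ g mod 2" by auto
  have ub: "u z = bitr (\<lambda>_. c') g z" for z using c(2) by (simp add: bitr_def)
  have "h' z = of_bool (2 ^ Suc g dvd z - c')" for z
  proof -
    have "2 ^ Suc g dvd z - c' \<longleftrightarrow> 2 ^ g dvd z - c' \<and> u (z - 1) = 1"
      using bitr_ge(2)[OF odo_const, of c' g z] by (simp only: ge_def ub)
    also have "2 ^ g dvd z - c' \<longleftrightarrow> 2 ^ g dvd z - c" by (rule dvd_diff_cong[OF c(1)])
    finally have *: "2 ^ Suc g dvd z - c' \<longleftrightarrow> 2 ^ g dvd z - c \<and> u (z - 1) = 1" .
    have "u (z - 1) = 0 \<or> u (z - 1) = 1" unfolding ub bitr_def by presburger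
    then show ?thesis using h'[of z] h[of z] * by auto
  qed
  with c(1) ub show ?thesis by blast
qed

lemma bitr_cong:
  assumes "2 ^ Suc k dvd c - r (Suc k)" shows "bitr (\<lambda>_. c) k z = bitr r k z"
proof -
  from assms obtain q where "c - r (Suc k) = 2 ^ Suc k * q" by (elim dvdE)
  then have s: "z - c = (z - r (Suc k)) + 2 ^ k * (- 2 * q)" by simp
  have ne: "(2::int) ^ k \<noteq> 0" by simp
  have "(z - c) div 2 ^ k = - 2 * q + (z - r (Suc k)) div 2 ^ k" unfolding s by (rule div_mult_self2[OF ne])
  moreover have "(- 2 * q + u) mod 2 = u mod 2" for u :: int by presburger
  ultimately show ?thesis unfolding bitr_def by simp
qed

text \<open>The comparison \<open>cmp\<close> expressed through \<open>ge\<close>, so that it also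
  makes sense at points of infinite level.\<close>

definition cmg :: "(nat \<Rightarrow> int) \<Rightarrow> int \<Rightarrow> nat \<Rightarrow> int" where
  "cmg r n m = (if ge r (Suc m) n then 2 else if ge r m n then 1 else 0)"

locale rconf = driver +
  fixes \<xi> :: "pos \<Rightarrow> lay \<Rightarrow> int"
  assumes R: "ruled \<xi>"
begin

sublocale levelled \<xi>
  by unfold_locales (use R in \<open>simp add: ruled_def\<close>)

definition rr :: "ax \<Rightarrow> nat \<Rightarrow> int" where "rr = (SOME r. okr r)"

lemma okr_rr: "okr rr" unfolding rr_def using okr_exists by (rule someI_ex)

abbreviation gee :: "ax \<Rightarrow> nat \<Rightarrow> pos \<Rightarrow> bool" where "gee a k p \<equiv> ge (rr a) k (co a p)"
abbreviation exx :: "ax \<Rightarrow> nat \<Rightarrow> pos \<Rightarrow> bool" where "exx a k p \<equiv> ex (rr a) k (co a p)"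

lemma odo_rr: "odo (rr a)" using okr_rr by (simp add: okr_def)

lemma B0_rr: "\<xi> p (B0 a) = 1 \<longleftrightarrow> exx a 0 p" using okr_rr by (simp add: okr_def)

lemma EV_rr: "a \<noteq> b \<Longrightarrow> exx b k p \<Longrightarrow> \<xi> p (EV a b) = 1 \<longleftrightarrow> gee a k p"
  and PH_rr: "a \<noteq> b \<Longrightarrow> exx b k p \<Longrightarrow> \<xi> p (PH a b) = ph (rr a) k (co a p)"
  using okr_rr unfolding okr_def by blast+

lemma gtl_rr: "a \<noteq> b \<Longrightarrow> exx b k p \<Longrightarrow> gtl (\<xi> p) a b \<longleftrightarrow> gee a (Suc k) p"
  using EV_rr[of a b k p] PH_rr[of a b k p] ph_level(1)[OF odo_rr, of a k "co a p"] ge_mono[OF odo_rr, of a "Suc k" "co a p" k]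
  by (auto simp: gtl_def)

lemma sul_rr: "a \<noteq> b \<Longrightarrow> exx b k p \<Longrightarrow> sul (\<xi> p) a b \<longleftrightarrow> exx a (Suc k) p"
  using EV_rr[of a b k p] PH_rr[of a b k p] ph_level(3)[OF odo_rr, of a k "co a p"] ge_mono[OF odo_rr, of a "Suc k" "co a p" k]
  by (auto simp: sul_def ex_def)

lemma eql_rr: "a \<noteq> b \<Longrightarrow> exx b k p \<Longrightarrow> eql (\<xi> p) a b \<longleftrightarrow> exx a k p"
  using EV_rr[of a b k p] PH_rr[of a b k p] ph_level(1)[OF odo_rr, of a k "co a p"]
  by (auto simp: eql_def ex_def)

text \<open>\<open>EV_rr\<close> is silent when \<open>b\<close> has infinite level; there the value
  follows from the parity of \<open>PH b a\<close>.\<close>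

lemma EV_inf: assumes "a \<noteq> b" "exx a k p" "gee b (Suc k) p" shows "\<xi> p (EV a b) = 0"
proof -
  have "gtl (\<xi> p) b a" using gtl_rr[of b a k p] assms by simp
  then have "\<xi> p (EV a b) \<noteq> 1" using L_EV(5)[of a b p] assms by (simp add: gtl_def)
  then show ?thesis using L_EV(1)[OF assms(1), of p] by auto
qed

lemma M_LA: "\<xi> p (B0 a) = 1 \<Longrightarrow> \<xi> p (LA a) = Lam 0" "c \<noteq> a \<Longrightarrow> \<xi> (dn c p) (LA a) = \<xi> p (LA a)"
  using R unfolding ruled_def rul_mach_def by blast+

lemma M_CM: "a = b \<or> M \<le> l \<Longrightarrow> \<xi> p (CM l a b) = 0"
  "a \<noteq> b \<Longrightarrow> l < M \<Longrightarrow> \<xi> p (CM l a b) \<in> {0, 1, 2}"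
  "a \<noteq> b \<Longrightarrow> l < M \<Longrightarrow> \<xi> p (B0 b) = 1 \<Longrightarrow> \<xi> p (CM l a b) = (if \<xi> p (B0 a) = 1 then 1 else 2)"
  "a \<noteq> b \<Longrightarrow> l < M \<Longrightarrow> gtl (\<xi> p) a b \<Longrightarrow> \<xi> p (CM l a b) = 2"
proof -
  have m: "rul_mach (\<xi> p) (\<lambda>a. \<xi> (dn a p))" using R unfolding ruled_def by blast
  note c = m[unfolded rul_mach_def, THEN conjunct2, THEN conjunct1]
  have "(a = b \<or> M \<le> l \<longrightarrow> \<xi> p (CM l a b) = 0) \<and>
      (a \<noteq> b \<and> l < M \<longrightarrow> \<xi> p (CM l a b) \<in> {0, 1, 2} \<and>
        (\<xi> p (B0 b) = 1 \<longrightarrow> \<xi> p (CM l a b) = (if \<xi> p (B0 a) = 1 then 1 else 2)) \<and>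
        (gtl (\<xi> p) a b \<longrightarrow> \<xi> p (CM l a b) = 2))"
    by (rule spec[OF spec[OF spec[OF c]]])
  then show "a = b \<or> M \<le> l \<Longrightarrow> \<xi> p (CM l a b) = 0"
  "a \<noteq> b \<Longrightarrow> l < M \<Longrightarrow> \<xi> p (CM l a b) \<in> {0, 1, 2}"
  "a \<noteq> b \<Longrightarrow> l < M \<Longrightarrow> \<xi> p (B0 b) = 1 \<Longrightarrow> \<xi> p (CM l a b) = (if \<xi> p (B0 a) = 1 then 1 else 2)"
  "a \<noteq> b \<Longrightarrow> l < M \<Longrightarrow> gtl (\<xi> p) a b \<Longrightarrow> \<xi> p (CM l a b) = 2"
    by blast+
qed

lemma M_3: assumes "l < M" "dist3 a b c"
  shows "\<xi> (dn c p) (CM l a b) = \<xi> p (CM l a b)"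
    "sul (\<xi> p) b c \<Longrightarrow> \<not> mv l (\<xi> p (LA c)) \<Longrightarrow> \<xi> p (CM l a b) = \<xi> p (CM l a c)"
    "sul (\<xi> p) b c \<Longrightarrow> mv l (\<xi> p (LA c)) \<Longrightarrow> \<xi> p (CM l a c) \<le> 1 \<Longrightarrow> \<xi> p (CM l a b) = 0"
    "sul (\<xi> p) b c \<Longrightarrow> mv l (\<xi> p (LA c)) \<Longrightarrow> \<xi> p (CM l a c) = 2 \<Longrightarrow> \<xi> p (CM l a b) \<ge> 1"
    "gtl (\<xi> p) b c \<Longrightarrow> \<xi> p (CM l a c) = 0 \<Longrightarrow> \<xi> p (CM l a b) = 0"
    "sul (\<xi> p) a c \<Longrightarrow> \<xi> p (CM l c b) = 0 \<Longrightarrow> \<xi> p (CM l a b) \<le> 1"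
    "gtl (\<xi> p) a c \<Longrightarrow> \<xi> p (CM l c b) \<ge> 1 \<Longrightarrow> \<xi> p (CM l a b) = 2"
proof -
  have m: "rul_mach (\<xi> p) (\<lambda>a. \<xi> (dn a p))" using R unfolding ruled_def by blast
  note c = m[unfolded rul_mach_def if_bool_eq_conj, THEN conjunct2, THEN conjunct2, THEN conjunct1]
  have "\<xi> (dn c p) (CM l a b) = \<xi> p (CM l a b) \<and>
      (sul (\<xi> p) b c \<longrightarrow> (mv l (\<xi> p (LA c)) \<longrightarrow>
         (\<xi> p (CM l a c) \<le> 1 \<longrightarrow> \<xi> p (CM l a b) = 0) \<and> (\<xi> p (CM l a c) = 2 \<longrightarrow> \<xi> p (CM l a b) \<ge> 1)) \<and>
         (\<not> mv l (\<xi> p (LA c)) \<longrightarrow> \<xi> p (CM l a b) = \<xi> p (CM l a c))) \<and>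
      (gtl (\<xi> p) b c \<and> \<xi> p (CM l a c) = 0 \<longrightarrow> \<xi> p (CM l a b) = 0) \<and>
      (sul (\<xi> p) a c \<and> \<xi> p (CM l c b) = 0 \<longrightarrow> \<xi> p (CM l a b) \<le> 1) \<and>
      (gtl (\<xi> p) a c \<and> \<xi> p (CM l c b) \<ge> 1 \<longrightarrow> \<xi> p (CM l a b) = 2)"
    by (rule mp[OF spec[OF spec[OF spec[OF spec[OF c]]]] conjI[OF assms]])
  then show "\<xi> (dn c p) (CM l a b) = \<xi> p (CM l a b)"
    "sul (\<xi> p) b c \<Longrightarrow> \<not> mv l (\<xi> p (LA c)) \<Longrightarrow> \<xi> p (CM l a b) = \<xi> p (CM l a c)"
    "sul (\<xi> p) b c \<Longrightarrow> mv l (\<xi> p (LA c)) \<Longrightarrow> \<xi> p (CM l a c) \<le> 1 \<Longrightarrow> \<xi> p (CM l a b) = 0"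
    "sul (\<xi> p) b c \<Longrightarrow> mv l (\<xi> p (LA c)) \<Longrightarrow> \<xi> p (CM l a c) = 2 \<Longrightarrow> \<xi> p (CM l a b) \<ge> 1"
    "gtl (\<xi> p) b c \<Longrightarrow> \<xi> p (CM l a c) = 0 \<Longrightarrow> \<xi> p (CM l a b) = 0"
    "sul (\<xi> p) a c \<Longrightarrow> \<xi> p (CM l c b) = 0 \<Longrightarrow> \<xi> p (CM l a b) \<le> 1"
    "gtl (\<xi> p) a c \<Longrightarrow> \<xi> p (CM l c b) \<ge> 1 \<Longrightarrow> \<xi> p (CM l a b) = 2"
    by blast+
qed

lemma M_del: "dist3 a b c \<Longrightarrow> sul (\<xi> p) b c \<Longrightarrow> \<xi> p (CM 0 a b) = 1 \<Longrightarrow>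
    \<xi> p (LA b) = del (\<xi> p (LA c)) {l. l < M \<and> \<xi> p (CM l a b) = 1}"
  using R unfolding ruled_def rul_mach_def by blast

lemma CM_dep: assumes "co a p = co a q" "co b p = co b q"
  shows "\<xi> p (CM l a b) = \<xi> q (CM l a b)"
proof (cases "a = b \<or> M \<le> l")
  case True then show ?thesis using M_CM(1) by metis
next
  case False
  then obtain c where d: "dist3 a b c" using dist3_cases by blast
  show ?thesis
    by (rule depends2[of "\<lambda>p. \<xi> p (CM l a b)" c a b]) (use False M_3(1)[OF _ d] d assms in auto)
qed

lemma LA_dep: "co a p = co a q \<Longrightarrow> \<xi> p (LA a) = \<xi> q (LA a)"
  by (rule depends1[of a "\<lambda>p. \<xi> p (LA a)"]) (simp_all add: M_LA(2))

lemma level_point: "\<exists>n. ex (rr a) k n"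
  using ex_exists[OF odo_rr] by blast

text \<open>Induction on time. A third axis of level \<open>k\<close> shows the comparison one unit
  earlier. For a marker that moves, a third axis of level \<open>P l k\<close> shows that the next
  level is at the new position (\<open>one\<close>), and a third axis at that next level shows that
  higher ones are above it (\<open>two\<close>).\<close>

lemma mach_level:
  "(\<forall>b p. exx b k p \<longrightarrow> \<xi> p (LA b) = Lam k) \<and>
   (\<forall>a b p l. a \<noteq> b \<and> l < M \<and> exx b k p \<longrightarrow> \<xi> p (CM l a b) = cmg (rr a) (co a p) (P l k))"
proof (induction k)
  case 0
  have "\<xi> p (CM l a b) = cmg (rr a) (co a p) (P l 0)" if "a \<noteq> b" "l < M" "exx b 0 p" for a b p l
    using that M_CM(3)[of a b l p] B0_rr[of p a] B0_rr[of p b] by (auto simp: cmg_def P_0 ex_def)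
  then show ?case using M_LA(1) B0_rr by blast
next
  case (Suc k)
  have IH: "\<And>b p. exx b k p \<Longrightarrow> \<xi> p (LA b) = Lam k"
    "\<And>a b p l. a \<noteq> b \<Longrightarrow> l < M \<Longrightarrow> exx b k p \<Longrightarrow> \<xi> p (CM l a b) = cmg (rr a) (co a p) (P l k)"
    using Suc by blast+
  \<comment> \<open>The comparison depends on the coordinates \<open>a\<close> and \<open>b\<close>
    only, so the third one may be moved to any desired level.\<close>
  have tr: "\<exists>c q. dist3 a b c \<and> co a q = co a p \<and> co b q = co b p \<and> exx c j q \<and>
      \<xi> q (CM l a b) = \<xi> p (CM l a b)" if ab: "a \<noteq> b" for a b p l j
  proof -
    obtain c where d: "dist3 a b c" using dist3_cases[OF ab] by blast
    obtain t where t: "ex (rr c) j t" using level_point by blast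
    have "\<xi> (upd c t p) (CM l a b) = \<xi> p (CM l a b)" by (rule CM_dep) (use d in \<open>auto simp: dist3_def\<close>)
    with d t show ?thesis by (intro exI[of _ c] exI[of _ "upd c t p"]) (auto simp: dist3_def)
  qed
  have base: "if mv l (Lam k) then (\<not> gee a (Suc (P l k)) p \<longrightarrow> \<xi> p (CM l a b) = 0) \<and>
        (gee a (Suc (P l k)) p \<longrightarrow> \<xi> p (CM l a b) \<ge> 1)
      else \<xi> p (CM l a b) = cmg (rr a) (co a p) (P l k)"
    if ab: "a \<noteq> b" "l < M" "exx b (Suc k) p" for a b p l
  proof -
    obtain c q where q: "dist3 a b c" "co a q = co a p" "co b q = co b p" "exx c k q"
      "\<xi> q (CM l a b) = \<xi> p (CM l a b)" using tr[OF ab(1)] by blast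
    have n: "a \<noteq> c" "b \<noteq> c" using q by (auto simp: dist3_def)
    have s: "sul (\<xi> q) b c" using sul_rr[OF n(2) q(4)] ab q by simp
    have "\<xi> q (CM l a c) = cmg (rr a) (co a p) (P l k)" "\<xi> q (LA c) = Lam k"
      using IH(2)[OF n(1) ab(2) q(4)] IH(1)[OF q(4)] q by auto
    then show ?thesis using M_3(2-4)[OF ab(2) q(1) s] q(5) by (auto simp: cmg_def split: if_splits)
  qed
  have one: "\<xi> p (CM l a b) = 1"
    if ab: "a \<noteq> b" "l < M" "exx b (Suc k) p" and m: "mv l (Lam k)" and e: "exx a (Suc (P l k)) p" for a b p l
  proof -
    obtain c q where q: "dist3 a b c" "co a q = co a p" "co b q = co b p" "exx c (P l k) q"
      "\<xi> q (CM l a b) = \<xi> p (CM l a b)" using tr[OF ab(1)] by blast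
    have n: "a \<noteq> c" "c \<noteq> b" using q by (auto simp: dist3_def)
    have "sul (\<xi> q) a c" using sul_rr[OF n(1) q(4)] e q by simp
    moreover have "\<xi> q (CM l c b) = 0" using base[OF n(2) ab(2), of q] q ab m by (simp add: ex_def)
    ultimately have "\<xi> q (CM l a b) \<le> 1" using M_3(6)[OF ab(2) q(1)] by blast
    moreover have "\<xi> p (CM l a b) \<ge> 1" using base[OF ab] m e by (simp add: ex_def)
    ultimately show ?thesis using q(5) by simp
  qed
  have two: "\<xi> p (CM l a b) = 2"
    if ab: "a \<noteq> b" "l < M" "exx b (Suc k) p" and m: "mv l (Lam k)" and e: "gee a (Suc (Suc (P l k))) p" for a b p l
  proof -
    obtain c q where q: "dist3 a b c" "co a q = co a p" "co b q = co b p" "exx c (Suc (P l k)) q"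
      "\<xi> q (CM l a b) = \<xi> p (CM l a b)" using tr[OF ab(1)] by blast
    have n: "a \<noteq> c" "c \<noteq> b" using q by (auto simp: dist3_def)
    have "gtl (\<xi> q) a c" using gtl_rr[OF n(1) q(4)] e q by simp
    moreover have "\<xi> q (CM l c b) = 1" using one[OF n(2) ab(2) _ m q(4)] q ab by simp
    ultimately show ?thesis using M_3(7)[OF ab(2) q(1)] q(5) by simp
  qed
  have C: "\<xi> p (CM l a b) = cmg (rr a) (co a p) (P l (Suc k))" if ab: "a \<noteq> b" "l < M" "exx b (Suc k) p" for a b p l
  proof (cases "mv l (Lam k)")
    case False then show ?thesis using base[OF ab] P_Suc[OF ab(2)] by simp
  next
    case True
    then have S: "P l (Suc k) = Suc (P l k)" using P_Suc[OF ab(2)] by simp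
    show ?thesis using base[OF ab] one[OF ab True] two[OF ab True] True unfolding S cmg_def by (auto simp: ex_def)
  qed
  moreover have "\<xi> p (LA b) = Lam (Suc k)" if b: "exx b (Suc k) p" for b p
  proof -
    obtain a where ab: "a \<noteq> b" by (cases b) auto
    \<comment> \<open>The rule for \<open>del\<close> applies only where the level of
      \<open>a\<close> is that of marker 0, so \<open>a\<close> is moved there.\<close>
    obtain t where t: "ex (rr a) (P 0 (Suc k)) t" using level_point by blast
    from tr[OF ab, of "upd a t p" k] obtain c q where
      q': "dist3 a b c" "co a q = co a (upd a t p)" "co b q = co b (upd a t p)" "exx c k q" by blast
    then have q: "dist3 a b c" "co a q = t" "co b q = co b p" "exx c k q" using ab by simp_all
    have n: "a \<noteq> c" "b \<noteq> c" using q by (auto simp: dist3_def)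
    have s: "sul (\<xi> q) b c" using sul_rr[OF n(2) q(4)] b q by simp
    have one: "\<xi> q (CM l a b) = 1 \<longleftrightarrow> P l (Suc k) = P 0 (Suc k)" if "l < M" for l
    proof -
      have "\<xi> q (CM l a b) = 1 \<longleftrightarrow> ex (rr a) (P l (Suc k)) t"
        using C[OF ab that, of q] b q by (auto simp: cmg_def ex_def dest: ge_mono[OF odo_rr, of _ "Suc _"])
      also have "\<dots> \<longleftrightarrow> P l (Suc k) = P 0 (Suc k)" by (metis t ex_unique odo_rr)
      finally show ?thesis .
    qed
    have "{l. l < M \<and> \<xi> q (CM l a b) = 1} = {l. l < M \<and> P l (Suc k) = P 0 (Suc k)}" using one by auto
    then have "\<xi> q (LA b) = Lam (Suc k)"
      using M_del[OF q(1) s] one[of 0] M2 IH(1)[OF q(4)] Lam_Suc[of k] by simp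
    then show ?thesis using LA_dep[of b q p] q by simp
  qed
  ultimately show ?case by blast
qed

lemma LA_rr: "exx b k p \<Longrightarrow> \<xi> p (LA b) = Lam k" using mach_level by blast
lemma CM_rr: "a \<noteq> b \<Longrightarrow> l < M \<Longrightarrow> exx b k p \<Longrightarrow> \<xi> p (CM l a b) = cmg (rr a) (co a p) (P l k)"
  using mach_level by blast

text \<open>This covers time axes of infinite level, which the induction on time never
  reaches.\<close>

lemma CM_time_big: assumes ab: "a \<noteq> b" "l < M" and k: "gee b (Suc k) p" and i: "\<not> gee a (P l k) p"
  shows "\<xi> p (CM l a b) = 0"
proof -
  obtain c where d: "dist3 a b c" using dist3_cases[OF ab(1)] by blast
  then have n: "a \<noteq> c" "b \<noteq> c" by (auto simp: dist3_def)
  obtain t where t: "ex (rr c) k t" using level_point by blast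
  let ?q = "upd c t p"
  have "gtl (\<xi> ?q) b c" using gtl_rr[OF n(2), of k ?q] t k n by simp
  moreover have "\<xi> ?q (CM l a c) = 0" using CM_rr[OF n(1) ab(2), of k ?q] t i n ge_mono[OF odo_rr, of a "Suc (P l k)" "co a p" "P l k"]
    by (auto simp: cmg_def)
  ultimately have "\<xi> ?q (CM l a b) = 0" using M_3(5)[OF ab(2) d] by blast
  then show ?thesis using CM_dep[of a ?q p b l] n by simp
qed

lemma CM_pos_big: assumes ab: "a \<noteq> b" "l < M" and "exx b k p" "gee a (Suc k) p"
  shows "\<xi> p (CM l a b) = 2"
  using M_CM(4)[OF ab] gtl_rr[OF ab(1) assms(3)] assms(4) by blast

end

section \<open>Rigidity of the digits\<close>

lemma co_pt [simp]: "co AX (x, y, z) = x" "co AY (x, y, z) = y" "co AZ (x, y, z) = z"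
  by (simp_all add: co.simps)

lemma dn_pt [simp]: "dn AX (x, y, z) = (x - 1, y, z)" "dn AY (x, y, z) = (x, y - 1, z)" "dn AZ (x, y, z) = (x, y, z - 1)"
  by (simp_all add: dn_def upd.simps)

lemma upd_pt [simp]: "upd AX n (x, y, z) = (n, y, z)" "upd AY n (x, y, z) = (x, n, z)" "upd AZ n (x, y, z) = (x, y, n)"
  by (simp_all add: upd.simps)

context rconf begin

abbreviation rX where "rX \<equiv> rr AX"
abbreviation rY where "rY \<equiv> rr AY"
abbreviation rZ where "rZ \<equiv> rr AZ"

lemma D_rul: "rul_digit (\<xi> p) (\<lambda>a. \<xi> (dn a p))" using R unfolding ruled_def by blast

lemma D_range: "i \<in> {ST, OV, HH, UU, VV, FX, FY} \<Longrightarrow> \<xi> p i = 0 \<or> \<xi> p i = 1"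
  using D_rul[of p, unfolded rul_digit_def, THEN conjunct1] by fast

lemma D_const: "\<xi> (x, y, z) ST = \<xi> (x', y, z) ST" "\<xi> (x, y, z) OV = \<xi> (x', y, z) OV"
  "\<xi> (x, y, z) FX = \<xi> (x, y', z) FX" "\<xi> (x, y, z) FY = \<xi> (x', y, z) FY"
proof -
  have c: "\<xi> (dn AX p) ST = \<xi> p ST" "\<xi> (dn AX p) OV = \<xi> p OV" "\<xi> (dn AY p) FX = \<xi> p FX" "\<xi> (dn AX p) FY = \<xi> p FY" for p
    using D_rul[of p, unfolded rul_digit_def] by blast+
  show "\<xi> (x, y, z) ST = \<xi> (x', y, z) ST"
    using const_along[of "\<lambda>p. \<xi> p ST" AX x' "(x, y, z)"] c(1) by simp
  show "\<xi> (x, y, z) OV = \<xi> (x', y, z) OV"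
    using const_along[of "\<lambda>p. \<xi> p OV" AX x' "(x, y, z)"] c(2) by simp
  show "\<xi> (x, y, z) FX = \<xi> (x, y', z) FX"
    using const_along[of "\<lambda>p. \<xi> p FX" AY y' "(x, y, z)"] c(3) by simp
  show "\<xi> (x, y, z) FY = \<xi> (x', y, z) FY"
    using const_along[of "\<lambda>p. \<xi> p FY" AX x' "(x, y, z)"] c(4) by simp
qed

lemma D_V: "\<xi> (x, y, z) (CM 1 AX AY) = 0 \<Longrightarrow> \<xi> (x, y, z) VV = \<xi> (x, y, z) (EV AZ AX)"
  "\<xi> (x, y, z) (CM 1 AX AY) = 0 \<Longrightarrow> \<xi> (x, y, z) FX = \<xi> (x, y - 1, z) VV"
  "\<xi> (x, y, z) (CM 1 AX AY) \<noteq> 0 \<Longrightarrow> eql (\<xi> (x, y, z)) AX AY \<Longrightarrow> \<xi> (x, y, z) VV = \<xi> (x, y, z) OV"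
  "\<xi> (x, y, z) (CM 1 AX AY) \<noteq> 0 \<Longrightarrow> eql (\<xi> (x, y, z)) AX AY \<Longrightarrow> \<xi> (x, y, z) ST = \<xi> (x, y - 1, z) VV"
  "\<xi> (x, y, z) (CM 1 AX AY) \<noteq> 0 \<Longrightarrow> \<not> eql (\<xi> (x, y, z)) AX AY \<Longrightarrow> \<xi> (x, y, z) VV = \<xi> (x, y - 1, z) VV"
  using D_rul[of "(x, y, z)", unfolded rul_digit_def dn_pt, THEN conjunct2, THEN conjunct2, THEN conjunct2,
    THEN conjunct2, THEN conjunct2, THEN conjunct1] by presburger+

lemma D_H: "\<xi> (x, y, z) (CM 1 AY AX) = 0 \<Longrightarrow> \<xi> (x, y, z) HH = \<xi> (x, y, z) ST"
  "\<xi> (x, y, z) (CM 1 AY AX) = 0 \<Longrightarrow> \<xi> (x, y, z) OV = \<xi> (x - 1, y, z) HH"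
  "\<xi> (x, y, z) (CM 1 AY AX) \<noteq> 0 \<Longrightarrow> eql (\<xi> (x, y, z)) AX AY \<Longrightarrow> \<xi> (x, y, z) HH = \<xi> (x - 1, y, z) HH * \<xi> (x, y, z - 1) UU"
  "\<xi> (x, y, z) (CM 1 AY AX) \<noteq> 0 \<Longrightarrow> eql (\<xi> (x, y, z)) AX AY \<Longrightarrow> \<xi> (x, y, z) UU = (\<xi> (x - 1, y, z) HH + \<xi> (x, y, z - 1) UU) mod 2"
  "\<xi> (x, y, z) (CM 1 AY AX) \<noteq> 0 \<Longrightarrow> \<not> eql (\<xi> (x, y, z)) AX AY \<Longrightarrow> \<xi> (x, y, z) HH = \<xi> (x - 1, y, z) HH"
  "\<xi> (x, y, z) (CM 1 AY AX) = 0 \<or> \<not> eql (\<xi> (x, y, z)) AX AY \<Longrightarrow> \<xi> (x, y, z) UU = 0"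
proof -
  note r = D_rul[of "(x, y, z)", unfolded rul_digit_def dn_pt, THEN conjunct2, THEN conjunct2, THEN conjunct2,
    THEN conjunct2, THEN conjunct2, THEN conjunct2, THEN conjunct1]
  show "\<xi> (x, y, z) (CM 1 AY AX) = 0 \<Longrightarrow> \<xi> (x, y, z) HH = \<xi> (x, y, z) ST" using r by (simp split: if_splits)
  show "\<xi> (x, y, z) (CM 1 AY AX) = 0 \<Longrightarrow> \<xi> (x, y, z) OV = \<xi> (x - 1, y, z) HH" using r by (simp split: if_splits)
  show "\<xi> (x, y, z) (CM 1 AY AX) \<noteq> 0 \<Longrightarrow> eql (\<xi> (x, y, z)) AX AY \<Longrightarrow> \<xi> (x, y, z) HH = \<xi> (x - 1, y, z) HH * \<xi> (x, y, z - 1) UU"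
    using r by (simp split: if_splits)
  show "\<xi> (x, y, z) (CM 1 AY AX) \<noteq> 0 \<Longrightarrow> eql (\<xi> (x, y, z)) AX AY \<Longrightarrow> \<xi> (x, y, z) UU = (\<xi> (x - 1, y, z) HH + \<xi> (x, y, z - 1) UU) mod 2"
    using r by (simp split: if_splits)
  show "\<xi> (x, y, z) (CM 1 AY AX) \<noteq> 0 \<Longrightarrow> \<not> eql (\<xi> (x, y, z)) AX AY \<Longrightarrow> \<xi> (x, y, z) HH = \<xi> (x - 1, y, z) HH"
    using r by (simp split: if_splits)
  show "\<xi> (x, y, z) (CM 1 AY AX) = 0 \<or> \<not> eql (\<xi> (x, y, z)) AX AY \<Longrightarrow> \<xi> (x, y, z) UU = 0"
    using r by (auto split: if_splits)
qed

lemma D_clean: "i \<in> {HH, ST, OV, FY} \<Longrightarrow> \<xi> p (EV AZ AY) \<noteq> 1 \<Longrightarrow> \<xi> p i = 0"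
  "i \<in> {VV, FX} \<Longrightarrow> \<xi> p (EV AZ AX) \<noteq> 1 \<Longrightarrow> \<xi> p i = 0"
proof -
  have "(\<forall>i\<in>{HH, ST, OV, FY}. \<xi> p i = 1 \<longrightarrow> \<xi> p (EV AZ AY) = 1) \<and> (\<forall>i\<in>{VV, FX}. \<xi> p i = 1 \<longrightarrow> \<xi> p (EV AZ AX) = 1)"
    using D_rul[of p, unfolded rul_digit_def] by blast
  then show "i \<in> {HH, ST, OV, FY} \<Longrightarrow> \<xi> p (EV AZ AY) \<noteq> 1 \<Longrightarrow> \<xi> p i = 0"
    "i \<in> {VV, FX} \<Longrightarrow> \<xi> p (EV AZ AX) \<noteq> 1 \<Longrightarrow> \<xi> p i = 0"
    using D_range[of i p] by auto
qed

lemma D_nest: "eql (\<xi> p) AX AY \<Longrightarrow> \<xi> p FX = \<xi> p FY" "sul (\<xi> p) AX AY \<Longrightarrow> \<xi> p FX = 1 \<Longrightarrow> \<xi> p FY = 1"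
  "sul (\<xi> p) AY AX \<Longrightarrow> \<xi> p FY = 1 \<Longrightarrow> \<xi> p FX = 1"
  using D_rul[of p, unfolded rul_digit_def] by blast+

text \<open>The period mark of \<open>y0_CM1\<close> in an arbitrary ruled configuration. If
  \<open>b\<close> has infinite level, the fact that marker 1 is above \<open>s\<close> at time
  \<open>Suc (JJ s)\<close> is carried over by \<open>CM_time_big\<close>.\<close>

lemma bnd: assumes ab: "a \<noteq> b" and s: "exx a s p"
  shows "\<xi> p (CM 1 a b) = 0 \<longleftrightarrow> gee b (Suc (JJ s)) p"
proof -
  have M: "1 < M" using M2 by simp
  consider i where "exx b i p" | "\<forall>k. gee b k p" using ex_or_all by blast
  then show ?thesis
  proof cases
    case 1
    have "\<xi> p (CM 1 a b) = 0 \<longleftrightarrow> \<not> gee a (P 1 i) p"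
      using CM_rr[OF ab M 1] ge_mono[OF odo_rr, of a "Suc (P 1 i)" "co a p" "P 1 i"] by (auto simp: cmg_def)
    also have "\<dots> \<longleftrightarrow> s < P 1 i" using ex_ge_iff[OF odo_rr s] by auto
    also have "\<dots> \<longleftrightarrow> gee b (Suc (JJ s)) p" using ex_ge_iff[OF odo_rr 1] JJ_iff by (simp add: Suc_le_eq)
    finally show ?thesis .
  next
    case 2
    have "s < P 1 (Suc (JJ s))" using JJ_iff by simp
    then have "\<not> gee a (P 1 (Suc (JJ s))) p" using ex_ge_iff[OF odo_rr s] by simp
    then show ?thesis using CM_time_big[OF ab M] 2 by blast
  qed
qed

lemma inner_not_ge:
  assumes o: "odo r" and g: "ge r (Suc J) x0" and d: "0 < d" "d < 2 ^ Suc J"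
  shows "\<not> ge r (Suc J) (x0 + int d)"
proof
  assume "ge r (Suc J) (x0 + int d)"
  then have "2 ^ Suc J dvd int d" using ge_rel[OF o g, of "Suc J" "x0 + int d"] by simp
  then have "2 ^ Suc J dvd d" by (metis int_dvd_int_iff of_nat_numeral of_nat_power)
  then show False using d by (meson dvd_imp_le linorder_not_le)
qed

lemma cnt_mono_block:
  assumes o: "odo r" and sJ: "s \<le> J" and g: "ge r (Suc J) x0" and e: "e < 2 ^ Suc J" and "d \<le> e"
  shows "cnt r J s (x0 + int d) \<le> cnt r J s (x0 + int e)"
  using \<open>d \<le> e\<close> e
proof (induction e rule: dec_induct)
  case (step n)
  have "\<not> ge r (Suc J) (x0 + int (Suc n))" by (rule inner_not_ge[OF o g]) (use step in auto)
  from cnt_step[OF o sJ this] have "cnt r J s (x0 + int n) \<le> cnt r J s (x0 + int (Suc n))" by simp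
  then show ?case using step by simp
qed simp

text \<open>Induction along the row from the start of a period. Every cell of level \<open>s\<close>
  is a half adder and replaces the residue by one that is finer by one digit; a single residue
  serves all cells passed so far, since earlier ones only see it modulo smaller powers.\<close>

lemma row_pre:
  assumes y: "ex rY s y" and S: "\<And>x z. \<xi> (x, y, z) ST = of_bool (2 ^ b dvd z - c)"
    and x0: "ge rX (Suc (JJ s)) x0"
  shows "d < 2 ^ Suc (JJ s) \<Longrightarrow> \<exists>c'. 2 ^ b dvd c' - c \<and> (\<forall>d'\<le>d. \<forall>z.
    \<xi> (x0 + int d', y, z) HH = of_bool (2 ^ (b + crow rX s (x0 + int d')) dvd z - c') \<and>
    (ex rX s (x0 + int d') \<longrightarrow> \<xi> (x0 + int d', y, z) UU = bitr (\<lambda>_. c') (b + crow rX s (x0 + int d') - 1) z))"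
proof (induction d)
  case 0
  have "\<xi> (x0, y, z) HH = of_bool (2 ^ (b + crow rX s x0) dvd z - c)" for z
    using D_H(1)[of x0 y z] bnd[of AY AX s "(x0, y, z)"] y x0 S cnt_0[OF x0] by simp
  moreover have "\<not> ex rX s x0" using ex_ge_iff[OF odo_rr, of AX s x0 "Suc (JJ s)"] x0 JJ_ge[of s] by auto
  ultimately show ?case by (intro exI[of _ c]) simp
next
  case (Suc d)
  then obtain c1 where c1: "2 ^ b dvd c1 - c" and IH: "\<And>d' z. d' \<le> d \<Longrightarrow>
    \<xi> (x0 + int d', y, z) HH = of_bool (2 ^ (b + crow rX s (x0 + int d')) dvd z - c1)"
    "\<And>d' z. d' \<le> d \<Longrightarrow> ex rX s (x0 + int d') \<Longrightarrow> \<xi> (x0 + int d', y, z) UU = bitr (\<lambda>_. c1) (b + crow rX s (x0 + int d') - 1) z"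
    by auto
  define x where "x = x0 + int (Suc d)"
  have x1: "x - 1 = x0 + int d" by (simp add: x_def)
  have ng: "\<not> ge rX (Suc (JJ s)) x" unfolding x_def using inner_not_ge[OF odo_rr x0] Suc.prems by blast
  have nb: "\<xi> (x, y, z) (CM 1 AY AX) \<noteq> 0" for z using bnd[of AY AX s "(x, y, z)"] y ng by simp
  have eq: "eql (\<xi> (x, y, z)) AX AY \<longleftrightarrow> ex rX s x" for z using eql_rr[of AX AY s "(x, y, z)"] y by simp
  have cs: "crow rX s x = crow rX s (x - 1) + of_bool (ex rX s x)" by (rule cnt_step[OF odo_rr JJ_ge ng])
  have cm: "crow rX s (x0 + int d') \<le> crow rX s (x - 1)" if "d' \<le> d" for d'
    unfolding x1 using cnt_mono_block[OF odo_rr JJ_ge x0 _ that] Suc.prems by simp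
  define g where "g = b + crow rX s (x - 1)"
  show ?case
  proof (cases "ex rX s x")
    case False
    have "\<xi> (x, y, z) HH = of_bool (2 ^ (b + crow rX s x) dvd z - c1)" for z
      using D_H(5)[OF nb] eq False IH(1)[of d z] cs by (simp add: x1)
    then have "\<xi> (x0 + int d', y, z) HH = of_bool (2 ^ (b + crow rX s (x0 + int d')) dvd z - c1) \<and>
      (ex rX s (x0 + int d') \<longrightarrow> \<xi> (x0 + int d', y, z) UU = bitr (\<lambda>_. c1) (b + crow rX s (x0 + int d') - 1) z)"
      if "d' \<le> Suc d" for d' z
      using IH[of d' z] that False unfolding x_def by (cases "d' = Suc d") auto
    with c1 show ?thesis by blast
  next
    case True
    have h: "\<xi> (x - 1, y, z) HH = of_bool (2 ^ g dvd z - c1)" for z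
      using IH(1)[of d z] by (simp add: x1 g_def)
    have "\<exists>c'. 2 ^ g dvd c' - c1 \<and> (\<forall>z. \<xi> (x, y, z) HH = of_bool (2 ^ Suc g dvd z - c')) \<and>
        (\<forall>z. \<xi> (x, y, z) UU = bitr (\<lambda>_. c') g z)"
      by (rule half_step[of "\<lambda>z. \<xi> (x - 1, y, z) HH" g c1 "\<lambda>z. \<xi> (x, y, z) UU" "\<lambda>z. \<xi> (x, y, z) HH"])
        (use h D_H(3)[OF nb] D_H(4)[OF nb] eq True in blast)+
    then obtain c' where c': "2 ^ g dvd c' - c1" "\<And>z. \<xi> (x, y, z) HH = of_bool (2 ^ Suc g dvd z - c')"
        "\<And>z. \<xi> (x, y, z) UU = bitr (\<lambda>_. c') g z" by blast
    have gx: "b + crow rX s x = Suc g" using cs True by (simp add: g_def)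
    have "\<xi> (x0 + int d', y, z) HH = of_bool (2 ^ (b + crow rX s (x0 + int d')) dvd z - c') \<and>
      (ex rX s (x0 + int d') \<longrightarrow> \<xi> (x0 + int d', y, z) UU = bitr (\<lambda>_. c') (b + crow rX s (x0 + int d') - 1) z)"
      if d': "d' \<le> Suc d" for d' z
    proof (cases "d' = Suc d")
      case True
      then show ?thesis using c'(2,3)[of z] gx unfolding x_def by simp
    next
      case False
      then have d: "d' \<le> d" using d' by simp
      \<comment> \<open>\<open>c'\<close> agrees with \<open>c1\<close> modulo \<open>2 ^ g\<close>,
        and cells further left use powers up to \<open>2 ^ g\<close> only, so they may be described
        by \<open>c'\<close> as well.\<close>
      define k where "k = b + crow rX s (x0 + int d')"
      have "k \<le> g" using cm[OF d] by (simp add: k_def g_def)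
      then have kd: "2 ^ k dvd c' - c1" using c'(1) by (meson dvd_trans le_imp_power_dvd)
      have 1: "2 ^ k dvd z - c' \<longleftrightarrow> 2 ^ k dvd z - c1" by (rule dvd_diff_cong[OF kd])
      have 2: "bitr (\<lambda>_. c') (k - 1) z = bitr (\<lambda>_. c1) (k - 1) z" if "ex rX s (x0 + int d')"
      proof -
        have "d' \<noteq> 0" using that x0 ex_ge_iff[OF odo_rr that, of "Suc (JJ s)"] JJ_ge[of s] by (cases d') auto
        then obtain e where e: "d' = Suc e" by (cases d') auto
        have "\<not> ge rX (Suc (JJ s)) (x0 + int d')"
          using inner_not_ge[OF odo_rr x0, of d'] e d Suc.prems by simp
        then have "k \<noteq> 0" using cnt_step[OF odo_rr JJ_ge, of AX s "x0 + int d'"] that by (simp add: k_def)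
        then show ?thesis using bitr_cong[of "k - 1" c' "\<lambda>_. c1" z] kd by simp
      qed
      show ?thesis using IH[OF d, of z] 1 2 unfolding k_def[symmetric] by auto
    qed
    moreover have "2 ^ b dvd c' - c"
    proof -
      have "2 ^ b dvd c' - c1" using c'(1) by (rule dvd_trans[rotated]) (simp add: g_def le_imp_power_dvd)
      from dvd_add[OF this c1] show ?thesis by simp
    qed
    ultimately show ?thesis by blast
  qed
qed

text \<open>The carry out is read in the first cell of the next period. As \<open>OV\<close> is
  constant along the row, it is then known in all periods at once.\<close>

lemma row_end:
  assumes y: "ex rY s y" and S: "\<And>x z. \<xi> (x, y, z) ST = of_bool (2 ^ b dvd z - c)"
    and x0: "ge rX (Suc (JJ s)) x0"
  shows "\<exists>c'. 2 ^ b dvd c' - c \<and> (\<forall>x z. \<xi> (x, y, z) OV = of_bool (2 ^ (b + NN s) dvd z - c')) \<and>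
    (\<forall>d<2 ^ Suc (JJ s). \<forall>z.
    \<xi> (x0 + int d, y, z) HH = of_bool (2 ^ (b + crow rX s (x0 + int d)) dvd z - c') \<and>
    (ex rX s (x0 + int d) \<longrightarrow> \<xi> (x0 + int d, y, z) UU = bitr (\<lambda>_. c') (b + crow rX s (x0 + int d) - 1) z))"
proof -
  define D where "D = (2::nat) ^ Suc (JJ s) - 1"
  have D: "D < 2 ^ Suc (JJ s)" by (simp add: D_def)
  from row_pre[OF y S x0 D] obtain c' where c': "2 ^ b dvd c' - c" and
    H: "\<And>d' z. d' \<le> D \<Longrightarrow> \<xi> (x0 + int d', y, z) HH = of_bool (2 ^ (b + crow rX s (x0 + int d')) dvd z - c') \<and>
    (ex rX s (x0 + int d') \<longrightarrow> \<xi> (x0 + int d', y, z) UU = bitr (\<lambda>_. c') (b + crow rX s (x0 + int d') - 1) z)" by blast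
  define x1 where "x1 = x0 + 2 ^ Suc (JJ s)"
  have g1: "ge rX (Suc (JJ s)) x1" using ge_rel[OF odo_rr x0, of "Suc (JJ s)" x1] by (simp add: x1_def)
  have x1': "x1 - 1 = x0 + int D" by (simp add: x1_def D_def of_nat_diff)
  have "crow rX s (x1 - 1) = NN s" unfolding NN_def by (rule cnt_last[OF g1 JJ_ge])
  then have "\<xi> (x1, y, z) OV = of_bool (2 ^ (b + NN s) dvd z - c')" for z
    using D_H(2)[of x1 y z] bnd[of AY AX s "(x1, y, z)"] y g1 H[of D z] by (simp add: x1')
  then have O: "\<xi> (x, y, z) OV = of_bool (2 ^ (b + NN s) dvd z - c')" for x z
    using D_const(2)[of x y z x1] by simp
  have "d \<le> D" if "d < 2 ^ Suc (JJ s)" for d using that by (simp add: D_def)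
  with c' H O show ?thesis by blast
qed

text \<open>The same induction with rows in place of digits: a row takes its carry from
  \<open>VV\<close> and by \<open>row_end\<close> multiplies the vertical period by
  \<open>2 ^ NN s\<close>. The column starts with \<open>EV AZ AX\<close>, so its residue is tied to
  the vertical odometer modulo \<open>2 ^ s\<close> and, so far, no further.\<close>

lemma col_pre:
  assumes x: "ex rX s x" and yb: "ge rY (Suc (JJ s)) yb"
  shows "d < 2 ^ Suc (JJ s) \<Longrightarrow> \<exists>c. 2 ^ s dvd c - rZ s \<and> (\<forall>d'\<le>d. \<forall>z.
    \<xi> (x, yb + int d', z) VV = of_bool (2 ^ (s + NN s * crow rY s (yb + int d')) dvd z - c))"
proof (induction d)
  case 0
  have "\<xi> (x, yb, z) VV = of_bool (2 ^ (s + NN s * crow rY s yb) dvd z - rZ s)" for z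
    using D_V(1)[of x yb z] bnd[of AX AY s "(x, yb, z)"] x yb cnt_0[OF yb] EV_rr[of AZ AX s "(x, yb, z)"]
      L_EV(1)[of AZ AX "(x, yb, z)"] by (auto simp: ge_def)
  then show ?case by (intro exI[of _ "rZ s"]) simp
next
  case (Suc d)
  then obtain c1 where c1: "2 ^ s dvd c1 - rZ s" and IH: "\<And>d' z. d' \<le> d \<Longrightarrow>
    \<xi> (x, yb + int d', z) VV = of_bool (2 ^ (s + NN s * crow rY s (yb + int d')) dvd z - c1)" by auto
  define y where "y = yb + int (Suc d)"
  have y1: "y - 1 = yb + int d" by (simp add: y_def)
  have ng: "\<not> ge rY (Suc (JJ s)) y" unfolding y_def using inner_not_ge[OF odo_rr yb] Suc.prems by blast
  have nb: "\<xi> (x, y, z) (CM 1 AX AY) \<noteq> 0" for z using bnd[of AX AY s "(x, y, z)"] x ng by simp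
  have eq: "eql (\<xi> (x, y, z)) AX AY \<longleftrightarrow> ex rY s y" for z
  proof -
    have "eql (\<xi> (x, y, z)) AX AY \<longleftrightarrow> eql (\<xi> (x, y, z)) AY AX"
    proof -
      consider i where "ex rY i y" | "\<forall>k. ge rY k y" using ex_or_all by blast
      then show ?thesis
      proof cases
        case 1
        show ?thesis using eql_rr[of AX AY i "(x, y, z)"] eql_rr[of AY AX s "(x, y, z)"] 1 x
            ex_unique[OF odo_rr] by auto
      next
        case 2 then show ?thesis using ng by blast
      qed
    qed
    then show ?thesis using eql_rr[of AY AX s "(x, y, z)"] x by simp
  qed
  have cs: "crow rY s y = crow rY s (y - 1) + of_bool (ex rY s y)" by (rule cnt_step[OF odo_rr JJ_ge ng])
  have cm: "crow rY s (yb + int d') \<le> crow rY s (y - 1)" if "d' \<le> d" for d'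
    unfolding y1 using cnt_mono_block[OF odo_rr JJ_ge yb _ that] Suc.prems by simp
  define g where "g = s + NN s * crow rY s (y - 1)"
  have V1: "\<xi> (x, y - 1, z) VV = of_bool (2 ^ g dvd z - c1)" for z
    using IH[of d z] by (simp add: y1 g_def)
  have "\<exists>c'. 2 ^ g dvd c' - c1 \<and> (\<forall>z. \<xi> (x, y, z) VV = of_bool (2 ^ (s + NN s * crow rY s y) dvd z - c'))"
  proof (cases "ex rY s y")
    case False
    then show ?thesis using D_V(5)[OF nb] eq V1 cs by (intro exI[of _ c1]) (simp add: g_def)
  next
    case True
    have S: "\<xi> (x', y, z) ST = of_bool (2 ^ g dvd z - c1)" for x' z
      using D_V(4)[OF nb] eq True V1 D_const(1)[of x' y z x] by simp
    obtain x0 where "ge rX (Suc (JJ s)) x0" using ge_exists by blast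
    from row_end[OF True S this] obtain c' where
      "2 ^ g dvd c' - c1" "\<And>z. \<xi> (x, y, z) OV = of_bool (2 ^ (g + NN s) dvd z - c')" by blast
    moreover have "g + NN s = s + NN s * crow rY s y" using cs True by (simp add: g_def)
    ultimately show ?thesis using D_V(3)[OF nb] eq True by auto
  qed
  then obtain c' where c': "2 ^ g dvd c' - c1" "\<And>z. \<xi> (x, y, z) VV = of_bool (2 ^ (s + NN s * crow rY s y) dvd z - c')" by blast
  have "\<xi> (x, yb + int d', z) VV = of_bool (2 ^ (s + NN s * crow rY s (yb + int d')) dvd z - c')" if "d' \<le> Suc d" for d' z
  proof (cases "d' = Suc d")
    case True then show ?thesis using c'(2)[of z] unfolding y_def by simp
  next
    case False
    then have d: "d' \<le> d" using that by simp
    have "s + NN s * crow rY s (yb + int d') \<le> g" using cm[OF d] by (simp add: g_def)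
    then have "2 ^ (s + NN s * crow rY s (yb + int d')) dvd c' - c1" using c'(1) by (meson dvd_trans le_imp_power_dvd)
    from dvd_diff_cong[OF this, of z] show ?thesis using IH[OF d, of z] by simp
  qed
  moreover have "2 ^ s dvd c' - rZ s"
  proof -
    have "2 ^ s dvd c' - c1" using c'(1) by (rule dvd_trans[rotated]) (simp add: g_def le_imp_power_dvd)
    from dvd_add[OF this c1] show ?thesis by simp
  qed
  ultimately show ?case by blast
qed

lemma col_end:
  assumes x: "ex rX s x" and yb: "ge rY (Suc (JJ s)) yb"
  shows "\<exists>c. 2 ^ s dvd c - rZ s \<and> (\<forall>y z. \<xi> (x, y, z) FX = of_bool (2 ^ (s + NN s * NN s) dvd z - c)) \<and>
    (\<forall>d<2 ^ Suc (JJ s). \<forall>z. \<xi> (x, yb + int d, z) VV = of_bool (2 ^ (s + NN s * crow rY s (yb + int d)) dvd z - c))"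
proof -
  define D where "D = (2::nat) ^ Suc (JJ s) - 1"
  have D: "D < 2 ^ Suc (JJ s)" by (simp add: D_def)
  from col_pre[OF x yb D] obtain c where c: "2 ^ s dvd c - rZ s" and
    V: "\<And>d' z. d' \<le> D \<Longrightarrow> \<xi> (x, yb + int d', z) VV = of_bool (2 ^ (s + NN s * crow rY s (yb + int d')) dvd z - c)" by blast
  define y1 where "y1 = yb + 2 ^ Suc (JJ s)"
  have g1: "ge rY (Suc (JJ s)) y1" using ge_rel[OF odo_rr yb, of "Suc (JJ s)" y1] by (simp add: y1_def)
  have y1': "y1 - 1 = yb + int D" by (simp add: y1_def D_def of_nat_diff)
  have "crow rY s (y1 - 1) = NN s" unfolding NN_def by (rule cnt_last[OF g1 JJ_ge])
  then have "\<xi> (x, y1, z) FX = of_bool (2 ^ (s + NN s * NN s) dvd z - c)" for z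
    using D_V(2)[of x y1 z] bnd[of AX AY s "(x, y1, z)"] x g1 V[of D z] by (simp add: y1')
  then have O: "\<xi> (x, y, z) FX = of_bool (2 ^ (s + NN s * NN s) dvd z - c)" for y z
    using D_const(3)[of x y z y1] by simp
  have "d \<le> D" if "d < 2 ^ Suc (JJ s)" for d using that by (simp add: D_def)
  with c V O show ?thesis by blast
qed

end

section \<open>Digits relative to a point of high level\<close>

abbreviation z0 :: "nat \<Rightarrow> int" where "z0 \<equiv> \<lambda>_. 0"

lemma div_mod_shift: "(2::int) ^ k * m dvd d \<Longrightarrow> (d + v) div 2 ^ k mod m = v div 2 ^ k mod m"
proof (elim dvdE)
  fix q assume d: "d = 2 ^ k * m * q"
  have ne: "(2::int) ^ k \<noteq> 0" by simp
  have "(d + v) div 2 ^ k = (v + 2 ^ k * (m * q)) div 2 ^ k" by (simp add: d algebra_simps)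
  also have "\<dots> = m * q + v div 2 ^ k" by (rule div_mult_self2[OF ne])
  finally show ?thesis by simp
qed

lemma ph_rel: "odo r \<Longrightarrow> ge r K p \<Longrightarrow> k + 2 \<le> K \<Longrightarrow> ph r k (p + v) = ph z0 k v"
proof -
  assume a: "odo r" "ge r K p" "k + 2 \<le> K"
  then have "ge r (k + 2) p" using ge_mono by blast
  then have "(2::int) ^ k * 4 dvd p - r (Suc (Suc k))" by (simp add: ge_def mult.commute)
  from div_mod_shift[OF this, of v] show ?thesis by (simp add: ph_def algebra_simps)
qed

lemma bitr_rel: "odo r \<Longrightarrow> ge r K p \<Longrightarrow> Suc k \<le> K \<Longrightarrow> bitr r k (p + v) = bitr z0 k v"
proof -
  assume a: "odo r" "ge r K p" "Suc k \<le> K"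
  then have "ge r (Suc k) p" using ge_mono by blast
  then have "(2::int) ^ k * 2 dvd p - r (Suc k)" by (simp add: ge_def mult.commute)
  from div_mod_shift[OF this, of v] show ?thesis by (simp add: bitr_def algebra_simps)
qed

lemma cnt_rel: "odo r \<Longrightarrow> ge r K p \<Longrightarrow> Suc J \<le> K \<Longrightarrow> cnt r J s (p + v) = cnt z0 J s v"
proof -
  assume a: "odo r" "ge r K p" "Suc J \<le> K"
  then have "ge r (Suc J) p" using ge_mono by blast
  then obtain q where "p - r (Suc J) = 2 ^ Suc J * q" unfolding ge_def by (elim dvdE)
  then have "p + v - r (Suc J) = v + 2 ^ Suc J * q" by simp
  then have "(p + v - r (Suc J)) mod 2 ^ Suc J = v mod 2 ^ Suc J" by (simp only: mod_mult_self2)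
  then show ?thesis by (simp add: cnt_def)
qed

lemma ge_rel0: "odo r \<Longrightarrow> ge r K p \<Longrightarrow> k \<le> K \<Longrightarrow> ge r k (p + v) \<longleftrightarrow> ge z0 k v"
  using ge_rel[of r K p k "p + v"] by (simp add: ge_def)

lemma ex_rel0: "odo r \<Longrightarrow> ge r K p \<Longrightarrow> k < K \<Longrightarrow> ex r k (p + v) \<longleftrightarrow> ex z0 k v"
  using ge_rel0[of r K p k v] ge_rel0[of r K p "Suc k" v] by (simp add: ex_def)

lemma small_level: assumes "v \<noteq> 0" "\<bar>v\<bar> < 2 ^ K" shows "\<exists>k<K. ex z0 k v"
proof -
  have "\<not> ge z0 K v" using assms zdvd_imp_le[of "2 ^ K" "\<bar>v\<bar>"] by (auto simp: ge_def)
  then obtain k where "ex z0 k v" using ex_or_all[of z0 v] by blast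
  moreover have "k < K" using \<open>\<not> ge z0 K v\<close> ex_ge_iff[OF odo_const \<open>ex z0 k v\<close>, of K] by simp
  ultimately show ?thesis by blast
qed

text \<open>The step from -1 to 0 is the one left open, so each side keeps a value of its own. This
  is why \<open>valf\<close> reads the germ at 0 and at -1, by way of \<open>sg\<close>.\<close>

lemma run_const:
  fixes f :: "int \<Rightarrow> 'a"
  assumes s: "\<And>t. t \<noteq> 0 \<Longrightarrow> \<bar>t\<bar> < B \<Longrightarrow> f t = f (t - 1)" and v: "\<bar>v\<bar> < B"
  shows "f v = (if 0 \<le> v then f 0 else f (- 1))"
proof (cases "0 \<le> v")
  case True
  have "v < B \<longrightarrow> f v = f 0" using True
  proof (induction v rule: int_ge_induct)
    case (step i) then show ?case using s[of "i + 1"] by simp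
  qed simp
  then show ?thesis using True v by simp
next
  case False
  then have "v \<le> - 1" by simp
  then have "- v < B \<longrightarrow> f v = f (- 1)"
  proof (induction v rule: int_le_induct)
    case (step i) then show ?case using s[of i] by simp
  qed simp
  then show ?thesis using False v by simp
qed

section \<open>Tying the digit layers to the vertical odometer\<close>

context rconf begin

lemma FX_FY_eq: "ex rX s x \<Longrightarrow> ex rY s y \<Longrightarrow> \<xi> (x, y', z) FX = \<xi> (x', y, z) FY"
proof -
  assume "ex rX s x" "ex rY s y"
  then have "\<xi> (x, y, z) FX = \<xi> (x, y, z) FY" using D_nest(1)[of "(x, y, z)"] eql_rr[of AX AY s "(x, y, z)"] by simp
  then show ?thesis using D_const(3)[of x y' z y] D_const(4)[of x' y z x] by simp
qed

text \<open>Each level has its own residue \<open>c s\<close>, tied to the vertical odometer modulo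
  \<open>2 ^ s\<close>, whereas \<open>2 ^ E s\<close> is wanted. A carry out of a higher array
  forces one out of every lower array, and this makes the residues of different levels
  compatible.\<close>

lemma FX_rr: assumes x: "ex rX s x"
  shows "\<xi> (x, y, z) FX = of_bool (ge rZ (s + NN s * NN s) z)"
proof -
  define E where "E s = s + NN s * NN s" for s
  define lp where "lp a k = (SOME n. ex (rr a) k n)" for a k
  have lp: "ex (rr a) k (lp a k)" for a k unfolding lp_def by (rule someI_ex[OF level_point])
  have "\<exists>c. 2 ^ s dvd c - rZ s \<and> (\<forall>y z. \<xi> (lp AX s, y, z) FX = of_bool (2 ^ E s dvd z - c))" for s
    using col_end[OF lp, of s] ge_exists[of rY "Suc (JJ s)"] unfolding E_def by blast
  then obtain c where c: "\<And>s. 2 ^ s dvd c s - rZ s" "\<And>s y z. \<xi> (lp AX s, y, z) FX = of_bool (2 ^ E s dvd z - c s)"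
    by metis
  have cy: "\<xi> (x, lp AY s, z) FY = of_bool (2 ^ E s dvd z - c s)" for x z s
    using FX_FY_eq[OF lp lp] c(2) by metis
  have n1: "2 ^ E s dvd z - c s" if "2 ^ E (Suc s) dvd z - c (Suc s)" for s z
  proof -
    let ?p = "(lp AX (Suc s), lp AY s, z)"
    have "sul (\<xi> ?p) AX AY" using sul_rr[of AX AY s ?p] lp by simp
    then have "\<xi> ?p FY = 1" using D_nest(2)[of ?p] c(2)[of "Suc s" "lp AY s" z] that by simp
    then show ?thesis using cy[of "lp AX (Suc s)" s z] by (simp split: if_splits)
  qed
  have nn: "2 ^ E s dvd z - c s" if "s \<le> t" "2 ^ E t dvd z - c t" for s t z
    using that by (induction t rule: dec_induct) (auto dest: n1)
  \<comment> \<open>The array of level \<open>E s\<close> starts at digit \<open>E s\<close>, so its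
    residue agrees with the vertical odometer modulo \<open>2 ^ E s\<close>; nesting hands this down
    to level \<open>s\<close>.\<close>
  have "2 ^ E s dvd c (E s) - c s" using nn[of s "E s" "c (E s)"] by (simp add: E_def)
  moreover have "2 ^ E s dvd c (E s) - rZ (E s)" by (rule c(1))
  ultimately have d: "2 ^ E s dvd c s - rZ (E s)" using dvd_diff_cong[of "2 ^ E s" "c (E s)" "c s"]
    by (metis dvd_diff_commute dvd_diff_cong)
  have "\<xi> (x, y, z) FX = \<xi> (x, lp AY s, z) FY" by (rule FX_FY_eq[OF x lp])
  also have "\<dots> = of_bool (2 ^ E s dvd z - c s)" by (rule cy)
  also have "2 ^ E s dvd z - c s \<longleftrightarrow> ge rZ (E s) z" using dvd_diff_cong[OF d, of z] by (simp add: ge_def)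
  finally show ?thesis by (simp add: E_def)
qed

lemma FY_rr: assumes y: "ex rY s y" shows "\<xi> (x, y, z) FY = of_bool (ge rZ (s + NN s * NN s) z)"
proof -
  obtain x0 where "ex rX s x0" using level_point by blast
  then show ?thesis using FX_FY_eq[OF _ y] FX_rr by metis
qed

lemma block_start: "\<exists>n0 d. ge (rr a) (Suc J) n0 \<and> n = n0 + int d \<and> d < 2 ^ Suc J"
proof -
  obtain n0 where n0: "ge (rr a) (Suc J) n0" "n - 2 ^ Suc J + 1 \<le> n0" "n0 < n - 2 ^ Suc J + 1 + 2 ^ Suc J"
    using ge_exists by blast
  then have "n = n0 + int (nat (n - n0))" "int (nat (n - n0)) < 2 ^ Suc J" by auto
  then show ?thesis using n0(1) by (metis of_nat_less_iff of_nat_numeral of_nat_power)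
qed

text \<open>Knowing the carry out of the last digit fixes the residue modulo \<open>2 ^ E\<close>,
  and with it all carries and digits before that one.\<close>

lemma tied: assumes "\<And>z. of_bool (2 ^ E dvd z - c) = (of_bool (ge rZ E z) :: int)" "k \<le> E"
  shows "2 ^ k dvd c - rZ k" "2 ^ k dvd z - c \<longleftrightarrow> ge rZ k z"
proof -
  have "2 ^ E dvd z - c \<longleftrightarrow> 2 ^ E dvd z - rZ E" for z using assms(1)[of z] by (auto simp: ge_def split: if_splits)
  then have "2 ^ E dvd c - rZ E" by (rule dvd_set_eq)
  then have "2 ^ k dvd c - rZ E" using assms(2) by (meson dvd_trans le_imp_power_dvd)
  with odo_dvd[OF odo_rr assms(2), of AZ] have "2 ^ k dvd (c - rZ E) + (rZ E - rZ k)" by (metis dvd_add)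
  then show d: "2 ^ k dvd c - rZ k" by simp
  show "2 ^ k dvd z - c \<longleftrightarrow> ge rZ k z" unfolding ge_def by (rule dvd_diff_cong[OF d])
qed

lemma crow_le: "crow r s n \<le> NN s" unfolding NN_def by (rule cnt_le[OF JJ_ge])

lemma VV_rr: assumes x: "ex rX s x"
  shows "\<xi> (x, y, z) VV = of_bool (ge rZ (s + NN s * crow rY s y) z)"
proof -
  obtain n0 d where n: "ge rY (Suc (JJ s)) n0" "y = n0 + int d" "d < 2 ^ Suc (JJ s)" using block_start by blast
  from col_end[OF x n(1)] obtain c where
    F: "\<And>y z. \<xi> (x, y, z) FX = of_bool (2 ^ (s + NN s * NN s) dvd z - c)" and
    V: "\<xi> (x, y, z) VV = of_bool (2 ^ (s + NN s * crow rY s y) dvd z - c)"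
    using n(2,3) by blast
  have le: "s + NN s * crow rY s y \<le> s + NN s * NN s" using crow_le by simp
  have t: "of_bool (2 ^ (s + NN s * NN s) dvd z - c) = (of_bool (ge rZ (s + NN s * NN s) z) :: int)" for z
    using F[of y z] FX_rr[OF x, of y z] by simp
  show ?thesis using V unfolding tied(2)[OF t le, of z] .
qed

lemma row_not_bnd: "ex rX s x \<Longrightarrow> ex rY s y \<Longrightarrow> \<xi> (x, y, z) (CM 1 AX AY) \<noteq> 0"
  "ex rX s x \<Longrightarrow> ex rY s y \<Longrightarrow> eql (\<xi> (x, y, z)) AX AY"
  "ex rY s y \<Longrightarrow> crow rY s y = crow rY s (y - 1) + 1"
proof -
  have ng: "\<not> ge rY (Suc (JJ s)) y" if "ex rY s y" using ex_ge_iff[OF odo_rr that] JJ_ge[of s] by simp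
  show "ex rX s x \<Longrightarrow> ex rY s y \<Longrightarrow> \<xi> (x, y, z) (CM 1 AX AY) \<noteq> 0"
    using bnd[of AX AY s "(x, y, z)"] ng by simp
  show "ex rX s x \<Longrightarrow> ex rY s y \<Longrightarrow> eql (\<xi> (x, y, z)) AX AY"
    using eql_rr[of AX AY s "(x, y, z)"] by simp
  show "ex rY s y \<Longrightarrow> crow rY s y = crow rY s (y - 1) + 1"
    using cnt_step[OF odo_rr JJ_ge ng] by simp
qed

lemma ST_rr: assumes y: "ex rY s y"
  shows "\<xi> (x, y, z) ST = of_bool (ge rZ (s + NN s * (crow rY s y - 1)) z)"
    "\<xi> (x, y, z) OV = of_bool (ge rZ (s + NN s * crow rY s y) z)"
proof -
  obtain x0 where x0: "ex rX s x0" using level_point by blast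
  note b = row_not_bnd(1,2)[OF x0 y]
  have "\<xi> (x0, y, z) ST = \<xi> (x0, y - 1, z) VV" by (rule D_V(4)[OF b])
  then show "\<xi> (x, y, z) ST = of_bool (ge rZ (s + NN s * (crow rY s y - 1)) z)"
    using VV_rr[OF x0, of "y - 1" z] row_not_bnd(3)[OF y] D_const(1)[of x y z x0] by simp
  have "\<xi> (x0, y, z) VV = \<xi> (x0, y, z) OV" by (rule D_V(3)[OF b])
  then show "\<xi> (x, y, z) OV = of_bool (ge rZ (s + NN s * crow rY s y) z)"
    using VV_rr[OF x0, of y z] D_const(2)[of x y z x0] by simp
qed

lemma HH_rr: assumes y: "ex rY s y"
  shows "\<xi> (x, y, z) HH = of_bool (ge rZ (s + NN s * (crow rY s y - 1) + crow rX s x) z)"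
    "ex rX s x \<Longrightarrow> \<xi> (x, y, z) UU = bitr rZ (s + NN s * (crow rY s y - 1) + crow rX s x - 1) z"
    "\<not> ex rX s x \<Longrightarrow> \<xi> (x, y, z) UU = 0"
proof -
  define b where "b = s + NN s * (crow rY s y - 1)"
  obtain n0 d where n: "ge rX (Suc (JJ s)) n0" "x = n0 + int d" "d < 2 ^ Suc (JJ s)" using block_start by blast
  have S: "\<xi> (x, y, z) ST = of_bool (2 ^ b dvd z - rZ b)" for x z
    using ST_rr(1)[OF y] by (simp add: b_def ge_def)
  from row_end[OF y S n(1)] obtain c where
    O: "\<And>x z. \<xi> (x, y, z) OV = of_bool (2 ^ (b + NN s) dvd z - c)" and
    H: "\<xi> (x, y, z) HH = of_bool (2 ^ (b + crow rX s x) dvd z - c)" and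
    U: "ex rX s x \<Longrightarrow> \<xi> (x, y, z) UU = bitr (\<lambda>_. c) (b + crow rX s x - 1) z"
    using n(2,3) by blast
  have bN: "b + NN s = s + NN s * crow rY s y" using row_not_bnd(3)[OF y] by (simp add: b_def)
  have t: "of_bool (2 ^ (b + NN s) dvd z - c) = (of_bool (ge rZ (b + NN s) z) :: int)" for z
    using O[of 0 z] ST_rr(2)[OF y, of 0 z] by (simp add: bN)
  have le: "b + crow rX s x \<le> b + NN s" using crow_le by simp
  show "\<xi> (x, y, z) HH = of_bool (ge rZ (s + NN s * (crow rY s y - 1) + crow rX s x) z)"
    using H unfolding tied(2)[OF t le, of z] unfolding b_def .
  show "\<xi> (x, y, z) UU = bitr rZ (s + NN s * (crow rY s y - 1) + crow rX s x - 1) z" if e: "ex rX s x"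
  proof -
    have ng: "\<not> ge rX (Suc (JJ s)) x" using ex_ge_iff[OF odo_rr e] JJ_ge[of s] by simp
    have "crow rX s x \<ge> 1" using cnt_step[OF odo_rr JJ_ge ng] e by simp
    then have "Suc (b + crow rX s x - 1) = b + crow rX s x" by simp
    then show ?thesis using U[OF e] bitr_cong[of "b + crow rX s x - 1" c rZ z] tied(1)[OF t le] by (simp add: b_def)
  qed
  show "\<xi> (x, y, z) UU = 0" if e: "\<not> ex rX s x"
    using D_H(6)[of x y z] eql_rr[of AX AY s "(x, y, z)"] y e by simp
qed

end

section \<open>Cells near a point of high level\<close>

definition lvz :: "int \<Rightarrow> nat" where "lvz n = (THE k. ex z0 k n)"

lemma lvz_eq: "ex z0 k n \<Longrightarrow> lvz n = k"
  unfolding lvz_def using ex_unique[OF odo_const] by blast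

definition sg :: "int \<Rightarrow> int" where "sg t = (if 0 \<le> t then 0 else - 1)"

text \<open>The levels of the offset are bounded by a separate \<open>m\<close>, since the array of
  level \<open>s\<close> uses digits up to \<open>s + NN s * NN s\<close>, which can lie far above
  \<open>s\<close>; all of them have to stay below \<open>K\<close>.\<close>

definition okv :: "nat \<Rightarrow> nat \<Rightarrow> pos \<Rightarrow> bool" where
  "okv K m v \<longleftrightarrow> (\<forall>a. \<bar>co a v\<bar> < 2 ^ K \<and> (co a v = 0 \<or> lvz (co a v) \<le> m))"

lemma vadd_0 [simp]: "vadd p (0, 0, 0) = p" by (simp add: vadd_def)

lemma pt_co [simp]: "(co AX p, co AY p, co AZ p) = p"
  by (rule pos_eqI) (metis ax.exhaust co_pt)

context driver begin

text \<open>For levels up to \<open>m\<close>, all markers have passed them by time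
  \<open>K - 1\<close>, and the periods and digits of their arrays are visible modulo
  \<open>2 ^ K\<close>.\<close>

definition bigK :: "nat \<Rightarrow> nat \<Rightarrow> bool" where
  "bigK K m \<longleftrightarrow> m + 3 \<le> K \<and> (\<forall>l<M. m < P l (K - 1)) \<and>
     (\<forall>s\<le>m. JJ s + 1 \<le> K \<and> s + NN s * NN s \<le> K)"

fun valf :: "(pos \<Rightarrow> lay \<Rightarrow> int) \<Rightarrow> pos \<Rightarrow> lay \<Rightarrow> int" where
  "valf g v (B0 a) = of_bool (odd (co a v))"
| "valf g v (EV a b) = (if a = b then 0 else if co b v \<noteq> 0 then of_bool (ge z0 (lvz (co b v)) (co a v))
     else if co a v \<noteq> 0 then 0 else g (0, 0, 0) (EV a b))"
| "valf g v (PH a b) = (if a = b then 0 else if co b v \<noteq> 0 then ph z0 (lvz (co b v)) (co a v)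
     else g (upd a (sg (co a v)) (0, 0, 0)) (PH a b))"
| "valf g v (LA a) = (if co a v \<noteq> 0 then Lam (lvz (co a v)) else g (0, 0, 0) (LA a))"
| "valf g v (CM l a b) = (if a = b \<or> M \<le> l then 0 else if co b v \<noteq> 0 then cmg z0 (co a v) (P l (lvz (co b v)))
     else if co a v \<noteq> 0 then 0 else g (0, 0, 0) (CM l a b))"
| "valf g v ST = (let y = co AY v; s = lvz y; z = co AZ v in
     if y \<noteq> 0 then of_bool (ge z0 (s + NN s * (crow z0 s y - 1)) z) else if z \<noteq> 0 then 0 else g (0, 0, 0) ST)"
| "valf g v OV = (let y = co AY v; s = lvz y; z = co AZ v in
     if y \<noteq> 0 then of_bool (ge z0 (s + NN s * crow z0 s y) z) else if z \<noteq> 0 then 0 else g (0, 0, 0) OV)"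
| "valf g v FX = (let x = co AX v; s = lvz x; z = co AZ v in
     if x \<noteq> 0 then of_bool (ge z0 (s + NN s * NN s) z) else if z \<noteq> 0 then 0 else g (0, 0, 0) FX)"
| "valf g v FY = (let y = co AY v; s = lvz y; z = co AZ v in
     if y \<noteq> 0 then of_bool (ge z0 (s + NN s * NN s) z) else if z \<noteq> 0 then 0 else g (0, 0, 0) FY)"
| "valf g v VV = (let x = co AX v; y = co AY v; s = lvz x; z = co AZ v in
     if x \<noteq> 0 then of_bool (ge z0 (s + NN s * crow z0 s y) z) else if z \<noteq> 0 then 0 else g (0, sg y, 0) VV)"
| "valf g v HH = (let x = co AX v; y = co AY v; s = lvz y; z = co AZ v in
     if y \<noteq> 0 then of_bool (ge z0 (s + NN s * (crow z0 s y - 1) + crow z0 s x) z)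
     else if z \<noteq> 0 then 0 else g (sg x, 0, 0) HH)"
| "valf g v UU = (let x = co AX v; y = co AY v; s = lvz y; z = co AZ v in
     if y \<noteq> 0 then (if ex z0 s x then bitr z0 (s + NN s * (crow z0 s y - 1) + crow z0 s x - 1) z else 0)
     else if x \<noteq> 0 then 0 else g (0, 0, sg z) UU)"

lemma valf_cong:
  assumes "\<And>u. (\<And>a. co a u = 0 \<or> co a u = - 1) \<Longrightarrow> g u = g' u"
  shows "valf g v i = valf g' v i"
proof -
  have 0: "g (0, 0, 0) = g' (0, 0, 0)" by (rule assms) (metis ax.exhaust co_pt)
  have 1: "g (upd a (sg t) (0, 0, 0)) = g' (upd a (sg t) (0, 0, 0))" for a t
    by (rule assms, simp add: sg_def) (metis ax.exhaust co_pt)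
  show ?thesis
    using 0 1 1[of AX] 1[of AY] 1[of AZ] by (cases i) (simp_all add: Let_def)
qed

end

text \<open>If the levels of all three coordinates of \<open>Q\<close> are at least \<open>K\<close>, then the layers around \<open>Q\<close>, at the offsets singled out
  by \<open>okv\<close>, are determined by those of the 27 cells around \<open>Q\<close>; \<open>valf\<close> is the resulting formula.\<close>

locale star = rconf +
  fixes Q :: pos and K m :: nat
  assumes Q: "gee a K Q" and big: "bigK K m"
begin

lemma s_ge: "k \<le> K \<Longrightarrow> gee a k (vadd Q v) \<longleftrightarrow> ge z0 k (co a v)"
  using ge_rel0[OF odo_rr Q] by simp

lemma s_ex: "k < K \<Longrightarrow> exx a k (vadd Q v) \<longleftrightarrow> ex z0 k (co a v)"
  using ex_rel0[OF odo_rr Q] by simp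

lemma s_lev: assumes "okv K m v" "co a v \<noteq> 0"
  shows "ex z0 (lvz (co a v)) (co a v)" "lvz (co a v) \<le> m" "exx a (lvz (co a v)) (vadd Q v)"
proof -
  obtain k where k: "k < K" "ex z0 k (co a v)" using small_level[of "co a v" K] assms unfolding okv_def by blast
  then show e: "ex z0 (lvz (co a v)) (co a v)" using lvz_eq by simp
  show l: "lvz (co a v) \<le> m" using assms by (auto simp: okv_def)
  show "exx a (lvz (co a v)) (vadd Q v)" using s_ex[of k a v] k lvz_eq[OF k(2)] by simp
qed

lemma s_mid: assumes "co a v \<noteq> 0" "\<bar>co a v\<bar> < 2 ^ K" shows "\<exists>k<K. exx a k (vadd Q v)"
  using small_level[OF assms] s_ex by blast

lemma s_zero: "co a v = 0 \<Longrightarrow> k \<le> K \<Longrightarrow> gee a k (vadd Q v)"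
  using s_ge[of k a v] by (simp add: ge_def)

lemma s_EV0: assumes "a \<noteq> b" "co b v = 0" "co a v \<noteq> 0" "\<bar>co a v\<bar> < 2 ^ K"
  shows "\<xi> (vadd Q v) (EV a b) = 0"
  using s_mid[OF assms(3,4)] EV_inf[OF assms(1)] s_zero[OF assms(2)] by (meson Suc_leI)

lemma v_B0: "\<xi> (vadd Q v) (B0 a) = valf g v (B0 a)"
  using B0_rr[of "vadd Q v" a] s_ex[of 0 a v] big L_B0(3)[of "vadd Q v" a]
  by (auto simp: bigK_def ex_def ge_def)

lemma v_EV: assumes v: "okv K m v" shows "\<xi> (vadd Q v) (EV a b) = valf (\<lambda>u. \<xi> (vadd Q u)) v (EV a b)"
proof (cases "a = b")
  case True then show ?thesis using L_diag by simp
next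
  case ab: False
  consider "co b v \<noteq> 0" | "co b v = 0" "co a v \<noteq> 0" | "co b v = 0" "co a v = 0" by blast
  then show ?thesis
  proof cases
    case 1
    note l = s_lev[OF v 1]
    have "lvz (co b v) \<le> K" using l(2) big by (simp add: bigK_def)
    then show ?thesis using EV_rr[OF ab l(3)] s_ge[of "lvz (co b v)" a v] 1 ab L_EV(1)[OF ab, of "vadd Q v"] by auto
  next
    case 2 then show ?thesis using s_EV0[OF ab 2] v ab by (simp add: okv_def)
  next
    case 3
    then show ?thesis using EV_dep(1)[OF ab, of "vadd Q v" Q] ab by simp
  qed
qed

lemma v_PH: assumes v: "okv K m v" shows "\<xi> (vadd Q v) (PH a b) = valf (\<lambda>u. \<xi> (vadd Q u)) v (PH a b)"
proof (cases "a = b")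
  case True then show ?thesis using L_diag by simp
next
  case ab: False
  show ?thesis
  proof (cases "co b v = 0")
    case False
    note l = s_lev[OF v False]
    have "lvz (co b v) + 2 \<le> K" using l(2) big by (simp add: bigK_def)
    then show ?thesis using PH_rr[OF ab l(3)] ph_rel[OF odo_rr Q, of "lvz (co b v)" a "co a v"] False ab by simp
  next
    case True
    define f where "f t = \<xi> (vadd Q (upd a t (0, 0, 0))) (PH a b)" for t
    have "f t = f (t - 1)" if "t \<noteq> 0" "\<bar>t\<bar> < 2 ^ K" for t
    proof -
      let ?u = "upd a t (0, 0, 0)"
      have "co b ?u = 0" using ab by (cases b) (auto simp: co.simps)
      then have "\<xi> (vadd Q ?u) (EV a b) = 0" using s_EV0[OF ab, of ?u] that by simp
      moreover have "dn a (vadd Q ?u) = vadd Q (upd a (t - 1) (0, 0, 0))" by (rule pos_eqI) simp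
      ultimately show ?thesis using L_EV(4)[OF ab, of "vadd Q ?u"] L_EV(4)[OF ab, of "dn a (vadd Q ?u)"]
        by (simp add: f_def)
    qed
    moreover have "\<bar>co a v\<bar> < 2 ^ K" using v by (simp add: okv_def)
    ultimately have "f (co a v) = f (sg (co a v))" using run_const[of "2 ^ K" f "co a v"] by (simp add: sg_def)
    moreover have "co b (0, 0, 0) = 0" by (cases b) auto
    then have "\<xi> (vadd Q v) (PH a b) = f (co a v)" unfolding f_def
      by (intro EV_dep(2)[OF ab]) (use True ab in auto)
    ultimately show ?thesis using True ab by (simp add: f_def)
  qed
qed

lemma v_LA: assumes v: "okv K m v" shows "\<xi> (vadd Q v) (LA a) = valf (\<lambda>u. \<xi> (vadd Q u)) v (LA a)"
  using LA_rr[OF s_lev(3)[OF v], of a] LA_dep[of a "vadd Q v" Q] by simp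

lemma cmg_rel: "Suc n \<le> K \<Longrightarrow> cmg (rr a) (co a (vadd Q v)) n = cmg z0 (co a v) n"
  using s_ge[of n a v] s_ge[of "Suc n" a v] by (simp add: cmg_def)

lemma v_CM: assumes v: "okv K m v" shows "\<xi> (vadd Q v) (CM l a b) = valf (\<lambda>u. \<xi> (vadd Q u)) v (CM l a b)"
proof (cases "a = b \<or> M \<le> l")
  case True then show ?thesis using M_CM(1) by simp
next
  case False
  then have ab: "a \<noteq> b" "l < M" by auto
  consider "co b v \<noteq> 0" | "co b v = 0" "co a v \<noteq> 0" | "co b v = 0" "co a v = 0" by blast
  then show ?thesis
  proof cases
    case 1
    note l = s_lev[OF v 1]
    have "Suc (P l (lvz (co b v))) \<le> K" using l(2) big P_le[OF ab(2), of "lvz (co b v)"] by (simp add: bigK_def)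
    then show ?thesis using CM_rr[OF ab l(3)] cmg_rel 1 False by simp
  next
    case 2
    note l = s_lev[OF v 2(2)]
    have k: "gee b (Suc (K - 1)) (vadd Q v)" using s_zero[OF 2(1)] big by (simp add: bigK_def)
    have "lvz (co a v) < P l (K - 1)" using l(2) big ab by (auto simp: bigK_def intro: le_less_trans)
    then have "\<not> gee a (P l (K - 1)) (vadd Q v)" using ex_ge_iff[OF odo_rr l(3)] by simp
    then show ?thesis using CM_time_big[OF ab k] 2 False by simp
  next
    case 3
    then show ?thesis using CM_dep[of a "vadd Q v" Q b l] False by simp
  qed
qed

lemma vadd_pt: "vadd Q (x, y, z) = (co AX Q + x, co AY Q + y, co AZ Q + z)"
  by (simp add: vadd_def co.simps)

text \<open>Where the second coordinate has level at least \<open>K\<close> and the vertical one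
  less, \<open>EV AZ AY\<close> is 0, and the rules then exclude any carry.\<close>

lemma z_clean: assumes "co AY v = 0" "co AZ v \<noteq> 0" "\<bar>co AZ v\<bar> < 2 ^ K" "i \<in> {HH, ST, OV, FY}"
  shows "\<xi> (vadd Q v) i = 0"
  by (rule D_clean(1)[OF assms(4)]) (use s_EV0[of AZ AY v] assms in simp)

lemma z_clean': assumes "co AX v = 0" "co AZ v \<noteq> 0" "\<bar>co AZ v\<bar> < 2 ^ K" "i \<in> {VV, FX}"
  shows "\<xi> (vadd Q v) i = 0"
  by (rule D_clean(2)[OF assms(4)]) (use s_EV0[of AZ AX v] assms in simp)

lemma small: assumes "okv K m (x, y, z)"
  shows "\<bar>x\<bar> < 2 ^ K" "\<bar>y\<bar> < 2 ^ K" "\<bar>z\<bar> < 2 ^ K"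
  using assms unfolding okv_def by (metis co_pt)+

lemma cls: assumes "okv K m v" "co a v \<noteq> 0"
  shows "lvz (co a v) + NN (lvz (co a v)) * NN (lvz (co a v)) \<le> K" "Suc (JJ (lvz (co a v))) \<le> K"
  using s_lev(2)[OF assms] big by (auto simp: bigK_def)

lemma crow_rel: "Suc (JJ s) \<le> K \<Longrightarrow> crow (rr a) s (co a Q + n) = crow z0 s n"
  by (rule cnt_rel[OF odo_rr Q])

lemma geZ: "k \<le> K \<Longrightarrow> ge rZ k (co AZ Q + n) \<longleftrightarrow> ge z0 k n"
  by (rule ge_rel0[OF odo_rr Q])

lemma NNle: "NN s * (crow r s n - 1) \<le> NN s * NN s" "NN s * crow r s n \<le> NN s * NN s"
  "crow r s n \<ge> 1 \<Longrightarrow> NN s * (crow r s n - 1) + crow r' s n' \<le> NN s * NN s"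
proof -
  show a: "NN s * crow r s n \<le> NN s * NN s" using crow_le by simp
  then show "NN s * (crow r s n - 1) \<le> NN s * NN s" by (meson diff_le_self le_trans mult_le_mono2)
  assume "crow r s n \<ge> 1"
  then have "NN s * (crow r s n - 1) + NN s = NN s * crow r s n"
    by (metis Suc_pred' add.commute less_eq_Suc_le mult_Suc_right One_nat_def)
  then show "NN s * (crow r s n - 1) + crow r' s n' \<le> NN s * NN s" using a crow_le[of r' s n'] by linarith
qed

lemma v_YZ: assumes v: "okv K m (x, y, z)"
  shows "\<xi> (vadd Q (x, y, z)) ST = valf (\<lambda>u. \<xi> (vadd Q u)) (x, y, z) ST"
    "\<xi> (vadd Q (x, y, z)) OV = valf (\<lambda>u. \<xi> (vadd Q u)) (x, y, z) OV"
    "\<xi> (vadd Q (x, y, z)) FY = valf (\<lambda>u. \<xi> (vadd Q u)) (x, y, z) FY"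
proof -
  define s where "s = lvz y"
  consider "y \<noteq> 0" | "y = 0" "z \<noteq> 0" | "y = 0" "z = 0" by blast
  then have "\<xi> (vadd Q (x, y, z)) ST = valf (\<lambda>u. \<xi> (vadd Q u)) (x, y, z) ST \<and>
    \<xi> (vadd Q (x, y, z)) OV = valf (\<lambda>u. \<xi> (vadd Q u)) (x, y, z) OV \<and>
    \<xi> (vadd Q (x, y, z)) FY = valf (\<lambda>u. \<xi> (vadd Q u)) (x, y, z) FY"
  proof cases
    case 1
    have e: "ex rY s (co AY Q + y)" using s_lev(3)[OF v, of AY] 1 by (simp add: s_def)
    have c: "s + NN s * NN s \<le> K" "Suc (JJ s) \<le> K" using cls[OF v, of AY] 1 by (simp_all add: s_def)
    have "s + NN s * (crow z0 s y - 1) \<le> K" "s + NN s * crow z0 s y \<le> K" using NNle[where s = s and r = z0 and n = y] c by linarith+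
    then show ?thesis unfolding vadd_pt ST_rr[OF e] FY_rr[OF e] crow_rel[OF c(2)] using 1 c(1)
      by (simp add: Let_def geZ s_def)
  next
    case 2
    then show ?thesis using z_clean[of "(x, y, z)"] small[OF v] by (simp add: Let_def)
  next
    case 3
    then show ?thesis using D_const(1,2,4)[of "co AX Q + x" "co AY Q" "co AZ Q" "co AX Q"]
      by (simp add: Let_def vadd_pt)
  qed
  then show "\<xi> (vadd Q (x, y, z)) ST = valf (\<lambda>u. \<xi> (vadd Q u)) (x, y, z) ST"
    "\<xi> (vadd Q (x, y, z)) OV = valf (\<lambda>u. \<xi> (vadd Q u)) (x, y, z) OV"
    "\<xi> (vadd Q (x, y, z)) FY = valf (\<lambda>u. \<xi> (vadd Q u)) (x, y, z) FY" by blast+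
qed

lemma v_FX: assumes v: "okv K m (x, y, z)"
  shows "\<xi> (vadd Q (x, y, z)) FX = valf (\<lambda>u. \<xi> (vadd Q u)) (x, y, z) FX"
proof -
  define s where "s = lvz x"
  consider "x \<noteq> 0" | "x = 0" "z \<noteq> 0" | "x = 0" "z = 0" by blast
  then show ?thesis
  proof cases
    case 1
    have e: "ex rX s (co AX Q + x)" using s_lev(3)[OF v, of AX] 1 by (simp add: s_def)
    have c: "s + NN s * NN s \<le> K" using cls[OF v, of AX] 1 by (simp_all add: s_def)
    then show ?thesis unfolding vadd_pt FX_rr[OF e] using 1 by (simp add: Let_def geZ s_def)
  next
    case 2
    then show ?thesis using z_clean'[of "(x, y, z)"] small[OF v] by (simp add: Let_def)
  next
    case 3
    then show ?thesis using D_const(3)[of "co AX Q" "co AY Q + y" "co AZ Q" "co AY Q"]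
      by (simp add: Let_def vadd_pt)
  qed
qed

lemma no_eql: assumes "\<bar>co AX v\<bar> < 2 ^ K" "\<bar>co AY v\<bar> < 2 ^ K" "(co AX v = 0) \<noteq> (co AY v = 0)"
  shows "\<not> eql (\<xi> (vadd Q v)) AX AY"
proof (cases "co AX v = 0")
  case True
  then obtain k where k: "k < K" "exx AY k (vadd Q v)" using s_mid[of AY v] assms by blast
  have "gee AX (Suc k) (vadd Q v)" using s_zero[OF True, of "Suc k"] k by simp
  then show ?thesis using eql_rr[of AX AY k "vadd Q v"] k by (simp add: ex_def)
next
  case False
  then show ?thesis using s_EV0[of AX AY v] assms by (simp add: eql_def)
qed

lemma v_VV: assumes v: "okv K m (x, y, z)"
  shows "\<xi> (vadd Q (x, y, z)) VV = valf (\<lambda>u. \<xi> (vadd Q u)) (x, y, z) VV"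
proof -
  define s where "s = lvz x"
  consider "x \<noteq> 0" | "x = 0" "z \<noteq> 0" | "x = 0" "z = 0" by blast
  then show ?thesis
  proof cases
    case 1
    have e: "ex rX s (co AX Q + x)" using s_lev(3)[OF v, of AX] 1 by (simp add: s_def)
    have c: "s + NN s * NN s \<le> K" "Suc (JJ s) \<le> K" using cls[OF v, of AX] 1 by (simp_all add: s_def)
    have "s + NN s * crow z0 s y \<le> K" using NNle[where s = s and r = z0 and n = y] c by linarith
    then show ?thesis unfolding vadd_pt VV_rr[OF e] crow_rel[OF c(2)] using 1 by (simp add: Let_def geZ s_def)
  next
    case 2
    then show ?thesis using z_clean'[of "(x, y, z)"] small[OF v] by (simp add: Let_def)
  next
    case 3
    define f where "f t = \<xi> (vadd Q (0, t, 0)) VV" for t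
    have "f t = f (t - 1)" if t: "t \<noteq> 0" "\<bar>t\<bar> < 2 ^ K" for t
    proof -
      let ?p = "vadd Q (0, t, 0)"
      obtain k where k: "k < K" "exx AY k ?p" using s_mid[of AY "(0, t, 0)"] t by auto
      have "gee AX (Suc k) ?p" using s_zero[of AX "(0, t, 0)" "Suc k"] k by simp
      then have "\<xi> ?p (CM 1 AX AY) = 2" using CM_pos_big[of AX AY 1 k ?p] k M2 by simp
      moreover have "\<not> eql (\<xi> ?p) AX AY" using no_eql[of "(0, t, 0)"] t by simp
      ultimately show ?thesis using D_V(5)[of "co AX Q" "co AY Q + t" "co AZ Q"]
        by (simp add: f_def vadd_pt add_diff_eq)
    qed
    then have "f y = f (sg y)" using run_const[of "2 ^ K" f y] small[OF v] by (simp add: sg_def)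
    then show ?thesis using 3 by (simp add: Let_def f_def)
  qed
qed

lemma v_HH: assumes v: "okv K m (x, y, z)"
  shows "\<xi> (vadd Q (x, y, z)) HH = valf (\<lambda>u. \<xi> (vadd Q u)) (x, y, z) HH"
proof -
  define s where "s = lvz y"
  consider "y \<noteq> 0" | "y = 0" "z \<noteq> 0" | "y = 0" "z = 0" by blast
  then show ?thesis
  proof cases
    case 1
    have e: "ex rY s (co AY Q + y)" using s_lev(3)[OF v, of AY] 1 by (simp add: s_def)
    have c: "s + NN s * NN s \<le> K" "Suc (JJ s) \<le> K" using cls[OF v, of AY] 1 by (simp_all add: s_def)
    have "crow rY s (co AY Q + y) \<ge> 1" using row_not_bnd(3)[OF e] by simp
    then have "s + NN s * (crow z0 s y - 1) + crow z0 s x \<le> K" using NNle(3)[where s = s and r = z0 and n = y and r' = z0 and n' = x] c crow_rel[OF c(2)] by simp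
    then show ?thesis unfolding vadd_pt HH_rr(1)[OF e] crow_rel[OF c(2)] using 1 by (simp add: Let_def geZ s_def)
  next
    case 2
    then show ?thesis using z_clean[of "(x, y, z)"] small[OF v] by (simp add: Let_def)
  next
    case 3
    define f where "f t = \<xi> (vadd Q (t, 0, 0)) HH" for t
    have "f t = f (t - 1)" if t: "t \<noteq> 0" "\<bar>t\<bar> < 2 ^ K" for t
    proof -
      let ?p = "vadd Q (t, 0, 0)"
      obtain k where k: "k < K" "exx AX k ?p" using s_mid[of AX "(t, 0, 0)"] t by auto
      have "gee AY (Suc k) ?p" using s_zero[of AY "(t, 0, 0)" "Suc k"] k by simp
      then have "\<xi> ?p (CM 1 AY AX) = 2" using CM_pos_big[of AY AX 1 k ?p] k M2 by simp
      moreover have "\<not> eql (\<xi> ?p) AX AY" using no_eql[of "(t, 0, 0)"] t by simp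
      ultimately show ?thesis using D_H(5)[of "co AX Q + t" "co AY Q" "co AZ Q"]
        by (simp add: f_def vadd_pt add_diff_eq)
    qed
    then have "f x = f (sg x)" using run_const[of "2 ^ K" f x] small[OF v] by (simp add: sg_def)
    then show ?thesis using 3 by (simp add: Let_def f_def)
  qed
qed

lemma v_UU: assumes v: "okv K m (x, y, z)"
  shows "\<xi> (vadd Q (x, y, z)) UU = valf (\<lambda>u. \<xi> (vadd Q u)) (x, y, z) UU"
proof -
  define s where "s = lvz y"
  consider "y \<noteq> 0" | "y = 0" "x \<noteq> 0" | "y = 0" "x = 0" by blast
  then show ?thesis
  proof cases
    case 1
    have e: "ex rY s (co AY Q + y)" using s_lev(3)[OF v, of AY] 1 by (simp add: s_def)
    have c: "s + NN s * NN s \<le> K" "Suc (JJ s) \<le> K" using cls[OF v, of AY] 1 by (simp_all add: s_def)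
    have "s < K" using c NN_pos[of s] by (metis add_less_same_cancel1 le_neq_implies_less le_add1 nat_0_less_mult_iff not_less_zero order_less_le_trans less_add_same_cancel1)
    then have ex: "ex rX s (co AX Q + x) \<longleftrightarrow> ex z0 s x" using s_ex[of s AX "(x, y, z)"] by simp
    have "crow rY s (co AY Q + y) \<ge> 1" using row_not_bnd(3)[OF e] by simp
    then have le: "s + NN s * (crow z0 s y - 1) + crow z0 s x \<le> K" using NNle(3)[where s = s and r = z0 and n = y and r' = z0 and n' = x] c crow_rel[OF c(2)] by simp
    show ?thesis
    proof (cases "ex z0 s x")
      case False
      then show ?thesis unfolding vadd_pt using HH_rr(3)[OF e] ex 1 by (simp add: Let_def s_def)
    next
      case True
      have "\<not> ge rX (Suc (JJ s)) (co AX Q + x)" using ex_ge_iff[OF odo_rr, of AX s "co AX Q + x"] True ex JJ_ge[of s] by simp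
      then have "crow rX s (co AX Q + x) \<ge> 1" using cnt_step[OF odo_rr JJ_ge, of AX s "co AX Q + x"] True ex by simp
      then have "Suc (s + NN s * (crow z0 s y - 1) + crow z0 s x - 1) \<le> K" using le crow_rel[OF c(2)] by simp
      then show ?thesis unfolding vadd_pt using HH_rr(2)[OF e] ex True 1 bitr_rel[OF odo_rr Q, of _ AZ z]
        by (simp add: Let_def s_def[symmetric] crow_rel[OF c(2)])
    qed
  next
    case 2
    have "\<not> eql (\<xi> (vadd Q (x, y, z))) AX AY" using no_eql[of "(x, y, z)"] 2 small[OF v] by simp
    then show ?thesis using 2 D_H(6)[of "co AX Q + x" "co AY Q + y" "co AZ Q + z"] by (simp add: Let_def vadd_pt)
  next
    case 3
    define f where "f t = \<xi> (vadd Q (0, 0, t)) UU" for t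
    have "f t = f (t - 1)" if t: "t \<noteq> 0" "\<bar>t\<bar> < 2 ^ K" for t
    proof -
      let ?p = "(co AX Q, co AY Q, co AZ Q + t)" and ?q = "(co AX Q, co AY Q, co AZ Q + t - 1)"
      \<comment> \<open>By \<open>z_clean\<close> no carry enters this cell away from the height of
        \<open>Q\<close>, so its digit stays constant above and below that height.\<close>
      have h: "\<xi> (co AX Q - 1, co AY Q, co AZ Q + t) HH = 0"
        using z_clean[of "(- 1, 0, t)" HH] t by (simp add: vadd_pt)
      have r: "\<xi> ?q UU = 0 \<or> \<xi> ?q UU = 1" using D_range[of UU ?q] by simp
      have e: "\<xi> ?p (CM 1 AY AX) = \<xi> ?q (CM 1 AY AX)" "eql (\<xi> ?p) AX AY = eql (\<xi> ?q) AX AY"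
        using CM_dep[of AY ?p ?q AX 1] EV_dep[of AX AY ?p ?q] by (simp_all add: eql_def)
      show ?thesis
      proof (cases "\<xi> ?p (CM 1 AY AX) = 0 \<or> \<not> eql (\<xi> ?p) AX AY")
        case True
        then show ?thesis using D_H(6)[of "co AX Q" "co AY Q" "co AZ Q + t"] D_H(6)[of "co AX Q" "co AY Q" "co AZ Q + t - 1"] e
          by (simp add: f_def vadd_pt add_diff_eq)
      next
        case False
        then have "\<xi> ?p UU = (0 + \<xi> ?q UU) mod 2" using D_H(4)[of "co AX Q" "co AY Q" "co AZ Q + t"] h by simp
        then show ?thesis using r by (auto simp: f_def vadd_pt add_diff_eq)
      qed
    qed
    then have "f z = f (sg z)" using run_const[of "2 ^ K" f z] small[OF v] by (simp add: sg_def)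
    then show ?thesis using 3 by (simp add: Let_def f_def)
  qed
qed

lemma star_val: assumes v: "okv K m v"
  shows "\<xi> (vadd Q v) i = valf (\<lambda>u. \<xi> (vadd Q u)) v i"
proof -
  obtain x y z where xyz: "v = (x, y, z)" by (cases v) auto
  show ?thesis
    using v_B0[of v _ "\<lambda>u. \<xi> (vadd Q u)"] v_EV[OF v] v_PH[OF v] v_LA[OF v] v_CM[OF v] v_YZ[OF v[unfolded xyz]]
      v_FX[OF v[unfolded xyz]] v_VV[OF v[unfolded xyz]] v_HH[OF v[unfolded xyz]] v_UU[OF v[unfolded xyz]]
    unfolding xyz by (cases i) blast+
qed

end

section \<open>Recurrent germs\<close>

lemma co_zero [simp]: "co a (0, 0, 0) = 0"
  by (cases a) simp_all

lemma UNIV_ax: "(UNIV :: ax set) = {AX, AY, AZ}"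
  by (auto intro: ax.exhaust)

lemma all_ax: "(\<forall>a. R a) \<longleftrightarrow> R AX \<and> R AY \<and> R AZ"
  by (metis ax.exhaust)

definition sbox :: "int \<Rightarrow> pos set" where "sbox n = {u. \<forall>a. \<bar>co a u\<bar> \<le> n}"

lemma sbox_pt: "(x, y, z) \<in> sbox n \<longleftrightarrow> \<bar>x\<bar> \<le> n \<and> \<bar>y\<bar> \<le> n \<and> \<bar>z\<bar> \<le> n"
  by (simp add: sbox_def all_ax)

lemma finite_sbox: "finite (sbox n)"
proof (rule finite_subset)
  show "sbox n \<subseteq> {-n..n} \<times> {-n..n} \<times> {-n..n}" by (auto simp: sbox_pt abs_le_iff)
qed simp

lemma vadd_diff: "\<exists>v. vadd p v = q \<and> (\<forall>a. co a v = co a q - co a p)"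
proof (intro exI conjI allI)
  let ?v = "(co AX q - co AX p, co AY q - co AY p, co AZ q - co AZ p)"
  show c: "co a ?v = co a q - co a p" for a by (cases a) simp_all
  show "vadd p ?v = q" by (rule pos_eqI) (simp add: c)
qed

lemma vadd_assoc: "vadd (vadd p q) r = vadd p (vadd q r)"
  by (rule pos_eqI) simp

lemma vadd_commute: "vadd p q = vadd q p"
  by (rule pos_eqI) simp

text \<open>Either a point of the window has infinite level, and it serves as the centre for all
  \<open>K\<close>; or the levels in the window are bounded, and any point of level \<open>K\<close>
  at distance below \<open>2 ^ K\<close> will do. In both cases the bound \<open>m\<close> on the
  levels of the offsets does not depend on \<open>K\<close>.\<close>

lemma axis_star:
  assumes o: "odo r" and n: "0 \<le> n"
  shows "\<exists>m K1. \<forall>K\<ge>K1. \<exists>P. ge r K P \<and> (\<forall>t. \<bar>t\<bar> \<le> n \<longrightarrow> \<bar>t - P\<bar> < 2 ^ K \<and> (t = P \<or> lvz (t - P) \<le> m))"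
proof -
  have pw: "\<exists>k. c < (2::int) ^ k" for c
  proof
    have "c \<le> int (nat c)" by simp
    also have "\<dots> < 2 ^ nat c" by (metis less_exp of_nat_less_iff of_nat_numeral of_nat_power)
    finally show "c < 2 ^ nat c" .
  qed
  show ?thesis
  proof (cases "\<exists>N. \<bar>N\<bar> \<le> n \<and> (\<forall>k. ge r k N)")
    case True
    then obtain N where N: "\<bar>N\<bar> \<le> n" "\<And>k. ge r k N" by blast
    obtain m where m: "2 * n < (2::int) ^ m" using pw by blast
    have "\<bar>t - N\<bar> < 2 ^ K \<and> (t = N \<or> lvz (t - N) \<le> m)" if K: "m \<le> K" and t: "\<bar>t\<bar> \<le> n" for K t
    proof -
      have 1: "\<bar>t - N\<bar> < 2 ^ m" using t N(1) m by linarith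
      also have "(2::int) ^ m \<le> 2 ^ K" using K by simp
      finally have "\<bar>t - N\<bar> < 2 ^ K" .
      moreover have "lvz (t - N) \<le> m" if "t \<noteq> N"
        using small_level[of "t - N" m] 1 that lvz_eq by auto
      ultimately show ?thesis by blast
    qed
    then show ?thesis using N(2) by blast
  next
    case False
    then have "\<forall>t\<in>{-n..n}. \<exists>k. \<not> ge r k t" by (auto simp: abs_le_iff)
    then obtain k where k: "\<And>t. t \<in> {-n..n} \<Longrightarrow> \<not> ge r (k t) t" by metis
    define m where "m = Max (k ` {-n..n})"
    have ng: "\<not> ge r m t" if "t \<in> {-n..n}" for t
    proof
      assume "ge r m t"
      moreover have "k t \<le> m" unfolding m_def using that by (intro Max_ge) auto
      ultimately show False using ge_mono[OF o] k[OF that] by blast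
    qed
    obtain k1 where k1: "n < (2::int) ^ k1" using pw by blast
    define K1 where "K1 = Suc (max m k1)"
    have "\<exists>P. ge r K P \<and> (\<forall>t. \<bar>t\<bar> \<le> n \<longrightarrow> \<bar>t - P\<bar> < 2 ^ K \<and> (t = P \<or> lvz (t - P) \<le> m))" if K: "K1 \<le> K" for K
    proof -
      obtain K' where K': "K = Suc K'" "max m k1 \<le> K'" using K unfolding K1_def by (cases K) auto
      obtain Pc where Pc: "ge r K Pc" "- (2 ^ K') \<le> Pc" "Pc < - (2 ^ K') + 2 ^ K" using ge_exists by blast
      have "(2::int) ^ k1 \<le> 2 ^ K'" using K' by simp
      then have nK: "n < 2 ^ K'" using k1 by linarith
      have "\<bar>t - Pc\<bar> < 2 ^ K \<and> (t = Pc \<or> lvz (t - Pc) \<le> m)" if t: "\<bar>t\<bar> \<le> n" for t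
      proof -
        have 1: "\<bar>t - Pc\<bar> < 2 ^ K" using t nK Pc K'(1) by auto
        have gm: "ge r m Pc" using ge_mono[OF o Pc(1)] K' by simp
        have "\<not> ge z0 m (t - Pc)" using ge_rel[OF o gm, of m t] ng[of t] t by (auto simp: ge_def abs_le_iff)
        then obtain j where j: "ex z0 j (t - Pc)" using ex_or_all by blast
        then have "j < m" using \<open>\<not> ge z0 m (t - Pc)\<close> ex_ge_iff[OF odo_const j, of m] by simp
        then show ?thesis using 1 lvz_eq[OF j] by simp
      qed
      with Pc(1) show ?thesis by blast
    qed
    then show ?thesis by blast
  qed
qed

context driver begin

lemma finite_y0: "finite (range y0)"
proof -
  define I where "I = range B0 \<union> (\<Union>a. range (EV a)) \<union> (\<Union>a. range (PH a)) \<union> range LA \<union>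
     (\<Union>l<M. \<Union>a. range (CM l a)) \<union> {ST, OV, HH, UU, VV, FX, FY}"
  define B where "B = {0..3} \<union> range Lam"
  have f: "finite (UNIV :: ax set)" by (simp add: UNIV_ax)
  have "finite I" unfolding I_def using f by (intro finite_UnI finite_UN_I finite_imageI) auto
  moreover have "finite B" unfolding B_def using Lam_fin by simp
  ultimately have fin: "finite {h. \<forall>i. (i \<in> I \<longrightarrow> h i \<in> B) \<and> (i \<notin> I \<longrightarrow> h i = 0)}"
    by (rule finite_set_of_finite_funs)
  have b: "{0, 1, 2} \<subseteq> B" by (auto simp: B_def)
  have "y0 p i \<in> B" for p i
  proof (cases i)
    case (PH a b)
    have "ph r0 k n \<in> B" for k n using ph_range[of r0 k n] by (simp add: B_def)
    then show ?thesis using PH b by simp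
  next
    case (CM l a b)
    have "cmp j k \<in> B" for j k using b by (auto simp: cmp_def)
    then show ?thesis unfolding CM using b by simp
  next
    case UU
    have "0 \<le> bitr r0 k n" "bitr r0 k n < 2" for k n by (simp_all add: bitr_def)
    then have "bitr r0 k n \<in> {0..3}" for k n by (smt (verit) atLeastAtMost_iff)
    then have "bitr r0 k n \<in> B" for k n unfolding B_def by blast
    then show ?thesis using UU b by (simp add: Let_def)
  qed (use b in \<open>auto simp: B_def Let_def\<close>)
  moreover have "y0 p i = 0" if "i \<notin> I" for p i
  proof (cases i)
    case (CM l a b)
    have "CM l a b \<in> I" if "l < M"
    proof -
      have "CM l a b \<in> (\<Union>l<M. \<Union>a. range (CM l a))" using that by blast
      then show ?thesis unfolding I_def by (rule UnI1[OF UnI2])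
    qed
    with \<open>i \<notin> I\<close> CM have "\<not> l < M" by blast
    then show ?thesis using CM by simp
  next
    case (EV a b)
    have "EV a b \<in> (\<Union>a. range (EV a))" by blast
    then have "EV a b \<in> I" unfolding I_def by simp
    then show ?thesis using EV that by blast
  next
    case (PH a b)
    have "PH a b \<in> (\<Union>a. range (PH a))" by blast
    then have "PH a b \<in> I" unfolding I_def by simp
    then show ?thesis using PH that by blast
  qed (use that in \<open>simp_all add: I_def\<close>)
  ultimately have "range y0 \<subseteq> {h. \<forall>i. (i \<in> I \<longrightarrow> h i \<in> B) \<and> (i \<notin> I \<longrightarrow> h i = 0)}" by blast
  then show ?thesis using fin by (rule finite_subset)
qed

text \<open>\<open>near n\<close> describes the candidate for the subshift of finite type, with windows of radius \<open>n\<close>.\<close>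

definition near :: "int \<Rightarrow> (pos \<Rightarrow> lay \<Rightarrow> int) \<Rightarrow> bool" where
  "near n \<xi> \<longleftrightarrow> (\<forall>p. \<exists>q. \<forall>u\<in>sbox n. \<xi> (vadd p u) = y0 (vadd q u))"

lemma near_ruled: assumes "near n \<xi>" "1 \<le> n" shows "ruled \<xi>"
  unfolding ruled_def
proof
  fix p
  obtain q where q: "\<And>u. u \<in> sbox n \<Longrightarrow> \<xi> (vadd p u) = y0 (vadd q u)" using assms(1) unfolding near_def by blast
  have 0: "\<xi> p = y0 q" using q[of "(0, 0, 0)"] assms(2) by (simp add: sbox_pt)
  have 1: "\<xi> (dn a p) = y0 (dn a q)" for a
  proof -
    let ?u = "upd a (- 1) (0, 0, 0)"
    have "?u \<in> sbox n" using assms(2) by (cases a) (simp_all add: sbox_pt)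
    moreover have "vadd r ?u = dn a r" for r by (rule pos_eqI) simp
    ultimately show ?thesis using q[of ?u] by simp
  qed
  show "rul_level (\<xi> p) (\<lambda>a. \<xi> (dn a p)) \<and> rul_mach (\<xi> p) (\<lambda>a. \<xi> (dn a p)) \<and> rul_digit (\<xi> p) (\<lambda>a. \<xi> (dn a p))"
    unfolding 0 1 using y0_ruled unfolding ruled_def by blast
qed

sublocale Y: rconf M P Lam mv del y0
  by unfold_locales (rule y0_ruled)

text \<open>Induction on \<open>k\<close>. Some point of level \<open>k\<close> on another axis lies
  within distance \<open>2 ^ Suc k\<close>; in the cell over it, the digit pair of \<open>a\<close>
  shows whether the level of \<open>a\<close> is at least \<open>k + 2\<close>.\<close>

lemma recognise:
  assumes A: "rconf M P Lam mv del \<xi>" and B: "rconf M P Lam mv del \<eta>"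
    and eq: "\<And>u. u \<in> sbox (2 ^ K) \<Longrightarrow> \<xi> (vadd p u) = \<eta> (vadd q u)"
  shows "k \<le> K \<Longrightarrow> (\<forall>a t. \<bar>t\<bar> \<le> 2 ^ K \<longrightarrow>
    (ge (rconf.rr \<xi> a) k (co a p + t) \<longleftrightarrow> ge (rconf.rr \<eta> a) k (co a q + t)) \<and>
    (ge (rconf.rr \<xi> a) (Suc k) (co a p + t) \<longleftrightarrow> ge (rconf.rr \<eta> a) (Suc k) (co a q + t)))"
proof (induction k)
  case 0
  interpret A: rconf M P Lam mv del \<xi> by (rule A)
  interpret B: rconf M P Lam mv del \<eta> by (rule B)
  show ?case
  proof (intro allI impI)
    fix a and t :: int assume t: "\<bar>t\<bar> \<le> 2 ^ K"
    let ?u = "upd a t (0, 0, 0)"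
    have "?u \<in> sbox (2 ^ K)" using t by (cases a) (simp_all add: sbox_pt)
    from eq[OF this] have "A.exx a 0 (vadd p ?u) \<longleftrightarrow> B.exx a 0 (vadd q ?u)" by (metis A.B0_rr B.B0_rr)
    then show "(ge (A.rr a) 0 (co a p + t) \<longleftrightarrow> ge (B.rr a) 0 (co a q + t)) \<and>
      (ge (A.rr a) (Suc 0) (co a p + t) \<longleftrightarrow> ge (B.rr a) (Suc 0) (co a q + t))" by (simp add: ex_def)
  qed
next
  case (Suc k)
  interpret A: rconf M P Lam mv del \<xi> by (rule A)
  interpret B: rconf M P Lam mv del \<eta> by (rule B)
  have IH: "ge (A.rr a) k (co a p + t) \<longleftrightarrow> ge (B.rr a) k (co a q + t)"
    "ge (A.rr a) (Suc k) (co a p + t) \<longleftrightarrow> ge (B.rr a) (Suc k) (co a q + t)" if "\<bar>t\<bar> \<le> 2 ^ K" for a t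
    using Suc that by auto
  have "ge (A.rr a) (k + 2) (co a p + t) \<longleftrightarrow> ge (B.rr a) (k + 2) (co a q + t)" if t: "\<bar>t\<bar> \<le> 2 ^ K" for a t
  proof -
    obtain b where ab: "a \<noteq> b" by (cases a) auto
    obtain n where n: "ex (A.rr b) k n" "co b p \<le> n" "n \<le> co b p + 2 ^ Suc k" using ex_exists[OF A.odo_rr] by blast
    define s where "s = n - co b p"
    have "(2::int) ^ Suc k \<le> 2 ^ K" using Suc.prems by (intro power_increasing) auto
    then have s: "\<bar>s\<bar> \<le> 2 ^ K" using n by (auto simp: s_def)
    have eA: "ex (A.rr b) k (co b p + s)" using n by (simp add: s_def)
    then have eB: "ex (B.rr b) k (co b q + s)" using IH[OF s] by (simp add: ex_def)
    let ?u = "upd a t (upd b s (0, 0, 0))"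
    have u: "?u \<in> sbox (2 ^ K)" using t s by (cases a; cases b) (simp_all add: sbox_pt)
    have c: "co a ?u = t" "co b ?u = s" using ab by auto
    have "ge (A.rr a) (k + 2) (co a p + t) \<longleftrightarrow> \<xi> (vadd p ?u) (EV a b) = 1 \<and> \<xi> (vadd p ?u) (PH a b) = 0"
      using A.EV_rr[OF ab, of k "vadd p ?u"] A.PH_rr[OF ab, of k "vadd p ?u"] eA c
        ph_level(2)[OF A.odo_rr, of a k "co a p + t"] ge_mono[OF A.odo_rr, of a "k + 2" "co a p + t" k] by auto
    moreover have "ge (B.rr a) (k + 2) (co a q + t) \<longleftrightarrow> \<eta> (vadd q ?u) (EV a b) = 1 \<and> \<eta> (vadd q ?u) (PH a b) = 0"
      using B.EV_rr[OF ab, of k "vadd q ?u"] B.PH_rr[OF ab, of k "vadd q ?u"] eB c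
        ph_level(2)[OF B.odo_rr, of a k "co a q + t"] ge_mono[OF B.odo_rr, of a "k + 2" "co a q + t" k] by auto
    ultimately show ?thesis using eq[OF u] by simp
  qed
  then show ?case using IH(2) by simp
qed

definition germ :: "(pos \<Rightarrow> lay \<Rightarrow> int) \<Rightarrow> pos \<Rightarrow> pos \<Rightarrow> lay \<Rightarrow> int" where
  "germ \<xi> q = restrict (\<lambda>u. \<xi> (vadd q u)) (sbox 1)"

lemma finite_germs: "finite (range (germ y0))"
proof (rule finite_subset)
  show "range (germ y0) \<subseteq> PiE (sbox 1) (\<lambda>_. range y0)" by (auto simp: germ_def)
  show "finite (PiE (sbox 1) (\<lambda>_. range y0))" using finite_y0 finite_sbox by (intro finite_PiE) auto
qed

definition recurrent :: "(pos \<Rightarrow> lay \<Rightarrow> int) \<Rightarrow> bool" where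
  "recurrent g \<longleftrightarrow> (\<forall>K. \<exists>q. (\<forall>a. Y.gee a K q) \<and> germ y0 q = g)"

text \<open>There are finitely many germs, and each one that is not recurrent is absent from some
  level on.\<close>

lemma eventually_recurrent: "\<exists>K. \<forall>q. (\<forall>a. Y.gee a K q) \<longrightarrow> recurrent (germ y0 q)"
proof -
  let ?N = "{g \<in> range (germ y0). \<not> recurrent g}"
  have "\<forall>g\<in>?N. \<exists>K. \<forall>q. (\<forall>a. Y.gee a K q) \<longrightarrow> germ y0 q \<noteq> g" unfolding recurrent_def by blast
  from bchoice[OF this] obtain k where k: "\<forall>g\<in>?N. \<forall>q. (\<forall>a. Y.gee a (k g) q) \<longrightarrow> germ y0 q \<noteq> g" ..
  define K where "K = Max (insert 0 (k ` ?N))"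
  have fin: "finite ?N" using finite_germs by simp
  have "recurrent (germ y0 q)" if q: "\<forall>a. Y.gee a K q" for q
  proof (rule ccontr)
    assume "\<not> recurrent (germ y0 q)"
    then have N: "germ y0 q \<in> ?N" by blast
    then have "k (germ y0 q) \<le> K" unfolding K_def using fin by (intro Max_ge) auto
    then have "\<forall>a. Y.gee a (k (germ y0 q)) q" using q ge_mono[OF Y.odo_rr] by blast
    then show False using k N by blast
  qed
  then show ?thesis by blast
qed

lemma bigK_ex: "\<exists>K1. \<forall>K\<ge>K1. bigK K m"
proof -
  have "\<exists>k. \<forall>l<M. m < P l k"
  proof -
    have "\<forall>l\<in>{..<M}. \<exists>k. Suc m \<le> P l k" using P_unb by blast
    then obtain k where k: "\<And>l. l < M \<Longrightarrow> Suc m \<le> P l (k l)" by (metis lessThan_iff)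
    have "m < P l (Max (k ` {..<M}))" if "l < M" for l
      using k[OF that] P_mono[OF that, of "k l" "Max (k ` {..<M})"] that by simp
    then show ?thesis by blast
  qed
  then obtain k where k: "\<And>l. l < M \<Longrightarrow> m < P l k" by blast
  define b where "b = Max ((\<lambda>s. JJ s + 1 + (s + NN s * NN s)) ` {..m})"
  have b: "JJ s + 1 + (s + NN s * NN s) \<le> b" if "s \<le> m" for s unfolding b_def using that by (intro Max_ge) auto
  have "bigK K m" if K: "m + 3 + Suc k + b \<le> K" for K
    unfolding bigK_def
  proof (intro conjI allI impI)
    fix l assume "l < M"
    moreover have "k \<le> K - 1" using K by simp
    ultimately show "m < P l (K - 1)" using k[of l] P_mono[of l k "K - 1"] by linarith
  next
    fix s assume "s \<le> m"
    then show "JJ s + 1 \<le> K" "s + NN s * NN s \<le> K" using b[of s] K by simp_all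
  qed (use K in simp)
  then show ?thesis by blast
qed

text \<open>Around points of levels at least \<open>K\<close>, \<open>star_val\<close> computes both
  configurations by the same formula from the germ. It remains to find such a point in
  \<open>y0\<close> with the germ of \<open>Q\<close>: the window at \<open>Q\<close> occurs in
  \<open>y0\<close> at a point \<open>q\<close> of levels at least \<open>K0\<close>, and the germ
  there is recurrent.\<close>

theorem near_limit: "\<exists>n\<ge>1. \<forall>\<xi>. near n \<xi> \<longrightarrow> (\<forall>N\<ge>0. \<exists>q. \<forall>u\<in>sbox N. \<xi> u = y0 (vadd q u))"
proof -
  obtain K0 where K0: "\<And>q. (\<And>a. Y.gee a K0 q) \<Longrightarrow> recurrent (germ y0 q)" using eventually_recurrent by blast
  have "\<exists>q. \<forall>u\<in>sbox N. \<xi> u = y0 (vadd q u)" if near: "near (2 ^ K0) \<xi>" and N: "0 \<le> N" for \<xi> N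
  proof -
    interpret A: rconf M P Lam mv del \<xi> by unfold_locales (rule near_ruled[OF near], simp)
    have "\<forall>a. \<exists>m K1. \<forall>K\<ge>K1. \<exists>P. ge (A.rr a) K P \<and> (\<forall>t. \<bar>t\<bar> \<le> N \<longrightarrow> \<bar>t - P\<bar> < 2 ^ K \<and> (t = P \<or> lvz (t - P) \<le> m))"
      using axis_star[OF A.odo_rr N] by blast
    from choice[OF this] obtain m where "\<forall>a. \<exists>K1. \<forall>K\<ge>K1. \<exists>P. ge (A.rr a) K P \<and>
        (\<forall>t. \<bar>t\<bar> \<le> N \<longrightarrow> \<bar>t - P\<bar> < 2 ^ K \<and> (t = P \<or> lvz (t - P) \<le> m a))" ..
    from choice[OF this] obtain K1 where mK: "\<forall>a. \<forall>K\<ge>K1 a. \<exists>P. ge (A.rr a) K P \<and>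
        (\<forall>t. \<bar>t\<bar> \<le> N \<longrightarrow> \<bar>t - P\<bar> < 2 ^ K \<and> (t = P \<or> lvz (t - P) \<le> m a))" ..
    \<comment> \<open>The bound on the levels is fixed before \<open>K\<close> is chosen, so
      \<open>K\<close> may be taken large in terms of it.\<close>
    define mm where "mm = m AX + m AY + m AZ"
    obtain K2 where K2: "\<And>K. K2 \<le> K \<Longrightarrow> bigK K mm" using bigK_ex by blast
    define K where "K = K0 + K1 AX + K1 AY + K1 AZ + K2"
    have big: "bigK K mm" using K2 by (simp add: K_def)
    have K1: "K1 a \<le> K" for a by (cases a) (simp_all add: K_def)
    have "\<forall>a. \<exists>P. ge (A.rr a) K P \<and> (\<forall>t. \<bar>t\<bar> \<le> N \<longrightarrow> \<bar>t - P\<bar> < 2 ^ K \<and> (t = P \<or> lvz (t - P) \<le> m a))"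
      using mK K1 by blast
    from choice[OF this] obtain p where "\<forall>a. ge (A.rr a) K (p a) \<and>
        (\<forall>t. \<bar>t\<bar> \<le> N \<longrightarrow> \<bar>t - p a\<bar> < 2 ^ K \<and> (t = p a \<or> lvz (t - p a) \<le> m a))" ..
    then have p: "ge (A.rr a) K (p a)" "\<bar>t\<bar> \<le> N \<Longrightarrow> \<bar>t - p a\<bar> < 2 ^ K"
      "\<bar>t\<bar> \<le> N \<Longrightarrow> t = p a \<or> lvz (t - p a) \<le> m a" for a t by blast+
    define Q where "Q = (p AX, p AY, p AZ)"
    have Qc: "co a Q = p a" for a by (cases a) (simp_all add: Q_def)
    have QK: "A.gee a K Q" for a using p(1) by (simp add: Qc)
    obtain q where q: "\<And>u. u \<in> sbox (2 ^ K0) \<Longrightarrow> \<xi> (vadd Q u) = y0 (vadd q u)" using near unfolding near_def by blast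
    \<comment> \<open>Equal windows of radius \<open>2 ^ K0\<close> have equal levels up to
      \<open>K0\<close>, so \<open>q\<close> inherits this much from \<open>Q\<close>.\<close>
    have "Y.gee a K0 q" for a
    proof -
      have "A.gee a K0 Q" using ge_mono[OF A.odo_rr QK] by (simp add: K_def)
      then show ?thesis using recognise[OF A.rconf_axioms Y.rconf_axioms q, of K0] by (metis abs_zero add_0_right order_refl zero_le_numeral zero_le_power)
    qed
    then have "recurrent (germ y0 q)" by (rule K0)
    then obtain Q' where Q': "\<And>a. Y.gee a K Q'" "germ y0 Q' = germ y0 q" unfolding recurrent_def by blast
    have b1: "u \<in> sbox (2 ^ K0)" if "u \<in> sbox 1" for u
      using that unfolding sbox_def by (auto intro: order_trans)
    have ge: "\<xi> (vadd Q u) = y0 (vadd Q' u)" if "u \<in> sbox 1" for u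
    proof -
      have "germ y0 Q' u = germ y0 q u" using Q'(2) by simp
      then show ?thesis using q[OF b1[OF that]] that by (simp add: germ_def)
    qed
    interpret SA: star M P Lam mv del \<xi> Q K mm by unfold_locales (use QK big in auto)
    interpret SB: star M P Lam mv del y0 Q' K mm by unfold_locales (use Q'(1) big in auto)
    obtain q' where q': "\<And>a. co a q' = co a Q' - co a Q" using vadd_diff[of Q Q'] by blast
    have "\<xi> u = y0 (vadd q' u)" if u: "u \<in> sbox N" for u
    proof
      fix i
      obtain v where v: "vadd Q v = u" "\<And>a. co a v = co a u - co a Q" using vadd_diff by blast
      have ok: "okv K mm v" unfolding okv_def
      proof
        fix a
        have t: "\<bar>co a u\<bar> \<le> N" using u by (simp add: sbox_def)
        have "m a \<le> mm" by (cases a) (simp_all add: mm_def)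
        then show "\<bar>co a v\<bar> < 2 ^ K \<and> (co a v = 0 \<or> lvz (co a v) \<le> mm)"
          using p(2,3)[OF t, of a] by (auto simp: v(2) Qc)
      qed
      have "vadd Q' v = vadd q' u" by (rule pos_eqI) (simp add: q' v(2))
      then have "y0 (vadd q' u) i = valf (\<lambda>u. y0 (vadd Q' u)) v i" using SB.star_val[OF ok, of i] by simp
      also have "\<dots> = valf (\<lambda>u. \<xi> (vadd Q u)) v i"
      proof (rule valf_cong)
        fix w :: pos assume "\<And>a. co a w = 0 \<or> co a w = - 1"
        then have "\<bar>co a w\<bar> \<le> 1" for a by (metis abs_0 abs_minus abs_one order_refl zero_le_one)
        then show "y0 (vadd Q' w) = \<xi> (vadd Q w)" using ge[of w] by (simp add: sbox_def)
      qed
      also have "\<dots> = \<xi> u i" using SA.star_val[OF ok, of i] by (simp add: v(1))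
      finally show "\<xi> u i = y0 (vadd q' u) i" by simp
    qed
    then show ?thesis by blast
  qed
  then show ?thesis by (intro exI[of _ "2 ^ K0"]) simp
qed

end

section \<open>The subshift of finite type\<close>

lemma SFT_subshift: assumes "SFT A X" shows "subshift A X"
proof -
  from assms obtain F where F: "finite A" "\<forall>P\<in>F. is_pattern P" "X = {x \<in> full_shift A. \<forall>P\<in>F. \<not> appears_in P x}"
    unfolding SFT_def by blast
  have cl: "closed {x :: config. x p \<in> S}" for p S
  proof -
    have "closed ((\<lambda>x :: config. x p) -` S)"
      by (intro closed_vimage continuous_on_product_coordinates) (simp add: closed_def open_discrete)
    then show ?thesis by (simp add: vimage_def)
  qed
  have "X = (\<Inter>p. {x. x p \<in> A}) \<inter> (\<Inter>P\<in>F. \<Inter>v. \<Union>p\<in>dom P. {x. x (vadd p v) \<in> {k. P p \<noteq> Some k}})"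
    unfolding F(3) full_shift_def appears_in_def by auto
  moreover have "closed \<dots>"
    by (intro closed_Int closed_INT ballI closed_UN cl) (use F(2) in \<open>auto simp: is_pattern_def\<close>)
  ultimately have "closed X" by simp
  moreover have "shift v x \<in> X" if "x \<in> X" for v x
  proof -
    have "\<not> appears_in P (shift v x)" if "P \<in> F" for P
    proof
      assume "appears_in P (shift v x)"
      then obtain w where "\<forall>p\<in>dom P. P p = Some (x (vadd (vadd p w) v))" unfolding appears_in_def shift_def by blast
      then have "appears_in P x" unfolding appears_in_def vadd_assoc by blast
      then show False using \<open>x \<in> X\<close> \<open>P \<in> F\<close> F(3) by blast
    qed
    then show ?thesis using that unfolding F(3) by (auto simp: full_shift_def shift_def)
  qed
  ultimately show ?thesis unfolding subshift_def using F by auto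
qed

section \<open>Periodicity of the values of \<open>y0\<close>\<close>

lemma per_ge: "odo r \<Longrightarrow> 2 ^ K dvd n' - n \<Longrightarrow> k \<le> K \<Longrightarrow> ge r k n' \<longleftrightarrow> ge r k n"
proof -
  assume "2 ^ K dvd n' - n" "k \<le> K"
  then have "2 ^ k dvd n' - n" by (meson dvd_trans le_imp_power_dvd)
  then have "2 ^ k dvd (n' - n) + (n - r k) \<longleftrightarrow> 2 ^ k dvd n - r k" by (rule dvd_add_right_iff)
  then show ?thesis by (simp add: ge_def)
qed

lemma per_lv: assumes "2 ^ K dvd n' - n" "lv n < K" shows "lv n' = lv n"
proof -
  have "ex r0 (lv n) n'" using per_ge[OF odo_r0 assms(1), of "lv n"] per_ge[OF odo_r0 assms(1), of "Suc (lv n)"] assms(2)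
      ex_r0_iff[of "lv n" n] by (simp add: ex_def)
  then show ?thesis by (simp add: ex_r0_iff)
qed

lemma per_div_mod: assumes "2 ^ K dvd n' - n" "(2::int) ^ k * m dvd 2 ^ K"
  shows "(n' - c) div 2 ^ k mod m = (n - c) div 2 ^ k mod m"
  using div_mod_shift[OF dvd_trans[OF assms(2,1)], of "n - c"] by simp

lemma per_ph: "2 ^ K dvd n' - n \<Longrightarrow> k + 2 \<le> K \<Longrightarrow> ph r k n' = ph r k n"
  unfolding ph_def using le_imp_power_dvd[of "k + 2" K "2 :: int"] by (intro per_div_mod[of K]) (auto simp: mult.commute)

lemma per_bitr: "2 ^ K dvd n' - n \<Longrightarrow> k + 1 \<le> K \<Longrightarrow> bitr r k n' = bitr r k n"
  unfolding bitr_def using le_imp_power_dvd[of "k + 1" K "2 :: int"] by (intro per_div_mod[of K]) (auto simp: mult.commute)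

lemma per_cnt: assumes "2 ^ K dvd n' - n" "Suc J \<le> K" shows "cnt r J s n' = cnt r J s n"
proof -
  have "2 ^ Suc J dvd n' - n" using assms by (meson dvd_trans le_imp_power_dvd)
  then obtain q where "n' - n = 2 ^ Suc J * q" by (elim dvdE)
  then have "n' - r (Suc J) = (n - r (Suc J)) + 2 ^ Suc J * q" by simp
  then have "(n' - r (Suc J)) mod 2 ^ Suc J = (n - r (Suc J)) mod 2 ^ Suc J" by (simp only: mod_mult_self2)
  then show ?thesis by (simp add: cnt_def)
qed

context driver begin

lemma idx_le: "crow r s n \<le> NN s" "NN s * (crow r s n - 1) + (crow r' s n' - 1) < NN s * NN s"
proof -
  show le: "crow r s n \<le> NN s" for r n unfolding NN_def by (rule cnt_le[OF JJ_ge])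
  have "crow r s n - 1 \<le> NN s - 1" "crow r' s n' - 1 < NN s"
    using le[of r n] le[of r' n'] NN_pos[of s] by auto
  then have "NN s * (crow r s n - 1) + (crow r' s n' - 1) < NN s * (NN s - 1) + NN s"
    by (intro add_le_less_mono mult_le_mono2) auto
  also have "\<dots> = NN s * NN s" using NN_pos[of s] by (cases "NN s") auto
  finally show "NN s * (crow r s n - 1) + (crow r' s n' - 1) < NN s * NN s" .
qed

lemma toeplitz: "\<exists>K. \<forall>p'. (\<forall>a. 2 ^ K dvd co a p' - co a p) \<longrightarrow> y0 p' = y0 p"
proof -
  \<comment> \<open>The summand 3 leaves room for the digit pair at level \<open>s\<close>,
    \<open>JJ s\<close> for the period of the numbering, and \<open>NN s * NN s\<close> for the
    index of the digit shown by \<open>UU\<close>.\<close>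
  define Kx where "Kx a = (let s = lv (co a p) in s + 3 + JJ s + NN s * NN s)" for a
  define K where "K = Kx AX + Kx AY + Kx AZ"
  have Kx: "Kx a \<le> K" for a by (cases a) (simp_all add: K_def)
  have b: "lv (co a p) + 3 \<le> K" "Suc (JJ (lv (co a p))) \<le> K" "lv (co a p) + NN (lv (co a p)) * NN (lv (co a p)) \<le> K" for a
    using Kx[of a] by (auto simp: Kx_def Let_def)
  have "y0 p' = y0 p" if d: "\<forall>a. 2 ^ K dvd co a p' - co a p" for p'
  proof
    fix i
    have d: "2 ^ K dvd co a p' - co a p" for a using d by blast
    have lv: "lv (co a p') = lv (co a p)" for a using per_lv[OF d] b(1)[of a] by simp
    have ph: "ph r0 (lv (co b p)) (co a p') = ph r0 (lv (co b p)) (co a p)" for a b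
      using per_ph[OF d] b(1)[of b] by simp
    have cnt: "crow r0 (lv (co b p)) (co a p') = crow r0 (lv (co b p)) (co a p)" for a b
      using per_cnt[OF d b(2)] by simp
    have bit: "bitr r0 (lv (co AY p) + NN (lv (co AY p)) * (crow r0 (lv (co AY p)) (co AY p) - 1) + (crow r0 (lv (co AY p)) (co AX p) - 1)) (co AZ p')
       = bitr r0 (lv (co AY p) + NN (lv (co AY p)) * (crow r0 (lv (co AY p)) (co AY p) - 1) + (crow r0 (lv (co AY p)) (co AX p) - 1)) (co AZ p)"
      using b(3)[of AY] idx_le(2)[where s = "lv (co AY p)" and r = r0 and n = "co AY p" and r' = r0 and n' = "co AX p"]
      by (intro per_bitr[OF d]) linarith
    show "y0 p' i = y0 p i"
      by (cases i) (simp_all only: y0.simps lv ph cnt bit Let_def)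
  qed
  then show ?thesis by blast
qed

lemma toeplitz_set:
  assumes "finite S" shows "\<exists>K. \<forall>p\<in>S. \<forall>p'. (\<forall>a. 2 ^ K dvd co a p' - co a p) \<longrightarrow> y0 p' = y0 p"
  using assms
proof induction
  case (insert p S)
  then obtain K where K: "\<forall>p\<in>S. \<forall>p'. (\<forall>a. 2 ^ K dvd co a p' - co a p) \<longrightarrow> y0 p' = y0 p" by blast
  obtain L where L: "\<forall>p'. (\<forall>a. 2 ^ L dvd co a p' - co a p) \<longrightarrow> y0 p' = y0 p" using toeplitz by blast
  have m: "2 ^ K dvd d \<and> 2 ^ L dvd d" if "2 ^ (K + L) dvd d" for d :: int
    using that by (metis dvd_mult_left dvd_mult_right power_add)
  have "\<forall>q\<in>insert p S. \<forall>p'. (\<forall>a. 2 ^ (K + L) dvd co a p' - co a q) \<longrightarrow> y0 p' = y0 q"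
    using K L m by blast
  then show ?case by blast
qed simp

definition pat :: "nat \<Rightarrow> pos \<Rightarrow> pos \<Rightarrow> lay \<Rightarrow> int" where
  "pat n q = restrict (\<lambda>u. y0 (vadd q u)) (cube n)"

lemma near_shift: "near n \<xi> \<Longrightarrow> near n (\<lambda>p. \<xi> (vadd v p))"
  unfolding near_def vadd_assoc[symmetric] by blast

lemma near_y0: "near n y0" unfolding near_def by blast

lemma finite_bounded: assumes "finite (S :: pos set)" shows "\<exists>N\<ge>0. S \<subseteq> sbox N"
  using assms
proof induction
  case (insert p S)
  then obtain N where N: "0 \<le> N" "S \<subseteq> sbox N" by blast
  define L where "L = N + \<bar>co AX p\<bar> + \<bar>co AY p\<bar> + \<bar>co AZ p\<bar>"
  have "\<bar>co a p\<bar> \<le> L" for a using N(1) by (cases a) (simp_all add: L_def)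
  moreover have "N \<le> L" by (simp add: L_def)
  then have "sbox N \<subseteq> sbox L" by (auto simp: sbox_def intro: order_trans)
  ultimately have "insert p S \<subseteq> sbox L" using N(2) by (auto simp: sbox_def)
  moreover have "0 \<le> L" using N(1) by (simp add: L_def)
  ultimately show ?case by blast
qed auto

theorem driver_sft:
  "\<exists>A X. X \<noteq> {} \<and> subshift A X \<and> SFT A X \<and> minimal_subshift X \<and> (\<forall>n. N_count X n = card (range (pat n)))"
proof -
  obtain n where n: "1 \<le> n" and lim: "\<And>\<xi> N. near n \<xi> \<Longrightarrow> 0 \<le> N \<Longrightarrow> \<exists>q. \<forall>u\<in>sbox N. \<xi> u = y0 (vadd q u)"
    using near_limit by blast
  have zero: "(0, 0, 0) \<in> sbox n" using n by (simp add: sbox_pt)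
  obtain enc :: "(lay \<Rightarrow> int) \<Rightarrow> nat" where enc: "inj_on enc (range y0)"
    using finite_imp_inj_to_nat_seg[OF finite_y0] by blast
  define A where "A = enc ` range y0"
  define X where "X = (\<lambda>\<xi> p. enc (\<xi> p)) ` {\<xi>. near n \<xi>}"
  have finA: "finite A" using finite_y0 by (simp add: A_def)
  have rng: "\<xi> p \<in> range y0" if "near n \<xi>" for \<xi> p
  proof -
    obtain q where "\<forall>u\<in>sbox n. \<xi> (vadd p u) = y0 (vadd q u)" using \<open>near n \<xi>\<close> unfolding near_def by blast
    then show ?thesis using zero by (metis rangeI vadd_0)
  qed
  define F where "F = {Pt :: pattern. dom Pt = sbox n \<and> ran Pt \<subseteq> A \<and> \<not> (\<exists>q. \<forall>u\<in>sbox n. Pt u = Some (enc (y0 (vadd q u))))}"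
  have finF: "finite F"
    by (rule finite_subset[OF _ finite_set_of_finite_maps[OF finite_sbox finA]]) (auto simp: F_def)
  have XF: "X = {x \<in> full_shift A. \<forall>Pt\<in>F. \<not> appears_in Pt x}"
  proof (intro equalityI subsetI)
    fix x assume "x \<in> X"
    then obtain \<xi> where \<xi>: "near n \<xi>" "x = (\<lambda>p. enc (\<xi> p))" by (auto simp: X_def)
    have "x \<in> full_shift A" using rng[OF \<xi>(1)] by (auto simp: full_shift_def A_def \<xi>(2))
    moreover have "\<not> appears_in Pt x" if Pt: "Pt \<in> F" for Pt
    proof
      assume "appears_in Pt x"
      then obtain v where v: "\<forall>p\<in>sbox n. Pt p = Some (x (vadd p v))" using Pt by (auto simp: appears_in_def F_def)
      obtain q where "\<forall>u\<in>sbox n. \<xi> (vadd v u) = y0 (vadd q u)" using \<xi>(1) unfolding near_def by blast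
      then have "\<forall>p\<in>sbox n. Pt p = Some (enc (y0 (vadd q p)))" using v \<xi>(2) vadd_commute by simp
      then show False using Pt by (auto simp: F_def)
    qed
    ultimately show "x \<in> {x \<in> full_shift A. \<forall>Pt\<in>F. \<not> appears_in Pt x}" by blast
  next
    fix x assume "x \<in> {x \<in> full_shift A. \<forall>Pt\<in>F. \<not> appears_in Pt x}"
    then have xA: "\<And>p. x p \<in> A" and xF: "\<And>Pt. Pt \<in> F \<Longrightarrow> \<not> appears_in Pt x" by (auto simp: full_shift_def)
    define \<xi> where "\<xi> p = inv_into (range y0) enc (x p)" for p
    have e: "enc (\<xi> p) = x p" for p unfolding \<xi>_def using xA[of p] by (simp add: A_def f_inv_into_f)
    have "near n \<xi>" unfolding near_def
    proof
      fix p
      define Pt where "Pt = (\<lambda>u. if u \<in> sbox n then Some (x (vadd u p)) else None)"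
      have d: "dom Pt = sbox n" by (auto simp: Pt_def split: if_splits)
      have "ran Pt \<subseteq> A"
      proof
        fix y assume "y \<in> ran Pt"
        then obtain u where u: "Pt u = Some y" unfolding ran_def by blast
        show "y \<in> A" using u xA[of "vadd u p"] by (simp add: Pt_def split: if_splits)
      qed
      moreover have "appears_in Pt x" unfolding appears_in_def d by (intro exI[of _ p]) (simp add: Pt_def)
      ultimately obtain q where q: "\<forall>u\<in>sbox n. Pt u = Some (enc (y0 (vadd q u)))" using xF[of Pt] d unfolding F_def by blast
      have "\<xi> (vadd p u) = y0 (vadd q u)" if "u \<in> sbox n" for u
      proof -
        have "x (vadd u p) = enc (y0 (vadd q u))" using q that by (simp add: Pt_def)
        then have "x (vadd p u) = enc (y0 (vadd q u))" unfolding vadd_commute[of u p] .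
        then show ?thesis unfolding \<xi>_def using enc by simp
      qed
      then show "\<exists>q. \<forall>u\<in>sbox n. \<xi> (vadd p u) = y0 (vadd q u)" by blast
    qed
    moreover have "x = (\<lambda>p. enc (\<xi> p))" using e by simp
    ultimately show "x \<in> X" unfolding X_def by blast
  qed
  have sft: "SFT A X" unfolding SFT_def
  proof (intro conjI exI)
    show "\<forall>Pt\<in>F. is_pattern Pt" using finite_sbox by (auto simp: F_def is_pattern_def)
  qed (use finA finF XF in auto)
  have occ: "\<exists>q. \<forall>u\<in>sbox N. \<xi> (vadd v u) = y0 (vadd q u)" if "near n \<xi>" "0 \<le> N" for \<xi> v N
    using lim[OF near_shift[OF that(1), of v] that(2)] .
  have "minimal_subshift X" unfolding minimal_subshift_def
  proof (intro allI impI ballI)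
    fix Pt y assume Pt: "is_pattern Pt" "\<exists>x\<in>X. appears_in Pt x" and y: "y \<in> X"
    have fin: "finite (dom Pt)" using Pt(1) by (simp add: is_pattern_def)
    obtain N where N: "0 \<le> N" "dom Pt \<subseteq> sbox N" using finite_bounded[OF fin] by blast
    obtain \<xi> v where \<xi>: "near n \<xi>" "\<forall>p\<in>dom Pt. Pt p = Some (enc (\<xi> (vadd p v)))"
      using Pt(2) unfolding X_def appears_in_def by auto
    obtain q where q: "\<forall>u\<in>sbox N. \<xi> (vadd v u) = y0 (vadd q u)" using occ[OF \<xi>(1) N(1)] by blast
    have Pq: "Pt p = Some (enc (y0 (vadd q p)))" if "p \<in> dom Pt" for p
      using \<xi>(2) q N(2) that vadd_commute by auto
    obtain K where K: "\<forall>p\<in>vadd q ` dom Pt. \<forall>p'. (\<forall>a. 2 ^ K dvd co a p' - co a p) \<longrightarrow> y0 p' = y0 p"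
      using toeplitz_set[of "vadd q ` dom Pt"] fin by blast
    obtain \<eta> where \<eta>: "near n \<eta>" "y = (\<lambda>p. enc (\<eta> p))" using y by (auto simp: X_def)
    \<comment> \<open>The pattern recurs in \<open>y0\<close> with period \<open>2 ^ K\<close> along
      each axis. A box enlarged by \<open>2 ^ K\<close> therefore contains a copy, displaced by the
      residue \<open>w\<close> defined next.\<close>
    obtain q' where q': "\<forall>u\<in>sbox (N + 2 ^ K). \<eta> u = y0 (vadd q' u)" using lim[OF \<eta>(1), of "N + 2 ^ K"] N(1) by auto
    define w where "w = ((co AX q - co AX q') mod 2 ^ K, (co AY q - co AY q') mod 2 ^ K, (co AZ q - co AZ q') mod 2 ^ K)"
    have wc: "co a w = (co a q - co a q') mod 2 ^ K" for a by (cases a) (simp_all add: w_def)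
    have "Pt p = Some (y (vadd p w))" if p: "p \<in> dom Pt" for p
    proof -
      have "\<bar>co a w\<bar> \<le> 2 ^ K" for a unfolding wc using pos_mod_bound[of "2 ^ K" "co a q - co a q'"] by (simp add: less_imp_le)
      moreover have "\<bar>co a p\<bar> \<le> N" for a using p N(2) by (auto simp: sbox_def)
      ultimately have "\<bar>co a p + co a w\<bar> \<le> N + 2 ^ K" for a
        by (meson abs_triangle_ineq add_mono order_trans)
      then have "\<eta> (vadd p w) = y0 (vadd q' (vadd p w))" using q' by (simp add: sbox_def)
      also have "\<dots> = y0 (vadd q p)"
      proof -
        have "2 ^ K dvd co a (vadd q' (vadd p w)) - co a (vadd q p)" for a
        proof -
          have "co a (vadd q' (vadd p w)) - co a (vadd q p) = - ((co a q - co a q') - (co a q - co a q') mod 2 ^ K)"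
            by (simp add: wc)
          then show ?thesis by (metis dvd_minus_iff dvd_minus_mod)
        qed
        then show ?thesis using K p by blast
      qed
      finally show ?thesis using Pq[OF p] \<eta>(2) by simp
    qed
    then show "appears_in Pt y" unfolding appears_in_def by blast
  qed
  moreover have "N_count X m = card (range (pat m))" for m
  proof -
    define e where "e f = restrict (\<lambda>u. enc (f u)) (cube m)" for f :: "pos \<Rightarrow> lay \<Rightarrow> int"
    have fc: "finite (cube m)" by (simp add: cube_def)
    obtain N where N: "0 \<le> N" "cube m \<subseteq> sbox N" using finite_bounded[OF fc] by blast
    have "(\<lambda>x. restrict x (cube m)) ` X = e ` range (pat m)"
    proof (intro equalityI subsetI)
      fix f assume "f \<in> (\<lambda>x. restrict x (cube m)) ` X"
      then obtain \<xi> where \<xi>: "near n \<xi>" "f = restrict (\<lambda>p. enc (\<xi> p)) (cube m)" by (auto simp: X_def)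
      obtain q where q: "\<forall>u\<in>sbox N. \<xi> u = y0 (vadd q u)" using lim[OF \<xi>(1) N(1)] by blast
      have "f = e (pat m q)" unfolding \<xi>(2) e_def pat_def using q N(2) by (intro restrict_ext) auto
      then show "f \<in> e ` range (pat m)" by blast
    next
      fix f assume "f \<in> e ` range (pat m)"
      then obtain q where q: "f = e (pat m q)" by blast
      have "(\<lambda>p. enc (y0 (vadd q p))) \<in> X" unfolding X_def
        by (rule image_eqI[where x = "\<lambda>p. y0 (vadd q p)"]) (use near_shift[OF near_y0, of n q] in simp_all)
      moreover have "f = restrict (\<lambda>p. enc (y0 (vadd q p))) (cube m)" unfolding q e_def pat_def by (intro restrict_ext) simp
      ultimately show "f \<in> (\<lambda>x. restrict x (cube m)) ` X" by blast
    qed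
    moreover have "inj_on e (range (pat m))"
    proof (rule inj_onI)
      fix f g assume "f \<in> range (pat m)" "g \<in> range (pat m)" and eq: "e f = e g"
      then obtain q q' where f: "f = pat m q" and g: "g = pat m q'" by blast
      have "y0 (vadd q u) = y0 (vadd q' u)" if u: "u \<in> cube m" for u
      proof -
        have "enc (y0 (vadd q u)) = enc (y0 (vadd q' u))" using fun_cong[OF eq, of u] u by (simp add: e_def f g pat_def)
        then show ?thesis using enc by (auto dest: inj_onD)
      qed
      then show "f = g" unfolding f g pat_def by (intro restrict_ext) simp
    qed
    ultimately show ?thesis unfolding N_count_def by (simp add: card_image)
  qed
  moreover have "X \<noteq> {}" using near_y0 by (auto simp: X_def)
  ultimately show ?thesis using sft SFT_subshift[OF sft] by blast
qed

end

section \<open>The lower bound on the number of patterns\<close>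

text \<open>Adding \<open>2 ^ B\<close> flips digit \<open>B\<close> and leaves the lower digits
  alone, so the digits can be set one after another.\<close>

lemma bits_exist: "\<exists>z. \<forall>i<B. bitr r0 i z = of_bool (w i)"
proof (induction B)
  case (Suc B)
  then obtain z where z: "\<And>i. i < B \<Longrightarrow> bitr r0 i z = of_bool (w i)" by blast
  have z2: "bitr r0 i (z + 2 ^ B) = of_bool (w i)" if "i < B" for i
    using z[OF that] per_bitr[of B "z + 2 ^ B" z i r0] that by simp
  have fl: "bitr r0 B (z + 2 ^ B) = (bitr r0 B z + 1) mod 2"
  proof -
    have ne: "(2::int) ^ B \<noteq> 0" by simp
    have "(z + 2 ^ B - r0 (Suc B)) div 2 ^ B = (z - r0 (Suc B) + 2 ^ B * 1) div 2 ^ B" by (simp add: algebra_simps)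
    also have "\<dots> = 1 + (z - r0 (Suc B)) div 2 ^ B" by (rule div_mult_self2[OF ne])
    finally show ?thesis unfolding bitr_def by (simp add: mod_simps add.commute)
  qed
  have r: "bitr r0 B z = 0 \<or> bitr r0 B z = 1" unfolding bitr_def by presburger
  show ?case
  proof (cases "bitr r0 B z = of_bool (w B)")
    case True
    then have "\<forall>i<Suc B. bitr r0 i z = of_bool (w i)" using z by (auto simp: less_Suc_eq)
    then show ?thesis by blast
  next
    case False
    then have "bitr r0 B (z + 2 ^ B) = of_bool (w B)" using fl r by (cases "w B") auto
    then have "\<forall>i<Suc B. bitr r0 i (z + 2 ^ B) = of_bool (w i)" using z2 by (auto simp: less_Suc_eq)
    then show ?thesis by blast
  qed
qed simp

context driver begin

lemma finite_pat: "finite (range (pat n))"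
proof (rule finite_subset)
  show "range (pat n) \<subseteq> PiE (cube n) (\<lambda>_. range y0)" by (auto simp: pat_def)
  show "finite (PiE (cube n) (\<lambda>_. range y0))" using finite_y0 by (intro finite_PiE) (auto simp: cube_def)
qed

lemma pat_mono: assumes "n \<le> n'" shows "card (range (pat n)) \<le> card (range (pat n'))"
proof -
  have "cube n \<subseteq> cube n'" using assms by (auto simp: cube_def)
  then have "pat n q = restrict (pat n' q) (cube n)" for q
    unfolding pat_def by (auto simp: restrict_def fun_eq_iff)
  then have "range (pat n) = (\<lambda>f. restrict f (cube n)) ` range (pat n')" by auto
  then show ?thesis by (metis card_image_le finite_pat)
qed

lemma digit_pos:
  assumes g: "ge r0 (Suc (JJ s)) xb" and a: "a < 2 ^ (JJ s - s)"
  shows "lv (xb + 2 ^ s * (2 * int a + 1)) = s" "crow r0 s (xb + 2 ^ s * (2 * int a + 1)) = Suc a"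
proof -
  let ?d = "2 ^ s * (2 * int a + 1)"
  have sJ: "s \<le> JJ s" by (rule JJ_ge)
  have e: "?d + 2 ^ s = 2 ^ Suc s * (int a + 1)" by (simp add: algebra_simps)
  have "ex z0 s ?d"
  proof -
    have "\<not> 2 ^ Suc s dvd ?d"
    proof
      assume "2 ^ Suc s dvd ?d"
      then have "(2::int) dvd 2 * int a + 1" by (simp add: mult.commute[of 2])
      then show False by presburger
    qed
    then show ?thesis by (simp add: ex_def ge_def)
  qed
  then have "ex r0 s (xb + ?d)" using ex_rel0[OF odo_r0 g, of s ?d] sJ by simp
  then show "lv (xb + ?d) = s" by (simp add: ex_r0_iff)
  have "int a + 1 \<le> 2 ^ (JJ s - s)" using a by (metis Suc_leI add.commute int_ops(4) of_nat_Suc of_nat_le_iff of_nat_numeral of_nat_power)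
  then have "?d + 2 ^ s \<le> 2 ^ Suc s * 2 ^ (JJ s - s)" unfolding e by simp
  also have "\<dots> = 2 ^ Suc (JJ s)" using sJ by (simp flip: power_add)
  finally have lt: "?d < 2 ^ Suc (JJ s)" by (smt (verit) zero_less_power)
  have "cnt z0 (JJ s) s ?d = nat ((?d + 2 ^ s) div 2 ^ Suc s)" unfolding cnt_def using lt by simp
  also have "\<dots> = Suc a" unfolding e by simp
  finally show "crow r0 s (xb + ?d) = Suc a" using cnt_rel[OF odo_r0 g, of "JJ s" s ?d] by simp
qed

text \<open>\<open>P 1 k\<close> is the lowest level \<open>s\<close> with
  \<open>k \<le> JJ s\<close>. A window of length \<open>2 ^ k\<close> sees
  \<open>2 ^ (k - s - 1)\<close> of its coordinates, and all these rows and columns lie in one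
  array, whose digits the vertical coordinate can realise at will.\<close>

theorem pat_lower:
  assumes "P 1 k < k" shows "2 ^ (4 ^ (k - P 1 k - 1)) \<le> card (range (pat (2 ^ k)))"
proof -
  define s where "s = P 1 k"
  define D where "D = (2::nat) ^ (k - s - 1)"
  have kJ: "k \<le> JJ s" using JJ_iff[of s k] by (simp add: s_def)
  have sk: "s < k" using assms by (simp add: s_def)
  have DN: "D \<le> NN s" unfolding D_def NN_def using kJ by (intro power_increasing) auto
  obtain xb where xb: "ge r0 (Suc (JJ s)) xb" using ge_exists by blast
  define B where "B = s + NN s * NN s"
  \<comment> \<open>The digit with index \<open>i\<close> stands in column
    \<open>(i - s) mod NN s\<close> and row \<open>(i - s) div NN s\<close>; digits outside the
    visible square are set to 0.\<close>
  define w where "w S i = ((i - s) mod NN s < D \<and> ((i - s) mod NN s, (i - s) div NN s) \<in> S)" for S :: "(nat \<times> nat) set" and i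
  have "\<forall>S. \<exists>z. \<forall>i<B. bitr r0 i z = of_bool (w S i)" using bits_exist by blast
  from choice[OF this] obtain z where z: "\<And>S i. i < B \<Longrightarrow> bitr r0 i (z S) = of_bool (w S i)" by blast
  define S0 where "S0 = {..<D} \<times> {..<D}"
  \<comment> \<open>The vertical corner lies one below \<open>z S\<close> because the cube starts at
    coordinate 1.\<close>
  define f where "f S = pat (2 ^ k) (xb, xb, z S - 1)" for S
  have val: "y0 (xb + 2 ^ s * (2 * int a + 1), xb + 2 ^ s * (2 * int b + 1), z S) UU = of_bool ((a, b) \<in> S)"
    if ab: "a < D" "b < D" and S: "S \<subseteq> S0" for a b S
  proof -
    have l: "a < 2 ^ (JJ s - s)" "b < 2 ^ (JJ s - s)" using ab DN by (auto simp: NN_def)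
    have "NN s * b + a < NN s * NN s"
    proof -
      have "NN s * b + a < NN s * b + NN s" using ab DN by simp
      also have "\<dots> = NN s * Suc b" by simp
      also have "\<dots> \<le> NN s * NN s" using ab DN by (intro mult_le_mono2) simp
      finally show ?thesis .
    qed
    then have "bitr r0 (s + NN s * b + a) (z S) = of_bool (w S (s + NN s * b + a))" by (intro z) (simp add: B_def)
    moreover have "w S (s + NN s * b + a) \<longleftrightarrow> (a, b) \<in> S" using ab DN by (simp add: w_def)
    ultimately show ?thesis using digit_pos[OF xb l(1)] digit_pos[OF xb l(2)] by (simp add: Let_def)
  qed
  have cb: "(2 ^ s * (2 * int a + 1), 2 ^ s * (2 * int b + 1), 1) \<in> cube (2 ^ k)" if ab: "a < D" "b < D" for a b
  proof -
    have "1 \<le> 2 ^ s * (2 * int a + 1) \<and> 2 ^ s * (2 * int a + 1) \<le> 2 ^ k" if "a < D" for a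
    proof -
      have "2 * int a + 1 \<le> 2 * int D" using that by simp
      then have "2 ^ s * (2 * int a + 1) \<le> 2 ^ s * (2 * int D)" by (intro mult_left_mono) auto
      also have "\<dots> = 2 ^ (s + Suc (k - s - 1))" by (simp add: D_def power_add)
      also have "s + Suc (k - s - 1) = k" using sk by simp
      finally have "2 ^ s * (2 * int a + 1) \<le> 2 ^ k" by simp
      moreover have "0 < 2 ^ s * (2 * int a + 1)" by (intro mult_pos_pos) auto
      ultimately show ?thesis by linarith
    qed
    then show ?thesis using ab by (simp add: cube_def)
  qed
  have "inj_on f (Pow S0)"
  proof (rule inj_onI)
    fix S T assume S: "S \<in> Pow S0" and T: "T \<in> Pow S0" and eq: "f S = f T"
    have "(a, b) \<in> S \<longleftrightarrow> (a, b) \<in> T" if ab: "a < D" "b < D" for a b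
    proof -
      let ?u = "(2 ^ s * (2 * int a + 1), 2 ^ s * (2 * int b + 1), 1)"
      have "y0 (vadd (xb, xb, z S - 1) ?u) UU = y0 (vadd (xb, xb, z T - 1) ?u) UU"
        using fun_cong[OF eq, of ?u] cb[OF ab] by (simp add: f_def pat_def)
      then show ?thesis using val[OF ab, of S] val[OF ab, of T] S T by (simp add: vadd_def of_bool_def del: y0.simps split: if_splits)
    qed
    then show "S = T" using S T unfolding S0_def by (intro set_eqI) auto
  qed
  then have "card (Pow S0) \<le> card (range (pat (2 ^ k)))"
    by (rule card_inj_on_le) (auto simp: f_def finite_pat)
  moreover have "card (Pow S0) = 2 ^ (4 ^ (k - s - 1))"
  proof -
    have "D * D = 4 ^ (k - s - 1)" by (simp add: D_def flip: power_mult_distrib)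
    then show ?thesis by (simp add: card_Pow S0_def card_cartesian_product)
  qed
  ultimately show ?thesis by (simp add: s_def)
qed

end

section \<open>The upper bound on the number of patterns\<close>

lemma card_range_le:
  assumes "finite (range h)" and "\<And>x y. h x = h y \<Longrightarrow> f x = f y"
  shows "card (range f) \<le> card (range h)"
proof -
  have "f x = f (inv h (h x))" for x by (rule assms(2)) (simp add: f_inv_into_f)
  then have "range f \<subseteq> (\<lambda>k. f (inv h k)) ` range h" by blast
  then show ?thesis using assms(1) by (meson card_image_le card_mono finite_imageI order_trans)
qed

lemma run_eq:
  fixes f :: "int \<Rightarrow> 'a"
  assumes "a \<le> b" and "\<And>m. a < m \<Longrightarrow> m \<le> b \<Longrightarrow> f m = f (m - 1)" shows "f b = f a"
  using assms
proof (induction b rule: int_ge_induct)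
  case (step i)
  have "f i = f a" using step by simp
  then show ?case using step(3)[of "i + 1"] step(1) by simp
qed simp

lemma ph_run:
  assumes o: "odo r" and "a \<le> b" and "\<And>m. a < m \<Longrightarrow> m \<le> b \<Longrightarrow> \<not> ge r L (c + m)"
  shows "ph r L (c + b) = ph r L (c + a)"
proof (rule run_eq[of a b "\<lambda>m. ph r L (c + m)"])
  fix m assume "a < m" "m \<le> b"
  then have "ph r L (c + m) = ph r L (c + m - 1) mod 4" using ph_step[OF o, of L "c + m"] assms(3) by simp
  then show "ph r L (c + m) = ph r L (c + (m - 1))" using ph_range[of r L "c + m - 1"] by (simp add: add_diff_eq)
qed fact

lemma cnt_run:
  assumes o: "odo r" and sJ: "s \<le> J" and "a \<le> b" and "\<And>m. a < m \<Longrightarrow> m \<le> b \<Longrightarrow> \<not> ge r s (c + m)"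
  shows "cnt r J s (c + b) = cnt r J s (c + a)"
proof (rule run_eq[of a b "\<lambda>m. cnt r J s (c + m)"])
  fix m assume "a < m" "m \<le> b"
  then have n: "\<not> ge r s (c + m)" by (rule assms(4))
  then have "\<not> ge r (Suc J) (c + m)" using ge_mono[OF o, of "Suc J" "c + m" s] sJ by auto
  from cnt_step[OF o sJ this] show "cnt r J s (c + m) = cnt r J s (c + (m - 1))" using n by (simp add: ex_def add_diff_eq)
qed fact

context driver begin

text \<open>A box pattern is determined by the coordinates of its corner modulo suitable powers of 2 and by the letters on the skeleton, which in each axis keeps
  0, the positions of level above the threshold, and the first position of each lower level.\<close>

definition thr :: "nat \<Rightarrow> nat \<Rightarrow> ax \<Rightarrow> nat" where
  "thr K t a = (if a = AZ then K - 1 else t)"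

definition skl :: "nat \<Rightarrow> nat \<Rightarrow> int \<Rightarrow> pos \<Rightarrow> ax \<Rightarrow> int set" where
  "skl K t n q a = {m. 0 \<le> m \<and> m \<le> n \<and> (m = 0 \<or> thr K t a \<le> lv (co a q + m) \<or>
     (\<forall>m'. 0 \<le> m' \<and> m' < m \<longrightarrow> lv (co a q + m') \<noteq> lv (co a q + m)))}"

definition skel :: "nat \<Rightarrow> nat \<Rightarrow> int \<Rightarrow> pos \<Rightarrow> pos set" where
  "skel K t n q = {u. \<forall>a. co a u \<in> skl K t n q a}"

lemma skel_prod: "skel K t n q = skl K t n q AX \<times> skl K t n q AY \<times> skl K t n q AZ"
  by (auto simp: skel_def all_ax)

text \<open>Positions of level at or above the threshold differ by multiples of
  \<open>2 ^ thr K t a\<close>; each lower level contributes at most its first position, and 0 is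
  added.\<close>

lemma card_skl:
  assumes "0 \<le> n" shows "finite (skl K t n q a)" "card (skl K t n q a) \<le> nat (n div 2 ^ thr K t a) + 2 + thr K t a"
proof -
  let ?h = "thr K t a"
  let ?c = "co a q"
  define A where "A = {m. 0 \<le> m \<and> m \<le> n \<and> ?h \<le> lv (?c + m)}"
  define C where "C = {m. 0 \<le> m \<and> m \<le> n \<and> lv (?c + m) < ?h \<and> (\<forall>m'. 0 \<le> m' \<and> m' < m \<longrightarrow> lv (?c + m') \<noteq> lv (?c + m))}"
  have sub: "skl K t n q a \<subseteq> {0} \<union> A \<union> C" by (auto simp: skl_def A_def C_def not_le)
  have fA: "finite A" by (rule finite_subset[of _ "{0..n}"]) (auto simp: A_def)
  have fC: "finite C" by (rule finite_subset[of _ "{0..n}"]) (auto simp: C_def)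
  have "inj_on (\<lambda>m. m div 2 ^ ?h) A"
  proof (rule inj_onI)
    fix m m' assume m: "m \<in> A" "m' \<in> A" and e: "m div 2 ^ ?h = m' div 2 ^ ?h"
    have "2 ^ ?h dvd ?c + m - r0 ?h" "2 ^ ?h dvd ?c + m' - r0 ?h" using m ge_r0_iff[of ?h] by (auto simp: A_def ge_def)
    then have "2 ^ ?h dvd (?c + m - r0 ?h) - (?c + m' - r0 ?h)" by (rule dvd_diff)
    then have "m mod 2 ^ ?h = m' mod 2 ^ ?h" by (simp add: mod_eq_dvd_iff)
    then show "m = m'" using e by (metis div_mult_mod_eq)
  qed
  moreover have "(\<lambda>m. m div 2 ^ ?h) ` A \<subseteq> {0..n div 2 ^ ?h}" by (auto simp: A_def pos_imp_zdiv_nonneg_iff zdiv_mono1)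
  ultimately have "card A \<le> card {0..n div 2 ^ ?h}" by (intro card_inj_on_le) auto
  then have cA: "card A \<le> nat (n div 2 ^ ?h) + 1" using assms by (simp add: nat_add_distrib pos_imp_zdiv_nonneg_iff)
  have "inj_on (\<lambda>m. lv (?c + m)) C"
  proof (rule inj_onI)
    fix m m' assume "m \<in> C" "m' \<in> C" "lv (?c + m) = lv (?c + m')"
    then show "m = m'" unfolding C_def by (metis (mono_tags, lifting) linorder_neqE_linordered_idom mem_Collect_eq)
  qed
  moreover have "(\<lambda>m. lv (?c + m)) ` C \<subseteq> {..<?h}" by (auto simp: C_def)
  ultimately have cC: "card C \<le> ?h" using card_inj_on_le[of "\<lambda>m. lv (?c + m)" C "{..<?h}"] by simp
  have f: "finite ({0} \<union> A \<union> C)" using fA fC by simp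
  show "finite (skl K t n q a)" using sub f by (rule finite_subset)
  have "card (skl K t n q a) \<le> card ({0} \<union> A \<union> C)" using f sub by (rule card_mono)
  also have "\<dots> \<le> card {0::int} + card A + card C" by (meson add_le_mono1 card_Un_le order_trans)
  finally show "card (skl K t n q a) \<le> nat (n div 2 ^ ?h) + 2 + ?h" using cA cC by simp
qed

end

text \<open>Arrays of levels below \<open>t\<close> have periods dividing \<open>2 ^ K\<close> and
  digits below \<open>B\<close>, so the residues of the corner decide them. Coordinates of level
  \<open>t\<close> or more are rare and belong to the skeleton.\<close>

locale twin = driver +
  fixes K t B :: nat and n :: int and q q' :: pos
  assumes K: "2 \<le> K" and n0: "0 \<le> n" and t: "t \<le> K - 1" "t \<le> P 1 K"
    and B: "K \<le> B" "\<And>s. s < t \<Longrightarrow> s + NN s * NN s \<le> B"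
    and per: "\<And>a. 2 ^ K dvd co a q' - co a q" and perZ: "2 ^ B dvd co AZ q' - co AZ q"
begin

lemma p_ge: "k \<le> K \<Longrightarrow> ge r0 k (co a q' + m) \<longleftrightarrow> ge r0 k (co a q + m)"
  using per_ge[OF odo_r0, of K "co a q' + m" "co a q + m" k] per[of a] by simp

lemma p_geZ: "k \<le> B \<Longrightarrow> k \<le> lv (co AZ q' + m) \<longleftrightarrow> k \<le> lv (co AZ q + m)"
  using per_ge[OF odo_r0, of B "co AZ q' + m" "co AZ q + m" k] perZ by (simp add: ge_r0_iff)

lemma p_lv: "lv (co a q + m) < K \<Longrightarrow> lv (co a q' + m) = lv (co a q + m)"
  using per_lv[of K "co a q' + m" "co a q + m"] per[of a] by simp

lemma p_le: "k \<le> K \<Longrightarrow> k \<le> lv (co a q' + m) \<longleftrightarrow> k \<le> lv (co a q + m)"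
  using p_ge by (simp add: ge_r0_iff)

lemma thr_le: "thr K t a \<le> K - 1" "a \<noteq> AZ \<Longrightarrow> thr K t a = t"
  using t by (auto simp: thr_def)

lemma skl_eq: "skl K t n q' a = skl K t n q a"
proof -
  have th: "thr K t a \<le> K" using thr_le(1)[of a] by simp
  have "thr K t a \<le> lv (co a q' + m) \<or> (\<forall>m'. 0 \<le> m' \<and> m' < m \<longrightarrow> lv (co a q' + m') \<noteq> lv (co a q' + m)) \<longleftrightarrow>
    thr K t a \<le> lv (co a q + m) \<or> (\<forall>m'. 0 \<le> m' \<and> m' < m \<longrightarrow> lv (co a q + m') \<noteq> lv (co a q + m))" for m
  proof (cases "thr K t a \<le> lv (co a q + m)")
    case True then show ?thesis using p_le[OF th] by simp
  next
    case False
    then have l: "lv (co a q + m) < K" using th by simp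
    have "lv (co a q' + m') = lv (co a q + m) \<longleftrightarrow> lv (co a q + m') = lv (co a q + m)" for m'
      using p_lv[of a m'] p_le[of K a m'] l by (metis linorder_not_le order.refl)
    then show ?thesis using False p_le[OF th] unfolding p_lv[OF l] by blast
  qed
  then show ?thesis unfolding skl_def by blast
qed

lemma rep_ex: assumes "0 \<le> m" "m \<le> n"
  shows "\<exists>m'. m' \<in> skl K t n q a \<and> lv (co a q + m') = lv (co a q + m) \<and> lv (co a q' + m') = lv (co a q' + m)"
proof (cases "thr K t a \<le> lv (co a q + m)")
  case True
  then show ?thesis using assms by (intro exI[of _ m]) (simp add: skl_def)
next
  case False
  define L where "L = lv (co a q + m)"
  define j where "j = (LEAST j. lv (co a q + int j) = L)"
  have ex: "lv (co a q + int (nat m)) = L" using assms by (simp add: L_def)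
  have j: "lv (co a q + int j) = L" unfolding j_def using ex by (rule LeastI)
  have jm: "j \<le> nat m" unfolding j_def using ex by (rule Least_le)
  have "lv (co a q + m') \<noteq> L" if "0 \<le> m'" "m' < int j" for m'
  proof
    assume "lv (co a q + m') = L"
    then have "lv (co a q + int (nat m')) = L" using that by simp
    then have "j \<le> nat m'" unfolding j_def by (rule Least_le)
    then show False using that by simp
  qed
  then have s: "int j \<in> skl K t n q a" using j jm assms by (simp add: skl_def)
  have "L < K" using False thr_le(1)[of a] K by (simp add: L_def)
  then have "lv (co a q' + int j) = lv (co a q' + m)" using p_lv[of a "int j"] p_lv[of a m] j by (simp add: L_def)
  then show ?thesis using s j by (intro exI[of _ "int j"]) (simp add: L_def)
qed

lemma lst_ex: assumes "0 \<le> m" "m \<le> n"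
  shows "\<exists>m'. m' \<in> skl K t n q a \<and> m' \<le> m \<and> (\<forall>i. m' < i \<and> i \<le> m \<longrightarrow> lv (co a q + i) < thr K t a \<and> lv (co a q' + i) < thr K t a)"
  using assms
proof (induction m rule: int_ge_induct)
  case base
  then show ?case by (intro exI[of _ 0]) (simp add: skl_def)
next
  case (step m)
  show ?case
  proof (cases "thr K t a \<le> lv (co a q + (m + 1))")
    case True
    then show ?thesis using step by (intro exI[of _ "m + 1"]) (simp add: skl_def)
  next
    case False
    then have 1: "lv (co a q + (m + 1)) < thr K t a" by simp
    then have 2: "lv (co a q' + (m + 1)) < thr K t a" using p_lv[of a "m + 1"] thr_le(1)[of a] K by simp
    obtain m' where m': "m' \<in> skl K t n q a" "m' \<le> m"
      "\<forall>i. m' < i \<and> i \<le> m \<longrightarrow> lv (co a q + i) < thr K t a \<and> lv (co a q' + i) < thr K t a" using step by auto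
    have "lv (co a q + i) < thr K t a \<and> lv (co a q' + i) < thr K t a" if "m' < i" "i \<le> m + 1" for i
      using m'(3) 1 2 that by (cases "i = m + 1") auto
    then show ?thesis using m' by (intro exI[of _ m']) auto
  qed
qed

lemma self_in: "0 \<le> m \<Longrightarrow> m \<le> n \<Longrightarrow> thr K t a \<le> lv (co a q + m) \<Longrightarrow> m \<in> skl K t n q a"
  by (simp add: skl_def)

lemma zero_in: "0 \<in> skl K t n q a" using n0 by (simp add: skl_def)

end

locale twin_eq = twin +
  assumes eq: "\<And>u. u \<in> skel K t n q \<Longrightarrow> y0 (vadd q u) = y0 (vadd q' u)"
begin

abbreviation inb :: "pos \<Rightarrow> bool" where "inb u \<equiv> \<forall>a. 0 \<le> co a u \<and> co a u \<le> n"

lemma eq3: "x \<in> skl K t n q AX \<Longrightarrow> y \<in> skl K t n q AY \<Longrightarrow> z \<in> skl K t n q AZ \<Longrightarrow>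
  y0 (vadd q (x, y, z)) = y0 (vadd q' (x, y, z))"
  by (rule eq) (simp add: skel_prod)

lemma lev_only:
  assumes "inb u" and "\<And>p p'. (\<And>a. lv (co a p) = lv (co a p')) \<Longrightarrow> y0 p i = y0 p' i"
  shows "y0 (vadd q u) i = y0 (vadd q' u) i"
proof -
  have "\<forall>a. \<exists>m'. m' \<in> skl K t n q a \<and> lv (co a q + m') = lv (co a q + co a u) \<and> lv (co a q' + m') = lv (co a q' + co a u)"
    using rep_ex assms(1) by blast
  from choice[OF this] obtain f where f: "\<And>a. f a \<in> skl K t n q a" "\<And>a. lv (co a q + f a) = lv (co a q + co a u)"
    "\<And>a. lv (co a q' + f a) = lv (co a q' + co a u)" by blast
  let ?v = "(f AX, f AY, f AZ)"
  have c: "co a ?v = f a" for a by (cases a) simp_all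
  have "y0 (vadd q u) i = y0 (vadd q ?v) i" by (rule assms(2)) (simp only: co_vadd c f)
  also have "\<dots> = y0 (vadd q' ?v) i" using eq3 f(1) by simp
  also have "\<dots> = y0 (vadd q' u) i" by (rule assms(2)) (simp only: co_vadd c f)
  finally show ?thesis .
qed

text \<open>For a low level of \<open>b\<close> the pair is decided by the residue modulo
  \<open>2 ^ K\<close>. For a high one, it changes only at positions of \<open>a\<close> of at least
  that level; these belong to the skeleton, so the pair can be read at an earlier skeleton
  position.\<close>

lemma e_PH: assumes u: "inb u" and ab: "a \<noteq> b" shows "y0 (vadd q u) (PH a b) = y0 (vadd q' u) (PH a b)"
proof (cases "lv (co b q + co b u) + 2 \<le> K")
  case True
  then have "lv (co b q' + co b u) = lv (co b q + co b u)" using p_lv by simp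
  then show ?thesis using per_ph[of K "co a q' + co a u" "co a q + co a u"] True per[of a] ab by simp
next
  case False
  then have L: "K - 1 \<le> lv (co b q + co b u)" by simp
  then have L': "K - 1 \<le> lv (co b q' + co b u)" using p_le[of "K - 1" b "co b u"] by simp
  obtain mb where mb: "mb \<in> skl K t n q b" "lv (co b q + mb) = lv (co b q + co b u)" "lv (co b q' + mb) = lv (co b q' + co b u)"
    using rep_ex u by blast
  obtain ma where ma: "ma \<in> skl K t n q a" "ma \<le> co a u"
    "\<And>i. ma < i \<Longrightarrow> i \<le> co a u \<Longrightarrow> lv (co a q + i) < thr K t a \<and> lv (co a q' + i) < thr K t a"
    using lst_ex u by metis
  let ?v = "upd a ma (upd b mb (0, 0, 0))"
  have v: "?v \<in> skel K t n q" unfolding skel_def using ma(1) mb(1) zero_in by (simp add: co_zero)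
  have c: "co a ?v = ma" "co b ?v = mb" using ab by simp_all
  have "ph r0 (lv (co b q + co b u)) (co a q + co a u) = ph r0 (lv (co b q + co b u)) (co a q + ma)"
  proof (rule ph_run[OF odo_r0 ma(2)])
    fix m assume "ma < m" "m \<le> co a u"
    then show "\<not> ge r0 (lv (co b q + co b u)) (co a q + m)" using ma(3)[of m] thr_le(1)[of a] L by (simp add: ge_r0_iff)
  qed
  moreover have "ph r0 (lv (co b q' + co b u)) (co a q' + co a u) = ph r0 (lv (co b q' + co b u)) (co a q' + ma)"
  proof (rule ph_run[OF odo_r0 ma(2)])
    fix m assume "ma < m" "m \<le> co a u"
    then show "\<not> ge r0 (lv (co b q' + co b u)) (co a q' + m)" using ma(3)[of m] thr_le(1)[of a] L' by (simp add: ge_r0_iff)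
  qed
  moreover have "y0 (vadd q ?v) (PH a b) = y0 (vadd q' ?v) (PH a b)" using eq[OF v] by simp
  ultimately show ?thesis using ab c mb by simp
qed

lemma small: assumes "s < t" shows "s < K" "Suc (JJ s) \<le> K" "s + NN s * NN s \<le> B"
proof -
  show "s < K" using assms t by simp
  have "s < P 1 K" using assms t by simp
  then show "Suc (JJ s) \<le> K" using JJ_iff by simp
qed (use assms B in auto)

lemma crow_per: "Suc (JJ s) \<le> K \<Longrightarrow> crow r0 s (co a q' + m) = crow r0 s (co a q + m)"
  using per_cnt[of K "co a q' + m" "co a q + m"] per[of a] by simp

lemma idx_bounds: "NN s * (crow r0 s m - 1) \<le> NN s * NN s" "NN s * crow r0 s m \<le> NN s * NN s"
  "NN s * (crow r0 s m - 1) + crow r0 s m' \<le> NN s * NN s"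
proof -
  show 2: "NN s * crow r0 s m \<le> NN s * NN s" using idx_le(1) by simp
  then show "NN s * (crow r0 s m - 1) \<le> NN s * NN s" by (meson diff_le_self le_trans mult_le_mono2)
  have "crow r0 s m - 1 \<le> NN s - 1" using idx_le(1)[of r0 s m] by simp
  then have "NN s * (crow r0 s m - 1) + crow r0 s m' \<le> NN s * (NN s - 1) + NN s"
    using idx_le(1)[of r0 s m'] by (intro add_mono mult_le_mono2) auto
  also have "\<dots> = NN s * NN s" using NN_pos[of s] by (cases "NN s") auto
  finally show "NN s * (crow r0 s m - 1) + crow r0 s m' \<le> NN s * NN s" .
qed

lemma e_ST: assumes u: "inb (x, y, z)"
  shows "y0 (vadd q (x, y, z)) ST = y0 (vadd q' (x, y, z)) ST" "y0 (vadd q (x, y, z)) OV = y0 (vadd q' (x, y, z)) OV"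
proof -
  define s where "s = lv (co AY q + y)"
  have b: "0 \<le> y" "y \<le> n" "0 \<le> z" "z \<le> n" using u by (simp_all add: all_ax)
  have "y0 (vadd q (x, y, z)) ST = y0 (vadd q' (x, y, z)) ST \<and> y0 (vadd q (x, y, z)) OV = y0 (vadd q' (x, y, z)) OV"
  proof (cases "s < t")
    case True
    note sm = small[OF True]
    have s': "lv (co AY q' + y) = s" using p_lv[of AY y] sm by (simp add: s_def)
    have "s + NN s * (crow r0 s (co AY q + y) - 1) \<le> B" "s + NN s * crow r0 s (co AY q + y) \<le> B"
      using idx_bounds[of s "co AY q + y"] sm(3) by linarith+
    then show ?thesis using p_geZ[of _ z] crow_per[OF sm(2), of AY y] s' by (simp add: Let_def s_def[symmetric])
  next
    case False
    then have yS: "y \<in> skl K t n q AY" using self_in[of y AY] b thr_le(2)[of AY] by (simp add: s_def)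
    obtain m where m: "m \<in> skl K t n q AZ" "lv (co AZ q + m) = lv (co AZ q + z)" "lv (co AZ q' + m) = lv (co AZ q' + z)"
      using rep_ex b by blast
    have "y0 (vadd q (0, y, m)) = y0 (vadd q' (0, y, m))" using eq3[OF zero_in yS m(1)] .
    then have "y0 (vadd q (0, y, m)) ST = y0 (vadd q' (0, y, m)) ST" "y0 (vadd q (0, y, m)) OV = y0 (vadd q' (0, y, m)) OV" by simp_all
    then show ?thesis using m by (simp add: Let_def)
  qed
  then show "y0 (vadd q (x, y, z)) ST = y0 (vadd q' (x, y, z)) ST" "y0 (vadd q (x, y, z)) OV = y0 (vadd q' (x, y, z)) OV" by blast+
qed

lemma e_VV: assumes u: "inb (x, y, z)" shows "y0 (vadd q (x, y, z)) VV = y0 (vadd q' (x, y, z)) VV"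
proof -
  define s where "s = lv (co AX q + x)"
  have b: "0 \<le> x" "x \<le> n" "0 \<le> y" "y \<le> n" "0 \<le> z" "z \<le> n" using u by (simp_all add: all_ax)
  show ?thesis
  proof (cases "s < t")
    case True
    note sm = small[OF True]
    have s': "lv (co AX q' + x) = s" using p_lv[of AX x] sm by (simp add: s_def)
    have "s + NN s * crow r0 s (co AY q + y) \<le> B" using idx_bounds[of s "co AY q + y"] sm(3) by linarith
    then show ?thesis using p_geZ[of _ z] crow_per[OF sm(2), of AY y] s' by (simp add: Let_def s_def[symmetric])
  next
    case False
    then have xS: "x \<in> skl K t n q AX" using self_in[of x AX] b thr_le(2)[of AX] by (simp add: s_def)
    define s' where "s' = lv (co AX q' + x)"
    have ts: "t \<le> s" "t \<le> s'" using False p_le[of t AX x] t by (simp_all add: s_def s'_def)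
    obtain m where m: "m \<in> skl K t n q AZ" "lv (co AZ q + m) = lv (co AZ q + z)" "lv (co AZ q' + m) = lv (co AZ q' + z)"
      using rep_ex b by blast
    obtain l where l: "l \<in> skl K t n q AY" "l \<le> y"
      "\<And>i. l < i \<Longrightarrow> i \<le> y \<Longrightarrow> lv (co AY q + i) < thr K t AY \<and> lv (co AY q' + i) < thr K t AY" using lst_ex b by metis
    have 1: "crow r0 s (co AY q + y) = crow r0 s (co AY q + l)"
      by (rule cnt_run[OF odo_r0 JJ_ge l(2)]) (use l(3) ts thr_le(2)[of AY] in \<open>force simp: ge_r0_iff\<close>)
    have 2: "crow r0 s' (co AY q' + y) = crow r0 s' (co AY q' + l)"
      by (rule cnt_run[OF odo_r0 JJ_ge l(2)]) (use l(3) ts thr_le(2)[of AY] in \<open>force simp: ge_r0_iff\<close>)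
    have "y0 (vadd q (x, l, m)) VV = y0 (vadd q' (x, l, m)) VV" using eq3[OF xS l(1) m(1)] by simp
    then show ?thesis using m 1 2 by (simp add: Let_def s_def s'_def)
  qed
qed

lemma e_HH: assumes u: "inb (x, y, z)" shows "y0 (vadd q (x, y, z)) HH = y0 (vadd q' (x, y, z)) HH"
proof -
  define s where "s = lv (co AY q + y)"
  have b: "0 \<le> x" "x \<le> n" "0 \<le> y" "y \<le> n" "0 \<le> z" "z \<le> n" using u by (simp_all add: all_ax)
  show ?thesis
  proof (cases "s < t")
    case True
    note sm = small[OF True]
    have s': "lv (co AY q' + y) = s" using p_lv[of AY y] sm by (simp add: s_def)
    have "s + NN s * (crow r0 s (co AY q + y) - 1) + crow r0 s (co AX q + x) \<le> B"
      using idx_bounds(3)[of s "co AY q + y" "co AX q + x"] sm(3) by linarith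
    then show ?thesis using p_geZ[of _ z] crow_per[OF sm(2)] s' by (simp add: Let_def s_def[symmetric])
  next
    case False
    then have yS: "y \<in> skl K t n q AY" using self_in[of y AY] b thr_le(2)[of AY] by (simp add: s_def)
    define s' where "s' = lv (co AY q' + y)"
    have ts: "t \<le> s" "t \<le> s'" using False p_le[of t AY y] t by (simp_all add: s_def s'_def)
    obtain m where m: "m \<in> skl K t n q AZ" "lv (co AZ q + m) = lv (co AZ q + z)" "lv (co AZ q' + m) = lv (co AZ q' + z)"
      using rep_ex b by blast
    obtain l where l: "l \<in> skl K t n q AX" "l \<le> x"
      "\<And>i. l < i \<Longrightarrow> i \<le> x \<Longrightarrow> lv (co AX q + i) < thr K t AX \<and> lv (co AX q' + i) < thr K t AX" using lst_ex b by metis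
    have 1: "crow r0 s (co AX q + x) = crow r0 s (co AX q + l)"
      by (rule cnt_run[OF odo_r0 JJ_ge l(2)]) (use l(3) ts thr_le(2)[of AX] in \<open>force simp: ge_r0_iff\<close>)
    have 2: "crow r0 s' (co AX q' + x) = crow r0 s' (co AX q' + l)"
      by (rule cnt_run[OF odo_r0 JJ_ge l(2)]) (use l(3) ts thr_le(2)[of AX] in \<open>force simp: ge_r0_iff\<close>)
    have "y0 (vadd q (l, y, m)) HH = y0 (vadd q' (l, y, m)) HH" using eq3[OF l(1) yS m(1)] by simp
    then show ?thesis using m 1 2 by (simp add: Let_def s_def s'_def)
  qed
qed

lemma e_EV: "inb u \<Longrightarrow> y0 (vadd q u) (EV a b) = y0 (vadd q' u) (EV a b)"
  by (rule lev_only) simp_all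

lemma UU_step: assumes "lv x = lv y"
  shows "y0 (x, y, z) UU = (y0 (x - 1, y, z) HH + y0 (x, y, z - 1) UU) mod 2"
proof -
  have "y0 (x, y, z) (CM 1 AY AX) \<noteq> 0" using y0_CM1[of AY AX "(x, y, z)"] JJ_ge[of "lv y"] assms by simp
  moreover have "eql (y0 (x, y, z)) AX AY" using y0_eql[of AX AY "(x, y, z)"] assms by simp
  ultimately show ?thesis by (rule Y.D_H(4))
qed

text \<open>At a high level both horizontal coordinates are in the skeleton but the height need not
  be. The digit is then followed upwards from height 0, driven by the carry \<open>HH\<close> at
  \<open>x - 1\<close>; that cell has to lie in the box, hence \<open>1 \<le> x\<close>.\<close>

lemma e_UU: assumes u: "inb (x, y, z)" and x: "1 \<le> x" shows "y0 (vadd q (x, y, z)) UU = y0 (vadd q' (x, y, z)) UU"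
proof -
  define s where "s = lv (co AY q + y)"
  have b: "0 \<le> x" "x \<le> n" "0 \<le> y" "y \<le> n" "0 \<le> z" "z \<le> n" using u by (simp_all add: all_ax)
  have e: "lv (co AX q + x) = lv (co AY q + y) \<longleftrightarrow> lv (co AX q' + x) = lv (co AY q' + y)"
    using e_EV[OF u, of AX AY] e_EV[OF u, of AY AX] by (simp split: if_splits add: of_bool_def) linarith?
  show ?thesis
  proof (cases "lv (co AX q + x) = lv (co AY q + y)")
    case False
    then show ?thesis using e by (simp add: Let_def)
  next
    case eq: True
    show ?thesis
    proof (cases "s < t")
      case True
      note sm = small[OF True]
      have s': "lv (co AY q' + y) = s" using p_lv[of AY y] sm by (simp add: s_def)
      define i where "i = s + NN s * (crow r0 s (co AY q + y) - 1) + (crow r0 s (co AX q + x) - 1)"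
      have "i + 1 \<le> B"
        using idx_le(2)[of s r0 "co AY q + y" r0 "co AX q + x"] sm(3) unfolding i_def by linarith
      then have "bitr r0 i (co AZ q' + z) = bitr r0 i (co AZ q + z)"
        using per_bitr[of B "co AZ q' + z" "co AZ q + z" i] perZ by simp
      then show ?thesis using crow_per[OF sm(2)] s' eq e by (simp add: Let_def s_def[symmetric] i_def)
    next
      case False
      have xS: "x \<in> skl K t n q AX" "y \<in> skl K t n q AY"
        using self_in[of x AX] self_in[of y AY] b thr_le(2) False eq by (simp_all add: s_def)
      have "y0 (vadd q (x, y, w)) UU = y0 (vadd q' (x, y, w)) UU" if "0 \<le> w" "w \<le> z" for w
        using that
      proof (induction w rule: int_ge_induct)
        case base
        show ?case using eq3[OF xS zero_in] by simp
      next
        case (step w)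
        have "inb (x - 1, y, w + 1)" using b x step by (simp add: all_ax)
        from e_HH[OF this] have h: "y0 (vadd q (x - 1, y, w + 1)) HH = y0 (vadd q' (x - 1, y, w + 1)) HH" .
        have "y0 (vadd p (x, y, w + 1)) UU = (y0 (vadd p (x - 1, y, w + 1)) HH + y0 (vadd p (x, y, w)) UU) mod 2"
          if "lv (co AX p + x) = lv (co AY p + y)" for p
          using UU_step[of "co AX p + x" "co AY p + y" "co AZ p + (w + 1)"] that
          by (simp add: vadd_def co.simps add_diff_eq add.assoc[symmetric] del: y0.simps)
        from this[of q] this[of q'] show ?case using h step e eq by simp
      qed
      then show ?thesis using b by simp
    qed
  qed
qed

lemma all_eq: assumes "inb (x, y, z)" "1 \<le> x" shows "y0 (vadd q (x, y, z)) = y0 (vadd q' (x, y, z))"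
proof
  fix i
  note lo = lev_only[OF assms(1)]
  show "y0 (vadd q (x, y, z)) i = y0 (vadd q' (x, y, z)) i"
  proof (cases i)
    case (PH a b)
    then show ?thesis using e_PH[OF assms(1), of a b] by (cases "a = b") simp_all
  next
    case (B0 a) show ?thesis unfolding B0 by (rule lo) simp
  next
    case (EV a b) show ?thesis unfolding EV by (rule lo) simp
  next
    case (LA a) show ?thesis unfolding LA by (rule lo) simp
  next
    case (CM l a b) show ?thesis unfolding CM by (rule lo) simp
  next
    case FX show ?thesis unfolding FX by (rule lo) (simp add: Let_def)
  next
    case FY show ?thesis unfolding FY by (rule lo) (simp add: Let_def)
  next
    case ST show ?thesis unfolding ST by (rule e_ST(1)[OF assms(1)])
  next
    case OV show ?thesis unfolding OV by (rule e_ST(2)[OF assms(1)])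
  next
    case VV show ?thesis unfolding VV by (rule e_VV[OF assms(1)])
  next
    case HH show ?thesis unfolding HH by (rule e_HH[OF assms(1)])
  next
    case UU show ?thesis unfolding UU by (rule e_UU[OF assms])
  qed
qed

end

text \<open>This default value makes the double logarithm 0 when there is a single pattern, so that
  it is never negative.\<close>

lemma log_at_0 [simp]: "log b 0 = 0"
  by (simp add: log_def)

lemma log_pow_mult: "1 \<le> c \<Longrightarrow> log 2 (real (2 ^ a * c ^ b)) = real a + real b * log 2 (real c)"
  by (simp add: log_mult log_nat_power)

context driver begin

text \<open>With \<open>K = k + 2\<close> the vertical threshold \<open>k + 1\<close> exceeds the
  logarithm of the side, so the vertical skeleton has at most \<open>K + 2\<close> points, while
  each horizontal one has at most \<open>2 ^ g * (K + 2)\<close>. The first power counts the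
  residues of the corner, the second the letters on the skeleton.\<close>

theorem pat_upper:
  fixes k :: nat
  defines "K \<equiv> k + 2"
  defines "g \<equiv> K - P 1 K"
  shows "card (range (pat (2 ^ k))) \<le> 2 ^ (3 * K + 4 ^ g + 1) * card (range y0) ^ (4 ^ g * (K + 2) ^ 3)"
proof -
  define t where "t = min (P 1 K) (K - 1)"
  define B where "B = K + 4 ^ g + 1"
  define n where "n = (2::int) ^ k"
  have M1: "1 < M" using M2 by simp
  have Bs: "s + NN s * NN s \<le> B" if "s < t" for s
  proof -
    have s: "s < P 1 K" using that by (simp add: t_def)
    then have J: "JJ s < K" using JJ_iff by blast
    \<comment> \<open>From time \<open>JJ s\<close> to time \<open>K\<close> the marker climbs at
      most \<open>K - JJ s\<close> levels; this bounds the side of the arrays of level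
      \<open>s\<close> by \<open>2 ^ g\<close>.\<close>
    have "P 1 K \<le> s + (K - JJ s)" using P_diff[OF M1, of "JJ s" K] J unfolding P_JJ by simp
    then have "JJ s - s \<le> g" using J P_le[OF M1, of K] unfolding g_def by linarith
    then have "NN s \<le> 2 ^ g" unfolding NN_def by (intro power_increasing) auto
    then have "NN s * NN s \<le> 2 ^ g * 2 ^ g" by (intro mult_mono) auto
    also have "\<dots> = 4 ^ g" by (simp flip: power_mult_distrib)
    finally show ?thesis using s P_le[OF M1, of K] by (simp add: B_def)
  qed
  define res where "res q = (co AX q mod 2 ^ K, co AY q mod 2 ^ K, co AZ q mod 2 ^ B)" for q
  have resd: "2 ^ K dvd co a (res q) - co a q" "2 ^ B dvd co AZ (res q) - co AZ q" for a q
  proof -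
    have m: "d dvd x mod d - x" for d x :: int by (metis dvd_minus_mod dvd_diff_commute)
    show z: "2 ^ B dvd co AZ (res q) - co AZ q" by (simp add: res_def m)
    have "(2::int) ^ K dvd 2 ^ B" by (intro le_imp_power_dvd) (simp add: B_def)
    then have "2 ^ K dvd co AZ (res q) - co AZ q" using z dvd_trans by blast
    then show "2 ^ K dvd co a (res q) - co a q" by (cases a) (simp_all add: res_def m)
  qed
  have tw: "twin M P Lam mv del K t B n q q'" if "\<And>a. 2 ^ K dvd co a q' - co a q" "2 ^ B dvd co AZ q' - co AZ q" for q q'
    by unfold_locales (use that Bs in \<open>auto simp: K_def n_def t_def B_def\<close>)
  \<comment> \<open>The skeleton is taken at \<open>res q\<close>, so that the domain of the second
    component is a function of the first and the keys lie in a \<open>Sigma\<close> set.\<close>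
  define key where "key q = (res q, restrict (\<lambda>u. y0 (vadd q u)) (skel K t n (res q)))" for q
  have pe: "pat (2 ^ k) q = pat (2 ^ k) q'" if key: "key q = key q'" for q q'
  proof -
    have r: "res q = res q'" using key by (simp add: key_def)
    have d: "2 ^ K dvd co a q' - co a q" for a
      using dvd_diff[OF resd(1)[of a q] resd(1)[of a q']] r by simp
    have dz: "2 ^ B dvd co AZ q' - co AZ q" using dvd_diff[OF resd(2)[of q] resd(2)[of q']] r by simp
    interpret A: twin M P Lam mv del K t B n q "res q" by (rule tw) (use resd in auto)
    interpret T: twin M P Lam mv del K t B n q q' by (rule tw) (use d dz in auto)
    have sk: "skel K t n (res q) = skel K t n q" unfolding skel_def A.skl_eq ..
    have "snd (key q) = snd (key q')" using key by simp
    then have re: "restrict (\<lambda>u. y0 (vadd q u)) (skel K t n q) = restrict (\<lambda>u. y0 (vadd q' u)) (skel K t n q)"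
      unfolding key_def snd_conv r[symmetric] sk .
    have "y0 (vadd q u) = y0 (vadd q' u)" if "u \<in> skel K t n q" for u
      using fun_cong[OF re, of u] that by simp
    then interpret E: twin_eq M P Lam mv del K t B n q q' by unfold_locales
    have "y0 (vadd q u) = y0 (vadd q' u)" if u: "u \<in> cube (2 ^ k)" for u
    proof -
      obtain x y z where xyz: "u = (x, y, z)" by (cases u) auto
      show ?thesis unfolding xyz by (rule E.all_eq) (use u in \<open>auto simp: xyz cube_def n_def all_ax\<close>)
    qed
    then show ?thesis unfolding pat_def by (intro restrict_ext) simp
  qed
  define R where "R = {0..<(2::int) ^ K} \<times> {0..<(2::int) ^ K} \<times> {0..<(2::int) ^ B}"
  define L where "L = 4 ^ g * (K + 2) ^ 3"
  have n0: "0 \<le> n" by (simp add: n_def)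
  have skc: "card (skel K t n q) \<le> L" "finite (skel K t n q)" for q
  proof -
    have xy: "card (skl K t n q a) \<le> 2 ^ g * (K + 2)" if "a \<noteq> AZ" for a
    proof -
      have th: "thr K t a = t" using that by (simp add: thr_def)
      have "nat (n div 2 ^ t) \<le> 2 ^ g"
      proof (cases "t \<le> k")
        case True
        then have tP: "t = P 1 K" unfolding t_def K_def by linarith
        have "n = 2 ^ t * 2 ^ (k - t)" unfolding n_def using True by (simp flip: power_add)
        then have "nat (n div 2 ^ t) = 2 ^ (k - t)" by (simp add: nat_power_eq)
        also have "\<dots> \<le> 2 ^ g" unfolding g_def tP[symmetric] by (intro power_increasing) (auto simp: K_def)
        finally show ?thesis .
      next
        case False
        then have "n < 2 ^ t" unfolding n_def by simp
        then show ?thesis using n0 by (simp add: div_pos_pos_trivial)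
      qed
      moreover have "t \<le> K - 1" by (simp add: t_def)
      ultimately have "card (skl K t n q a) \<le> 2 ^ g + (K + 1)"
        using card_skl(2)[OF n0, of K t q a, unfolded th] unfolding K_def by linarith
      also have "\<dots> \<le> 2 ^ g + 2 ^ g * (K + 1)" using mult_le_mono1[of 1 "2 ^ g" "K + 1"] by simp
      finally show ?thesis by (simp add: algebra_simps)
    qed
    have z: "card (skl K t n q AZ) \<le> K + 2"
    proof -
      have th: "thr K t AZ = k + 1" by (simp add: thr_def K_def)
      have "n < 2 ^ (k + 1)" by (simp add: n_def)
      then have "nat (n div 2 ^ (k + 1)) = 0" using n0 by (simp only: div_pos_pos_trivial)
      then show ?thesis using card_skl(2)[OF n0, of K t q AZ] unfolding th by (simp add: K_def)
    qed
    have "card (skel K t n q) = card (skl K t n q AX) * (card (skl K t n q AY) * card (skl K t n q AZ))"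
      unfolding skel_prod by (simp add: card_cartesian_product)
    also have "\<dots> \<le> (2 ^ g * (K + 2)) * ((2 ^ g * (K + 2)) * (K + 2))"
      using xy[of AX] xy[of AY] z by (intro mult_mono) auto
    also have "\<dots> = (2 ^ g * 2 ^ g) * (K + 2) ^ 3" by (simp add: power3_eq_cube algebra_simps)
    also have "2 ^ g * 2 ^ g = (4::nat) ^ g" by (simp flip: power_mult_distrib)
    finally show "card (skel K t n q) \<le> L" by (simp add: L_def)
    show "finite (skel K t n q)" unfolding skel_prod using card_skl(1)[OF n0] by simp
  qed
  define c where "c = card (range y0)"
  have c1: "1 \<le> c" unfolding c_def using finite_y0 by (simp add: Suc_le_eq card_gt_0_iff)
  have sub: "range key \<subseteq> Sigma R (\<lambda>p. PiE (skel K t n p) (\<lambda>_. range y0))"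
    by (auto simp: key_def res_def R_def)
  have finP: "finite (PiE (skel K t n p) (\<lambda>_. range y0))" for p using skc(2) finite_y0 by (intro finite_PiE) auto
  have finS: "finite (Sigma R (\<lambda>p. PiE (skel K t n p) (\<lambda>_. range y0)))"
    using finP by (intro finite_SigmaI) (auto simp: R_def)
  have "card (range (pat (2 ^ k))) \<le> card (range key)"
    by (rule card_range_le[OF finite_subset[OF sub finS] pe])
  also have "\<dots> \<le> card (Sigma R (\<lambda>p. PiE (skel K t n p) (\<lambda>_. range y0)))" by (rule card_mono[OF finS sub])
  also have "\<dots> = (\<Sum>p\<in>R. card (PiE (skel K t n p) (\<lambda>_. range y0)))"
    by (rule card_SigmaI) (use finP in \<open>auto simp: R_def\<close>)
  also have "\<dots> \<le> (\<Sum>p\<in>R. c ^ L)"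
  proof (rule sum_mono)
    fix p
    have "card (PiE (skel K t n p) (\<lambda>_. range y0)) = c ^ card (skel K t n p)"
      by (subst card_PiE[OF skc(2)]) (simp add: c_def)
    also have "\<dots> \<le> c ^ L" using c1 skc(1) by (intro power_increasing) auto
    finally show "card (PiE (skel K t n p) (\<lambda>_. range y0)) \<le> c ^ L" .
  qed
  also have "\<dots> = card R * c ^ L" by simp
  also have "card R = 2 ^ (3 * K + 4 ^ g + 1)"
  proof -
    have "card R = 2 ^ K * (2 ^ K * 2 ^ B)" unfolding R_def by (simp add: card_cartesian_product nat_power_eq)
    also have "\<dots> = 2 ^ (K + (K + B))" by (simp only: power_add)
    also have "K + (K + B) = 3 * K + 4 ^ g + 1" by (simp add: B_def)
    finally show ?thesis .
  qed
  finally show ?thesis by (simp add: L_def c_def)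
qed

section \<open>Passage to logarithms\<close>

lemma log_upper:
  assumes n: "2 ^ k \<le> n" "n < 2 ^ Suc k" and k: "1 \<le> k"
  defines "N \<equiv> card (range (pat n))"
  shows "log 2 (log 2 (real N)) \<le> 2 * real (k - P 1 k) + 6 + 3 * log 2 (real k + 5) + log 2 (5 + log 2 (real (card (range y0))))"
    and "2 * real (k - P 1 k) - 2 \<le> log 2 (log 2 (real N))"
proof -
  have M1: "1 < M" using M2 by simp
  have N1: "1 \<le> N" unfolding N_def using finite_pat by (simp add: Suc_le_eq card_gt_0_iff)
  have l0: "0 \<le> log 2 (log 2 (real N))"
  proof (cases "N = 1")
    case False
    then have "2 \<le> N" using N1 by simp
    then have "log 2 2 \<le> log 2 (real N)" by (subst log_le_cancel_iff) auto
    then show ?thesis by (simp add: zero_le_log_cancel_iff)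
  qed simp
  define c where "c = card (range y0)"
  have c1: "1 \<le> c" unfolding c_def using finite_y0 by (simp add: Suc_le_eq card_gt_0_iff)
  define C where "C = 5 + log 2 (real c)"
  have lc: "0 \<le> log 2 (real c)" using c1 by (simp add: zero_le_log_cancel_iff)
  define K where "K = Suc k + 2"
  define g where "g = K - P 1 K"
  have gk: "real g \<le> real (k - P 1 k) + 3"
  proof -
    have "P 1 k \<le> P 1 K" using P_mono[OF M1] by (simp add: K_def)
    then have "g \<le> (k - P 1 k) + 3" using P_le[OF M1, of K] unfolding g_def K_def by linarith
    then show ?thesis by linarith
  qed
  have "N \<le> card (range (pat (2 ^ Suc k)))" unfolding N_def using n by (intro pat_mono) simp
  also have "\<dots> \<le> 2 ^ (3 * K + 4 ^ g + 1) * c ^ (4 ^ g * (K + 2) ^ 3)"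
    using pat_upper[of "Suc k"] unfolding K_def[symmetric] g_def[symmetric] c_def .
  finally have "real N \<le> real (2 ^ (3 * K + 4 ^ g + 1) * c ^ (4 ^ g * (K + 2) ^ 3))" by (simp only: of_nat_le_iff)
  then have "log 2 (real N) \<le> log 2 (real (2 ^ (3 * K + 4 ^ g + 1) * c ^ (4 ^ g * (K + 2) ^ 3)))"
    using N1 c1 by (subst log_le_cancel_iff) auto
  also have "\<dots> = real (3 * K + 4 ^ g + 1) + real (4 ^ g * (K + 2) ^ 3) * log 2 (real c)"
    using c1 by (rule log_pow_mult)
  also have "\<dots> \<le> 4 ^ g * (real K + 2) ^ 3 * C"
  proof -
    have a: "1 \<le> (4::real) ^ g" by simp
    have kk: "3 * real K + 2 \<le> 5 * (real K + 2) ^ 3 - 1"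
    proof -
      have "(real K + 2) \<le> (real K + 2) ^ 3" by (rule self_le_power) auto
      then show ?thesis by linarith
    qed
    have "real (3 * K + 4 ^ g + 1) = 3 * real K + 1 + 4 ^ g" by simp
    also have "\<dots> \<le> 4 ^ g * (3 * real K + 1) + 4 ^ g"
      using mult_right_mono[OF a, of "3 * real K + 1"] by simp
    also have "\<dots> = 4 ^ g * (3 * real K + 2)" by (simp add: algebra_simps)
    also have "\<dots> \<le> 4 ^ g * (5 * (real K + 2) ^ 3)" using kk by (intro mult_left_mono) auto
    finally show ?thesis by (simp add: C_def algebra_simps)
  qed
  finally have lN: "log 2 (real N) \<le> 4 ^ g * (real K + 2) ^ 3 * C" .
  have pos: "0 < 4 ^ g * (real K + 2) ^ 3 * C" using lc by (simp add: C_def)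
  have "log 2 (log 2 (real N)) \<le> log 2 (4 ^ g * (real K + 2) ^ 3 * C)"
  proof (cases "log 2 (real N) \<le> 0")
    case True
    moreover have "0 \<le> log 2 (real N)" using N1 by (simp add: zero_le_log_cancel_iff)
    ultimately have "log 2 (real N) = 0" by linarith
    then have "log 2 (log 2 (real N)) = 0" by simp
    moreover have "1 \<le> 4 ^ g * (real K + 2) ^ 3 * C"
    proof -
      have "(1::real) \<le> 4 ^ g" "1 \<le> (real K + 2) ^ 3" "1 \<le> C" using lc by (auto simp: C_def one_le_power)
      then have "(1::real) * 1 * 1 \<le> 4 ^ g * (real K + 2) ^ 3 * C" by (intro mult_mono) auto
      then show ?thesis by simp
    qed
    ultimately show ?thesis by (simp add: zero_le_log_cancel_iff)
  next
    case False
    then show ?thesis using lN pos by (subst log_le_cancel_iff) auto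
  qed
  also have "\<dots> = 2 * real g + 3 * log 2 (real K + 2) + log 2 C"
  proof -
    have "log 2 ((4::real) ^ g) = 2 * real g"
    proof -
      have "(4::real) ^ g = 2 ^ (2 * g)" by (simp add: power_mult)
      then show ?thesis by (simp add: log_nat_power)
    qed
    then show ?thesis using lc by (simp add: log_mult log_nat_power C_def)
  qed
  finally show "log 2 (log 2 (real N)) \<le> 2 * real (k - P 1 k) + 6 + 3 * log 2 (real k + 5) + log 2 (5 + log 2 (real (card (range y0))))"
    using gk by (simp add: K_def C_def c_def add.commute)
  show "2 * real (k - P 1 k) - 2 \<le> log 2 (log 2 (real N))"
  proof (cases "P 1 k < k")
    case False then show ?thesis using l0 by simp
  next
    case True
    have "2 ^ (4 ^ (k - P 1 k - 1)) \<le> card (range (pat (2 ^ k)))" by (rule pat_lower[OF True])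
    also have "\<dots> \<le> N" unfolding N_def using n by (intro pat_mono) simp
    finally have "real (2 ^ (4 ^ (k - P 1 k - 1))) \<le> real N" by (simp only: of_nat_le_iff)
    then have "log 2 (real (2 ^ (4 ^ (k - P 1 k - 1)))) \<le> log 2 (real N)" using N1 by (subst log_le_cancel_iff) auto
    then have "real (4 ^ (k - P 1 k - 1)) \<le> log 2 (real N)" by (simp add: log_nat_power)
    then have "log 2 (real (4 ^ (k - P 1 k - 1))) \<le> log 2 (log 2 (real N))"
      by (subst log_le_cancel_iff) (auto intro: order.strict_trans2[rotated])
    moreover have "log 2 (real (4 ^ (k - P 1 k - 1))) = 2 * real (k - P 1 k - 1)"
    proof -
      have "log 2 (4::real) = 2" using log_nat_power[of 2 2 2] by simp
      then show ?thesis by (simp add: log_nat_power)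
    qed
    ultimately have "2 * real (k - P 1 k - 1) \<le> log 2 (log 2 (real N))" by linarith
    then show ?thesis using True by (simp add: of_nat_diff)
  qed
qed

text \<open>For \<open>n\<close> in the dyadic interval with index \<open>kk n\<close>, the bounds
  of \<open>log_upper\<close> differ by a multiple of \<open>log 2 (kk n)\<close> and a constant,
  which is negligible after division by \<open>log 2 n\<close>.\<close>

theorem dim_limit:
  assumes lim: "(\<lambda>k. real (P 1 k) / real k) \<longlonglongrightarrow> 1 - x / 2"
  shows "(\<lambda>n. log 2 (log 2 (real (card (range (pat n))))) / log 2 (real n)) \<longlonglongrightarrow> x"
proof -
  have M1: "1 < M" using M2 by simp
  define h where "h k = real (k - P 1 k)" for k
  define c0 where "c0 = log 2 (5 + log 2 (real (card (range y0))))"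
  define kk where "kk n = nat \<lfloor>log 2 (real n)\<rfloor>" for n :: nat
  define G where "G n = log 2 (log 2 (real (card (range (pat n)))))" for n
  have hk: "h k = real k - real (P 1 k)" for k unfolding h_def using P_le[OF M1, of k] by (simp add: of_nat_diff)
  have hl: "(\<lambda>k. h k / real k) \<longlonglongrightarrow> x / 2"
  proof -
    have "(\<lambda>k. 1 - real (P 1 k) / real k) \<longlonglongrightarrow> 1 - (1 - x / 2)" by (intro tendsto_intros lim)
    moreover have "\<forall>\<^sub>F k in sequentially. 1 - real (P 1 k) / real k = h k / real k"
      using eventually_gt_at_top[of 0] by eventually_elim (simp add: hk field_simps)
    ultimately show ?thesis by (simp add: tendsto_cong)
  qed
  have kinf: "filterlim kk at_top sequentially" unfolding kk_def
    by (rule filterlim_compose[OF filterlim_nat_sequentially], rule filterlim_compose[OF filterlim_floor_sequentially]) real_asymp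
  have b: "2 ^ kk n \<le> n \<and> n < 2 ^ Suc (kk n) \<and> 1 \<le> kk n \<and> real (kk n) \<le> log 2 (real n) \<and> log 2 (real n) < real (kk n) + 1" if n: "2 \<le> n" for n
  proof -
    have l1: "1 \<le> log 2 (real n)" using n by (simp add: le_log_iff)
    then have f: "1 \<le> \<lfloor>log 2 (real n)\<rfloor>" by (simp add: le_floor_iff)
    then have r: "real (kk n) = of_int \<lfloor>log 2 (real n)\<rfloor>" by (simp add: kk_def)
    have lo: "real (kk n) \<le> log 2 (real n)" and hi: "log 2 (real n) < real (kk n) + 1" unfolding r by linarith+
    have "2 powr real (kk n) \<le> real n" using lo n by (simp add: le_log_iff)
    then have "real (2 ^ kk n) \<le> real n" by (simp add: powr_realpow)
    then have 1: "2 ^ kk n \<le> n" by (simp only: of_nat_le_iff)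
    have "real n < 2 powr (real (kk n) + 1)" using hi n by (simp add: log_less_iff)
    then have "real n < real (2 ^ Suc (kk n))" by (simp add: powr_realpow powr_add)
    then have 2: "n < 2 ^ Suc (kk n)" by (simp only: of_nat_less_iff)
    have "1 \<le> kk n" using f by (simp add: kk_def le_nat_iff)
    then show ?thesis using 1 2 lo hi by blast
  qed
  have up: "(\<lambda>k. (2 * h k + 6 + 3 * log 2 (real k + 5) + c0) / real k) \<longlonglongrightarrow> x"
  proof -
    have "(\<lambda>k. 2 * (h k / real k) + (6 + 3 * log 2 (real k + 5) + c0) / real k) \<longlonglongrightarrow> 2 * (x / 2) + 0"
      by (intro tendsto_intros hl) real_asymp
    then show ?thesis by (simp add: add_divide_distrib add.assoc)
  qed
  have lo: "(\<lambda>k. (2 * h k - 2) / (real k + 1)) \<longlonglongrightarrow> x"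
  proof -
    have "(\<lambda>k. 2 * (h k / real k) * (real k / (real k + 1)) - 2 / (real k + 1)) \<longlonglongrightarrow> 2 * (x / 2) * 1 - 0"
      by (intro tendsto_intros hl; real_asymp)
    moreover have "\<forall>\<^sub>F k in sequentially. 2 * (h k / real k) * (real k / (real k + 1)) - 2 / (real k + 1) = (2 * h k - 2) / (real k + 1)"
      using eventually_gt_at_top[of 0] by eventually_elim (simp add: diff_divide_distrib)
    ultimately show ?thesis by (simp add: tendsto_cong)
  qed
  have m0: "2 * h k - 2 \<le> G n" "G n \<le> 2 * h k + 6 + 3 * log 2 (real k + 5) + c0"
    if "2 ^ k \<le> n" "n < 2 ^ Suc k" "1 \<le> k" for k n
    using log_upper[OF that] by (simp_all add: G_def h_def c0_def)
  have up': "(\<lambda>n. max 0 ((2 * h (kk n) + 6 + 3 * log 2 (real (kk n) + 5) + c0) / real (kk n))) \<longlonglongrightarrow> max 0 x"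
    by (rule tendsto_max[OF tendsto_const filterlim_compose[OF up kinf]])
  have lo': "(\<lambda>n. (2 * h (kk n) - 2) / (real (kk n) + 1)) \<longlonglongrightarrow> x" by (rule filterlim_compose[OF lo kinf])
  have x0: "0 \<le> x / 2" using hl by (rule LIMSEQ_le_const) (auto simp: h_def)
  have G0: "0 \<le> G n" for n
  proof -
    let ?N = "card (range (pat n))"
    have N1: "1 \<le> ?N" using finite_pat by (simp add: Suc_le_eq card_gt_0_iff)
    show ?thesis
    proof (cases "?N = 1")
      case True then show ?thesis by (simp add: G_def)
    next
      case False
      then have "2 \<le> ?N" using N1 by simp
      then have "log 2 2 \<le> log 2 (real ?N)" by (subst log_le_cancel_iff) auto
      then show ?thesis by (simp add: G_def zero_le_log_cancel_iff)
    qed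
  qed
  have "(\<lambda>n. G n / log 2 (real n)) \<longlonglongrightarrow> x"
  proof (rule tendsto_sandwich[OF _ _ lo'])
    show "(\<lambda>n. max 0 ((2 * h (kk n) + 6 + 3 * log 2 (real (kk n) + 5) + c0) / real (kk n))) \<longlonglongrightarrow> x"
      using up' x0 by simp
    show "\<forall>\<^sub>F n in sequentially. (2 * h (kk n) - 2) / (real (kk n) + 1) \<le> G n / log 2 (real n)"
      using eventually_ge_at_top[of 2]
    proof eventually_elim
      case (elim n)
      note bn = b[OF elim]
      then have lp: "0 < log 2 (real n)" by linarith
      have "(2 * h (kk n) - 2) / (real (kk n) + 1) \<le> G n / (real (kk n) + 1)"
        using m0(1)[of "kk n" n] bn by (intro divide_right_mono) auto
      also have "\<dots> \<le> G n / log 2 (real n)" using bn G0 lp by (intro divide_left_mono mult_pos_pos) auto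
      finally show ?case .
    qed
    show "\<forall>\<^sub>F n in sequentially. G n / log 2 (real n) \<le> max 0 ((2 * h (kk n) + 6 + 3 * log 2 (real (kk n) + 5) + c0) / real (kk n))"
      using eventually_ge_at_top[of 2]
    proof eventually_elim
      case (elim n)
      note bn = b[OF elim]
      then have lp: "0 < log 2 (real n)" by linarith
      have "G n / log 2 (real n) \<le> G n / real (kk n)" using bn G0 lp by (intro divide_left_mono mult_pos_pos) auto
      also have "\<dots> \<le> (2 * h (kk n) + 6 + 3 * log 2 (real (kk n) + 5) + c0) / real (kk n)"
        using m0(2)[of "kk n" n] bn by (intro divide_right_mono) auto
      finally show ?case by simp
    qed
  qed
  then show ?thesis by (simp add: G_def)
qed

theorem driver_dim:
  assumes "(\<lambda>k. real (P 1 k) / real k) \<longlonglongrightarrow> 1 - x / 2"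
  shows "\<exists>(A::nat set) (X::config set). X \<noteq> {} \<and> subshift A X \<and> SFT A X \<and> minimal_subshift X
           \<and> has_entropy_dim X \<and> entropy_dim X = ereal x"
proof -
  obtain A X where X: "X \<noteq> {}" "subshift A X" "SFT A X" "minimal_subshift X" "\<And>n. N_count X n = card (range (pat n))"
    using driver_sft by blast
  have "dim_seq X \<longlonglongrightarrow> x" using dim_limit[OF assms] by (simp add: dim_seq_def[abs_def] X(5))
  then have e: "(\<lambda>n. ereal (dim_seq X n)) \<longlonglongrightarrow> ereal x" by simp
  have "upper_entropy_dim X = ereal x" "lower_entropy_dim X = ereal x"
    unfolding upper_entropy_dim_def lower_entropy_dim_def
    using lim_imp_Limsup[OF _ e] lim_imp_Liminf[OF _ e] by simp_all
  then show ?thesis using X(1-4) unfolding has_entropy_dim_def entropy_dim_def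
    by (intro exI[of _ A] exI[of _ X]) simp
qed

end

section \<open>Register programs\<close>

datatype com = CInc nat | CDec nat | CSeq com com | CLoop nat com

text \<open>A configuration consists of the list of programs still to be run and the register contents.\<close>

type_synonym ccfg = "com list \<times> (nat \<Rightarrow> nat)"

fun cstep :: "ccfg \<Rightarrow> ccfg" where
  "cstep ([], v) = ([], v)"
| "cstep (CInc r # K, v) = (K, v(r := v r + 1))"
| "cstep (CDec r # K, v) = (K, v(r := v r - 1))"
| "cstep (CSeq a b # K, v) = (a # b # K, v)"
| "cstep (CLoop r c # K, v) = (if v r = 0 then K else c # CLoop r c # K, v)"

text \<open>Registers below 4 are reserved: 0 and 2 count the produced bits 1 and 0, while 1 and 3 are working space of the driver.\<close>

definition qstep :: "ccfg \<Rightarrow> ccfg \<Rightarrow> bool" where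
  "qstep x y \<longleftrightarrow> y = cstep x \<and> (\<forall>r<4. snd y r = snd x r)"

definition crun :: "com \<Rightarrow> (nat \<Rightarrow> nat) \<Rightarrow> (nat \<Rightarrow> nat) \<Rightarrow> bool" where
  "crun c v w \<longleftrightarrow> (\<forall>K. qstep\<^sup>*\<^sup>* (c # K, v) (K, w))"

lemma crun_Inc: "4 \<le> r \<Longrightarrow> crun (CInc r) v (v(r := v r + 1))"
  unfolding crun_def by (auto simp: qstep_def)

lemma crun_Dec: "4 \<le> r \<Longrightarrow> crun (CDec r) v (v(r := v r - 1))"
  unfolding crun_def by (auto simp: qstep_def)

lemma crun_Seq: assumes "crun a u v" "crun b v w" shows "crun (CSeq a b) u w"
  unfolding crun_def
proof
  fix K
  have "qstep (CSeq a b # K, u) (a # b # K, u)" by (simp add: qstep_def)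
  moreover have "qstep\<^sup>*\<^sup>* (a # b # K, u) (b # K, v)" using assms(1) unfolding crun_def by blast
  moreover have "qstep\<^sup>*\<^sup>* (b # K, v) (K, w)" using assms(2) unfolding crun_def by blast
  ultimately show "qstep\<^sup>*\<^sup>* (CSeq a b # K, u) (K, w)" by (meson converse_rtranclp_into_rtranclp rtranclp_trans)
qed

lemma crun_Loop0: assumes "v r = 0" shows "crun (CLoop r c) v v"
proof -
  have "qstep (CLoop r c # K, v) (K, v)" for K using assms by (simp add: qstep_def)
  then show ?thesis unfolding crun_def by blast
qed

lemma crun_LoopS: assumes "u r \<noteq> 0" "crun c u v" "crun (CLoop r c) v w" shows "crun (CLoop r c) u w"
  unfolding crun_def
proof
  fix K
  have "qstep (CLoop r c # K, u) (c # CLoop r c # K, u)" using assms(1) by (simp add: qstep_def)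
  moreover have "qstep\<^sup>*\<^sup>* (c # CLoop r c # K, u) (CLoop r c # K, v)" using assms(2) unfolding crun_def by blast
  moreover have "qstep\<^sup>*\<^sup>* (CLoop r c # K, v) (K, w)" using assms(3) unfolding crun_def by blast
  ultimately show "qstep\<^sup>*\<^sup>* (CLoop r c # K, u) (K, w)" by (meson converse_rtranclp_into_rtranclp rtranclp_trans)
qed

lemma crun_Loop_iter:
  assumes "\<And>j. j < N \<Longrightarrow> t j r \<noteq> 0" "\<And>j. j < N \<Longrightarrow> crun c (t j) (t (Suc j))" "t N r = 0"
  shows "crun (CLoop r c) (t 0) (t N)"
proof -
  have "j \<le> N \<Longrightarrow> crun (CLoop r c) (t (N - j)) (t N)" for j
  proof (induction j)
    case 0 show ?case using assms(3) by (simp add: crun_Loop0)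
  next
    case (Suc j)
    have s: "N - j = Suc (N - Suc j)" using Suc.prems by simp
    show ?case
    proof (rule crun_LoopS)
      show "t (N - Suc j) r \<noteq> 0" using assms(1) Suc.prems by simp
      show "crun c (t (N - Suc j)) (t (N - j))" unfolding s using assms(2) Suc.prems by simp
      show "crun (CLoop r c) (t (N - j)) (t N)" using Suc by simp
    qed
  qed
  from this[of N] show ?thesis by simp
qed

section \<open>Compiling total recursive functions into register programs\<close>

definition cmove :: "nat \<Rightarrow> nat \<Rightarrow> com" where "cmove r d = CLoop r (CSeq (CDec r) (CInc d))"
definition cclear :: "nat \<Rightarrow> com" where "cclear r = CLoop r (CDec r)"
definition ccopy :: "nat \<Rightarrow> nat \<Rightarrow> nat \<Rightarrow> com" where
  "ccopy r d t = CSeq (CLoop r (CSeq (CDec r) (CSeq (CInc d) (CInc t)))) (cmove t r)"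

lemma crun_cmove: assumes "4 \<le> r" "4 \<le> d" "r \<noteq> d" shows "crun (cmove r d) v (v(r := 0, d := v d + v r))"
proof -
  define t where "t j = v(r := v r - j, d := v d + j)" for j
  have it: "crun (CSeq (CDec r) (CInc d)) (t j) (t (Suc j))" for j
  proof -
    have "crun (CInc d) ((t j)(r := t j r - 1)) ((t j)(r := t j r - 1, d := ((t j)(r := t j r - 1)) d + 1))"
      by (rule crun_Inc[OF assms(2)])
    moreover have "(t j)(r := t j r - 1, d := ((t j)(r := t j r - 1)) d + 1) = t (Suc j)"
      using assms by (auto simp: t_def fun_eq_iff)
    ultimately show ?thesis using crun_Seq[OF crun_Dec[OF assms(1), of "t j"]] by simp
  qed
  have "crun (cmove r d) (t 0) (t (v r))" unfolding cmove_def
    by (rule crun_Loop_iter[where t = t, OF _ it]) (use assms in \<open>auto simp: t_def\<close>)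
  moreover have "t 0 = v" "t (v r) = v(r := 0, d := v d + v r)" by (auto simp: t_def)
  ultimately show ?thesis by simp
qed

lemma crun_cclear: assumes "4 \<le> r" shows "crun (cclear r) v (v(r := 0))"
proof -
  define t where "t j = v(r := v r - j)" for j
  have it: "crun (CDec r) (t j) (t (Suc j))" for j
  proof -
    have "(t j)(r := t j r - 1) = t (Suc j)" by (auto simp: t_def fun_eq_iff)
    then show ?thesis using crun_Dec[OF assms, of "t j"] by simp
  qed
  have "crun (cclear r) (t 0) (t (v r))" unfolding cclear_def
    by (rule crun_Loop_iter[where t = t, OF _ it]) (use assms in \<open>auto simp: t_def\<close>)
  moreover have "t 0 = v" "t (v r) = v(r := 0)" by (auto simp: t_def)
  ultimately show ?thesis by simp
qed

lemma crun_ccopy: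
  assumes "4 \<le> r" "4 \<le> d" "4 \<le> t" "distinct [r, d, t]" "v d = 0" "v t = 0"
  shows "crun (ccopy r d t) v (v(d := v r))"
proof -
  define u where "u j = v(r := v r - j, d := j, t := j)" for j
  let ?b = "CSeq (CDec r) (CSeq (CInc d) (CInc t))"
  have it: "crun ?b (u j) (u (Suc j))" for j
  proof -
    let ?x = "(u j)(r := u j r - 1)" let ?y = "?x(d := ?x d + 1)" let ?z = "?y(t := ?y t + 1)"
    have "crun ?b (u j) ?z"
      by (rule crun_Seq[OF crun_Dec[OF assms(1)] crun_Seq[OF crun_Inc[OF assms(2)] crun_Inc[OF assms(3)]]])
    moreover have "?z = u (Suc j)" using assms(4) by (auto simp: u_def fun_eq_iff)
    ultimately show ?thesis by simp
  qed
  have 1: "crun (CLoop r ?b) (u 0) (u (v r))"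
    by (rule crun_Loop_iter[where t = u, OF _ it]) (use assms in \<open>auto simp: u_def\<close>)
  have 2: "u 0 = v" using assms by (auto simp: u_def fun_eq_iff)
  have 3: "crun (cmove t r) (u (v r)) ((u (v r))(t := 0, r := u (v r) r + u (v r) t))"
    by (rule crun_cmove) (use assms in auto)
  have "(u (v r))(t := 0, r := u (v r) r + u (v r) t) = v(d := v r)"
    using assms by (auto simp: u_def fun_eq_iff)
  then show ?thesis using crun_Seq[OF 1 3] 2 unfolding ccopy_def by simp
qed

text \<open>\<open>js\<close> are the input registers, \<open>d\<close> is the target and
  \<open>s\<close> the first register of a clean scratch area. Inputs are preserved and the scratch
  area is left at 0, so compiled programs can be nested and repeated.\<close>

definition compiles :: "nat \<Rightarrow> (nat list \<Rightarrow> nat) \<Rightarrow> bool" where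
  "compiles n f \<longleftrightarrow> (\<forall>js d s. length js = n \<longrightarrow> (\<forall>i\<in>set js. 4 \<le> i \<and> i < s \<and> i \<noteq> d) \<longrightarrow> 4 \<le> d \<longrightarrow> d < s \<longrightarrow>
     (\<exists>c. \<forall>v. (\<forall>i\<ge>s. v i = 0) \<longrightarrow> v d = 0 \<longrightarrow> crun c v (v(d := f (map v js)))))"

lemma compilesD:
  assumes "compiles n f" "length js = n" "\<forall>i\<in>set js. 4 \<le> i \<and> i < s \<and> i \<noteq> d" "4 \<le> d" "d < s"
  obtains c where "\<forall>v. (\<forall>i\<ge>s. v i = 0) \<longrightarrow> v d = 0 \<longrightarrow> crun c v (v(d := f (map v js)))"
proof -
  note assms(1)[unfolded compiles_def, THEN spec[of _ js], THEN spec[of _ d], THEN spec[of _ s],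
      THEN mp, OF assms(2), THEN mp, OF assms(3), THEN mp, OF assms(4), THEN mp, OF assms(5)]
  then obtain c where c: "\<forall>v. (\<forall>i\<ge>s. v i = 0) \<longrightarrow> v d = 0 \<longrightarrow> crun c v (v(d := f (map v js)))" by (rule exE)
  show ?thesis by (rule that[of c]) (fact c)
qed

lemma compilesI:
  assumes "\<And>js d s. length js = n \<Longrightarrow> (\<And>i. i \<in> set js \<Longrightarrow> 4 \<le> i \<and> i < s \<and> i \<noteq> d) \<Longrightarrow> 4 \<le> d \<Longrightarrow> d < s \<Longrightarrow>
     \<exists>c. \<forall>v. (\<forall>i\<ge>s. v i = 0) \<longrightarrow> v d = 0 \<longrightarrow> crun c v (v(d := f (map v js)))"
  shows "compiles n f"
  unfolding compiles_def using assms by blast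

lemma compiles_list:
  assumes "\<forall>g\<in>set gs. compiles n g" "length js = n" "\<forall>i\<in>set js. 4 \<le> i \<and> i < s" "4 \<le> s"
  shows "\<exists>c. \<forall>v. (\<forall>i\<ge>s. v i = 0) \<longrightarrow>
    crun c v (\<lambda>r. if s \<le> r \<and> r < s + length gs then (gs ! (r - s)) (map v js) else v r)"
  using assms(1)
proof (induction gs rule: rev_induct)
  case Nil
  \<comment> \<open>A loop on a register holding 0 plays the part of a skip instruction.\<close>
  have "crun (CLoop s (CInc s)) v (\<lambda>r. if s \<le> r \<and> r < s + length ([] :: (nat list \<Rightarrow> nat) list) then ([] ! (r - s)) (map v js) else v r)"
    if "\<forall>i\<ge>s. v i = 0" for v
  proof -
    have "(\<lambda>r. if s \<le> r \<and> r < s + length ([] :: (nat list \<Rightarrow> nat) list) then ([] ! (r - s)) (map v js) else v r) = v" by auto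
    then show ?thesis using crun_Loop0[of v s] that by simp
  qed
  then show ?case by blast
next
  case (snoc g gs)
  from snoc obtain c1 where c1: "\<forall>v. (\<forall>i\<ge>s. v i = 0) \<longrightarrow>
    crun c1 v (\<lambda>r. if s \<le> r \<and> r < s + length gs then (gs ! (r - s)) (map v js) else v r)" by auto
  let ?d = "s + length gs"
  have "compiles n g" using snoc.prems by simp
  note g = this
  have b: "\<forall>i\<in>set js. 4 \<le> i \<and> i < ?d + 1 \<and> i \<noteq> ?d" using assms(3) by auto
  have d: "4 \<le> ?d" "?d < ?d + 1" using assms(4) by auto
  obtain c2 where c2: "\<forall>v. (\<forall>i\<ge>?d + 1. v i = 0) \<longrightarrow> v ?d = 0 \<longrightarrow> crun c2 v (v(?d := g (map v js)))"
    by (rule compilesD[OF g assms(2) b d])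
  have "crun (CSeq c1 c2) v (\<lambda>r. if s \<le> r \<and> r < s + length (gs @ [g]) then ((gs @ [g]) ! (r - s)) (map v js) else v r)"
    if z: "\<forall>i\<ge>s. v i = 0" for v
  proof -
    let ?w = "\<lambda>r. if s \<le> r \<and> r < s + length gs then (gs ! (r - s)) (map v js) else v r"
    have m: "map ?w js = map v js" using assms(3) by (auto simp: not_le)
    have u: "crun c2 ?w (?w(?d := g (map ?w js)))" by (rule c2[rule_format]) (use z in auto)
    have e: "?w(?d := g (map ?w js)) = (\<lambda>r. if s \<le> r \<and> r < s + length (gs @ [g]) then ((gs @ [g]) ! (r - s)) (map v js) else v r)"
      unfolding m by (auto simp: fun_eq_iff nth_append)
    have w: "crun c1 v ?w" using c1 z by blast
    show ?thesis using crun_Seq[OF w u] unfolding e .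
  qed
  then show ?case by blast
qed

lemma crun_clear_range:
  assumes "4 \<le> s"
  shows "\<exists>c. \<forall>v. crun c v (\<lambda>r. if s \<le> r \<and> r \<le> s + m then 0 else v r)"
proof (induction m)
  case 0
  have "v(s := 0) = (\<lambda>r. if s \<le> r \<and> r \<le> s + 0 then 0 else v r)" for v :: "nat \<Rightarrow> nat" by auto
  then show ?case using crun_cclear[OF assms] by (intro exI[of _ "cclear s"]) simp
next
  case (Suc m)
  then obtain c where c: "\<And>v. crun c v (\<lambda>r. if s \<le> r \<and> r \<le> s + m then 0 else v r)" by blast
  have "crun (CSeq c (cclear (s + Suc m))) v (\<lambda>r. if s \<le> r \<and> r \<le> s + Suc m then 0 else v r)" for v
  proof -
    let ?w = "\<lambda>r. if s \<le> r \<and> r \<le> s + m then 0 else v r"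
    have u: "crun (cclear (s + Suc m)) ?w (?w(s + Suc m := 0))" by (rule crun_cclear) (use assms in auto)
    have e: "?w(s + Suc m := 0) = (\<lambda>r. if s \<le> r \<and> r \<le> s + Suc m then 0 else v r)" by (auto simp: fun_eq_iff)
    show ?thesis using crun_Seq[OF c u] unfolding e .
  qed
  then show ?case by blast
qed

lemma compiles_comp:
  assumes f: "compiles m f" and gs: "length gs = m" "\<forall>g\<in>set gs. compiles n g"
  shows "compiles n (\<lambda>xs. f (map (\<lambda>g. g xs) gs))"
proof (rule compilesI)
  fix js and d s :: nat
  assume l: "length js = n" and i: "\<And>i. i \<in> set js \<Longrightarrow> 4 \<le> i \<and> i < s \<and> i \<noteq> d" and d: "4 \<le> d" "d < s"
  obtain c1 where c1: "\<forall>v. (\<forall>i\<ge>s. v i = 0) \<longrightarrow>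
    crun c1 v (\<lambda>r. if s \<le> r \<and> r < s + length gs then (gs ! (r - s)) (map v js) else v r)"
    using compiles_list[OF gs(2) l] i d by force
  have "4 \<le> s" using d by simp
  have b: "length [s..<s+m] = m" "\<forall>i\<in>set [s..<s+m]. 4 \<le> i \<and> i < s + m \<and> i \<noteq> d" "d < s + m" using d by auto
  obtain c2 where c2: "\<forall>v. (\<forall>i\<ge>s + m. v i = 0) \<longrightarrow> v d = 0 \<longrightarrow> crun c2 v (v(d := f (map v [s..<s+m])))"
    by (rule compilesD[OF f b(1,2) d(1) b(3)])
  obtain c3 where c3: "\<And>v. crun c3 v (\<lambda>r. if s \<le> r \<and> r \<le> s + m then 0 else v r)"
    using crun_clear_range[OF \<open>4 \<le> s\<close>] by blast
  have "crun (CSeq c1 (CSeq c2 c3)) v (v(d := f (map (\<lambda>g. g (map v js)) gs)))"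
    if z: "\<forall>i\<ge>s. v i = 0" "v d = 0" for v
  proof -
    let ?w = "\<lambda>r. if s \<le> r \<and> r < s + length gs then (gs ! (r - s)) (map v js) else v r"
    have w: "crun c1 v ?w" using c1 z by blast
    have m: "map ?w [s..<s+m] = map (\<lambda>g. g (map v js)) gs"
      by (rule nth_equalityI) (auto simp: gs(1))
    have u: "crun c2 ?w (?w(d := f (map ?w [s..<s+m])))" by (rule c2[rule_format]) (use z d gs(1) in auto)
    let ?u = "?w(d := f (map ?w [s..<s+m]))"
    have x: "crun c3 ?u (\<lambda>r. if s \<le> r \<and> r \<le> s + m then 0 else ?u r)" by (rule c3)
    have "(\<lambda>r. if s \<le> r \<and> r \<le> s + m then 0 else ?u r) = v(d := f (map (\<lambda>g. g (map v js)) gs))"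
      unfolding m using z d gs(1) by (auto simp: fun_eq_iff)
    then show ?thesis using crun_Seq[OF w crun_Seq[OF u x]] by simp
  qed
  then show "\<exists>c. \<forall>v. (\<forall>i\<ge>s. v i = 0) \<longrightarrow> v d = 0 \<longrightarrow> crun c v (v(d := f (map (\<lambda>g. g (map v js)) gs)))" by blast
qed

lemma compiles_prim:
  assumes f: "compiles n f" and g: "compiles (Suc (Suc n)) g"
  shows "compiles (Suc n) (\<lambda>xs. rec_nat (f (tl xs)) (\<lambda>y r. g (y # r # tl xs)) (hd xs))"
proof (rule compilesI)
  fix js and d s :: nat
  assume l: "length js = Suc n" and i: "\<And>i. i \<in> set js \<Longrightarrow> 4 \<le> i \<and> i < s \<and> i \<noteq> d" and d: "4 \<le> d" "d < s"
  obtain i0 rs where is_eq: "js = i0 # rs" using l by (cases js) auto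
  have lr: "length rs = n" and ir: "\<And>i. i \<in> set rs \<Longrightarrow> 4 \<le> i \<and> i < s \<and> i \<noteq> d" and i0: "4 \<le> i0" "i0 < s" "i0 \<noteq> d"
    using l i is_eq by auto
  have b: "\<forall>i\<in>set rs. 4 \<le> i \<and> i < s + 3 \<and> i \<noteq> d" "d < s + 3"
    "\<forall>i\<in>set ((s + 1) # d # rs). 4 \<le> i \<and> i < s + 3 \<and> i \<noteq> s + 2" "4 \<le> s + 2" "s + 2 < s + 3"
    "length ((s + 1) # d # rs) = Suc (Suc n)"
    using d lr by (auto dest: ir)
  obtain c1 where c1: "\<forall>v. (\<forall>i\<ge>s + 3. v i = 0) \<longrightarrow> v d = 0 \<longrightarrow> crun c1 v (v(d := f (map v rs)))"
    by (rule compilesD[OF f lr b(1) d(1) b(2)])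
  obtain c2 where c2: "\<forall>v. (\<forall>i\<ge>s + 3. v i = 0) \<longrightarrow> v (s + 2) = 0 \<longrightarrow>
      crun c2 v (v(s + 2 := g (map v ((s + 1) # d # rs))))"
    by (rule compilesD[OF g b(6,3,4,5)])
  \<comment> \<open>Register \<open>s\<close> counts the remaining rounds, \<open>s + 1\<close>
    holds the index and \<open>d\<close> the current value; the next value is formed in
    \<open>s + 2\<close>, because \<open>d\<close> is an input of \<open>c2\<close>.\<close>
  let ?b = "CSeq (CDec s) (CSeq c2 (CSeq (cclear d) (CSeq (cmove (s + 2) d) (CInc (s + 1)))))"
  let ?c = "CSeq (ccopy i0 s (s + 1)) (CSeq c1 (CSeq (CLoop s ?b) (cclear (s + 1))))"
  have "crun ?c v (v(d := rec_nat (f (tl (map v js))) (\<lambda>y r. g (y # r # tl (map v js))) (hd (map v js))))"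
    if z: "\<forall>i\<ge>s. v i = 0" "v d = 0" for v
  proof -
    define F where "F = rec_nat (f (map v rs)) (\<lambda>y r. g (y # r # map v rs))"
    have F: "F 0 = f (map v rs)" "F (Suc j) = g (j # F j # map v rs)" for j by (auto simp: F_def)
    let ?N = "v i0"
    define t where "t j = v(s := ?N - j, s + 1 := j, d := F j)" for j
    have r1: "crun (ccopy i0 s (s + 1)) v (v(s := ?N))"
      by (rule crun_ccopy) (use z i0 d in auto)
    have r2: "crun c1 (v(s := ?N)) (t 0)"
    proof -
      have m: "map (v(s := ?N)) rs = map v rs" by (auto dest: ir)
      have "crun c1 (v(s := ?N)) ((v(s := ?N))(d := f (map (v(s := ?N)) rs)))" by (rule c1[rule_format]) (use z d in auto)
      moreover have "(v(s := ?N))(d := f (map (v(s := ?N)) rs)) = t 0"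
        unfolding m t_def F using z by (auto simp: fun_eq_iff)
      ultimately show ?thesis by simp
    qed
    have it: "crun ?b (t j) (t (Suc j))" for j
    proof -
      let ?x = "(t j)(s := t j s - 1)"
      have m: "map ?x ((s + 1) # d # rs) = j # F j # map v rs"
        using d by (auto simp: t_def dest: ir)
      have a: "crun (CDec s) (t j) ?x" by (rule crun_Dec) (use d in auto)
      have b: "crun c2 ?x (?x(s + 2 := F (Suc j)))"
      proof -
        have "crun c2 ?x (?x(s + 2 := g (map ?x ((s + 1) # d # rs))))" by (rule c2[rule_format]) (use z d in \<open>auto simp: t_def\<close>)
        then show ?thesis unfolding m F(2) .
      qed
      let ?y = "?x(s + 2 := F (Suc j))" let ?y1 = "?y(d := 0)" let ?z = "?y1(s + 2 := 0, d := ?y1 d + ?y1 (s + 2))"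
      have c: "crun (cclear d) ?y ?y1" by (rule crun_cclear[OF d(1)])
      have e: "crun (cmove (s + 2) d) ?y1 ?z" by (rule crun_cmove) (use d in auto)
      have h: "crun (CInc (s + 1)) ?z (?z(s + 1 := ?z (s + 1) + 1))" by (rule crun_Inc) (use d in auto)
      have "?z(s + 1 := ?z (s + 1) + 1) = t (Suc j)"
        using z d by (auto simp: t_def fun_eq_iff)
      then show ?thesis using crun_Seq[OF a crun_Seq[OF b crun_Seq[OF c crun_Seq[OF e h]]]] by simp
    qed
    have r3: "crun (CLoop s ?b) (t 0) (t ?N)"
      by (rule crun_Loop_iter[where t = t, OF _ it]) (use d in \<open>auto simp: t_def\<close>)
    have r4: "crun (cclear (s + 1)) (t ?N) ((t ?N)(s + 1 := 0))" by (rule crun_cclear) (use d in auto)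
    have "(t ?N)(s + 1 := 0) = v(d := F ?N)" using z d by (auto simp: t_def fun_eq_iff)
    then have "crun ?c v (v(d := F ?N))" using crun_Seq[OF r1 crun_Seq[OF r2 crun_Seq[OF r3 r4]]] by simp
    then show ?thesis by (simp add: is_eq F_def)
  qed
  then show "\<exists>c. \<forall>v. (\<forall>i\<ge>s. v i = 0) \<longrightarrow> v d = 0 \<longrightarrow>
      crun c v (v(d := rec_nat (f (tl (map v js))) (\<lambda>y r. g (y # r # tl (map v js))) (hd (map v js))))" by blast
qed

lemma compiles_mu:
  assumes f: "compiles (Suc n) f" and ex0: "\<forall>xs. length xs = n \<longrightarrow> (\<exists>y. f (y # xs) = 0)"
  shows "compiles n (\<lambda>xs. LEAST y. f (y # xs) = 0)"
proof (rule compilesI)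
  fix js and d s :: nat
  assume l: "length js = n" and i: "\<And>i. i \<in> set js \<Longrightarrow> 4 \<le> i \<and> i < s \<and> i \<noteq> d" and d: "4 \<le> d" "d < s"
  have b: "length (d # js) = Suc n" "\<forall>i\<in>set (d # js). 4 \<le> i \<and> i < s + 1 \<and> i \<noteq> s" "4 \<le> s" "s < s + 1"
    using d l by (auto dest: i)
  obtain c1 where c1: "\<forall>v. (\<forall>i\<ge>s + 1. v i = 0) \<longrightarrow> v s = 0 \<longrightarrow> crun c1 v (v(s := f (map v (d # js))))"
    by (rule compilesD[OF f b])
  \<comment> \<open>\<open>d\<close> holds the candidate and \<open>s\<close> the value of
    \<open>f\<close> at it, so the loop stops at the first zero; \<open>s\<close> is cleared because
    \<open>c1\<close> expects its target to be 0.\<close>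
  let ?b = "CSeq (cclear s) (CSeq (CInc d) c1)"
  have "crun (CSeq c1 (CLoop s ?b)) v (v(d := LEAST y. f (y # map v js) = 0))"
    if z: "\<forall>i\<ge>s. v i = 0" "v d = 0" for v
  proof -
    define F where "F j = f (j # map v js)" for j
    define L where "L = (LEAST y. F y = 0)"
    obtain y where "F y = 0" using ex0 l unfolding F_def by force
    then have L0: "F L = 0" unfolding L_def by (rule LeastI)
    define t where "t j = v(d := j, s := F j)" for j
    have e: "crun c1 (v(d := j)) (t j)" for j
    proof -
      have m: "map (v(d := j)) (d # js) = j # map v js" by (auto dest: i)
      have "crun c1 (v(d := j)) ((v(d := j))(s := f (map (v(d := j)) (d # js))))" by (rule c1[rule_format]) (use z d in auto)
      then show ?thesis unfolding m F_def[symmetric] t_def .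
    qed
    have it: "crun ?b (t j) (t (Suc j))" for j
    proof -
      have a: "crun (cclear s) (t j) ((t j)(s := 0))" by (rule crun_cclear) (use d in auto)
      have b: "crun (CInc d) ((t j)(s := 0)) (((t j)(s := 0))(d := ((t j)(s := 0)) d + 1))" by (rule crun_Inc[OF d(1)])
      have "((t j)(s := 0))(d := ((t j)(s := 0)) d + 1) = v(d := Suc j)"
        using z d by (auto simp: t_def fun_eq_iff)
      then show ?thesis using crun_Seq[OF a crun_Seq[OF b]] e[of "Suc j"] by simp
    qed
    have "crun (CLoop s ?b) (t 0) (t L)"
    proof (rule crun_Loop_iter[where t = t, OF _ it])
      fix j assume "j < L"
      then show "t j s \<noteq> 0" unfolding t_def L_def using not_less_Least by auto
    qed (simp add: t_def L0)
    moreover have "t L = v(d := L)" using L0 z d by (auto simp: t_def fun_eq_iff)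
    moreover have "v(d := 0) = v" using z(2) by auto
    ultimately show ?thesis using crun_Seq[OF e[of 0]] by (simp add: L_def F_def)
  qed
  then show "\<exists>c. \<forall>v. (\<forall>i\<ge>s. v i = 0) \<longrightarrow> v d = 0 \<longrightarrow> crun c v (v(d := LEAST y. f (y # map v js) = 0))" by blast
qed

theorem total_rec_compiles: "total_rec n f \<Longrightarrow> compiles n f"
proof (induction rule: total_rec.induct)
  case (zero n)
  show ?case
  proof (rule compilesI)
    fix js and d s :: nat
    have "crun (CLoop d (CInc d)) v (v(d := 0))" if "v d = 0" for v
    proof -
      have "v(d := 0) = v" using that by auto
      then show ?thesis using crun_Loop0[of v d "CInc d"] that by simp
    qed
    then show "\<exists>c. \<forall>v. (\<forall>i\<ge>s. v i = 0) \<longrightarrow> v d = 0 \<longrightarrow> crun c v (v(d := 0))" by blast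
  qed
next
  case succ
  show ?case
  proof (rule compilesI)
    fix js and d s :: nat
    assume l: "length js = 1" and i: "\<And>i. i \<in> set js \<Longrightarrow> 4 \<le> i \<and> i < s \<and> i \<noteq> d" and d: "4 \<le> d" "d < s"
    obtain i0 where is0: "js = [i0]" using l by (auto simp: length_Suc_conv)
    have "crun (CSeq (ccopy i0 d s) (CInc d)) v (v(d := Suc (hd (map v js))))"
      if z: "\<forall>i\<ge>s. v i = 0" "v d = 0" for v
    proof -
      have 1: "crun (ccopy i0 d s) v (v(d := v i0))" by (rule crun_ccopy) (use i[of i0] d z is0 in auto)
      show ?thesis using crun_Seq[OF 1 crun_Inc[OF d(1)]] by (simp add: is0)
    qed
    then show "\<exists>c. \<forall>v. (\<forall>i\<ge>s. v i = 0) \<longrightarrow> v d = 0 \<longrightarrow> crun c v (v(d := Suc (hd (map v js))))" by blast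
  qed
next
  case (proj j n)
  show ?case
  proof (rule compilesI)
    fix js and d s :: nat
    assume l: "length js = n" and i: "\<And>i. i \<in> set js \<Longrightarrow> 4 \<le> i \<and> i < s \<and> i \<noteq> d" and d: "4 \<le> d" "d < s"
    have j: "js ! j \<in> set js" using l proj by simp
    have "crun (ccopy (js ! j) d s) v (v(d := map v js ! j))"
      if z: "\<forall>i\<ge>s. v i = 0" "v d = 0" for v
    proof -
      have 1: "crun (ccopy (js ! j) d s) v (v(d := v (js ! j)))" by (rule crun_ccopy) (use i[OF j] d z in auto)
      then show ?thesis using l proj by simp
    qed
    then show "\<exists>c. \<forall>v. (\<forall>i\<ge>s. v i = 0) \<longrightarrow> v d = 0 \<longrightarrow> crun c v (v(d := map v js ! j))" by blast
  qed
next
  case (comp m f gs n) then show ?case by (intro compiles_comp) auto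
next
  case (prim n f g) then show ?case by (intro compiles_prim)
next
  case (mu n f) then show ?case by (intro compiles_mu)
next
  case (ext n f g)
  show ?case unfolding compiles_def
  proof (intro allI impI)
    fix js and d s :: nat
    assume l: "length js = n" and i: "\<forall>i\<in>set js. 4 \<le> i \<and> i < s \<and> i \<noteq> d" and d: "4 \<le> d" "d < s"
    then have "\<exists>c. \<forall>v. (\<forall>i\<ge>s. v i = 0) \<longrightarrow> v d = 0 \<longrightarrow> crun c v (v(d := f (map v js)))"
      using ext unfolding compiles_def by blast
    moreover have "g (map v js) = f (map v js)" for v using ext l by simp
    ultimately show "\<exists>c. \<forall>v. (\<forall>i\<ge>s. v i = 0) \<longrightarrow> v d = 0 \<longrightarrow> crun c v (v(d := g (map v js)))" by simp
  qed
qed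

text \<open>The continuations that a run can reach; their number is finite, which makes the control of the driver finite.\<close>

fun conts :: "com \<Rightarrow> com list \<Rightarrow> com list set" where
  "conts (CInc r) K = {CInc r # K}"
| "conts (CDec r) K = {CDec r # K}"
| "conts (CSeq a b) K = {CSeq a b # K} \<union> conts a (b # K) \<union> conts b K"
| "conts (CLoop r c) K = {CLoop r c # K} \<union> conts c (CLoop r c # K)"

lemma finite_conts: "finite (conts c K)" by (induction c arbitrary: K) auto

lemma conts_self: "c # K \<in> conts c K" by (cases c) auto

lemma conts_step: "L \<in> conts c K \<Longrightarrow> fst (cstep (L, v)) \<in> insert K (conts c K)"
proof (induction c arbitrary: K)
  case (CSeq a b)
  then consider "L = CSeq a b # K" | "L \<in> conts a (b # K)" | "L \<in> conts b K" by auto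
  then show ?case
  proof cases
    case 1 then show ?thesis using conts_self[of a "b # K"] by simp
  next
    case 2 then show ?thesis using CSeq.IH(1)[OF 2] conts_self[of b K] by (simp del: insert_iff) (auto simp del: cstep.simps)
  next
    case 3 then show ?thesis using CSeq.IH(2)[OF 3] by (auto simp del: cstep.simps)
  qed
next
  case (CLoop r c)
  then consider "L = CLoop r c # K" | "L \<in> conts c (CLoop r c # K)" by auto
  then show ?case
  proof cases
    case 1 then show ?thesis using conts_self[of c "CLoop r c # K"] by simp
  next
    case 2 then show ?thesis using CLoop.IH[OF 2] by (auto simp del: cstep.simps)
  qed
qed auto

lemma conts_closed:
  assumes "L \<in> insert [] (conts c [])" shows "fst (cstep (L, v)) \<in> insert [] (conts c [])"
  using assms conts_step[of L c "[]" v] by (auto simp del: cstep.simps(2-))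

section \<open>Greedy bits of given density\<close>

lemma total_rec_const: "total_rec n (\<lambda>_. c)"
proof (induction c)
  case 0 show ?case by (rule total_rec.zero)
next
  case (Suc c)
  from total_rec.comp[OF total_rec.succ, of "[\<lambda>_. c]" n] Suc show ?case by simp
qed

lemma total_rec_hd: "total_rec (Suc n) hd"
proof (rule total_rec.ext)
  show "total_rec (Suc n) (\<lambda>xs. xs ! 0)" by (rule total_rec.proj) simp
  show "\<forall>xs. length xs = Suc n \<longrightarrow> hd xs = xs ! 0" by (metis hd_conv_nth length_0_conv nat.simps(3))
qed

lemma total_rec_comp1:
  assumes "total_rec 1 (\<lambda>xs. h (hd xs))" "total_rec n g"
  shows "total_rec n (\<lambda>xs. h (g xs))"
  using total_rec.comp[OF assms(1), of "[g]" n] assms(2) by simp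

lemma total_rec_comp2:
  assumes "total_rec 2 (\<lambda>xs. h (hd xs) (xs ! 1))" "total_rec n f" "total_rec n g"
  shows "total_rec n (\<lambda>xs. h (f xs) (g xs))"
  using total_rec.comp[OF assms(1), of "[f, g]" n] assms(2,3) by simp

lemma total_rec_Suc: "total_rec n f \<Longrightarrow> total_rec n (\<lambda>xs. Suc (f xs))"
  using total_rec_comp1[OF total_rec.succ] by simp

lemma total_rec_prim2:
  assumes "total_rec 1 (\<lambda>xs. f (hd xs))" "total_rec 3 (\<lambda>xs. g (xs ! 0) (xs ! 1) (xs ! 2))"
  shows "total_rec 2 (\<lambda>xs. rec_nat (f (xs ! 1)) (\<lambda>y r. g y r (xs ! 1)) (hd xs))"
proof (rule total_rec.ext)
  show "total_rec 2 (\<lambda>xs. rec_nat (f (hd (tl xs))) (\<lambda>y r. (\<lambda>xs. g (xs ! 0) (xs ! 1) (xs ! 2)) (y # r # tl xs)) (hd xs))"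
    using total_rec.prim[OF assms(1), of "\<lambda>xs. g (xs ! 0) (xs ! 1) (xs ! 2)"] assms(2)
    by (simp add: numeral_2_eq_2 numeral_3_eq_3)
  show "\<forall>xs. length xs = 2 \<longrightarrow> rec_nat (f (xs ! 1)) (\<lambda>y r. g y r (xs ! 1)) (hd xs) =
    rec_nat (f (hd (tl xs))) (\<lambda>y r. (\<lambda>xs. g (xs ! 0) (xs ! 1) (xs ! 2)) (y # r # tl xs)) (hd xs)"
    by (auto simp: length_Suc_conv numeral_2_eq_2)
qed

lemma total_rec_add: assumes "total_rec n f" "total_rec n g" shows "total_rec n (\<lambda>xs. f xs + g xs)"
proof -
  have "total_rec 2 (\<lambda>xs. rec_nat (xs ! 1) (\<lambda>y r. Suc r) (hd xs))"
    proof (rule total_rec_prim2[where f = "\<lambda>x. x" and g = "\<lambda>y r x. Suc r"])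
    show "total_rec 1 hd" using total_rec_hd[of 0] by simp
    show "total_rec 3 (\<lambda>xs. Suc (xs ! 1))" by (intro total_rec_Suc total_rec.proj) simp
  qed
  moreover have "rec_nat b (\<lambda>y r. Suc r) a = a + b" for a b by (induction a) auto
  ultimately show ?thesis using total_rec_comp2[of "(+)"] assms by simp
qed

lemma total_rec_pred: assumes "total_rec n f" shows "total_rec n (\<lambda>xs. f xs - 1)"
proof -
  have "total_rec 1 (\<lambda>xs. rec_nat 0 (\<lambda>y r. (y # r # tl xs) ! 0) (hd xs))"
    using total_rec.prim[OF total_rec.zero[of 0] total_rec.proj[of 0 "Suc (Suc 0)"]] by simp
  moreover have "rec_nat 0 (\<lambda>y r. (y # r # tl xs) ! 0) a = a - 1" for a :: nat and xs by (cases a) auto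
  ultimately show ?thesis using total_rec_comp1[of "\<lambda>a. a - 1"] assms by simp
qed

lemma total_rec_diff: assumes "total_rec n f" "total_rec n g" shows "total_rec n (\<lambda>xs. f xs - g xs)"
proof -
  have "total_rec 2 (\<lambda>xs. rec_nat (xs ! 1) (\<lambda>y r. r - 1) (hd xs))"
    proof (rule total_rec_prim2[where f = "\<lambda>x. x" and g = "\<lambda>y r x. r - 1"])
    show "total_rec 1 hd" using total_rec_hd[of 0] by simp
    show "total_rec 3 (\<lambda>xs. xs ! 1 - 1)" by (intro total_rec_pred total_rec.proj) simp
  qed
  moreover have "rec_nat b (\<lambda>y r. r - 1) a = b - a" for a b :: nat by (induction a) auto
  ultimately show ?thesis using total_rec_comp2[of "\<lambda>a b. b - a"] assms by simp
qed

lemma total_rec_mult: assumes "total_rec n f" "total_rec n g" shows "total_rec n (\<lambda>xs. f xs * g xs)"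
proof -
  have "total_rec 2 (\<lambda>xs. rec_nat 0 (\<lambda>y r. r + xs ! 1) (hd xs))"
    by (rule total_rec_prim2[where f = "\<lambda>x. 0" and g = "\<lambda>y r x. r + x"])
      (auto intro!: total_rec_add total_rec.proj total_rec.zero)
  moreover have "rec_nat 0 (\<lambda>y r. r + b) a = a * b" for a b :: nat by (induction a) auto
  ultimately show ?thesis using total_rec_comp2[of "(*)"] assms by simp
qed

lemma total_rec_less: assumes "total_rec n f" "total_rec n g"
  shows "total_rec n (\<lambda>xs. if f xs < g xs then 1 else 0)"
proof (rule total_rec.ext)
  show "total_rec n (\<lambda>xs. 1 - (1 - (g xs - f xs)))" by (intro total_rec_diff total_rec_const assms)
  show "\<forall>xs. length xs = n \<longrightarrow> (if f xs < g xs then 1 else 0) = 1 - (1 - (g xs - f xs))" by auto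
qed

text \<open>Once \<open>u\<close> is within \<open>d\<close> of \<open>t\<close>, \<open>S\<close>
  grows only while below \<open>n * (t + d)\<close> and has to grow while below
  \<open>n * (t - d)\<close>. Up to the initial segment of length \<open>N\<close> and one step it
  thus stays between these lines.\<close>

lemma greedy_density:
  fixes S :: "nat \<Rightarrow> nat" and u :: "nat \<Rightarrow> real"
  assumes S0: "S 0 = 0" and S: "\<And>n. S (Suc n) = S n + (if real (S n) < real n * u n then 1 else 0)"
    and u: "u \<longlonglongrightarrow> t" and t: "0 \<le> t" "t \<le> 1"
  shows "(\<lambda>n. real (S n) / real n) \<longlonglongrightarrow> t"
proof (rule LIMSEQ_I)
  fix r :: real assume r: "0 < r"
  define d where "d = r / 2"
  have d: "0 < d" using r by (simp add: d_def)
  obtain N where N: "\<And>n. N \<le> n \<Longrightarrow> norm (u n - t) < d" using LIMSEQ_D[OF u d] by blast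
  have Sle: "S n \<le> n" for n by (induction n) (auto simp: S0 S)
  have up: "real (S n) \<le> real N + real n * (t + d) + 1" for n
  proof (induction n)
    case 0 show ?case by (simp add: S0)
  next
    case (Suc n)
    have m: "real n * (t + d) \<le> real (Suc n) * (t + d)" using t d by (intro mult_right_mono) auto
    show ?case
    proof (cases "real (S n) < real n * u n")
      case False then show ?thesis using Suc m by (simp add: S)
    next
      case True
      then have e: "real (S (Suc n)) = real (S n) + 1" by (simp add: S)
      show ?thesis
      proof (cases "N \<le> n")
        case True
        have "real n * u n \<le> real n * (t + d)" using N[OF True] by (intro mult_left_mono) auto
        then show ?thesis using m e \<open>real (S n) < real n * u n\<close> by linarith
      next
        case False
        have "real (S n) \<le> real N" using Sle[of n] False by linarith
        moreover have "0 \<le> real (Suc n) * (t + d)" using t d by (intro mult_nonneg_nonneg) auto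
        ultimately show ?thesis using e by linarith
      qed
    qed
  qed
  have lo: "real n * (t - d) - real N - 1 \<le> real (S n)" for n
  proof (induction n)
    case 0 show ?case by (simp add: S0)
  next
    case (Suc n)
    have m: "real (Suc n) * (t - d) = real n * (t - d) + (t - d)" by (simp add: algebra_simps)
    show ?case
    proof (cases "real (S n) < real n * u n")
      case True
      then have "real (S (Suc n)) = real (S n) + 1" by (simp add: S)
      then show ?thesis using Suc m t d by linarith
    next
      case False
      then have e: "S (Suc n) = S n" by (simp add: S)
      show ?thesis
      proof (cases "N \<le> n")
        case True
        have "real n * (t - d) \<le> real n * u n" using N[OF True] by (intro mult_left_mono) auto
        then show ?thesis using m e False t d by linarith
      next
        case F: False
        have "real (Suc n) * (t - d) \<le> real (Suc n) * 1" using t d by (intro mult_left_mono) auto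
        also have "\<dots> \<le> real N" using F by simp
        finally have "real (Suc n) * (t - d) - real N - 1 \<le> 0" by simp
        also have "0 \<le> real (S (Suc n))" by simp
        finally show ?thesis .
      qed
    qed
  qed
  obtain n0 where n0: "(real N + 1) / d < real n0" using reals_Archimedean2 by blast
  show "\<exists>no. \<forall>n\<ge>no. norm (real (S n) / real n - t) < r"
  proof (intro exI[of _ "Suc n0"] allI impI)
    fix n assume n: "Suc n0 \<le> n"
    have "(real N + 1) / d < real n" using n0 n by linarith
    then have a: "real N + 1 < real n * d" using d by (simp add: field_simps)
    have n1: "0 < real n" using n by simp
    have "real (S n) < real n * (t + 2 * d)" using up[of n] a by (simp add: algebra_simps)
    moreover have "real n * (t - 2 * d) < real (S n)" using lo[of n] a by (simp add: algebra_simps)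
    ultimately have "real (S n) / real n < t + 2 * d" "t - 2 * d < real (S n) / real n"
      using n1 by (simp_all add: field_simps)
    then show "norm (real (S n) / real n - t) < r" by (simp add: d_def abs_if)
  qed
qed

lemma Delta2_greedy:
  assumes "Delta2_computable x" "0 \<le> x" "x \<le> 2"
  shows "\<exists>S b. S 0 = 0 \<and> (\<forall>n. S (Suc n) = S n + b n) \<and> (\<forall>n. b n \<le> 1) \<and> total_rec 1 (\<lambda>xs. b (hd xs)) \<and>
    (\<lambda>n. real (S n) / real n) \<longlonglongrightarrow> 1 - x / 2"
proof -
  obtain r a b c where r: "r \<longlonglongrightarrow> x" and abc: "computable_nat_fun a" "computable_nat_fun b" "computable_nat_fun c"
    and re: "\<And>n. r n = (real (a n) - real (b n)) / (real (c n) + 1)"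
    using assms(1) unfolding Delta2_computable_def computable_rat_seq_def by blast
  have rec: "total_rec 1 (\<lambda>xs. a (hd xs))" "total_rec 1 (\<lambda>xs. b (hd xs))" "total_rec 1 (\<lambda>xs. c (hd xs))"
    using abc unfolding computable_nat_fun_def by auto
  \<comment> \<open>The test \<open>s < n * (1 - r n / 2)\<close>, cleared of denominators and with
    the negative term moved across, so that only natural numbers occur.\<close>
  define e :: "nat \<Rightarrow> nat \<Rightarrow> nat" where
    "e n s = (if 2 * Suc (c n) * s + n * a n < n * (2 * Suc (c n) + b n) then 1 else 0)" for n s
  have tre: "total_rec n (\<lambda>xs. e (f xs) (g xs))" if "total_rec n f" "total_rec n g" for n f g
    unfolding e_def
    by (intro total_rec_less total_rec_add total_rec_mult total_rec_Suc total_rec_const that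
        total_rec_comp1[OF rec(1)] total_rec_comp1[OF rec(2)] total_rec_comp1[OF rec(3)])
  define S where "S = rec_nat 0 (\<lambda>n s. s + e n s)"
  have S: "S 0 = 0" "S (Suc n) = S n + e n (S n)" for n by (simp_all add: S_def)
  have trS: "total_rec 1 (\<lambda>xs. S (hd xs))"
  proof -
    have "total_rec 2 (\<lambda>xs. xs ! 1 + e (xs ! 0) (xs ! 1))"
      by (intro total_rec_add tre total_rec.proj) auto
    then have "total_rec (Suc 0) (\<lambda>xs. rec_nat 0 (\<lambda>y r. (y # r # tl xs) ! 1 + e ((y # r # tl xs) ! 0) ((y # r # tl xs) ! 1)) (hd xs))"
      using total_rec.prim[OF total_rec.zero[of 0], of "\<lambda>xs. xs ! 1 + e (xs ! 0) (xs ! 1)"] by (simp add: numeral_2_eq_2)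
    then show ?thesis by (simp add: S_def)
  qed
  define u where "u n = 1 - r n / 2" for n
  have lim: "(\<lambda>n. real (S n) / real n) \<longlonglongrightarrow> 1 - x / 2"
  proof (rule greedy_density[where u = u])
    show "u \<longlonglongrightarrow> 1 - x / 2" unfolding u_def by (intro tendsto_intros r) simp
    show "0 \<le> 1 - x / 2" "1 - x / 2 \<le> 1" using assms by auto
    fix n
    have c: "0 < 2 * (real (c n) + 1)" by simp
    have u: "u n = (2 * (real (c n) + 1) + real (b n) - real (a n)) / (2 * (real (c n) + 1))"
      unfolding u_def re using c by (simp add: field_simps)
    have "real (S n) < real n * u n \<longleftrightarrow>
        2 * (real (c n) + 1) * real (S n) < real n * (2 * (real (c n) + 1) + real (b n) - real (a n))"
      unfolding u times_divide_eq_right pos_less_divide_eq[OF c] by (simp only: mult.commute)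
    also have "\<dots> \<longleftrightarrow> 2 * (real (c n) + 1) * real (S n) + real n * real (a n) < real n * (2 * (real (c n) + 1) + real (b n))"
      by (simp add: algebra_simps)
    also have "\<dots> \<longleftrightarrow> real (2 * Suc (c n) * S n + n * a n) < real (n * (2 * Suc (c n) + b n))"
      by (simp add: algebra_simps)
    also have "\<dots> \<longleftrightarrow> 2 * Suc (c n) * S n + n * a n < n * (2 * Suc (c n) + b n)" by (simp only: of_nat_less_iff)
    finally show "S (Suc n) = S n + (if real (S n) < real n * u n then 1 else 0)" by (simp add: S(2) e_def)
  qed (rule S(1))
  have "total_rec 1 (\<lambda>xs. e (hd xs) (S (hd xs)))"
    using total_rec_hd[of 0] by (intro tre total_rec_comp1[OF trS]) auto
  moreover have "e n (S n) \<le> 1" for n by (simp add: e_def)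
  ultimately show ?thesis using S lim by (intro exI[of _ S] exI[of _ "\<lambda>n. e n (S n)"]) auto
qed

section \<open>The bit-producing machine\<close>

locale greedy =
  fixes S b :: "nat \<Rightarrow> nat"
  assumes S_0: "S 0 = 0" and S_Suc: "S (Suc n) = S n + b n" and b_le: "b n \<le> 1"
begin

text \<open>Registers 0 and 2 hold the numbers of bits 1 and 0. The relation is demanded at every
  step and not only between bits, because the driver uses both registers after each single
  instruction.\<close>

definition good :: "(nat \<Rightarrow> nat) \<Rightarrow> bool" where
  "good v \<longleftrightarrow> v 1 = 0 \<and> v 3 = 0 \<and> v 0 = S (v 0 + v 2)"

definition gstep :: "ccfg \<Rightarrow> ccfg \<Rightarrow> bool" where
  "gstep x y \<longleftrightarrow> y = cstep x \<and> good (snd y) \<and> snd x 0 + snd x 2 \<le> snd y 0 + snd y 2 \<and>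
     snd y 0 + snd y 2 \<le> Suc (snd x 0 + snd x 2)"

definition grun :: "com \<Rightarrow> (nat \<Rightarrow> nat) \<Rightarrow> (nat \<Rightarrow> nat) \<Rightarrow> bool" where
  "grun c v w \<longleftrightarrow> (\<forall>K. gstep\<^sup>*\<^sup>* (c # K, v) (K, w))"

lemma S_le: "S n \<le> n"
proof (induction n)
  case (Suc n) then show ?case using S_Suc[of n] b_le[of n] by linarith
qed (simp add: S_0)

lemma good_cong: "(\<And>r. r < 4 \<Longrightarrow> v r = w r) \<Longrightarrow> good v = good w"
  unfolding good_def by simp

lemma gstep_same: "y = cstep x \<Longrightarrow> good (snd x) \<Longrightarrow> snd y = snd x \<Longrightarrow> gstep x y"
  unfolding gstep_def by simp

lemma grun_crun:
  assumes "crun c v w" "good v" shows "grun c v w"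
  unfolding grun_def
proof
  fix K
  have "qstep\<^sup>*\<^sup>* x y \<Longrightarrow> good (snd x) \<Longrightarrow> gstep\<^sup>*\<^sup>* x y \<and> good (snd y)" for x y
  proof (induction rule: rtranclp_induct)
    case (step y z)
    have q: "z = cstep y" "\<And>r. r < 4 \<Longrightarrow> snd z r = snd y r" using step(2) unfolding qstep_def by auto
    have "good (snd z)" using step(3,4) good_cong[of "snd z" "snd y"] q(2) by blast
    then have "gstep y z" using q by (simp add: gstep_def)
    then show ?case using step(3,4) \<open>good (snd z)\<close> by (auto intro: rtranclp.rtrancl_into_rtrancl)
  qed simp
  from this[of "(c # K, v)" "(K, w)"] show "gstep\<^sup>*\<^sup>* (c # K, v) (K, w)" using assms unfolding crun_def by simp
qed

lemma grun_Seq: assumes "good u" "grun a u v" "grun c v w" shows "grun (CSeq a c) u w"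
  unfolding grun_def
proof
  fix K
  have "gstep (CSeq a c # K, u) (a # c # K, u)" using assms(1) by (intro gstep_same) auto
  moreover have "gstep\<^sup>*\<^sup>* (a # c # K, u) (c # K, v)" using assms(2) unfolding grun_def by blast
  moreover have "gstep\<^sup>*\<^sup>* (c # K, v) (K, w)" using assms(3) unfolding grun_def by blast
  ultimately show "gstep\<^sup>*\<^sup>* (CSeq a c # K, u) (K, w)" by (meson converse_rtranclp_into_rtranclp rtranclp_trans)
qed

text \<open>Compiled programs never change the reserved registers, so writing a bit is treated
  apart. As \<open>v 6 \<le> 1\<close>, there is at most one increment, and the count of bits grows
  by at most one.\<close>

lemma grun_flush:
  assumes v: "good v" "v 6 \<le> 1" and r: "r = 0 \<or> r = 2" and w: "w = v(6 := 0, r := v r + v 6)" "good w"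
  shows "grun (CLoop 6 (CSeq (CDec 6) (CInc r))) v w"
proof (cases "v 6 = 0")
  case True
  then have "w = v" using w(1) r by (auto simp: fun_eq_iff)
  then show ?thesis using grun_crun[OF crun_Loop0[of v 6 "CSeq (CDec 6) (CInc r)"]] True v by simp
next
  case False
  then have v6: "v 6 = 1" using v by simp
  let ?c = "CSeq (CDec 6) (CInc r)" let ?u = "v(6 := 0)"
  have gu: "good ?u" using v(1) good_cong[of ?u v] by auto
  have 1: "grun (CDec 6) v ?u" using grun_crun[OF crun_Dec[of 6 v] v(1)] v6 by simp
  have 2: "grun (CInc r) ?u w"
    unfolding grun_def
  proof
    fix K
    have "gstep (CInc r # K, ?u) (K, w)" using w r v6 by (auto simp: gstep_def)
    then show "gstep\<^sup>*\<^sup>* (CInc r # K, ?u) (K, w)" by blast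
  qed
  have w6: "w 6 = 0" using w r by auto
  have 3: "grun (CLoop 6 ?c) w w" by (rule grun_crun[OF crun_Loop0[of w 6, OF w6] w(2)])
  show ?thesis unfolding grun_def
  proof
    fix K
    have "gstep (CLoop 6 ?c # K, v) (?c # CLoop 6 ?c # K, v)" using v(1) v6 by (intro gstep_same) auto
    moreover have "gstep\<^sup>*\<^sup>* (?c # CLoop 6 ?c # K, v) (CLoop 6 ?c # K, w)" using grun_Seq[OF v(1) 1 2] unfolding grun_def by blast
    moreover have "gstep\<^sup>*\<^sup>* (CLoop 6 ?c # K, w) (K, w)" using 3 unfolding grun_def by blast
    ultimately show "gstep\<^sup>*\<^sup>* (CLoop 6 ?c # K, v) (K, w)" by (meson converse_rtranclp_into_rtranclp rtranclp_trans)
  qed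
qed

lemma gstep_path:
  assumes "gstep\<^sup>*\<^sup>* x y"
  shows "\<exists>L. y = (cstep ^^ L) x \<and> (\<forall>j<L. gstep ((cstep ^^ j) x) ((cstep ^^ Suc j) x))"
  using assms
proof (induction rule: rtranclp_induct)
  case base show ?case by (intro exI[of _ 0]) simp
next
  case (step y z)
  then obtain L where L: "y = (cstep ^^ L) x" "\<forall>j<L. gstep ((cstep ^^ j) x) ((cstep ^^ Suc j) x)" by blast
  have z: "z = (cstep ^^ Suc L) x" using step(2) L(1) unfolding gstep_def by simp
  show ?case using L z step(2) by (intro exI[of _ "Suc L"]) (auto simp: less_Suc_eq)
qed

lemma machine_exists:
  assumes "total_rec 1 (\<lambda>xs. b (hd xs))"
  shows "\<exists>c. \<forall>i. good (snd ((cstep ^^ i) ([c], \<lambda>_. 0))) \<and> gstep ((cstep ^^ i) ([c], \<lambda>_. 0)) ((cstep ^^ Suc i) ([c], \<lambda>_. 0)) \<and>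
     (\<exists>L. snd ((cstep ^^ L) ([c], \<lambda>_. 0)) 0 + snd ((cstep ^^ L) ([c], \<lambda>_. 0)) 2 = i)"
proof -
  have tr: "total_rec 1 (\<lambda>xs. 1 - b (hd xs))" by (intro total_rec_diff total_rec_const assms)
  have js: "length [5::nat] = 1" "\<forall>i\<in>set [5::nat]. 4 \<le> i \<and> i < 7 \<and> i \<noteq> 6" "4 \<le> (6::nat)" "6 < (7::nat)" by auto
  obtain c1 where c1: "\<forall>v. (\<forall>i\<ge>7. v i = 0) \<longrightarrow> v 6 = 0 \<longrightarrow> crun c1 v (v(6 := b (hd (map v [5]))))"
    by (rule compilesD[OF total_rec_compiles[OF assms] js])
  obtain c2 where c2: "\<forall>v. (\<forall>i\<ge>7. v i = 0) \<longrightarrow> v 6 = 0 \<longrightarrow> crun c2 v (v(6 := 1 - b (hd (map v [5]))))"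
    by (rule compilesD[OF total_rec_compiles[OF tr] js])
  define f1 where "f1 = CLoop 6 (CSeq (CDec 6) (CInc 0))"
  define f2 where "f2 = CLoop 6 (CSeq (CDec 6) (CInc 2))"
  \<comment> \<open>First \<open>b n\<close> is added to register 0, then \<open>1 - b n\<close> to
    register 2. Exactly one of the two flushes increments, so \<open>good\<close> holds in between
    as well.\<close>
  define body where "body = CSeq c1 (CSeq f1 (CSeq c2 (CSeq f2 (CInc 5))))"
  \<comment> \<open>Register 4 stays at 1 and keeps the main loop running, 5 is the number of
    finished bits, 6 receives a computed bit, and the registers from 7 on are scratch space.\<close>
  define hv :: "nat \<Rightarrow> nat \<Rightarrow> nat" where "hv n = (\<lambda>_. 0)(4 := 1, 5 := n, 0 := S n, 2 := n - S n)" for n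
  have ghv: "good (hv n)" for n using S_le[of n] by (simp add: good_def hv_def)
  have gb: "grun body (hv n) (hv (Suc n))" for n
  proof -
    define A where "A = (hv n)(6 := b n)"
    define B where "B = A(6 := 0, 0 := A 0 + A 6)"
    define C where "C = B(6 := 1 - b n)"
    define D where "D = C(6 := 0, 2 := C 2 + C 6)"
    have bn: "b n = 0 \<or> b n = 1" using b_le[of n] by linarith
    have gA: "good A" using ghv[of n] good_cong[of A "hv n"] by (auto simp: A_def)
    have gB: "good B" using S_le[of n] bn S_Suc[of n] by (auto simp: good_def B_def A_def hv_def)
    have gC: "good C" using gB good_cong[of C B] by (auto simp: C_def)
    have gD: "good D" using S_le[of n] bn S_Suc[of n] by (auto simp: good_def D_def C_def B_def A_def hv_def)
    have "crun c1 (hv n) ((hv n)(6 := b (hd (map (hv n) [5]))))" by (rule c1[rule_format]) (auto simp: hv_def)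
    then have 1: "grun c1 (hv n) A" using grun_crun ghv by (simp add: A_def hv_def)
    have 2: "grun f1 A B" unfolding f1_def by (rule grun_flush[OF gA _ _ B_def gB]) (use b_le in \<open>auto simp: A_def\<close>)
    have "crun c2 B (B(6 := 1 - b (hd (map B [5]))))" by (rule c2[rule_format]) (auto simp: B_def A_def hv_def)
    then have 3: "grun c2 B C" using grun_crun gB by (simp add: C_def B_def A_def hv_def)
    have 4: "grun f2 C D" unfolding f2_def by (rule grun_flush[OF gC _ _ D_def gD]) (auto simp: C_def)
    have "D(5 := D 5 + 1) = hv (Suc n)"
      using S_le[of n] bn S_Suc[of n] by (auto simp: fun_eq_iff D_def C_def B_def A_def hv_def)
    then have 5: "grun (CInc 5) D (hv (Suc n))" using grun_crun[OF crun_Inc[of 5 D] gD] by simp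
    show ?thesis unfolding body_def
      by (rule grun_Seq[OF ghv 1 grun_Seq[OF gA 2 grun_Seq[OF gB 3 grun_Seq[OF gC 4 5]]]])
  qed
  define main where "main = CSeq (CInc 4) (CLoop 4 body)"
  let ?x = "([main], \<lambda>_. 0) :: ccfg"
  have g0: "good (\<lambda>_. 0)" by (simp add: good_def S_0)
  have path: "gstep\<^sup>*\<^sup>* ?x ([CLoop 4 body], hv n)" for n
  proof (induction n)
    case 0
    have e: "(\<lambda>_. 0)(4 := 0 + 1) = hv 0" by (auto simp: hv_def S_0 fun_eq_iff)
    have 1: "gstep ?x ([CInc 4, CLoop 4 body], \<lambda>_. 0)" using g0 by (intro gstep_same) (auto simp: main_def)
    have 2: "gstep\<^sup>*\<^sup>* ([CInc 4, CLoop 4 body], \<lambda>_. 0) ([CLoop 4 body], hv 0)"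
      using grun_crun[OF crun_Inc[of 4 "\<lambda>_. 0"] g0] unfolding grun_def e by simp
    show ?case by (rule converse_rtranclp_into_rtranclp[OF 1 2])
  next
    case (Suc n)
    have "gstep ([CLoop 4 body], hv n) ([body, CLoop 4 body], hv n)" using ghv[of n] by (intro gstep_same) (auto simp: hv_def)
    moreover have "gstep\<^sup>*\<^sup>* ([body, CLoop 4 body], hv n) ([CLoop 4 body], hv (Suc n))"
      using gb[of n] unfolding grun_def by blast
    ultimately show ?case using Suc by (meson converse_rtranclp_into_rtranclp rtranclp_trans)
  qed
  let ?Y = "\<lambda>i. (cstep ^^ i) ?x"
  let ?C = "\<lambda>i. snd (?Y i) 0 + snd (?Y i) 2"
  \<comment> \<open>The time between two bits is unknown, but the count grows by at most one per
    step; so at least \<open>n\<close> steps precede the return with count \<open>n\<close>, and all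
    of these are of the form \<open>gstep\<close>.\<close>
  have len: "\<exists>L\<ge>n. ?C L = n \<and> (\<forall>j<L. gstep (?Y j) (?Y (Suc j)))" for n
  proof -
    obtain L where L: "([CLoop 4 body], hv n) = ?Y L" "\<forall>j<L. gstep (?Y j) (?Y (Suc j))"
      using gstep_path[OF path[of n]] by blast
    have c: "?C L = n" using L(1)[symmetric] S_le[of n] by (simp add: hv_def)
    have "j \<le> L \<Longrightarrow> ?C j \<le> j" for j
    proof (induction j)
      case (Suc j)
      then have "gstep (?Y j) (?Y (Suc j))" using L(2) by auto
      then have "?C (Suc j) \<le> Suc (?C j)" unfolding gstep_def by blast
      also have "\<dots> \<le> Suc j" using Suc by simp
      finally show ?case .
    qed simp
    from this[of L] c have "n \<le> L" by simp
    then show ?thesis using c L(2) by blast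
  qed
  have gs: "gstep (?Y i) (?Y (Suc i))" for i using len[of "Suc i"] by (metis Suc_le_lessD)
  have gd: "good (snd (?Y i))" for i
  proof (cases i)
    case 0 then show ?thesis using g0 by simp
  next
    case (Suc j) then show ?thesis using gs[of j] unfolding gstep_def by blast
  qed
  show ?thesis
  proof (intro exI[of _ main] allI conjI)
    fix i
    show "\<exists>L. ?C L = i" using len[of i] by blast
  qed (rule gd gs)+
qed

end

text \<open>In complete rounds the proportion of moves tends to \<open>h\<close>. The round in
  progress is negligible: the count grows by at most one per round, hence \<open>T i\<close> is at
  least \<open>2 * C i ^ 2\<close>, while the round has only \<open>4 * C i + 5\<close>
  steps.\<close>

lemma driver_cesaro:
  fixes A C T s :: "nat \<Rightarrow> nat"
  assumes AC: "\<And>i. A i \<le> C i" and C: "C 0 = 0" "\<And>i. C (Suc i) \<le> Suc (C i)" "\<And>i. C i \<le> C (Suc i)" "\<And>n. \<exists>i. n \<le> C i"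
    and lim: "(\<lambda>i. real (A i) / real (C i)) \<longlonglongrightarrow> h" and h: "0 \<le> h" "h \<le> 1"
    and T: "T 0 = 0" "\<And>i. T (Suc i) = T i + (4 * C i + 5)"
    and s: "mono s" "\<And>i. s (T (Suc i)) = s (T i) + (4 * A i + 2)"
  shows "(\<lambda>k. real (s k) / real k) \<longlonglongrightarrow> h"
proof (rule LIMSEQ_I)
  fix r :: real assume r: "0 < r"
  define e where "e = r / 4"
  have e: "0 < e" using r by (simp add: e_def)
  have monoC: "mono C" using C(3) by (simp add: mono_iff_le_Suc)
  have monoT: "mono T" using T(2) by (simp add: mono_iff_le_Suc)
  obtain N1 where N1: "\<And>i. N1 \<le> i \<Longrightarrow> norm (real (A i) / real (C i) - h) < e / 2"
    using LIMSEQ_D[OF lim, of "e / 2"] e by auto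
  obtain n2 where n2: "5 / (2 * e) < real n2" using reals_Archimedean2 by blast
  obtain N2 where N2: "Suc n2 \<le> C N2" using C(4) by blast
  define N where "N = max N1 N2"
  have inc: "\<bar>(4 * real (A i) + 2) - h * (4 * real (C i) + 5)\<bar> \<le> e * (4 * real (C i) + 5)" if "N \<le> i" for i
  proof -
    have "Suc n2 \<le> C i" using N2 monoD[OF monoC, of N2 i] that by (simp add: N_def)
    then have c: "0 < real (C i)" "5 / (2 * e) < real (C i)" using n2 by linarith+
    have "\<bar>real (A i) / real (C i) - h\<bar> < e / 2" using N1[of i] that by (simp add: N_def)
    then have "- (e / 2) < real (A i) / real (C i) - h" "real (A i) / real (C i) - h < e / 2" by linarith+
    then have "(h - e / 2) * real (C i) < real (A i)" "real (A i) < (h + e / 2) * real (C i)"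
      using c(1) by (simp_all add: field_simps)
    then have a: "h * real (C i) - e * real (C i) / 2 < real (A i)" "real (A i) < h * real (C i) + e * real (C i) / 2"
      by (simp_all add: algebra_simps)
    have "5 < 2 * (e * real (C i))" using c(2) e by (simp add: field_simps)
    then have "\<bar>(4 * real (A i) + 2) - (4 * (h * real (C i)) + 5 * h)\<bar> \<le> 4 * (e * real (C i)) + 5 * e"
      unfolding abs_le_iff using a h e by linarith
    then show ?thesis by (simp add: algebra_simps)
  qed
  define E where "E i = real (s (T i)) - h * real (T i)" for i
  have Eb: "\<bar>E (N + i)\<bar> \<le> \<bar>E N\<bar> + e * (real (T (N + i)) - real (T N))" for i
  proof (induction i)
    case (Suc i)
    have "E (N + Suc i) = E (N + i) + ((4 * real (A (N + i)) + 2) - h * (4 * real (C (N + i)) + 5))"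
      by (simp add: E_def s(2)) (simp add: T(2) algebra_simps)
    then have "\<bar>E (N + Suc i)\<bar> \<le> \<bar>E (N + i)\<bar> + e * (4 * real (C (N + i)) + 5)" using inc[of "N + i"] by simp
    also have "e * (4 * real (C (N + i)) + 5) = e * (real (T (N + Suc i)) - real (T (N + i)))" by (simp add: T(2))
    finally show ?case using Suc by (simp add: algebra_simps)
  qed simp
  have sq: "2 * (C i * C i) \<le> T i" for i
  proof (induction i)
    case (Suc i)
    have "C (Suc i) = C i \<or> C (Suc i) = Suc (C i)" using C(2)[of i] C(3)[of i] by linarith
    then show ?case using Suc by (auto simp: T(2))
  qed (simp add: C T)
  have Tge: "i \<le> T i" for i by (induction i) (auto simp: T)
  define B where "B = \<bar>E N\<bar> + 5 + 2 / e"
  have key: "\<bar>real (s k) - h * real k\<bar> \<le> 2 * e * real k + B" if k: "T N \<le> k" for k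
  proof -
    define i where "i = (LEAST j. k < T (Suc j))"
    have "k < T (Suc k)" using Tge[of "Suc k"] by simp
    then have i1: "k < T (Suc i)" unfolding i_def by (rule LeastI)
    have i0: "T i \<le> k"
    proof (cases i)
      case (Suc j) then show ?thesis using not_less_Least[of j "\<lambda>j. k < T (Suc j)"] by (simp add: i_def)
    qed (simp add: T)
    have "N \<le> i"
    proof (rule ccontr)
      assume "\<not> N \<le> i" then have "T (Suc i) \<le> T N" by (intro monoD[OF monoT]) simp
      then show False using i1 k by simp
    qed
    then obtain j where ij: "i = N + j" using le_Suc_ex by blast
    have "\<bar>E i\<bar> \<le> \<bar>E N\<bar> + e * (real (T i) - real (T N))" using Eb[of j] by (simp add: ij)
    also have "\<dots> \<le> \<bar>E N\<bar> + e * real k" using i0 e by (intro add_left_mono mult_left_mono) auto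
    finally have Ei: "\<bar>E i\<bar> \<le> \<bar>E N\<bar> + e * real k" .
    have s1: "s (T i) \<le> s k" by (rule monoD[OF s(1) i0])
    have "s k \<le> s (T (Suc i))" by (rule monoD[OF s(1)]) (use i1 in simp)
    also have "\<dots> \<le> s (T i) + (4 * C i + 5)" using AC[of i] by (simp add: s(2))
    finally have s2: "s k \<le> s (T i) + (4 * C i + 5)" .
    have h1: "h * real (T i) \<le> h * real k" using h i0 by (intro mult_left_mono) auto
    have "h * (real k - real (T i)) \<le> 1 * (real k - real (T i))" using h i0 by (intro mult_right_mono) auto
    moreover have "k \<le> T i + (4 * C i + 5)" using i1 by (simp add: T(2))
    ultimately have h2: "h * real k \<le> h * real (T i) + (4 * real (C i) + 5)" by (simp add: algebra_simps)
    have "2 * (C i * C i) \<le> k" using sq[of i] i0 by linarith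
    then have "real (2 * (C i * C i)) \<le> real k" by (simp only: of_nat_le_iff)
    then have "e * (2 * (real (C i) * real (C i))) \<le> e * real k" using e by simp
    moreover have "4 * real (C i) \<le> e * (2 * (real (C i) * real (C i))) + 2 / e"
    proof -
      \<comment> \<open>Expanding the square bounds the length of the current round by a small
        multiple of the elapsed time plus a constant.\<close>
      have "0 \<le> 2 / e * (e * real (C i) - 1)\<^sup>2" using e by simp
      also have "\<dots> = e * (2 * (real (C i) * real (C i))) + 2 / e - 4 * real (C i)"
        using e by (simp add: power2_eq_square field_simps)
      finally show ?thesis by simp
    qed
    ultimately have c: "4 * real (C i) \<le> e * real k + 2 / e" by linarith
    have "real (s k) \<le> real (s (T i)) + (4 * real (C i) + 5)" "real (s (T i)) \<le> real (s k)" using s1 s2 by linarith+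
    then have "\<bar>real (s k) - h * real k\<bar> \<le> \<bar>E i\<bar> + (4 * real (C i) + 5)" using h1 h2 unfolding E_def by linarith
    then show ?thesis using Ei c unfolding B_def by linarith
  qed
  obtain n0 where n0: "2 * B / r < real n0" using reals_Archimedean2 by blast
  show "\<exists>no. \<forall>k\<ge>no. norm (real (s k) / real k - h) < r"
  proof (intro exI[of _ "T N + Suc n0"] allI impI)
    fix k assume k: "T N + Suc n0 \<le> k"
    then have "2 * B / r < real k" "0 < real k" using n0 by linarith+
    then have a: "2 * B < r * real k" using r by (simp add: field_simps)
    have "\<bar>real (s k) - h * real k\<bar> < r * real k" using key[of k] k a by (simp add: e_def)
    then have "- (r * real k) < real (s k) - h * real k" "real (s k) - h * real k < r * real k" by linarith+
    then have "- r < real (s k) / real k - h" "real (s k) / real k - h < r"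
      using \<open>0 < real k\<close> by (simp_all add: field_simps)
    then show "norm (real (s k) / real k - h) < r" by simp
  qed
qed

section \<open>The driver\<close>

text \<open>In phases 0 to 7 the registers are poured from 0 to 1 and back, then from 2 to 3 and back; even phases test and decrement, odd phases
  increment.  In phase 8 one instruction of the program is carried out.  Marker 1 moves in phases 0 to 3 only, so a round moves it in a
  proportion given by the registers 0 and 2.\<close>

definition tdst :: "nat \<Rightarrow> nat" where "tdst i = (if even i then i + 1 else i - 1)"

text \<open>\<open>Inl r\<close> stands for an increment of register \<open>r\<close>,
  \<open>Inr r\<close> for a decrement. Only the set \<open>Z\<close> of zero registers is
  consulted, since coincidences with marker 0 are all that the control can see.\<close>

definition dins :: "nat \<times> com list \<Rightarrow> nat set \<Rightarrow> (nat + nat) option" where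
  "dins q Z = (if fst q < 8 then
      (if even (fst q) then (if fst q div 2 \<in> Z then None else Some (Inr (fst q div 2)))
       else Some (Inl (tdst (fst q div 2))))
    else (case snd q of CInc r # _ \<Rightarrow> Some (Inl r) | CDec r # _ \<Rightarrow> if r \<in> Z then None else Some (Inr r) | _ \<Rightarrow> None))"

text \<open>The next continuation depends on the registers only through zero tests, so
  \<open>cstep\<close> may be evaluated on an indicator function of the nonzero registers.\<close>

definition dnxt :: "nat \<times> com list \<Rightarrow> nat set \<Rightarrow> nat \<times> com list" where
  "dnxt q Z = (if fst q < 8 then
      (if even (fst q) then (if fst q div 2 \<in> Z then fst q + 2 else fst q + 1) else fst q - 1, snd q)
    else (0, fst (cstep (snd q, \<lambda>r. if r \<in> Z then 0 else 1))))"

definition dapp :: "(nat + nat) option \<Rightarrow> (nat \<Rightarrow> nat) \<Rightarrow> nat \<Rightarrow> nat" where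
  "dapp I v = (case I of None \<Rightarrow> v | Some (Inl r) \<Rightarrow> v(r := v r + 1) | Some (Inr r) \<Rightarrow> v(r := v r - 1))"

fun hreg :: "com list \<Rightarrow> nat set" where
  "hreg (CInc r # K) = {r}"
| "hreg (CDec r # K) = {r}"
| "hreg (CLoop r c # K) = {r}"
| "hreg _ = {}"

lemma finite_hreg: "finite (hreg K)" by (cases K rule: hreg.cases) auto

type_synonym dcfg = "(nat \<times> com list) \<times> (nat \<Rightarrow> nat) \<times> nat \<times> nat"

definition dzero :: "nat \<Rightarrow> (nat \<Rightarrow> nat) \<Rightarrow> nat set" where "dzero m v = {r. r < m \<and> v r = 0}"

text \<open>The last two components of a configuration are the positions of marker 1 and of marker 0.\<close>

definition dstep :: "nat \<Rightarrow> dcfg \<Rightarrow> dcfg" where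
  "dstep m = (\<lambda>(q, v, s, t). (dnxt q (dzero m v), dapp (dins q (dzero m v)) v,
     s + of_bool (fst q < 4), t + of_bool (\<exists>r. dins q (dzero m v) = Some (Inr r))))"

text \<open>Pouring out \<open>n\<close> units takes \<open>n\<close> pairs of a decrement and an
  increment, followed by one zero test.\<close>

lemma dstep_transfer:
  assumes i: "i < 4" and m: "4 \<le> m"
  shows "v i = n \<Longrightarrow> (dstep m ^^ (2 * n + 1)) ((2 * i, K), v, s, t) =
    ((2 * i + 2, K), v(i := 0, tdst i := v (tdst i) + n), s + (if i < 2 then 2 * n + 1 else 0), t + n)"
proof (induction n arbitrary: v s t)
  case 0
  have "tdst i \<noteq> i" by (cases i) (auto simp: tdst_def)
  then show ?case using i m 0 by (auto simp: dstep_def dnxt_def dins_def dapp_def dzero_def fun_eq_iff)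
next
  case (Suc n)
  have d: "tdst i \<noteq> i" by (cases i) (auto simp: tdst_def)
  let ?u = "v(i := n, tdst i := v (tdst i) + 1)"
  have 1: "dstep m (dstep m ((2 * i, K), v, s, t)) = ((2 * i, K), ?u, s + (if i < 2 then 2 else 0), t + 1)"
    using i m d Suc.prems by (auto simp: dstep_def dnxt_def dins_def dapp_def dzero_def fun_eq_iff)
  have e: "2 * Suc n + 1 = (2 * n + 1) + 2" by simp
  have "(dstep m ^^ (2 * Suc n + 1)) ((2 * i, K), v, s, t) = (dstep m ^^ (2 * n + 1)) ((dstep m ^^ 2) ((2 * i, K), v, s, t))"
    unfolding e funpow_add by simp
  also have "(dstep m ^^ 2) ((2 * i, K), v, s, t) = ((2 * i, K), ?u, s + (if i < 2 then 2 else 0), t + 1)"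
    using 1 by (simp add: numeral_2_eq_2)
  also have "(dstep m ^^ (2 * n + 1)) \<dots> = ((2 * i + 2, K), ?u(i := 0, tdst i := ?u (tdst i) + n),
      s + (if i < 2 then 2 else 0) + (if i < 2 then 2 * n + 1 else 0), t + 1 + n)"
    by (rule Suc.IH) (use d in simp)
  also have "\<dots> = ((2 * i + 2, K), v(i := 0, tdst i := v (tdst i) + Suc n), s + (if i < 2 then 2 * Suc n + 1 else 0), t + Suc n)"
    using d by (auto simp: fun_eq_iff)
  finally show ?case .
qed

lemma dstep_exec:
  assumes "hreg K \<subseteq> {..<m}"
  shows "\<exists>t'\<ge>t. dstep m ((8, K), v, s, t) = ((0, fst (cstep (K, v))), snd (cstep (K, v)), s, t')"
  using assms
  by (cases "(K, v)" rule: cstep.cases)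
    (auto simp: dstep_def dnxt_def dins_def dapp_def dzero_def fun_eq_iff)

text \<open>Pouring back and forth restores the registers and serves only to spend time:
  \<open>2 * (2 * v 0 + 1)\<close> steps with marker 1 moving, \<open>2 * (2 * v 2 + 1)\<close> with
  marker 1 at rest, and one step for the instruction.\<close>

lemma dstep_round:
  assumes m: "4 \<le> m" and v: "v 1 = 0" "v 3 = 0" and h: "hreg K \<subseteq> {..<m}"
  shows "\<exists>t'\<ge>t + 2 * (v 0 + v 2). (dstep m ^^ (4 * (v 0 + v 2) + 5)) ((0, K), v, s, t) =
    ((0, fst (cstep (K, v))), snd (cstep (K, v)), s + (4 * v 0 + 2), t')"
proof -
  let ?a = "v 0" let ?b = "v 2"
  let ?v1 = "v(0 := 0, 1 := ?a)" let ?v3 = "v(2 := 0, 3 := ?b)"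
  have 1: "(dstep m ^^ (2 * ?a + 1)) ((0, K), v, s, t) = ((2, K), ?v1, s + (2 * ?a + 1), t + ?a)"
    using dstep_transfer[of 0 m v ?a K s t] m v by (simp add: tdst_def)
  have 2: "(dstep m ^^ (2 * ?a + 1)) ((2, K), ?v1, s + (2 * ?a + 1), t + ?a) = ((4, K), v, s + (4 * ?a + 2), t + 2 * ?a)"
  proof -
    have "?v1(1 := 0, 0 := 0 + ?a) = v" using v by (auto simp: fun_eq_iff)
    then show ?thesis using dstep_transfer[of 1 m ?v1 ?a K "s + (2 * ?a + 1)" "t + ?a"] m by (simp add: tdst_def)
  qed
  have 3: "(dstep m ^^ (2 * ?b + 1)) ((4, K), v, s + (4 * ?a + 2), t + 2 * ?a) = ((6, K), ?v3, s + (4 * ?a + 2), t + 2 * ?a + ?b)"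
    using dstep_transfer[of 2 m v ?b K "s + (4 * ?a + 2)" "t + 2 * ?a"] m v by (simp add: tdst_def)
  have 4: "(dstep m ^^ (2 * ?b + 1)) ((6, K), ?v3, s + (4 * ?a + 2), t + 2 * ?a + ?b) = ((8, K), v, s + (4 * ?a + 2), t + 2 * ?a + 2 * ?b)"
  proof -
    have "?v3(3 := 0, 2 := 0 + ?b) = v" using v by (auto simp: fun_eq_iff)
    then show ?thesis using dstep_transfer[of 3 m ?v3 ?b K "s + (4 * ?a + 2)" "t + 2 * ?a + ?b"] m by (simp add: tdst_def)
  qed
  obtain t' where t': "t' \<ge> t + 2 * ?a + 2 * ?b"
      "dstep m ((8, K), v, s + (4 * ?a + 2), t + 2 * ?a + 2 * ?b) = ((0, fst (cstep (K, v))), snd (cstep (K, v)), s + (4 * ?a + 2), t')"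
    using dstep_exec[OF h] by blast
  define a1 b1 where "a1 = 2 * ?a + 1" and "b1 = 2 * ?b + 1"
  have e: "4 * (?a + ?b) + 5 = Suc (b1 + (b1 + (a1 + a1)))" by (simp add: a1_def b1_def)
  note tr = 1[folded a1_def] 2[folded a1_def] 3[folded b1_def] 4[folded b1_def]
  have "(dstep m ^^ (4 * (?a + ?b) + 5)) ((0, K), v, s, t) =
      ((0, fst (cstep (K, v))), snd (cstep (K, v)), s + (4 * ?a + 2), t')"
    unfolding e funpow.simps(2) funpow_add o_apply tr by (rule t'(2))
  then show ?thesis using t'(1) by (intro exI[of _ t']) simp
qed

theorem driver_exists:
  assumes "Delta2_computable x" "0 \<le> x" "x \<le> 2"
  shows "\<exists>M P Lam mv del. driver M P Lam mv del \<and> (\<lambda>k. real (P 1 k) / real k) \<longlonglongrightarrow> 1 - x / 2"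
proof -
  obtain S b where Sb: "S 0 = 0" "\<And>n. S (Suc n) = S n + b n" "\<And>n. b n \<le> 1"
    and tb: "total_rec 1 (\<lambda>xs. b (hd xs))" and lim: "(\<lambda>n. real (S n) / real n) \<longlonglongrightarrow> 1 - x / 2"
    using Delta2_greedy[OF assms] by auto
  interpret greedy S b by standard (rule Sb)+
  obtain c where c: "\<forall>i. good (snd ((cstep ^^ i) ([c], \<lambda>_. 0))) \<and> gstep ((cstep ^^ i) ([c], \<lambda>_. 0)) ((cstep ^^ Suc i) ([c], \<lambda>_. 0)) \<and>
     (\<exists>L. snd ((cstep ^^ L) ([c], \<lambda>_. 0)) 0 + snd ((cstep ^^ L) ([c], \<lambda>_. 0)) 2 = i)"
    using machine_exists[OF tb] by (rule exE)
  define Y where "Y i = (cstep ^^ i) ([c], \<lambda>_. 0)" for i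
  define A where "A i = snd (Y i) 0" for i
  define C where "C i = snd (Y i) 0 + snd (Y i) 2" for i
  have gd: "good (snd (Y i))" and gs: "gstep (Y i) (Y (Suc i))" and Cs: "\<exists>L. C L = i" for i
    using c unfolding Y_def C_def by blast+
  have C0: "C 0 = 0" by (simp add: C_def Y_def)
  have C1: "C (Suc i) \<le> Suc (C i)" "C i \<le> C (Suc i)" for i using gs[of i] unfolding gstep_def C_def by auto
  have monoC: "mono C" using C1(2) by (simp add: mono_iff_le_Suc)
  have AS: "A i = S (C i)" for i using gd[of i] unfolding good_def A_def C_def by blast
  have topC: "filterlim C at_top sequentially"
    unfolding filterlim_at_top eventually_sequentially
  proof
    fix n
    obtain L where "C L = n" using Cs by blast
    then show "\<exists>N. \<forall>i\<ge>N. n \<le> C i" using monoD[OF monoC] by blast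
  qed
  have limA: "(\<lambda>i. real (A i) / real (C i)) \<longlonglongrightarrow> 1 - x / 2"
    using filterlim_compose[OF lim topC] by (simp add: AS)
  define Q where "Q = insert [] (conts c [])"
  have finQ: "finite Q" unfolding Q_def using finite_conts by simp
  have QY: "fst (Y i) \<in> Q" for i
  proof (induction i)
    case 0 show ?case using conts_self[of c "[]"] by (simp add: Y_def Q_def)
  next
    case (Suc i)
    have "fst (cstep (fst (Y i), snd (Y i))) \<in> Q" using Suc unfolding Q_def by (rule conts_closed)
    then show ?case by (simp add: Y_def)
  qed
  have "finite (\<Union>K\<in>Q. hreg K)" using finQ finite_hreg by blast
  then obtain m0 where m0: "(\<Union>K\<in>Q. hreg K) \<subseteq> {..<m0}" using finite_nat_iff_bounded by blast
  define m where "m = max m0 4"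
  have m4: "4 \<le> m" by (simp add: m_def)
  have hm: "hreg K \<subseteq> {..<m}" if "K \<in> Q" for K
    using m0 that unfolding m_def by fastforce
  define D where "D k = (dstep m ^^ k) ((0, [c]), (\<lambda>_. 0), 0, 0)" for k
  define q where "q k = fst (D k)" for k
  define v where "v k = fst (snd (D k))" for k
  define s where "s k = fst (snd (snd (D k)))" for k
  define t where "t k = snd (snd (snd (D k)))" for k
  have D: "D k = (q k, v k, s k, t k)" for k by (simp add: q_def v_def s_def t_def)
  define Z where "Z k = dzero m (v k)" for k
  define I where "I k = dins (q k) (Z k)" for k
  have DS: "D (Suc k) = dstep m (D k)" for k by (simp add: D_def)
  have step: "q (Suc k) = dnxt (q k) (Z k)" "v (Suc k) = dapp (I k) (v k)"
      "s (Suc k) = s k + of_bool (fst (q k) < 4)" "t (Suc k) = t k + of_bool (\<exists>r. I k = Some (Inr r))" for k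
    using DS[of k] unfolding D[of k] D[of "Suc k"] by (simp_all add: dstep_def I_def Z_def)
  have z0: "q 0 = (0, [c])" "v 0 = (\<lambda>_. 0)" "s 0 = 0" "t 0 = 0" by (simp_all add: q_def v_def s_def t_def D_def)
  have qQ: "fst (q k) \<le> 8 \<and> snd (q k) \<in> Q" for k
  proof (induction k)
    case 0 show ?case using QY[of 0] by (simp add: z0 Y_def)
  next
    case (Suc k)
    have "fst (cstep (snd (q k), w)) \<in> Q" for w
      using Suc conts_closed unfolding Q_def by blast
    moreover have "fst (dnxt (q k) (Z k)) \<le> 8"
      using Suc by (auto simp: dnxt_def elim!: evenE)
    ultimately show ?case using Suc by (auto simp: step dnxt_def)
  qed
  have qz: "finite (range (\<lambda>k. (q k, Z k)))"
  proof (rule finite_subset)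
    show "range (\<lambda>k. (q k, Z k)) \<subseteq> ({..8} \<times> Q) \<times> Pow {..<m}"
    proof
      fix y assume "y \<in> range (\<lambda>k. (q k, Z k))"
      then obtain k where y: "y = (q k, Z k)" by blast
      show "y \<in> ({..8} \<times> Q) \<times> Pow {..<m}"
        using qQ[of k] unfolding y by (simp add: mem_Times_iff Z_def dzero_def subset_iff)
    qed
    show "finite (({..8::nat} \<times> Q) \<times> Pow {..<m})" using finQ by simp
  qed
  define T where "T = rec_nat 0 (\<lambda>i u. u + (4 * C i + 5))"
  have T: "T 0 = 0" "T (Suc i) = T i + (4 * C i + 5)" for i by (simp_all add: T_def)
  have round: "q (T i) = (0, fst (Y i)) \<and> v (T i) = snd (Y i)
      \<and> s (T (Suc i)) = s (T i) + (4 * A i + 2) \<and> t (T i) + 2 * C i \<le> t (T (Suc i))" for i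
  proof -
    have next_round: "q (T (Suc i)) = (0, fst (Y (Suc i))) \<and> v (T (Suc i)) = snd (Y (Suc i))
      \<and> s (T (Suc i)) = s (T i) + (4 * A i + 2) \<and> t (T i) + 2 * C i \<le> t (T (Suc i))"
      if h: "q (T i) = (0, fst (Y i))" "v (T i) = snd (Y i)" for i
    proof -
      have g: "snd (Y i) 1 = 0" "snd (Y i) 3 = 0" using gd[of i] unfolding good_def by auto
      obtain t' where t': "t' \<ge> t (T i) + 2 * C i"
        "(dstep m ^^ (4 * C i + 5)) ((0, fst (Y i)), snd (Y i), s (T i), t (T i)) =
          ((0, fst (cstep (Y i))), snd (cstep (Y i)), s (T i) + (4 * A i + 2), t')"
        using dstep_round[OF m4 g hm[OF QY[of i]], of "t (T i)" "s (T i)"] unfolding C_def A_def by auto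
      have "D (T (Suc i)) = (dstep m ^^ (4 * C i + 5)) (D (T i))"
        unfolding T(2) D_def by (subst add.commute) (simp only: funpow_add o_apply)
      then have "D (T (Suc i)) = ((0, fst (cstep (Y i))), snd (cstep (Y i)), s (T i) + (4 * A i + 2), t')"
        using t'(2) unfolding D[of "T i"] h by simp
      moreover have "cstep (Y i) = Y (Suc i)" by (simp add: Y_def)
      ultimately show ?thesis using t'(1) unfolding D[of "T (Suc i)"] by simp
    qed
    have "q (T i) = (0, fst (Y i)) \<and> v (T i) = snd (Y i)"
    proof (induction i)
      case 0 show ?case by (simp add: T z0 Y_def)
    next
      case (Suc i) then show ?case using next_round[of i] by blast
    qed
    then show ?thesis using next_round[of i] by blast
  qed
  \<comment> \<open>Register \<open>r\<close> is the distance of marker \<open>r + 2\<close> from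
    marker 0. Since markers only move up, an increment moves marker \<open>r + 2\<close> alone, and
    a decrement moves marker 0 and all register markers other than \<open>r + 2\<close>.\<close>
  define P where "P l k = (if l = 1 then s k else if l = 0 then t k else t k + v k (l - 2))" for l k
  have limP: "(\<lambda>k. real (P 1 k) / real k) \<longlonglongrightarrow> 1 - x / 2"
  proof -
    have "(\<lambda>k. real (s k) / real k) \<longlonglongrightarrow> 1 - x / 2"
    proof (rule driver_cesaro[where A = A and C = C and T = T])
      show "A i \<le> C i" for i by (simp add: A_def C_def)
      show "\<exists>i. n \<le> C i" for n using Cs[of n] by auto
      show "mono s" by (simp add: mono_iff_le_Suc step)
      show "s (T (Suc i)) = s (T i) + (4 * A i + 2)" for i using round[of i] by blast
    qed (use C0 C1 limA T assms in auto)
    then show ?thesis by (simp add: P_def)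
  qed
  obtain code :: "((nat \<times> com list) \<times> nat set) \<Rightarrow> nat" where code: "inj_on code (range (\<lambda>k. (q k, Z k)))"
    using finite_imp_inj_to_nat_seg[OF qz] by blast
  define dec where "dec n = inv_into (range (\<lambda>k. (q k, Z k))) code (nat n)" for n :: int
  \<comment> \<open>The zero set is stored in the letter together with the control state, because
    \<open>mv\<close> sees nothing but the letter.\<close>
  define Lam where "Lam k = int (code (q k, Z k))" for k
  have dec: "dec (Lam k) = (q k, Z k)" for k
    unfolding dec_def Lam_def nat_int by (rule inv_into_f_f[OF code]) blast
  define mv where "mv l n = (let (p, W) = dec n; J = dins p W in
     if l = 1 then fst p < 4 else if l = 0 then (\<exists>r. J = Some (Inr r))
     else J = Some (Inl (l - 2)) \<or> (\<exists>r. J = Some (Inr r) \<and> r \<noteq> l - 2))" for l n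
  define del where "del n W = int (code (dnxt (fst (dec n)) (snd (dec n)), {r. r + 2 \<in> W}))" for n and W :: "nat set"
  have ZP: "{r. r + 2 \<in> {l. l < m + 2 \<and> P l k = P 0 k}} = Z k" for k
    by (auto simp: P_def Z_def dzero_def)
  \<comment> \<open>A decrement is issued only for a nonzero register. Truncated subtraction
    therefore never takes effect, and marker \<open>r + 2\<close> stays in place while marker 0
    moves.\<close>
  have vpos: "0 < v k r" if ins: "I k = Some (Inr r)" for k r
  proof -
    have r: "r \<notin> Z k \<and> r < m"
    proof (cases "fst (q k) < 8")
      case True
      then have "even (fst (q k))" "r = fst (q k) div 2" "r \<notin> Z k"
        using ins by (auto simp: I_def dins_def split: if_splits)
      then show ?thesis using True m4 by auto
    next
      case False
      then obtain K where K: "snd (q k) = CDec r # K" "r \<notin> Z k"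
        using ins by (auto simp: I_def dins_def split: if_splits list.splits com.splits)
      then show ?thesis using hm[of "snd (q k)"] qQ[of k] by auto
    qed
    then show ?thesis by (auto simp: Z_def dzero_def)
  qed
  have PS: "P l (Suc k) = P l k + (if mv l (Lam k) then 1 else 0)" for l k
  proof -
    consider "l = 0" | "l = 1" | "l \<noteq> 0" "l \<noteq> 1" by blast
    then show ?thesis
    proof cases
      case 1 then show ?thesis by (simp add: P_def mv_def dec step flip: I_def)
    next
      case 2 then show ?thesis by (simp add: P_def mv_def dec step)
    next
      case 3
      consider "I k = None" | r where "I k = Some (Inl r)" | r where "I k = Some (Inr r)"
        by (metis old.sum.exhaust option.exhaust)
      then show ?thesis
      proof cases
        case 1 then show ?thesis using 3 by (simp add: P_def mv_def dec step dapp_def flip: I_def)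
      next
        case (2 r) then show ?thesis using 3 by (auto simp: P_def mv_def dec step dapp_def simp flip: I_def)
      next
        case (3 r)
        then show ?thesis using \<open>l \<noteq> 0\<close> \<open>l \<noteq> 1\<close> vpos[OF 3] by (auto simp: P_def mv_def dec step dapp_def simp flip: I_def)
      qed
    qed
  qed
  have tunb: "\<exists>k. B \<le> t k" for B
  proof -
    obtain i where "C i = B" using Cs by blast
    then show ?thesis using round[of i] by (intro exI[of _ "T (Suc i)"]) linarith
  qed
  have sunb: "\<exists>k. B \<le> s k" for B
  proof -
    have "i \<le> s (T i)" for i
    proof (induction i)
      case (Suc i) then show ?case using round[of i] by linarith
    qed simp
    then show ?thesis by blast
  qed
  have "driver (m + 2) P Lam mv del"
  proof
    show "2 \<le> m + 2" by simp
    have "range Lam = (\<lambda>y. int (code y)) ` range (\<lambda>k. (q k, Z k))" by (auto simp: Lam_def)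
    then show "finite (range Lam)" using qz by simp
    show "P l 0 = 0" for l by (simp add: P_def z0)
    show "P l (Suc k) = P l k + (if mv l (Lam k) then 1 else 0)" if "l < m + 2" for l k by (rule PS)
    show "Lam (Suc k) = del (Lam k) {l. l < m + 2 \<and> P l (Suc k) = P 0 (Suc k)}" for k
      unfolding del_def ZP dec by (simp add: Lam_def step)
    show "\<exists>k. B \<le> P l k" if "l < m + 2" for l B
      using tunb[of B] sunb[of B] unfolding P_def by (cases "l = 1"; cases "l = 0") (auto intro: trans_le_add1)
  qed
  then show ?thesis using limP by blast
qed

section \<open>The theorem\<close>

theorem mainTheorem2:
  fixes x :: real
  assumes "Delta2_computable x" and "0 \<le> x" and "x \<le> 2"
  shows "\<exists>(A::nat set) (X::config set). X \<noteq> {} \<and> subshift A X \<and> SFT A X \<and> minimal_subshift X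
           \<and> has_entropy_dim X \<and> entropy_dim X = ereal x"
proof -
  obtain M P Lam mv del where d: "driver M P Lam mv del" and l: "(\<lambda>k. real (P 1 k) / real k) \<longlonglongrightarrow> 1 - x / 2"
    using driver_exists[OF assms] by blast
  show ?thesis by (rule driver.driver_dim[OF d l])
qed

end
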